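(* Let $\gamma\in[-2,0)$, $0<\varepsilon<1$ and $s>0$. Put $$q=\frac{-3(\gamma-s)(2-\varepsilon)}{\varepsilon}>0,\qquad \alpha=\frac{2(3-\varepsilon)}{3(2-\varepsilon)}.$$ Let $f_t(v)$ be a weak solution of the spatially homogeneous Landau equation $\partial_t f_t=Q(f_t,f_t)$ with parameter $\gamma$ and with non-negative initial data $f_{\rm in}\in L^1_2(\mathbb{R}^3)\cap L^1_q(\mathbb{R}^3)\cap L\log L(\mathbb{R}^3)$. Then, at least formally (i.e. as an a priori estimate), $f_t\in L^\alpha([0,T],L^{3-\varepsilon}(\mathbb{R}^3))$ for every $T>0$. More precisely, $$\int_0^T\|f_t\|_{L^{3-\varepsilon}}^{\alpha}\,dt\lesssim C(T),$$ where, for some constant $C>0$, $$C(T)\lesssim (1+T)^{1+\frac{2\varepsilon(3+\varepsilon)}{3(2-\varepsilon)(2+\gamma)}}\quad\text{if }\gamma\in(-2,0),$$ $$C(T)\lesssim \exp\{C\,T^{z}\},\quad z=\frac{(3-\varepsilon)\,[\,3(2+s)(2-\varepsilon)-2\varepsilon\,]}{3(1-\varepsilon)},\quad\text{if }\gamma=-2.$$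
   Context: The spatially homogeneous Landau equation with parameter $\gamma$, for $f_t(v)\ge 0$, $v\in\mathbb{R}^3$, $t\ge0$, is $\partial_t f_t(v)=Q(f_t,f_t)(v)$ with $$Q(f,f)(v)=\nabla_v\cdot\Big\{\int_{\mathbb{R}^3} a(v-v_* )\,[f(v_* )\nabla f(v)-f(v)\nabla_* f(v_* )]\,dv_*\Big\},\qquad a(z)=|z|^{\gamma+2}\Big(I_3-\frac{z\otimes z}{|z|^2}\Big).$$ Set $b_i(z)=\sum_j\partial_j a_{ij}(z)=-2|z|^{\gamma}z_i$. A weak solution with initial data $f_{\rm in}\ge0$ is a non-negative $f_t$ such that, for every test function $\varphi:\mathbb{R}^3\to\mathbb{R}$ (e.g. $\varphi\in C_c^\infty(\mathbb{R}^3)$) and every $T>0$, $$\int\varphi f_T\,dv=\int\varphi f_{\rm in}\,dv+\int_0^T\!\!\iint f_t(v)f_t(v_* )\,L\varphi(v,v_* )\,dv\,dv_*\,dt,$$ $$L\varphi(v,v_* )=\sum_{i,j}a_{ij}(v-v_* )\,\partial_{ij}\varphi(v)+2\sum_i b_i(v-v_* )\,\partial_i\varphi(v).$$ Norms and spaces: $\langle v\rangle=(1+|v|^2)^{1/2}$; $\|f\|_{L^1_s}=\int|f|\langle v\rangle^s\,dv$; $L\log L=\{f\in L^1:\int|f|\,|\log|f||\,dv<\infty\}$. Convention on "at least formally": results are a priori estimates. Solutions are understood to be regular and decaying enough for formal manipulations of the equation to be justified; in particular mass $\int f_t$, momentum $\int f_t v$ and energy $\int f_t|v|^2$ are conserved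 in time, and the entropy $\int f_t\log f_t\,dv$ is non-increasing. Convention on constants: $X\lesssim Y$ means $X\le C\,Y$ with a constant $C>0$ depending only on the fixed parameters and on the initial data, not on time. *)

theory Defs
  imports "HOL-Analysis.Analysis"
begin

type_synonym r3 = "real ^ 3"


section \<open>Function spaces\<close>

definition jbracket :: "r3 \<Rightarrow> real" where
  "jbracket v = sqrt (1 + (norm v)\<^sup>2)"

definition in_L1w :: "real \<Rightarrow> (r3 \<Rightarrow> real) \<Rightarrow> bool" where
  "in_L1w r g \<longleftrightarrow> g \<in> borel_measurable borel \<and>
     integrable lborel (\<lambda>v. \<bar>g v\<bar> * jbracket v powr r)"

definition L1w_norm :: "real \<Rightarrow> (r3 \<Rightarrow> real) \<Rightarrow> real" where
  "L1w_norm r g = (\<integral>v. \<bar>g v\<bar> * jbracket v powr r \<partial>lborel)"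

text \<open>Since \<open>ln 0 = 0\<close>, the integrand vanishes where \<open>g\<close> does, as the usual convention
  \<open>0 log 0 = 0\<close> requires.\<close>

definition in_LlogL :: "(r3 \<Rightarrow> real) \<Rightarrow> bool" where
  "in_LlogL g \<longleftrightarrow> integrable lborel g \<and> integrable lborel (\<lambda>v. \<bar>g v\<bar> * \<bar>ln \<bar>g v\<bar>\<bar>)"

definition in_Lp :: "real \<Rightarrow> (r3 \<Rightarrow> real) \<Rightarrow> bool" where
  "in_Lp p g \<longleftrightarrow> g \<in> borel_measurable borel \<and> integrable lborel (\<lambda>v. \<bar>g v\<bar> powr p)"

definition Lp_norm :: "real \<Rightarrow> (r3 \<Rightarrow> real) \<Rightarrow> real" where
  "Lp_norm p g = (\<integral>v. \<bar>g v\<bar> powr p \<partial>lborel) powr (1 / p)"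

definition in_LtLp :: "real \<Rightarrow> real \<Rightarrow> real \<Rightarrow> (real \<Rightarrow> r3 \<Rightarrow> real) \<Rightarrow> bool" where
  "in_LtLp \<alpha> T p f \<longleftrightarrow>
     (AE t in lborel. t \<in> {0..T} \<longrightarrow> in_Lp p (f t)) \<and>
     set_integrable lborel {0..T} (\<lambda>t. Lp_norm p (f t) powr \<alpha>)"


section \<open>Smoothness and test functions\<close>

definition partial :: "'a::euclidean_space \<Rightarrow> ('a \<Rightarrow> real) \<Rightarrow> 'a \<Rightarrow> real" where
  "partial b g x = frechet_derivative g (at x) b"

text \<open>\<open>Ck_on k S g\<close> is meant for open \<open>S\<close>: \<open>g\<close> is \<open>k\<close> times continuously differentiable on \<open>S\<close>.\<close>

primrec Ck_on :: "nat \<Rightarrow> 'a::euclidean_space set \<Rightarrow> ('a \<Rightarrow> real) \<Rightarrow> bool" where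
  "Ck_on 0 S g \<longleftrightarrow> continuous_on S g"
| "Ck_on (Suc k) S g \<longleftrightarrow>
     (\<forall>x\<in>S. g differentiable (at x)) \<and> (\<forall>b\<in>Basis. Ck_on k S (partial b g))"

definition test_function :: "(r3 \<Rightarrow> real) \<Rightarrow> bool" where
  "test_function \<phi> \<longleftrightarrow> (\<forall>k. Ck_on k UNIV \<phi>) \<and> compact (closure {v. \<phi> v \<noteq> 0})"

abbreviation pd :: "3 \<Rightarrow> (r3 \<Rightarrow> real) \<Rightarrow> r3 \<Rightarrow> real" where
  "pd i \<equiv> partial (axis i 1)"


section \<open>Weak solutions of the Landau equation\<close>

definition landau_a :: "real \<Rightarrow> r3 \<Rightarrow> real ^ 3 ^ 3" where
  "landau_a \<gamma> z =
     norm z powr (\<gamma> + 2) *\<^sub>R (mat 1 - (1 / (norm z)\<^sup>2) *\<^sub>R (\<chi> i j. z $ i * z $ j))"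

text \<open>The row-wise divergence of \<open>landau_a \<gamma>\<close>.\<close>

definition landau_b :: "real \<Rightarrow> r3 \<Rightarrow> r3" where
  "landau_b \<gamma> z = (- 2 * norm z powr \<gamma>) *\<^sub>R z"

definition landau_L :: "real \<Rightarrow> (r3 \<Rightarrow> real) \<Rightarrow> r3 \<Rightarrow> r3 \<Rightarrow> real" where
  "landau_L \<gamma> \<phi> v w =
     (\<Sum>i\<in>UNIV. \<Sum>j\<in>UNIV. landau_a \<gamma> (v - w) $ i $ j * pd i (pd j \<phi>) v)
     + 2 * (\<Sum>i\<in>UNIV. landau_b \<gamma> (v - w) $ i * pd i \<phi> v)"

text \<open>The space-time integral in the weak formulation is required to converge absolutely,
  because the Bochner integral of a non-integrable function is \<open>0\<close> by convention.\<close>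

definition landau_weak_solution ::
  "real \<Rightarrow> (r3 \<Rightarrow> real) \<Rightarrow> (real \<Rightarrow> r3 \<Rightarrow> real) \<Rightarrow> bool" where
  "landau_weak_solution \<gamma> fin f \<longleftrightarrow>
     f 0 = fin \<and>
     (\<forall>t\<ge>0. \<forall>v. 0 \<le> f t v) \<and>
     (\<forall>t\<ge>0. integrable lborel (f t)) \<and>
     (\<forall>\<phi> T. test_function \<phi> \<longrightarrow> 0 < T \<longrightarrow>
        set_integrable lborel ({0..T} \<times> UNIV)
          (\<lambda>(t, v, w). f t v * f t w * landau_L \<gamma> \<phi> v w) \<and>
        (\<integral>v. \<phi> v * f T v \<partial>lborel) =
          (\<integral>v. \<phi> v * fin v \<partial>lborel)
          + set_lebesgue_integral lborel ({0..T} \<times> UNIV)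
              (\<lambda>(t, v, w). f t v * f t w * landau_L \<gamma> \<phi> v w))"


section \<open>Solutions for which formal manipulations are justified\<close>

definition conserves_and_dissipates :: "(real \<Rightarrow> r3 \<Rightarrow> real) \<Rightarrow> bool" where
  "conserves_and_dissipates f \<longleftrightarrow>
     (\<forall>t\<ge>0. in_L1w 2 (f t) \<and> in_LlogL (f t) \<and>
        (\<integral>v. f t v \<partial>lborel) = (\<integral>v. f 0 v \<partial>lborel) \<and>
        (\<integral>v. f t v *\<^sub>R v \<partial>lborel) = (\<integral>v. f 0 v *\<^sub>R v \<partial>lborel) \<and>
        (\<integral>v. f t v * (norm v)\<^sup>2 \<partial>lborel) = (\<integral>v. f 0 v * (norm v)\<^sup>2 \<partial>lborel)) \<and>
     (\<forall>t1 t2. 0 \<le> t1 \<longrightarrow> t1 \<le> t2 \<longrightarrow>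
        (\<integral>v. f t2 v * ln (f t2 v) \<partial>lborel) \<le> (\<integral>v. f t1 v * ln (f t1 v) \<partial>lborel))"

text \<open>Regularity is only imposed at positive times, so that it puts no smoothness on the initial
  datum, and the bounds may degenerate as \<open>t0\<close> tends to \<open>0\<close> or \<open>T\<close> to infinity. The decay is only
  polynomial, of an order \<open>p > 5\<close> that is compatible with finite energy in dimension 3: soft
  potentials do not create moments, and rapid decay would make weighted integrability of the
  initial datum redundant.\<close>

definition regular :: "(real \<Rightarrow> r3 \<Rightarrow> real) \<Rightarrow> bool" where
  "regular f \<longleftrightarrow>
     Ck_on 2 ({0<..} \<times> UNIV) (\<lambda>(t, v). f t v) \<and>
     (\<forall>t0 T. 0 < t0 \<longrightarrow> t0 \<le> T \<longrightarrow>
        (\<exists>p>5. \<exists>K. \<forall>t\<in>{t0..T}. \<forall>v.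
           \<bar>f t v\<bar> \<le> K * jbracket v powr (- p) \<and>
           \<bar>deriv (\<lambda>\<tau>. f \<tau> v) t\<bar> \<le> K * jbracket v powr (- p) \<and>
           (\<forall>i. \<bar>pd i (f t) v\<bar> \<le> K * jbracket v powr (- p)) \<and>
           (\<forall>i j. \<bar>pd i (pd j (f t)) v\<bar> \<le> K * jbracket v powr (- p))))"

text \<open>Polynomial moments that are finite initially stay finite, locally uniformly in time; nothing
  is assumed about how fast they grow.\<close>

definition keeps_moments :: "(real \<Rightarrow> r3 \<Rightarrow> real) \<Rightarrow> bool" where
  "keeps_moments f \<longleftrightarrow>
     (\<forall>r\<ge>0. in_L1w r (f 0) \<longrightarrow>
        (\<forall>T\<ge>0. \<exists>K. \<forall>t\<in>{0..T}. in_L1w r (f t) \<and> L1w_norm r (f t) \<le> K))"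

definition formal_landau_solution ::
  "real \<Rightarrow> (r3 \<Rightarrow> real) \<Rightarrow> (real \<Rightarrow> r3 \<Rightarrow> real) \<Rightarrow> bool" where
  "formal_landau_solution \<gamma> fin f \<longleftrightarrow>
     landau_weak_solution \<gamma> fin f \<and> conserves_and_dissipates f \<and> regular f \<and> keeps_moments f"

end

theory Submission
  imports Defs "HOL-Computational_Algebra.Polynomial"
begin

text \<open>
  For a regular solution the weak formulation is an equation that holds pointwise, and testing it
  with (a regularisation of) \<open>ln f\<close> gives the entropy identity. The dissipation is the quadratic form
  of the matrix \<open>a * f\<close> in \<open>\<nabla> f\<close> divided by \<open>f\<close>, minus \<open>2 (\<gamma> + 3)\<close> times the singular term
  \<open>\<integral>\<integral> f(v) f(w) \<bar>v - w\<bar>^\<gamma>\<close>. Mass, energy and entropy prevent \<open>f\<close> from concentrating near a line,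
  so \<open>a * f\<close> is bounded below by \<open>\<kappa> \<langle>v\<rangle>^\<gamma>\<close>. By Hardy's inequality the singular term is
  absorbed by the resulting weighted Fisher information: for \<open>\<gamma> > -2\<close> by cutting off small
  \<open>\<bar>v - w\<bar>\<close>, for \<open>\<gamma> = -2\<close> by cutting off large values of \<open>f\<close>, whose contribution is controlled by the
  entropy and the fourth moment; this makes the constant exponential in that moment.

  The Sobolev inequality for \<open>sqrt (\<langle>v\<rangle>^\<gamma> f)\<close> turns the Fisher information into a bound for
  \<open>\<langle>v\<rangle>^\<gamma> f\<close> in \<open>L^1(L^3)\<close>. Moments grow at most linearly in time: collisions between
  velocities of very different size make the moment of order \<open>r\<close> decrease at a rate of order
  \<open>r + \<gamma>\<close>, which absorbs the gain of order \<open>r - 2 + \<gamma>\<close>. Hoelder's inequality between \<open>L^3\<close> and a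
  weighted \<open>L^1\<close> then removes the weight.
\<close>

text \<open>Decay is only polynomial, so \<open>ln f\<close> is unbounded and cannot be tested
  against kernels that grow at infinity. The multiplier ln (1 + f / \<delta>) is at most f /
  \<delta> and decays like f. The price is that one factor f of the singular term becomes f -
  \<delta> ln (1 + f / \<delta>) and 1 / f in the dissipation becomes 1 / (f + \<delta>). The
  regularised entropy diverges like ln \<delta>, but its divergent part is a multiple of the mass
  and cancels between two times, so all bounds are uniform in \<delta>. One majorant, |z|^-2 +
  |z|^2, serves for every kernel: it allows the singularity of \<gamma> = -2 and is integrable
  against decay of order p > 5. The equation holds pointwise only at positive times, and the datum
  enters through mass, energy, entropy and moments. Constants have to precede the solution; this is
  why many results are quantified over densities, or over all solutions with a given datum. The
  exponent \<alpha> is the one for which interpolation uses the L^3 norm of <v>^\<gamma> f to the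
  power 1, the power that the dissipation integrates in time.\<close>

section \<open>Finiteness of integrals by dyadic balls\<close>

text \<open>The positive part of \<open>g\<close> is dominated by the sum of \<open>c n\<close>
  times the indicator of the ball of radius \<open>r n\<close>, and this sum integrates to a
  constant times the given series. Decay at infinity and a singularity at 0 are handled alike,
  without polar coordinates.\<close>

lemma nn_integral_dyadic_finite:
  fixes g :: "r3 \<Rightarrow> real"
  assumes ex: "\<And>x. g x \<le> 0 \<or> (\<exists>n. g x \<le> c n \<and> norm x \<le> r n)"
    and c: "\<And>n. 0 \<le> c n" and r: "\<And>n. 0 \<le> r n" and s: "summable (\<lambda>n. c n * r n ^ 3)"
  shows "(\<integral>\<^sup>+x. ennreal (g x) \<partial>lborel) < \<infinity>"
proof -
  define V where "V = unit_ball_vol (real DIM(r3))"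
  have V: "0 \<le> V" by (simp add: V_def)
  have "(\<integral>\<^sup>+x. ennreal (g x) \<partial>lborel) \<le> (\<integral>\<^sup>+x. (\<Sum>n. ennreal (c n) * indicator (cball 0 (r n)) x) \<partial>(lborel :: r3 measure))"
  proof (rule nn_integral_mono)
    fix x :: r3
    show "ennreal (g x) \<le> (\<Sum>n. ennreal (c n) * indicator (cball 0 (r n)) x)"
    proof (cases "g x \<le> 0")
      case True then show ?thesis by (simp add: ennreal_neg)
    next
      case False
      then obtain n where n: "g x \<le> c n" "norm x \<le> r n" using ex by blast
      have "ennreal (g x) \<le> (\<Sum>k\<in>{n}. ennreal (c k) * indicator (cball 0 (r k)) x)"
        using n by (simp add: ennreal_leI)
      also have "\<dots> \<le> (\<Sum>n. ennreal (c n) * indicator (cball 0 (r n)) x)"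
        by (rule sum_le_suminf) auto
      finally show ?thesis .
    qed
  qed
  also have "\<dots> = (\<Sum>n. \<integral>\<^sup>+x. ennreal (c n) * indicator (cball 0 (r n)) x \<partial>(lborel :: r3 measure))"
    by (intro nn_integral_suminf borel_measurable_times_ennreal borel_measurable_const borel_measurable_indicator) simp
  also have "\<dots> = (\<Sum>n. ennreal (V * (c n * r n ^ 3)))"
  proof (rule suminf_cong)
    fix n
    have "emeasure lborel (cball (0::r3) (r n)) = ennreal (V * r n ^ 3)"
      using emeasure_cball[OF r[of n], of "0::r3"] by (simp add: V_def)
    then show "(\<integral>\<^sup>+x. ennreal (c n) * indicator (cball 0 (r n)) x \<partial>(lborel :: r3 measure)) = ennreal (V * (c n * r n ^ 3))"
      using c[of n] V r[of n] by (simp add: nn_integral_cmult_indicator ennreal_mult[symmetric] mult.left_commute)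
  qed
  also have "\<dots> = ennreal (\<Sum>n. V * (c n * r n ^ 3))"
    by (intro suminf_ennreal2 summable_mult s mult_nonneg_nonneg V c zero_le_power r)
  finally show ?thesis by (simp add: order_le_less_trans)
qed

subsection \<open>The bracket and decaying functions\<close>

lemma jbracket_sq: "(jbracket v)\<^sup>2 = 1 + (norm v)\<^sup>2"
  by (simp add: jbracket_def)

lemma jbracket_ge_1: "1 \<le> jbracket v"
  by (simp add: jbracket_def)

lemma jbracket_pos [simp]: "0 < jbracket v"
  using jbracket_ge_1[of v] by linarith

lemma jbracket_neq_0 [simp]: "jbracket v \<noteq> 0"
  using jbracket_pos[of v] by linarith

lemma norm_le_jbracket: "norm v \<le> jbracket v"
  unfolding jbracket_def by (rule real_le_rsqrt) simp

lemma continuous_on_jbracket [continuous_intros]: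
  "continuous_on A g \<Longrightarrow> continuous_on A (\<lambda>x. jbracket (g x))"
  unfolding jbracket_def by (intro continuous_intros)

lemma borel_measurable_jbracket [measurable]: "jbracket \<in> borel_measurable borel"
  by (intro borel_measurable_continuous_onI continuous_intros)

lemma jbracket_powr_nonneg [simp]: "0 \<le> jbracket v powr r" by simp

text \<open>Peetre's inequality with a crude constant. It is the device for moving weights from one
  velocity to another.\<close>

lemma jbracket_add_le: "jbracket (x + y) \<le> 2 * jbracket x * jbracket y"
proof -
  have "norm (x + y) \<le> norm x + norm y" by (rule norm_triangle_ineq)
  then have "(norm (x + y))\<^sup>2 \<le> (norm x + norm y)\<^sup>2" by (intro power_mono) auto
  also have "\<dots> \<le> 2 * (norm x)\<^sup>2 + 2 * (norm y)\<^sup>2"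
    using sum_squares_bound[of "norm x" "norm y"] by (simp add: power2_eq_square algebra_simps)
  finally have a: "(norm (x + y))\<^sup>2 \<le> 2 * (norm x)\<^sup>2 + 2 * (norm y)\<^sup>2" .
  have b: "0 \<le> (norm x)\<^sup>2 * (norm y)\<^sup>2" by simp
  have "(jbracket (x + y))\<^sup>2 \<le> 4 * ((1 + (norm x)\<^sup>2) * (1 + (norm y)\<^sup>2))"
    using a b zero_le_power2[of "norm x"] zero_le_power2[of "norm y"]
    unfolding jbracket_sq ring_distribs by linarith
  also have "\<dots> = (2 * jbracket x * jbracket y)\<^sup>2"
    by (simp add: power_mult_distrib jbracket_sq)
  finally show ?thesis by (rule power2_le_imp_le) (simp add: less_imp_le)
qed

lemma jbracket_minus: "jbracket (- x) = jbracket x"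
  by (simp add: jbracket_def)

lemma jbracket_powr_mono: "r \<le> s \<Longrightarrow> jbracket v powr r \<le> jbracket v powr s"
  by (intro powr_mono jbracket_ge_1)

lemma jbracket_powr_2: "jbracket v powr 2 = 1 + (norm v)\<^sup>2"
  by (simp add: jbracket_sq less_imp_le)

lemma jbracket_powr_neg_shift:
  assumes "0 \<le> p"
  shows "jbracket (x - y) powr (- p) \<le> (2 * jbracket y) powr p * jbracket x powr (- p)"
proof -
  have "jbracket x \<le> 2 * jbracket (x - y) * jbracket y"
    using jbracket_add_le[of "x - y" y] by simp
  then have "jbracket x powr p \<le> (2 * jbracket y * jbracket (x - y)) powr p"
    using assms by (intro powr_mono2) (auto simp: less_imp_le ac_simps)
  also have "\<dots> = (2 * jbracket y) powr p * jbracket (x - y) powr p"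
    by (subst powr_mult) (auto simp: less_imp_le)
  finally show ?thesis
    by (simp add: powr_minus divide_simps ac_simps)
qed

text \<open>On the shell 2^(n-1) < |v| \<le> 2^n the function is at most 2^p 2^(-pn); together with
  the volume this gives a geometric series of ratio 2^(3-p).\<close>

lemma integrable_jbracket_powr:
  assumes p: "p > 3"
  shows "integrable lborel (\<lambda>v. jbracket v powr (- p))"
proof (rule integrableI_nonneg)
  show "(\<integral>\<^sup>+v. ennreal (jbracket v powr (- p)) \<partial>lborel) < \<infinity>"
  proof (rule nn_integral_dyadic_finite[where c="\<lambda>n. 2 powr p * 2 powr (- p * real n)" and r="\<lambda>n. 2 ^ n"])
    fix v :: r3
    obtain n0 where "norm v < 2 ^ n0" using real_arch_pow[of 2 "norm v"] by auto
    then have ex: "\<exists>n. norm v \<le> 2 ^ n" by (auto intro: less_imp_le)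
    \<comment> \<open>The least dyadic ball containing \<open>v\<close>: failure of the preceding
      one bounds \<open>jbracket v\<close> below by 2^(n-1).\<close>
    define n where "n = (LEAST n. norm v \<le> 2 ^ n)"
    have n: "norm v \<le> 2 ^ n" using LeastI_ex[OF ex] by (simp add: n_def)
    have "jbracket v powr (- p) \<le> 2 powr p * 2 powr (- p * real n)"
    proof (cases n)
      case 0
      have "jbracket v powr (- p) \<le> jbracket v powr 0"
        using p by (intro jbracket_powr_mono) auto
      moreover have "(1::real) \<le> 2 powr p" using p by (simp add: ge_one_powr_ge_zero)
      ultimately show ?thesis using 0 by simp
    next
      case (Suc m)
      have "\<not> norm v \<le> 2 ^ m" using not_less_Least[of m "\<lambda>n. norm v \<le> 2 ^ n"] Suc by (simp add: n_def)
      then have "2 powr real m \<le> jbracket v" using norm_le_jbracket[of v] by (simp add: powr_realpow)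
      then have "jbracket v powr (- p) \<le> (2 powr real m) powr (- p)"
        using p by (intro powr_mono2') auto
      also have "\<dots> = 2 powr p * 2 powr (- p * real n)"
        using Suc by (simp add: powr_powr powr_add[symmetric] algebra_simps)
      finally show ?thesis .
    qed
    then show "jbracket v powr (- p) \<le> 0 \<or> (\<exists>n. jbracket v powr (- p) \<le> 2 powr p * 2 powr (- p * real n) \<and> norm v \<le> 2 ^ n)"
      using n by blast
  next
    have eq: "(\<lambda>n. 2 powr p * 2 powr (- p * real n) * (2 ^ n) ^ 3) = (\<lambda>n. 2 powr p * (2 powr (3 - p)) ^ n)"
    proof
      fix n
      have "(2 ^ n) ^ 3 = 2 powr (real n * 3)"
        by (simp add: powr_powr[symmetric] powr_realpow powr_numeral)
      then show "2 powr p * 2 powr (- p * real n) * (2 ^ n) ^ 3 = 2 powr p * (2 powr (3 - p)) ^ n"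
        by (simp add: powr_add[symmetric] powr_realpow[symmetric] powr_powr algebra_simps)
    qed
    have "norm (2 powr (3 - p)) < (1::real)" using p by (simp add: powr_less_one)
    then show "summable (\<lambda>n. 2 powr p * 2 powr (- p * real n) * (2 ^ n) ^ 3)"
      unfolding eq by (intro summable_mult summable_geometric)
  qed auto
qed auto

text \<open>The weight \<open>1 / norm z\<^sup>2\<close> takes the value \<open>0\<close> at the origin, as do all Landau kernels.\<close>

definition kap :: "r3 \<Rightarrow> real" where
  "kap z = 1 / (norm z)\<^sup>2 + (norm z)\<^sup>2"

lemma kap_nonneg [simp]: "0 \<le> kap z" by (simp add: kap_def)

lemma borel_measurable_kap [measurable]: "kap \<in> borel_measurable borel"
  unfolding kap_def by measurable

text \<open>On the shell between the radii (1/2)^(n+1) and (1/2)^n the integrand is at most 4 times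
  4^n while the volume is of order 8^(-n), so the series has ratio 1/2.\<close>

lemma inverse_square_integrable_ball:
  "(\<integral>\<^sup>+z. ennreal (indicator (cball 0 1) z / (norm z)\<^sup>2) \<partial>(lborel :: r3 measure)) < \<infinity>"
proof (rule nn_integral_dyadic_finite[where c="\<lambda>n. 4 * 4 ^ n" and r="\<lambda>n. (1/2) ^ n"])
  fix z :: r3
  show "indicator (cball 0 1) z / (norm z)\<^sup>2 \<le> 0 \<or>
    (\<exists>n. indicator (cball 0 1) z / (norm z)\<^sup>2 \<le> 4 * 4 ^ n \<and> norm z \<le> (1/2::real) ^ n)"
  proof (cases "z \<noteq> 0 \<and> norm z \<le> 1")
    case True
    obtain n0 where n0: "(1/2) ^ n0 < norm z"
      using real_arch_pow_inv[of "norm z" "1/2"] True by auto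
    define n where "n = (LEAST n. (1/2) ^ n < norm z)"
    have n: "(1/2) ^ n < norm z" using LeastI[of "\<lambda>n. (1/2) ^ n < norm z", OF n0] by (simp add: n_def)
    then obtain m where m: "n = Suc m" using True by (cases n) auto
    have "\<not> (1/2) ^ m < norm z" using not_less_Least[of m "\<lambda>n. (1/2) ^ n < norm z"] m by (simp add: n_def)
    moreover have "((1/2) ^ n)\<^sup>2 \<le> (norm z)\<^sup>2" using n by (intro power_mono) auto
    then have "1 / (norm z)\<^sup>2 \<le> 1 / ((1/2) ^ n)\<^sup>2" by (intro divide_left_mono) (use True in auto)
    moreover have "1 / ((1/2::real) ^ n)\<^sup>2 = 4 * 4 ^ m"
      using m by (simp add: power_divide power_mult_distrib power2_eq_square power_mult[symmetric] flip: power_mult_distrib)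
    ultimately show ?thesis using True by (intro disjI2 exI[of _ m]) (auto simp: not_less)
  qed (auto split: split_indicator)
next
  have eq: "(\<lambda>n. 4 * 4 ^ n * ((1/2) ^ n) ^ 3 :: real) = (\<lambda>n. 4 * (1/2) ^ n)"
  proof
    fix n :: nat
    have "((1/2) ^ n) ^ 3 = ((1/8) ^ n :: real)" by (simp add: power_mult[symmetric] mult.commute[of _ 3]) (simp add: power_mult power_divide)
    then show "4 * 4 ^ n * ((1/2) ^ n) ^ 3 = (4 * (1/2) ^ n :: real)"
      by (simp flip: power_mult_distrib)
  qed
  show "summable (\<lambda>n. 4 * 4 ^ n * ((1/2) ^ n) ^ 3 :: real)"
    unfolding eq by (intro summable_mult summable_geometric) auto
qed auto

lemma nn_integral_shift: 
  fixes g :: "r3 \<Rightarrow> ennreal"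
  assumes [measurable]: "g \<in> borel_measurable borel"
  shows "(\<integral>\<^sup>+v. g (v - c) \<partial>lborel) = (\<integral>\<^sup>+v. g v \<partial>lborel)"
proof -
  have "(\<integral>\<^sup>+v. g v \<partial>lborel) = (\<integral>\<^sup>+v. g v \<partial>(distr lborel borel ((+) (- c))))"
    by (simp add: lborel_distr_plus)
  also have "\<dots> = (\<integral>\<^sup>+v. g (- c + v) \<partial>lborel)" by (subst nn_integral_distr) auto
  finally show ?thesis by simp
qed

text \<open>Near \<open>c\<close> the singular part is integrable and the weight is at most 1.
  Elsewhere 1 / |v - c|^2 \<le> 1, and |v - c|^2 is at most 4 <v>^2 <c>^2; these contribute the
  factor 5 = 1 + 4 and cost two powers of decay, which leaves p - 2 > 3. The growth in
  \<open>c\<close> is quadratic so that the decay of the partner density can absorb it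
  later.\<close>

lemma kap_convolution:
  assumes p: "p > 5"
  obtains C where "0 < C" 
    "\<And>c. (\<integral>\<^sup>+v. ennreal (kap (v - c) * jbracket v powr (- p)) \<partial>lborel) \<le> ennreal (C * (jbracket c)\<^sup>2)"
proof -
  define A where "A = (\<integral>\<^sup>+z. ennreal (indicator (cball 0 1) z / (norm z)\<^sup>2) \<partial>(lborel :: r3 measure))"
  define B where "B = (\<integral>\<^sup>+v. ennreal (5 * jbracket v powr (- (p - 2))) \<partial>lborel)"
  have mA [measurable]: "(\<lambda>z::r3. indicat_real (cball 0 1) z / (norm z)\<^sup>2) \<in> borel_measurable borel"
    by (intro borel_measurable_divide borel_measurable_indicator borel_measurable_power borel_measurable_norm) auto
  have mA' [measurable]: "(\<lambda>v::r3. indicat_real (cball 0 1) (v - c) / (norm (v - c))\<^sup>2) \<in> borel_measurable borel" for c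
    by (rule measurable_compose[OF _ mA]) measurable
  have A: "A < \<infinity>" unfolding A_def by (rule inverse_square_integrable_ball)
  have "integrable lborel (\<lambda>v. 5 * jbracket v powr (- (p - 2)))"
    using p by (intro integrable_mult_right integrable_jbracket_powr) auto
  then have B: "B < \<infinity>" unfolding B_def using integrable_iff_bounded
    by (metis (mono_tags, lifting) integrableD(2) less_top nn_integral_cong  norm_ge_zero real_integrable_def infinity_ennreal_def)
  obtain C0 where C0: "A + B = ennreal C0" "0 \<le> C0"
    using A B by (cases "A + B") auto
  have "(\<integral>\<^sup>+v. ennreal (kap (v - c) * jbracket v powr (- p)) \<partial>lborel) \<le> ennreal ((C0 + 1) * (jbracket c)\<^sup>2)" for c
  proof -
    have *: "ennreal (kap (v - c) * jbracket v powr (- p)) \<le> ennreal (indicator (cball 0 1) (v - c) / (norm (v - c))\<^sup>2)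
       + ennreal ((jbracket c)\<^sup>2) * ennreal (5 * jbracket v powr (- (p - 2)))" for v
    proof -
      have J: "jbracket v powr (- p) \<le> 1" using jbracket_powr_mono[of "-p" 0 v] p by auto
      have eq: "jbracket v powr (- (p - 2)) = (jbracket v)\<^sup>2 * jbracket v powr (- p)"
        using powr_add[of "jbracket v" 2 "-p"] by (simp add: less_imp_le)
      have Jc: "1 \<le> (jbracket c)\<^sup>2" "1 \<le> (jbracket v)\<^sup>2" by (simp_all add: jbracket_sq)
      have "1 / (norm (v - c))\<^sup>2 \<le> indicator (cball 0 1) (v - c) / (norm (v - c))\<^sup>2 + 1"
      proof (cases "norm (v - c) \<le> 1")
        case False
        then have "1 \<le> (norm (v - c))\<^sup>2" by simp
        then have "1 / (norm (v - c))\<^sup>2 \<le> 1" by (intro divide_le_eq_1_pos[THEN iffD2]) auto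
        then show ?thesis using False by simp
      qed simp
      then have "1 / (norm (v - c))\<^sup>2 * jbracket v powr (- p) \<le> (indicator (cball 0 1) (v - c) / (norm (v - c))\<^sup>2 + 1) * jbracket v powr (- p)"
        by (intro mult_right_mono) auto
      also have "\<dots> \<le> indicator (cball 0 1) (v - c) / (norm (v - c))\<^sup>2 * 1 + (jbracket c)\<^sup>2 * (jbracket v)\<^sup>2 * jbracket v powr (- p)"
        using J Jc mult_mono[of 1 "(jbracket c)\<^sup>2" 1 "(jbracket v)\<^sup>2"] unfolding distrib_right
        by (intro add_mono mult_left_mono mult_right_mono) auto
      finally have 1: "1 / (norm (v - c))\<^sup>2 * jbracket v powr (- p) \<le> indicator (cball 0 1) (v - c) / (norm (v - c))\<^sup>2 + (jbracket c)\<^sup>2 * jbracket v powr (- (p - 2))"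
        unfolding eq mult.assoc by simp
      have "norm (v - c) \<le> jbracket (v + (- c))" using norm_le_jbracket[of "v - c"] by simp
      also have "\<dots> \<le> 2 * jbracket v * jbracket c" using jbracket_add_le[of v "-c"] by (simp add: jbracket_minus)
      finally have "(norm (v - c))\<^sup>2 \<le> (2 * jbracket v * jbracket c)\<^sup>2" by (intro power_mono) auto
      then have "(norm (v - c))\<^sup>2 * jbracket v powr (- p) \<le> (2 * jbracket v * jbracket c)\<^sup>2 * jbracket v powr (- p)"
        by (intro mult_right_mono) auto
      also have "\<dots> = 4 * (jbracket c)\<^sup>2 * jbracket v powr (- (p - 2))"
        unfolding eq by (simp add: power_mult_distrib)
      finally have 2: "(norm (v - c))\<^sup>2 * jbracket v powr (- p) \<le> 4 * (jbracket c)\<^sup>2 * jbracket v powr (- (p - 2))" .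
      have "kap (v - c) * jbracket v powr (- p) \<le> indicator (cball 0 1) (v - c) / (norm (v - c))\<^sup>2 + (jbracket c)\<^sup>2 * (5 * jbracket v powr (- (p - 2)))"
        using 1 2 unfolding kap_def distrib_right by simp
      then have "ennreal (kap (v - c) * jbracket v powr (- p)) \<le> ennreal (indicator (cball 0 1) (v - c) / (norm (v - c))\<^sup>2 + (jbracket c)\<^sup>2 * (5 * jbracket v powr (- (p - 2))))"
        by (rule ennreal_leI)
      also have "\<dots> = ennreal (indicator (cball 0 1) (v - c) / (norm (v - c))\<^sup>2) + ennreal ((jbracket c)\<^sup>2 * (5 * jbracket v powr (- (p - 2))))"
        by (intro ennreal_plus) (auto split: split_indicator)
      also have "ennreal ((jbracket c)\<^sup>2 * (5 * jbracket v powr (- (p - 2)))) = ennreal ((jbracket c)\<^sup>2) * ennreal (5 * jbracket v powr (- (p - 2)))"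
        by (intro ennreal_mult) auto
      finally show ?thesis .
    qed
    have "(\<integral>\<^sup>+v. ennreal (kap (v - c) * jbracket v powr (- p)) \<partial>lborel) \<le> 
      (\<integral>\<^sup>+v. ennreal (indicator (cball 0 1) (v - c) / (norm (v - c))\<^sup>2)
       + ennreal ((jbracket c)\<^sup>2) * ennreal (5 * jbracket v powr (- (p - 2))) \<partial>lborel)"
      by (intro nn_integral_mono *)
    also have "\<dots> = (\<integral>\<^sup>+v. ennreal (indicator (cball 0 1) (v - c) / (norm (v - c))\<^sup>2) \<partial>lborel) + ennreal ((jbracket c)\<^sup>2) * B"
      unfolding B_def by (subst nn_integral_add) (auto simp: nn_integral_cmult)
    also have "(\<integral>\<^sup>+v. ennreal (indicator (cball 0 1) (v - c) / (norm (v - c))\<^sup>2) \<partial>lborel) = A"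
      unfolding A_def by (rule nn_integral_shift[where g="\<lambda>v. ennreal (indicator (cball 0 1) v / (norm v)\<^sup>2)"]) simp
    also have "A + ennreal ((jbracket c)\<^sup>2) * B \<le> ennreal ((jbracket c)\<^sup>2) * A + ennreal ((jbracket c)\<^sup>2) * B"
    proof -
      have "1 * A \<le> ennreal ((jbracket c)\<^sup>2) * A"
        by (intro mult_right_mono) (auto simp: jbracket_sq)
      then show ?thesis by simp
    qed
    also have "\<dots> = ennreal ((jbracket c)\<^sup>2) * ennreal C0" by (simp add: C0(1)[symmetric] distrib_left)
    also have "\<dots> = ennreal ((jbracket c)\<^sup>2 * C0)" using C0 by (simp add: ennreal_mult)
    also have "\<dots> \<le> ennreal ((C0 + 1) * (jbracket c)\<^sup>2)"
      using C0 by (intro ennreal_leI) (simp add: algebra_simps)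
    finally show ?thesis .
  qed
  with that[of "C0 + 1"] C0 show ?thesis by auto
qed

subsection \<open>Integration by parts against singular kernels\<close>

lemma integral_shift:
  fixes g :: "r3 \<Rightarrow> real"
  shows "(LBINT v. g (v + c)) = (LBINT v. g v)"
proof -
  have "(LBINT v. g v) = (\<integral>v. g v \<partial>(distr lborel borel ((+) c)))"
    by (simp add: lborel_distr_plus)
  also have "\<dots> = (LBINT v. g (v + c))"
  proof (cases "g \<in> borel_measurable borel")
    case True
    then show ?thesis by (subst integral_distr) (auto simp: add.commute)
  next
    \<comment> \<open>For a function that is not measurable both integrals are 0 by convention,
      provided that the translate is not integrable either.\<close>
    case False
    then have "\<not> integrable lborel g" by (auto simp: integrable_iff_bounded)
    moreover have "\<not> integrable lborel (\<lambda>v. g (v + c))"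
    proof
      assume "integrable lborel (\<lambda>v. g (v + c))"
      then have [measurable]: "(\<lambda>v. g (v + c)) \<in> borel_measurable borel" by (auto dest: borel_measurable_integrable)
      have "(\<lambda>v. (\<lambda>v. g (v + c)) (v - c)) \<in> borel_measurable borel" by measurable
      with False show False by simp
    qed
    ultimately show ?thesis by (simp add: lborel_distr_plus not_integrable_integral_eq)
  qed
  finally show ?thesis by simp
qed

lemma integrable_shift:
  fixes g :: "r3 \<Rightarrow> real"
  assumes "integrable lborel g"
  shows "integrable lborel (\<lambda>v. g (v + c))"
proof -
  have "integrable (distr lborel borel ((+) c)) g" using assms by (simp add: lborel_distr_plus)
  then show ?thesis by (subst (asm) integrable_distr_eq) (use assms in \<open>auto simp: add.commute\<close>)
qed

text \<open>The span of one vector has dimension at most 1 and is therefore negligible in dimension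
  3; \<open>e = 0\<close> is included.\<close>

lemma line_null_sets: "range (\<lambda>s. c + s *\<^sub>R e) \<in> null_sets (lborel :: r3 measure)"
proof -
  have eq: "range (\<lambda>s. c + s *\<^sub>R e) = (\<lambda>x. c + x) ` span {e}"
    by (auto simp: span_singleton)
  have "dim (span {e}) \<le> 1" by (metis dim_span dim_singleton dim_eq_0 le_refl zero_le_one dim_le_card' card.insert finite.emptyI One_nat_def card.empty empty_iff finite.insertI)
  then have "negligible (span {e})" by (intro negligible_lowdim) auto
  then have n: "negligible ((\<lambda>x. c + x) ` span {e})" by (rule negligible_translation)
  have "closed ((\<lambda>x. c + x) ` span {e})" by (intro closed_translation closed_subspace subspace_span)
  then have "(\<lambda>x. c + x) ` span {e} \<in> sets lborel" by simp
  with n show ?thesis unfolding eq by (simp add: negligible_iff_null_sets null_sets_completion_iff)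
qed

text \<open>One singular point is harmless because almost every line in direction \<open>e\<close> misses it.\<close>

lemma integral_directional_derivative_eq_0:
  fixes w w' :: "r3 \<Rightarrow> real"
  assumes w: "integrable lborel w" and w': "integrable lborel w'"
    and der: "\<And>v. v \<noteq> c \<Longrightarrow> ((\<lambda>s. w (v + s *\<^sub>R e)) has_real_derivative w' v) (at 0)"
  shows "(LBINT v. w' v) = 0"
proof -
  have [measurable]: "w' \<in> borel_measurable borel" using w' by auto
  \<comment> \<open>The derivative is averaged over the translations by \<open>s *\<^sub>R e\<close>
    with s in the unit interval. Integrating in \<open>v\<close> for fixed s returns the integral of
    \<open>w'\<close>; integrating in s for fixed \<open>v\<close> gives w (v + e) - w v, whose
    integral is 0 by translation invariance. Integrability of \<open>w\<close> thus takes the place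
    of a boundary condition at infinity.\<close>
  define h where "h = (\<lambda>(v, s). indicator {0..1} s *\<^sub>R w' (v + s *\<^sub>R e))"
  have hm [measurable]: "h \<in> borel_measurable (lborel \<Otimes>\<^sub>M lborel)"
    unfolding h_def by (measurable; simp)
  have n1: "(\<integral>\<^sup>+v. norm (w' (v + s *\<^sub>R e)) \<partial>lborel) = (\<integral>\<^sup>+v. norm (w' v) \<partial>lborel)" for s
    using nn_integral_shift[of "\<lambda>v. ennreal (norm (w' v))" "- s *\<^sub>R e"] by simp
  have hint: "integrable (lborel \<Otimes>\<^sub>M lborel) h"
  proof (rule integrableI_bounded[OF hm])
    have "(\<integral>\<^sup>+x. norm (h x) \<partial>(lborel \<Otimes>\<^sub>M lborel)) = (\<integral>\<^sup>+s. \<integral>\<^sup>+v. norm (h (v, s)) \<partial>lborel \<partial>lborel)"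
      by (rule lborel_pair.nn_integral_snd[symmetric]) measurable
    also have "\<dots> = (\<integral>\<^sup>+s. indicator {0..1} s * (\<integral>\<^sup>+v. norm (w' v) \<partial>lborel) \<partial>(lborel :: real measure))"
    proof (rule nn_integral_cong)
      fix s :: real
      show "(\<integral>\<^sup>+v. norm (h (v, s)) \<partial>lborel) = indicator {0..1} s * (\<integral>\<^sup>+v. norm (w' v) \<partial>lborel)"
        using n1[of s] by (cases "s \<in> {0..1}") (auto simp: h_def)
    qed
    also have "\<dots> = (\<integral>\<^sup>+v. norm (w' v) \<partial>lborel)"
      by (subst nn_integral_multc) auto
    also have "\<dots> < \<infinity>" using w' by (simp add: integrable_iff_bounded)
    finally show "(\<integral>\<^sup>+x. norm (h x) \<partial>(lborel \<Otimes>\<^sub>M lborel)) < \<infinity>" .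
  qed
  have A: "AE v in lborel. (LINT s|lborel. h (v, s)) = w (v + e) - w v"
  proof -
    have "AE v in lborel. integrable lborel (\<lambda>s. h (v, s))"
      using lborel_pair.AE_integrable_fst'[OF hint] by simp
    moreover have "AE v in lborel. v \<notin> range (\<lambda>s. c + s *\<^sub>R e)"
      using line_null_sets by (rule AE_not_in)
    ultimately show ?thesis
    proof eventually_elim
      case (elim v)
      have ne: "v + s *\<^sub>R e \<noteq> c" for s
      proof
        assume "v + s *\<^sub>R e = c"
        then have "v = c + (- s) *\<^sub>R e" by (simp add: algebra_simps)
        with elim(2) show False by blast
      qed
      have d: "((\<lambda>s. w (v + s *\<^sub>R e)) has_real_derivative w' (v + s *\<^sub>R e)) (at s)" for s
      proof -
        have "((\<lambda>t. w ((v + s *\<^sub>R e) + t *\<^sub>R e)) has_real_derivative w' (v + s *\<^sub>R e)) (at (s - s))"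
          using der[OF ne[of s]] by simp
        then have "((\<lambda>t. w ((v + s *\<^sub>R e) + (t - s) *\<^sub>R e)) has_real_derivative w' (v + s *\<^sub>R e) * 1) (at s)"
          by (rule DERIV_chain2[where g="\<lambda>t. t - s"]) (auto intro!: derivative_eq_intros)
        then show ?thesis by (simp add: algebra_simps)
      qed
      have "((\<lambda>s. w' (v + s *\<^sub>R e)) has_integral (w (v + 1 *\<^sub>R e) - w (v + 0 *\<^sub>R e))) {0..1}"
        by (rule fundamental_theorem_of_calculus)
          (auto intro!: has_field_derivative_at_within[OF d] simp: has_real_derivative_iff_has_vector_derivative[symmetric])
      moreover have "set_integrable lborel {0..1} (\<lambda>s. w' (v + s *\<^sub>R e))"
        using elim(1) by (simp add: h_def set_integrable_def)
      ultimately show ?case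
        using set_borel_integral_eq_integral(2)[of "{0..1}" "\<lambda>s. w' (v + s *\<^sub>R e)"]
        by (simp add: h_def set_lebesgue_integral_def integral_unique)
    qed
  qed
  have "(LBINT v. w' v) = (LINT s|(lborel :: real measure). indicator {0..1} s *\<^sub>R (LBINT v. w' v))"
    by (simp)
  also have "\<dots> = (LINT s|lborel. LINT v|lborel. h (v, s))"
    by (intro Bochner_Integration.integral_cong refl)
       (auto simp: h_def integral_shift split: split_indicator)
  also have "\<dots> = (LINT v|lborel. LINT s|lborel. h (v, s))"
    using lborel_pair.Fubini_integral[of "\<lambda>v s. h (v, s)"] hint by simp
  also have "\<dots> = (LINT v|lborel. w (v + e) - w v)"
    by (intro integral_cong_AE A borel_measurable_diff) (use w integrable_shift[OF w, of e] in \<open>auto intro!: lborel.borel_measurable_lebesgue_integral hm[unfolded lborel_prod] simp: hm\<close>)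
  also have "\<dots> = 0"
    using integrable_shift[OF w, of e] w by (simp add: integral_shift)
  finally show ?thesis .
qed

section \<open>Decaying densities, admissible kernels and directional derivatives\<close>

definition decays :: "real \<Rightarrow> (r3 \<Rightarrow> real) \<Rightarrow> bool" where
  "decays p g \<longleftrightarrow> g \<in> borel_measurable borel \<and> (\<exists>K. \<forall>v. \<bar>g v\<bar> \<le> K * jbracket v powr (- p))"

text \<open>Membership asks for no smoothness: a kernel and its derivative are two separate members,
  related only away from the origin.\<close>

definition kernel :: "(r3 \<Rightarrow> real) \<Rightarrow> bool" where
  "kernel k \<longleftrightarrow> k \<in> borel_measurable borel \<and> (\<exists>C. \<forall>z. \<bar>k z\<bar> \<le> C * kap z)"

text \<open>A partial derivative as a one-variable derivative along coordinate lines, which is the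
  form consumed by the fundamental theorem of calculus. Joint differentiability is not asked
  for.\<close>

definition ddir :: "3 \<Rightarrow> (r3 \<Rightarrow> real) \<Rightarrow> (r3 \<Rightarrow> real) \<Rightarrow> bool" where
  "ddir i g dg \<longleftrightarrow> (\<forall>v. ((\<lambda>s. g (v + s *\<^sub>R axis i 1)) has_real_derivative dg v) (at 0))"

lemma decays_measurable [measurable_dest]: "decays p g \<Longrightarrow> g \<in> borel_measurable borel"
  by (simp add: decays_def)

lemma kernel_measurable [measurable_dest]: "kernel k \<Longrightarrow> k \<in> borel_measurable borel"
  by (simp add: kernel_def)

lemma decaysE:
  assumes "decays p g" obtains K where "0 \<le> K" "\<And>v. \<bar>g v\<bar> \<le> K * jbracket v powr (- p)"
proof -
  from assms obtain K where K: "\<And>v. \<bar>g v\<bar> \<le> K * jbracket v powr (- p)" by (auto simp: decays_def)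
  have "\<bar>g v\<bar> \<le> \<bar>K\<bar> * jbracket v powr (- p)" for v
    using K[of v] mult_right_mono[OF abs_ge_self[of K] jbracket_powr_nonneg[of v "- p"]] by linarith
  then show ?thesis using that[of "\<bar>K\<bar>"] by auto
qed

lemma kernelE:
  assumes "kernel k" obtains C where "0 \<le> C" "\<And>z. \<bar>k z\<bar> \<le> C * kap z"
proof -
  from assms obtain C where C: "\<And>z. \<bar>k z\<bar> \<le> C * kap z" by (auto simp: kernel_def)
  have "\<bar>k z\<bar> \<le> \<bar>C\<bar> * kap z" for z
    using C[of z] mult_right_mono[OF abs_ge_self[of C] kap_nonneg[of z]] by linarith
  then show ?thesis using that[of "\<bar>C\<bar>"] by auto
qed

lemma decays_bounded_mult:
  assumes g: "decays p g" and h [measurable]: "h \<in> borel_measurable borel" and b: "\<And>v. \<bar>h v\<bar> \<le> B"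
  shows "decays p (\<lambda>v. h v * g v)"
proof -
  obtain K where K: "0 \<le> K" "\<And>v. \<bar>g v\<bar> \<le> K * jbracket v powr (- p)" using decaysE[OF g] by blast
  note [measurable] = decays_measurable[OF g]
  have "\<bar>h v * g v\<bar> \<le> (B * K) * jbracket v powr (- p)" for v
  proof -
    have "\<bar>h v * g v\<bar> \<le> B * (K * jbracket v powr (- p))"
      unfolding abs_mult using b[of v] K(2)[of v] by (intro mult_mono) auto
    then show ?thesis by (simp add: ac_simps)
  qed
  then show ?thesis unfolding decays_def by (auto intro!: exI[of _ "B * K"])
qed

lemma decays_bound:
  assumes "decays p g" "0 \<le> p" obtains B where "0 \<le> B" "\<And>v. \<bar>g v\<bar> \<le> B"
proof -
  obtain K where K: "0 \<le> K" "\<And>v. \<bar>g v\<bar> \<le> K * jbracket v powr (- p)" using decaysE[OF assms(1)] by blast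
  have "\<bar>g v\<bar> \<le> K" for v
  proof -
    have "jbracket v powr (- p) \<le> 1" using jbracket_powr_mono[of "-p" 0 v] assms by auto
    then show ?thesis using K(2)[of v] mult_left_mono[of "jbracket v powr (- p)" 1 K] K(1) by auto
  qed
  with K that show ?thesis by blast
qed

lemma decays_mult:
  assumes "decays p g" "decays p h" "0 \<le> p"
  shows "decays p (\<lambda>v. h v * g v)"
  using decays_bound[OF assms(2,3)] decays_bounded_mult[OF assms(1)] decays_measurable[OF assms(2)] by metis

lemma decays_add:
  assumes g: "decays p g" and h: "decays p h" shows "decays p (\<lambda>v. g v + h v)"
proof -
  obtain K where K: "0 \<le> K" "\<And>v. \<bar>g v\<bar> \<le> K * jbracket v powr (- p)" using decaysE[OF g] by blast
  obtain L where L: "0 \<le> L" "\<And>v. \<bar>h v\<bar> \<le> L * jbracket v powr (- p)" using decaysE[OF h] by blast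
  note [measurable] = decays_measurable[OF g] decays_measurable[OF h]
  have "\<bar>g v + h v\<bar> \<le> (K + L) * jbracket v powr (- p)" for v
    using K(2)[of v] L(2)[of v] abs_triangle_ineq[of "g v" "h v"] unfolding distrib_right by linarith
  then show ?thesis unfolding decays_def by (auto intro!: exI[of _ "K + L"])
qed

lemma decays_dominated:
  assumes "decays p h" "g \<in> borel_measurable borel" "\<And>v. \<bar>g v\<bar> \<le> C * \<bar>h v\<bar>" "0 \<le> C"
  shows "decays p g"
proof -
  obtain K where K: "\<And>v. \<bar>h v\<bar> \<le> K * jbracket v powr (- p)" using decaysE[OF assms(1)] by blast
  have "\<bar>g v\<bar> \<le> (C * K) * jbracket v powr (- p)" for v
    using assms(3)[of v] mult_left_mono[OF K[of v] assms(4)] by (simp add: ac_simps)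
  then show ?thesis using assms(2) unfolding decays_def by blast
qed

lemma decays_integrable:
  assumes "decays p g" "p > 3"
  shows "integrable lborel g"
proof -
  obtain K where K: "0 \<le> K" "\<And>v. \<bar>g v\<bar> \<le> K * jbracket v powr (- p)" using decaysE[OF assms(1)] by blast
  show ?thesis
    by (rule Bochner_Integration.integrable_bound[OF integrable_mult_right[OF integrable_jbracket_powr[OF assms(2)], of K]])
      (use K decays_measurable[OF assms(1)] in \<open>auto simp: \<close>)
qed

lemma kernel_mult_decays_bound:
  assumes "kernel k" "decays p g" "p > 5"
  obtains B where "0 \<le> B" "\<And>c. (\<integral>\<^sup>+v. ennreal \<bar>k (v - c) * g v\<bar> \<partial>lborel) \<le> ennreal (B * (jbracket c)\<^sup>2)"
proof -
  obtain K where K: "0 \<le> K" "\<And>v. \<bar>g v\<bar> \<le> K * jbracket v powr (- p)" using decaysE[OF assms(2)] by blast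
  obtain C where C: "0 \<le> C" "\<And>v. \<bar>k v\<bar> \<le> C * kap v" using kernelE[OF assms(1)] by blast
  obtain D where D: "0 < D" "\<And>c. (\<integral>\<^sup>+v. ennreal (kap (v - c) * jbracket v powr (- p)) \<partial>lborel) \<le> ennreal (D * (jbracket c)\<^sup>2)"
    using kap_convolution[OF assms(3)] by blast
  have "(\<integral>\<^sup>+v. ennreal \<bar>k (v - c) * g v\<bar> \<partial>lborel) \<le> ennreal ((C * K * D) * (jbracket c)\<^sup>2)" for c
  proof -
    have "(\<integral>\<^sup>+v. ennreal \<bar>k (v - c) * g v\<bar> \<partial>lborel) \<le> (\<integral>\<^sup>+v. ennreal (C * K) * ennreal (kap (v - c) * jbracket v powr (- p)) \<partial>lborel)"
    proof (rule nn_integral_mono)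
      fix v
      have "\<bar>k (v - c) * g v\<bar> \<le> (C * kap (v - c)) * (K * jbracket v powr (- p))"
        unfolding abs_mult using C K by (intro mult_mono) auto
      then have "ennreal \<bar>k (v - c) * g v\<bar> \<le> ennreal ((C * K) * (kap (v - c) * jbracket v powr (- p)))"
        by (intro ennreal_leI) (simp add: ac_simps)
      also have "\<dots> = ennreal (C * K) * ennreal (kap (v - c) * jbracket v powr (- p))"
        using C K by (intro ennreal_mult) auto
      finally show "ennreal \<bar>k (v - c) * g v\<bar> \<le> ennreal (C * K) * ennreal (kap (v - c) * jbracket v powr (- p))" .
    qed
    also have "\<dots> = ennreal (C * K) * (\<integral>\<^sup>+v. ennreal (kap (v - c) * jbracket v powr (- p)) \<partial>lborel)"
      by (rule nn_integral_cmult) measurable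
    also have "\<dots> \<le> ennreal (C * K) * ennreal (D * (jbracket c)\<^sup>2)"
      by (intro mult_left_mono D) auto
    also have "\<dots> = ennreal ((C * K * D) * (jbracket c)\<^sup>2)"
      using C K D by (subst ennreal_mult[symmetric]) (auto simp: mult.assoc)
    finally show ?thesis .
  qed
  moreover have "0 \<le> C * K * D" using C K D by simp
  ultimately show ?thesis using that by blast
qed

lemma kernel_mult_decays_integrable:
  assumes "kernel k" "decays p g" "p > 5"
  shows "integrable lborel (\<lambda>v. k (v - c) * g v)"
proof (rule integrableI_bounded)
  note [measurable] = kernel_measurable[OF assms(1)] decays_measurable[OF assms(2)]
  show "(\<lambda>v. k (v - c) * g v) \<in> borel_measurable lborel" by measurable
  obtain B where "(\<integral>\<^sup>+v. ennreal \<bar>k (v - c) * g v\<bar> \<partial>lborel) \<le> ennreal (B * (jbracket c)\<^sup>2)"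
    using kernel_mult_decays_bound[OF assms] by metis
  then show "(\<integral>\<^sup>+v. ennreal (norm (k (v - c) * g v)) \<partial>lborel) < \<infinity>"
    by (simp add: order_le_less_trans)
qed

text \<open>The product of the shifted kernel with \<open>g\<close> is integrable and so is its
  directional derivative away from \<open>c\<close>, hence the integral of the latter vanishes. No
  boundary term arises at \<open>c\<close> or at infinity, even when \<open>dk\<close> is as
  singular as |z|^-2.\<close>

lemma integral_by_parts_kernel:
  assumes k: "kernel k" and dk: "kernel dk"
    and dder: "\<And>z. z \<noteq> 0 \<Longrightarrow> ((\<lambda>s. k (z + s *\<^sub>R axis i 1)) has_real_derivative dk z) (at 0)"
    and g: "decays p g" and dg: "decays p dg" and p: "p > 5" and d: "ddir i g dg"
  shows "(LBINT v. k (v - c) * dg v) = - (LBINT v. dk (v - c) * g v)"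
proof -
  note int = kernel_mult_decays_integrable[OF _ _ p]
  have "(LBINT v. k (v - c) * dg v + dk (v - c) * g v) = 0"
  proof (rule integral_directional_derivative_eq_0[where c=c and e="axis i 1"])
    show "integrable lborel (\<lambda>v. k (v - c) * g v)" by (rule int[OF k g])
    show "integrable lborel (\<lambda>v. k (v - c) * dg v + dk (v - c) * g v)"
      by (intro Bochner_Integration.integrable_add int k dg dk g)
    fix v assume "v \<noteq> c"
    then have "((\<lambda>s. k (v - c + s *\<^sub>R axis i 1)) has_real_derivative dk (v - c)) (at 0)"
      by (intro dder) auto
    moreover have "((\<lambda>s. g (v + s *\<^sub>R axis i 1)) has_real_derivative dg v) (at 0)"
      using d by (simp add: ddir_def)
    ultimately have "((\<lambda>s. k (v - c + s *\<^sub>R axis i 1) * g (v + s *\<^sub>R axis i 1)) has_real_derivative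
        dk (v - c) * g (v + 0 *\<^sub>R axis i 1) + dg v * k (v - c + 0 *\<^sub>R axis i 1)) (at 0)"
      by (rule DERIV_mult)
    then show "((\<lambda>s. k (v + s *\<^sub>R axis i 1 - c) * g (v + s *\<^sub>R axis i 1)) has_real_derivative
          k (v - c) * dg v + dk (v - c) * g v) (at 0)"
      by (simp add: algebra_simps)
  qed
  then show ?thesis
    by (simp add: Bochner_Integration.integral_add[OF int[OF k dg] int[OF dk g]])
qed

subsection \<open>The Landau kernels\<close>

lemma norm_powr_le_kap:
  assumes "-2 \<le> t" "t \<le> 2" shows "norm z powr t \<le> kap z"
proof (cases "z = 0")
  case False
  then have n: "norm z > 0" by simp
  show ?thesis
  proof (cases "norm z \<le> 1")
    case True
    have "norm z powr t \<le> norm z powr (-2)" using True n assms by (intro powr_mono') auto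
    also have "\<dots> = 1 / (norm z)\<^sup>2" using n by (simp add: powr_minus inverse_eq_divide)
    finally show ?thesis by (simp add: kap_def add_increasing2)
  next
    case nle: False
    have "norm z powr t \<le> norm z powr 2" using nle assms by (intro powr_mono) auto
    also have "\<dots> = (norm z)\<^sup>2" using n by simp
    finally show ?thesis by (simp add: kap_def add_increasing)
  qed
qed simp

lemma kernel_norm_powr: "-2 \<le> t \<Longrightarrow> t \<le> 2 \<Longrightarrow> kernel (\<lambda>z. norm z powr t)"
  unfolding kernel_def by (auto intro!: exI[of _ 1] norm_powr_le_kap)

lemma kernel_dominated:
  assumes "k \<in> borel_measurable borel" "-2 \<le> t" "t \<le> 2" "\<And>z. \<bar>k z\<bar> \<le> C * norm z powr t" "0 \<le> C"
  shows "kernel k"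
  unfolding kernel_def using assms(1) order_trans[OF assms(4) mult_left_mono[OF norm_powr_le_kap[OF assms(2,3)] assms(5)]] by blast

text \<open>The entries of \<open>landau_a\<close> with the division by |z|^2 carried out, which
  makes them easy to differentiate along lines; at the origin both forms are 0.\<close>

definition ka :: "real \<Rightarrow> 3 \<Rightarrow> 3 \<Rightarrow> r3 \<Rightarrow> real" where
  "ka \<gamma> i j z = norm z powr \<gamma> * ((norm z)\<^sup>2 * (if i = j then 1 else 0) - z $ i * z $ j)"

definition kb :: "real \<Rightarrow> 3 \<Rightarrow> r3 \<Rightarrow> real" where
  "kb \<gamma> i z = - 2 * norm z powr \<gamma> * z $ i"

text \<open>The derivative of the entry (i, j) in the direction of its row index \<open>i\<close>
  only, since the divergence is all that is used. The last two terms of the second bracket come from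
  differentiating the product of the components i and j.\<close>

definition dka :: "real \<Rightarrow> 3 \<Rightarrow> 3 \<Rightarrow> r3 \<Rightarrow> real" where
  "dka \<gamma> i j z = \<gamma> * norm z powr (\<gamma> - 2) * z $ i * ((norm z)\<^sup>2 * (if i = j then 1 else 0) - z $ i * z $ j)
     + norm z powr \<gamma> * (2 * z $ i * (if i = j then 1 else 0) - z $ j - z $ i * (if i = j then 1 else 0))"

definition dkb :: "real \<Rightarrow> 3 \<Rightarrow> r3 \<Rightarrow> real" where
  "dkb \<gamma> i z = - 2 * (\<gamma> * norm z powr (\<gamma> - 2) * (z $ i)\<^sup>2 + norm z powr \<gamma>)"

lemma ka_measurable [measurable]: "ka \<gamma> i j \<in> borel_measurable borel"
  unfolding ka_def by measurable
lemma kb_measurable [measurable]: "kb \<gamma> i \<in> borel_measurable borel"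
  unfolding kb_def by measurable
lemma dka_measurable [measurable]: "dka \<gamma> i j \<in> borel_measurable borel"
  unfolding dka_def by measurable
lemma dkb_measurable [measurable]: "dkb \<gamma> i \<in> borel_measurable borel"
  unfolding dkb_def by measurable

text \<open>Valid at z = 0 as well, because \<open>0 powr t = 0\<close> for every t.\<close>

lemma norm_powr_shift: "norm (z::r3) powr t * norm z ^ n = norm z powr (t + real n)"
  by (cases "z = 0") (auto simp: powr_add powr_realpow)

lemma landau_a_eq: "landau_a \<gamma> z $ i $ j = ka \<gamma> i j z"
proof (cases "z = 0")
  case False
  then have "norm z powr (\<gamma> + 2) = norm z powr \<gamma> * (norm z)\<^sup>2" by (simp add: powr_add)
  then show ?thesis using False
    by (auto simp: landau_a_def ka_def mat_def field_simps)
qed (simp add: landau_a_def ka_def)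

lemma landau_b_eq: "landau_b \<gamma> z $ i = kb \<gamma> i z"
  by (simp add: landau_b_def kb_def)

lemma abs_nth_le: "\<bar>z $ i\<bar> \<le> norm (z :: r3)"
  by (rule component_le_norm_cart)

lemma ka_core_le: "\<bar>(norm z)\<^sup>2 * (if i = j then 1 else 0) - z $ i * z $ j\<bar> \<le> (norm (z::r3))\<^sup>2"
proof -
  have "\<bar>z $ i * z $ j\<bar> \<le> (norm z)\<^sup>2"
    unfolding abs_mult power2_eq_square by (intro mult_mono abs_nth_le) auto
  moreover have "0 \<le> z $ i * z $ i" by simp
  ultimately show ?thesis by (auto simp: abs_le_iff)
qed

lemma ka_le: "\<bar>ka \<gamma> i j z\<bar> \<le> norm z powr (\<gamma> + 2)"
proof -
  have "\<bar>ka \<gamma> i j z\<bar> \<le> norm z powr \<gamma> * (norm z)\<^sup>2"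
    unfolding ka_def abs_mult by (intro mult_mono ka_core_le) auto
  then show ?thesis using norm_powr_shift[of z \<gamma> 2] by simp
qed

lemma kb_le: "\<bar>kb \<gamma> i z\<bar> \<le> 2 * norm z powr (\<gamma> + 1)"
proof -
  have "\<bar>kb \<gamma> i z\<bar> \<le> 2 * (norm z powr \<gamma> * norm z ^ 1)"
    unfolding kb_def abs_mult by (auto intro!: mult_left_mono abs_nth_le)
  then show ?thesis using norm_powr_shift[of z \<gamma> 1] by simp
qed

lemma dka_le: "\<bar>dka \<gamma> i j z\<bar> \<le> (\<bar>\<gamma>\<bar> + 4) * norm z powr (\<gamma> + 1)"
proof -
  have "\<bar>\<gamma> * norm z powr (\<gamma> - 2) * z $ i * ((norm z)\<^sup>2 * (if i = j then 1 else 0) - z $ i * z $ j)\<bar>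
    \<le> \<bar>\<gamma>\<bar> * norm z powr (\<gamma> - 2) * norm z * (norm z)\<^sup>2"
    unfolding abs_mult by (intro mult_mono abs_nth_le ka_core_le) auto
  also have "\<dots> = \<bar>\<gamma>\<bar> * norm z powr (\<gamma> + 1)"
    using norm_powr_shift[of z "\<gamma> - 2" 3] by (simp add: power3_eq_cube power2_eq_square mult.assoc add.commute)
  finally have 1: "\<bar>\<gamma> * norm z powr (\<gamma> - 2) * z $ i * ((norm z)\<^sup>2 * (if i = j then 1 else 0) - z $ i * z $ j)\<bar>
    \<le> \<bar>\<gamma>\<bar> * norm z powr (\<gamma> + 1)" .
  have "\<bar>2 * z $ i * (if i = j then 1 else 0) - z $ j - z $ i * (if i = j then 1 else 0)\<bar> \<le> 4 * norm z"
    using abs_nth_le[of z i] abs_nth_le[of z j] by (auto split: if_splits)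
  then have "\<bar>norm z powr \<gamma> * (2 * z $ i * (if i = j then 1 else 0) - z $ j - z $ i * (if i = j then 1 else 0))\<bar>
    \<le> norm z powr \<gamma> * (4 * norm z)"
    unfolding abs_mult by (intro mult_mono) auto
  also have "\<dots> = 4 * norm z powr (\<gamma> + 1)"
    using norm_powr_shift[of z \<gamma> 1] by simp
  finally show ?thesis unfolding dka_def distrib_right using 1 by linarith
qed

lemma dkb_le: "\<bar>dkb \<gamma> i z\<bar> \<le> (2 * (\<bar>\<gamma>\<bar> + 1)) * norm z powr \<gamma>"
proof -
  have "(z $ i)\<^sup>2 \<le> (norm z)\<^sup>2" using abs_nth_le[of z i] by (metis abs_norm_cancel abs_le_square_iff)
  then have "\<bar>\<gamma> * norm z powr (\<gamma> - 2) * (z $ i)\<^sup>2\<bar> \<le> \<bar>\<gamma>\<bar> * norm z powr (\<gamma> - 2) * (norm z)\<^sup>2"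
    unfolding abs_mult by (intro mult_mono) auto
  also have "\<dots> = \<bar>\<gamma>\<bar> * norm z powr \<gamma>"
    using norm_powr_shift[of z "\<gamma> - 2" 2] by (simp add: mult.assoc)
  finally have "\<bar>\<gamma> * norm z powr (\<gamma> - 2) * (z $ i)\<^sup>2\<bar> \<le> \<bar>\<gamma>\<bar> * norm z powr \<gamma>" .
  then have "\<bar>\<gamma> * norm z powr (\<gamma> - 2) * (z $ i)\<^sup>2 + norm z powr \<gamma>\<bar> \<le> (\<bar>\<gamma>\<bar> + 1) * norm z powr \<gamma>"
    using abs_triangle_ineq[of "\<gamma> * norm z powr (\<gamma> - 2) * (z $ i)\<^sup>2" "norm z powr \<gamma>"] by (simp add: distrib_right)
  then have "2 * \<bar>\<gamma> * norm z powr (\<gamma> - 2) * (z $ i)\<^sup>2 + norm z powr \<gamma>\<bar> \<le> (2 * (\<bar>\<gamma>\<bar> + 1)) * norm z powr \<gamma>"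
    unfolding mult.assoc by (intro mult_left_mono) auto
  then show ?thesis by (simp only: dkb_def abs_mult abs_neg_numeral abs_numeral)
qed

lemma kernel_ka: "-2 \<le> \<gamma> \<Longrightarrow> \<gamma> \<le> 0 \<Longrightarrow> kernel (ka \<gamma> i j)"
  by (rule kernel_dominated[where t="\<gamma> + 2" and C=1]) (auto intro: order_trans[OF ka_le])
lemma kernel_kb: "-2 \<le> \<gamma> \<Longrightarrow> \<gamma> \<le> 0 \<Longrightarrow> kernel (kb \<gamma> i)"
  by (rule kernel_dominated[where t="\<gamma> + 1" and C=2]) (auto intro: order_trans[OF kb_le])
lemma kernel_dka: "-2 \<le> \<gamma> \<Longrightarrow> \<gamma> \<le> 0 \<Longrightarrow> kernel (dka \<gamma> i j)"
  by (rule kernel_dominated[where t="\<gamma> + 1" and C="\<bar>\<gamma>\<bar> + 4"]) (auto intro: order_trans[OF dka_le])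
lemma kernel_dkb: "-2 \<le> \<gamma> \<Longrightarrow> \<gamma> \<le> 0 \<Longrightarrow> kernel (dkb \<gamma> i)"
  by (rule kernel_dominated[where t="\<gamma>" and C="2 * (\<bar>\<gamma>\<bar> + 1)"]) (auto intro: order_trans[OF dkb_le])

lemma norm_sq_3: "(norm (z::r3))\<^sup>2 = (z $ 1)\<^sup>2 + (z $ 2)\<^sup>2 + (z $ 3)\<^sup>2"
  unfolding power2_norm_eq_inner by (simp add: inner_vec_def sum_3 power2_eq_square)

lemma inner_3: "(z::r3) \<bullet> w = z $ 1 * w $ 1 + z $ 2 * w $ 2 + z $ 3 * w $ 3"
  by (simp add: inner_vec_def sum_3)

lemma DERIV_norm_sq_line:
  "((\<lambda>s. (norm (z + s *\<^sub>R axis i 1))\<^sup>2) has_real_derivative 2 * (z::r3) $ i) (at 0)"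
proof -
  have eq: "(\<lambda>s. (norm (z + s *\<^sub>R axis i 1))\<^sup>2) = (\<lambda>s. (norm z)\<^sup>2 + 2 * s * z $ i + s\<^sup>2)"
    unfolding power2_norm_eq_inner
    by (auto simp: inner_add_left inner_add_right inner_axis' inner_axis fun_eq_iff power2_eq_square algebra_simps)
  show ?thesis unfolding eq by (auto intro!: derivative_eq_intros)
qed

lemma DERIV_nth_line: "((\<lambda>s. (z + s *\<^sub>R axis i 1) $ j) has_real_derivative (if i = j then 1 else 0)) (at 0)"
  by (auto intro!: derivative_eq_intros simp: axis_def)

text \<open>The square of the norm is a quadratic polynomial along the line, so the power is
  differentiated as a power of the square.\<close>

lemma DERIV_norm_powr_line:
  assumes "z \<noteq> (0::r3)"
  shows "((\<lambda>s. norm (z + s *\<^sub>R axis i 1) powr t) has_real_derivative t * norm z powr (t - 2) * z $ i) (at 0)"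
proof -
  have sq: "((norm x)\<^sup>2) powr a = norm x powr (2 * a)" for x :: r3 and a
    unfolding powr_powr[symmetric] by simp
  have eq: "norm x powr t = ((norm x)\<^sup>2) powr (t / 2)" for x :: r3
    by (simp add: sq)
  have eq2: "norm z powr (t - 2) = ((norm z)\<^sup>2) powr (t / 2 - 1)"
    by (simp add: sq)
  have "((\<lambda>s. ((norm (z + s *\<^sub>R axis i 1))\<^sup>2) powr (t / 2)) has_real_derivative
     (t / 2) * ((norm (z + 0 *\<^sub>R axis i 1))\<^sup>2) powr (t / 2 - of_nat 1) * (2 * z $ i)) (at 0)"
    by (rule DERIV_fun_powr[OF DERIV_norm_sq_line]) (use assms in auto)
  then show ?thesis unfolding eq eq2 by (simp add: mult.assoc)
qed

lemma ka_deriv: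
  assumes "z \<noteq> 0"
  shows "((\<lambda>s. ka \<gamma> i j (z + s *\<^sub>R axis i 1)) has_real_derivative dka \<gamma> i j z) (at 0)"
  unfolding ka_def
  by (rule DERIV_cong[OF DERIV_mult[OF DERIV_norm_powr_line[OF assms]
     DERIV_diff[OF DERIV_cmult_right[OF DERIV_norm_sq_line] DERIV_mult[OF DERIV_nth_line DERIV_nth_line]]]])
     (simp add: dka_def algebra_simps)

lemma kb_deriv:
  assumes "z \<noteq> 0"
  shows "((\<lambda>s. kb \<gamma> i (z + s *\<^sub>R axis i 1)) has_real_derivative dkb \<gamma> i z) (at 0)"
  unfolding kb_def mult.assoc
  by (rule DERIV_cong[OF DERIV_cmult[OF DERIV_mult[OF DERIV_norm_powr_line[OF assms] DERIV_nth_line]]])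
     (simp add: dkb_def algebra_simps power2_eq_square)

text \<open>The terms with the factor \<gamma> cancel because the matrix annihilates
  \<open>z\<close>; of the others 2 - 3 - 1 = -2 copies of the component j remain.\<close>

lemma sum_dka: "(\<Sum>i\<in>UNIV. dka \<gamma> i j z) = kb \<gamma> j z"
proof -
  have *: "j = 1 \<or> j = 2 \<or> j = 3" using exhaust_3 by blast
  show ?thesis unfolding sum_3 dka_def kb_def norm_sq_3 using *
    by (elim disjE) (simp_all add: algebra_simps power2_eq_square)
qed

text \<open>The source of the singular term. In the range \<gamma> \<ge> -2 the right-hand side is
  locally integrable and no point mass appears at the origin.\<close>

lemma sum_dkb: "(\<Sum>i\<in>UNIV. dkb \<gamma> i z) = - 2 * (\<gamma> + 3) * norm z powr \<gamma>"
proof -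
  have "norm z powr (\<gamma> - 2) * (norm z)\<^sup>2 = norm z powr \<gamma>"
    using norm_powr_shift[of z "\<gamma> - 2" 2] by simp
  then have *: "\<gamma> * (norm z powr (\<gamma> - 2) * ((z $ 1)\<^sup>2 + (z $ 2)\<^sup>2 + (z $ 3)\<^sup>2)) = \<gamma> * norm z powr \<gamma>"
    unfolding norm_sq_3[symmetric] by simp
  show ?thesis unfolding sum_3 dkb_def using * by (simp add: algebra_simps)
qed

text \<open>Formulated for a vector field \<open>g\<close> with derivatives \<open>dg i j\<close>,
  so that it applies to products such as a test function times a gradient; the row sums of the
  differentiated kernel collapse to the drift.\<close>

lemma ka_divergence_parts:
  assumes \<gamma>: "-2 \<le> \<gamma>" "\<gamma> \<le> 0" and p: "p > 5"
    and g: "\<And>j. decays p (g j)" and dg: "\<And>i j. decays p (dg i j)" and d: "\<And>i j. ddir i (g j) (dg i j)"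
  shows "(LBINT v. (\<Sum>i\<in>UNIV. \<Sum>j\<in>UNIV. ka \<gamma> i j (v - c) * dg i j v))
    = - (LBINT v. (\<Sum>j\<in>UNIV. kb \<gamma> j (v - c) * g j v))"
proof -
  note int = kernel_mult_decays_integrable[OF _ _ p]
  have "(LBINT v. (\<Sum>i\<in>UNIV. \<Sum>j\<in>UNIV. ka \<gamma> i j (v - c) * dg i j v))
     = (\<Sum>i\<in>UNIV. \<Sum>j\<in>UNIV. \<integral>v. ka \<gamma> i j (v - c) * dg i j v \<partial>lborel)"
    by (simp add: Bochner_Integration.integral_sum Bochner_Integration.integrable_sum int[OF kernel_ka[OF \<gamma>] dg])
  also have "\<dots> = (\<Sum>i\<in>UNIV. \<Sum>j\<in>UNIV. - \<integral>v. dka \<gamma> i j (v - c) * g j v \<partial>lborel)"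
    by (intro sum.cong refl integral_by_parts_kernel[OF kernel_ka[OF \<gamma>] kernel_dka[OF \<gamma>] ka_deriv g dg p d])
  also have "\<dots> = - (\<Sum>j\<in>UNIV. \<Sum>i\<in>UNIV. \<integral>v. dka \<gamma> i j (v - c) * g j v \<partial>lborel)"
    by (subst sum.swap) (simp add: sum_negf)
  also have "\<dots> = - (LBINT v. (\<Sum>j\<in>UNIV. \<Sum>i\<in>UNIV. dka \<gamma> i j (v - c) * g j v))"
    by (simp add: Bochner_Integration.integral_sum Bochner_Integration.integrable_sum int[OF kernel_dka[OF \<gamma>] g])
  also have "\<dots> = - (LBINT v. (\<Sum>j\<in>UNIV. kb \<gamma> j (v - c) * g j v))"
    by (simp add: sum_distrib_right[symmetric] sum_dka)
  finally show ?thesis .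
qed

lemma kb_divergence_parts:
  assumes \<gamma>: "-2 \<le> \<gamma>" "\<gamma> \<le> 0" and p: "p > 5"
    and g: "decays p g" and dg: "\<And>i. decays p (dg i)" and d: "\<And>i. ddir i g (dg i)"
  shows "(LBINT v. (\<Sum>i\<in>UNIV. kb \<gamma> i (v - c) * dg i v))
    = 2 * (\<gamma> + 3) * (LBINT v. norm (v - c) powr \<gamma> * g v)"
proof -
  note int = kernel_mult_decays_integrable[OF _ _ p]
  have "(LBINT v. (\<Sum>i\<in>UNIV. kb \<gamma> i (v - c) * dg i v))
     = (\<Sum>i\<in>UNIV. \<integral>v. kb \<gamma> i (v - c) * dg i v \<partial>lborel)"
    by (simp add: Bochner_Integration.integral_sum int[OF kernel_kb[OF \<gamma>] dg])
  also have "\<dots> = (\<Sum>i\<in>UNIV. - \<integral>v. dkb \<gamma> i (v - c) * g v \<partial>lborel)"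
    by (intro sum.cong refl integral_by_parts_kernel[OF kernel_kb[OF \<gamma>] kernel_dkb[OF \<gamma>] kb_deriv g dg p d])
  also have "\<dots> = - (LBINT v. (\<Sum>i\<in>UNIV. dkb \<gamma> i (v - c) * g v))"
    by (simp add: Bochner_Integration.integral_sum int[OF kernel_dkb[OF \<gamma>] g] sum_negf)
  also have "\<dots> = - (LBINT v. - 2 * (\<gamma> + 3) * (norm (v - c) powr \<gamma> * g v))"
    by (simp add: sum_distrib_right[symmetric] sum_dkb mult.assoc)
  also have "\<dots> = 2 * (\<gamma> + 3) * (LBINT v. norm (v - c) powr \<gamma> * g v)"
    unfolding integral_mult_right_zero by (simp only: mult_minus_left minus_minus)
  finally show ?thesis .
qed

lemma integral_linear_comb3:
  fixes f g h :: "'a \<Rightarrow> real"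
  assumes "integrable M f" "integrable M g" "integrable M h"
  shows "(\<integral>x. a * f x + b * g x + c * h x \<partial>M) = a * (\<integral>x. f x \<partial>M) + b * (\<integral>x. g x \<partial>M) + c * (\<integral>x. h x \<partial>M)"
  using assms by simp

lemma ddir_mult:
  assumes "ddir i g dg" "ddir i h dh"
  shows "ddir i (\<lambda>v. g v * h v) (\<lambda>v. dg v * h v + dh v * g v)"
  unfolding ddir_def
proof
  fix v
  from assms have "((\<lambda>s. g (v + s *\<^sub>R axis i 1)) has_real_derivative dg v) (at 0)"
    "((\<lambda>s. h (v + s *\<^sub>R axis i 1)) has_real_derivative dh v) (at 0)" by (auto simp: ddir_def)
  from DERIV_mult[OF this]
  show "((\<lambda>s. g (v + s *\<^sub>R axis i 1) * h (v + s *\<^sub>R axis i 1)) has_real_derivative dg v * h v + dh v * g v) (at 0)"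
    by simp
qed

lemma ddir_chain:
  assumes "ddir i g dg" "\<And>v. (F has_real_derivative F' (g v)) (at (g v))"
  shows "ddir i (\<lambda>v. F (g v)) (\<lambda>v. F' (g v) * dg v)"
  unfolding ddir_def
proof
  fix v
  have "((\<lambda>s. g (v + s *\<^sub>R axis i 1)) has_real_derivative dg v) (at 0)"
    using assms(1) by (auto simp: ddir_def)
  moreover have "(F has_real_derivative F' (g v)) (at (g (v + 0 *\<^sub>R axis i 1)))" using assms(2) by simp
  ultimately show "((\<lambda>s. F (g (v + s *\<^sub>R axis i 1))) has_real_derivative F' (g v) * dg v) (at 0)"
    by (intro DERIV_chain2)
qed

lemma ddir_jbracket_powr: "ddir i (\<lambda>v. jbracket v powr t) (\<lambda>v. t * jbracket v powr (t - 2) * v $ i)"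
  unfolding ddir_def
proof
  fix v
  have sq: "jbracket x powr t = (1 + (norm x)\<^sup>2) powr (t / 2)" for x t
  proof -
    have "jbracket x powr t = (jbracket x powr 2) powr (t / 2)" by (simp only: powr_powr) simp
    then show ?thesis by (simp add: jbracket_powr_2)
  qed
  have "((\<lambda>s. 1 + (norm (v + s *\<^sub>R axis i 1))\<^sup>2) has_real_derivative 2 * v $ i) (at 0)"
    using DERIV_add[OF DERIV_const DERIV_norm_sq_line[of v i], of 1] by simp
  from DERIV_fun_powr[OF this, of "t / 2"]
  have "((\<lambda>s. (1 + (norm (v + s *\<^sub>R axis i 1))\<^sup>2) powr (t / 2)) has_real_derivative
     (t / 2) * (1 + (norm v)\<^sup>2) powr (t / 2 - 1) * (2 * v $ i)) (at 0)"
    by (simp add: add_pos_nonneg)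
  then show "((\<lambda>s. jbracket (v + s *\<^sub>R axis i 1) powr t) has_real_derivative t * jbracket v powr (t - 2) * v $ i) (at 0)"
    unfolding sq by (simp add: diff_divide_distrib mult.assoc)
qed

subsection \<open>The regularised entropy\<close>

text \<open>The primitive of x / (x + \<delta>) that vanishes at 0; it tends to x as \<delta> tends
  to 0. It arises because u times the gradient of ln (1 + u / \<delta>) is the gradient of
  \<open>entG \<delta> u\<close>.\<close>

definition entG :: "real \<Rightarrow> real \<Rightarrow> real" where
  "entG \<delta> x = x - \<delta> * ln (1 + x / \<delta>)"

lemma entG_deriv:
  assumes "0 < \<delta>" "0 \<le> x"
  shows "(entG \<delta> has_real_derivative x / (x + \<delta>)) (at x)"
proof -
  have p: "1 + x / \<delta> > 0" using assms by (simp add: add_pos_nonneg)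
  have "((\<lambda>x. x - \<delta> * ln (1 + x / \<delta>)) has_real_derivative 1 - \<delta> * (1 / (1 + x / \<delta>) * (1 / \<delta>))) (at x)"
    using p by (auto intro!: derivative_eq_intros)
  moreover have "1 - \<delta> * (1 / (1 + x / \<delta>) * (1 / \<delta>)) = x / (x + \<delta>)"
    using assms by (simp add: divide_simps add_nonneg_eq_0_iff)
  ultimately show ?thesis unfolding entG_def by simp
qed

lemma entG_le: "0 < \<delta> \<Longrightarrow> 0 \<le> x \<Longrightarrow> entG \<delta> x \<le> x"
  by (simp add: entG_def ln_ge_zero)

lemma entG_nonneg:
  assumes "0 < \<delta>" "0 \<le> x" shows "0 \<le> entG \<delta> x"
proof -
  have "ln (1 + x / \<delta>) \<le> x / \<delta>" using assms by (intro ln_add_one_self_le_self) auto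
  then have "\<delta> * ln (1 + x / \<delta>) \<le> \<delta> * (x / \<delta>)" using assms by (intro mult_left_mono) auto
  then show ?thesis using assms by (simp add: entG_def)
qed

text \<open>The difference of the two sides vanishes at 0 and has derivative x^2 / (x + \<delta>)^2.
  The inequality is what lets the regularised Hardy argument close: the square left over by Young's
  inequality is again bounded by \<open>entG\<close>.\<close>

lemma entG_lower:
  assumes \<delta>: "0 < \<delta>" and x: "0 \<le> x" shows "x\<^sup>2 / (x + \<delta>) \<le> 2 * entG \<delta> x"
proof -
  have "2 * entG \<delta> 0 - 0\<^sup>2 / (0 + \<delta>) \<le> 2 * entG \<delta> x - x\<^sup>2 / (x + \<delta>)"
  proof (rule DERIV_nonneg_imp_nondecreasing[OF x])
    fix y assume y: "0 \<le> y" "y \<le> x"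
    have nz: "y + \<delta> \<noteq> 0" using y \<delta> by auto
    have 1: "((\<lambda>y. 2 * entG \<delta> y - y\<^sup>2 / (y + \<delta>)) has_real_derivative
        2 * (y / (y + \<delta>)) - (2 * y * (y + \<delta>) - y\<^sup>2 * 1) / ((y + \<delta>) * (y + \<delta>))) (at y)"
      using nz by (auto intro!: derivative_eq_intros entG_deriv[OF \<delta> y(1)] simp: power2_eq_square)
    have "2 * (y / (y + \<delta>)) - (2 * y * (y + \<delta>) - y\<^sup>2 * 1) / ((y + \<delta>) * (y + \<delta>)) = y\<^sup>2 / ((y + \<delta>) * (y + \<delta>))"
      using nz by (simp add: divide_simps power2_eq_square)
    then show "\<exists>D. ((\<lambda>y. 2 * entG \<delta> y - y\<^sup>2 / (y + \<delta>)) has_real_derivative D) (at y) \<and> 0 \<le> D"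
      using 1 by (intro exI conjI) auto
  qed
  then show ?thesis by (simp add: entG_def)
qed

subsection \<open>The collision operator at a fixed time\<close>

locale snapshot =
  fixes \<gamma> p :: real and u :: "r3 \<Rightarrow> real" and u1 :: "3 \<Rightarrow> r3 \<Rightarrow> real" and u2 :: "3 \<Rightarrow> 3 \<Rightarrow> r3 \<Rightarrow> real"
  assumes \<gamma>_ge: "-2 \<le> \<gamma>" and \<gamma>_neg: "\<gamma> < 0" and p: "p > 5"
    and u_nonneg: "0 \<le> u v"
    and du: "decays p u" and du1: "decays p (u1 i)" and du2: "decays p (u2 i j)"
    and dd1: "ddir i u (u1 i)" and dd2: "ddir i (u1 j) (u2 i j)"
begin

lemma \<gamma>_le: "\<gamma> \<le> 0" using \<gamma>_neg by simp

lemma \<gamma>_le2: "\<gamma> \<le> 2" using \<gamma>_neg by simp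

lemma u_measurable [measurable]: "u \<in> borel_measurable borel"
  and u1_measurable [measurable]: "u1 i \<in> borel_measurable borel"
  and u2_measurable [measurable]: "u2 i j \<in> borel_measurable borel"
  using du du1 du2 by (auto simp: decays_def)

lemma kint: "kernel k \<Longrightarrow> decays p g \<Longrightarrow> integrable lborel (\<lambda>v. k (v - c) * g v)"
  by (rule kernel_mult_decays_integrable[OF _ _ p])

text \<open>The integrand of the collision operator after both derivatives of \<open>u\<close> at the partner velocity
  \<open>c\<close> have been moved to the kernel.\<close>

definition core :: "r3 \<Rightarrow> r3 \<Rightarrow> real" where
  "core v c = (\<Sum>i\<in>UNIV. \<Sum>j\<in>UNIV. ka \<gamma> i j (v - c) * u2 i j v) + 2 * (\<gamma> + 3) * norm (v - c) powr \<gamma> * u v"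

text \<open>The two integrands differ by divergences. The vector fields u \<nabla>\<phi> and \<phi>
  \<nabla>u are integrated against the matrix and \<phi> u against its divergence; these three
  identities remove every term except \<phi> times \<open>core\<close>.\<close>

lemma core_weak:
  assumes b: "\<And>v. \<bar>\<phi> v\<bar> \<le> B" "\<And>i v. \<bar>\<phi>1 i v\<bar> \<le> B" "\<And>i j v. \<bar>\<phi>2 i j v\<bar> \<le> B"
    and m [measurable]: "\<phi> \<in> borel_measurable borel" "\<And>i. \<phi>1 i \<in> borel_measurable borel" "\<And>i j. \<phi>2 i j \<in> borel_measurable borel"
    and d1: "\<And>i. ddir i \<phi> (\<phi>1 i)" and d2: "\<And>i j. ddir i (\<phi>1 j) (\<phi>2 i j)"
  shows "(LBINT v. u v * ((\<Sum>i\<in>UNIV. \<Sum>j\<in>UNIV. ka \<gamma> i j (v - c) * \<phi>2 i j v) + 2 * (\<Sum>i\<in>UNIV. kb \<gamma> i (v - c) * \<phi>1 i v)))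
    = (LBINT v. \<phi> v * core v c)"
proof -
  have dec: "decays p (\<lambda>v. \<phi> v * u v)" "decays p (\<lambda>v. \<phi>1 i v * u v)" "decays p (\<lambda>v. \<phi>2 i j v * u v)"
     "decays p (\<lambda>v. \<phi> v * u1 i v)" "decays p (\<lambda>v. \<phi>1 i v * u1 j v)" "decays p (\<lambda>v. \<phi> v * u2 i j v)" for i j
    using du du1 du2 b by (auto intro!: decays_bounded_mult m)
  then have dec': "decays p (\<lambda>v. u1 i v * \<phi>1 j v)" "decays p (\<lambda>v. u2 i j v * \<phi> v)" "decays p (\<lambda>v. u1 i v * \<phi> v)" for i j
    by (simp_all add: mult.commute)
  note ki = kint[OF kernel_ka[OF \<gamma>_ge \<gamma>_le]] kint[OF kernel_kb[OF \<gamma>_ge \<gamma>_le]]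
    kint[OF kernel_norm_powr[OF \<gamma>_ge \<gamma>_le2]]
  define A1 where "A1 = (\<lambda>v. \<Sum>i\<in>UNIV. \<Sum>j\<in>UNIV. ka \<gamma> i j (v - c) * (\<phi>2 i j v * u v + u1 i v * \<phi>1 j v))"
  define A2 where "A2 = (\<lambda>v. \<Sum>i\<in>UNIV. \<Sum>j\<in>UNIV. ka \<gamma> i j (v - c) * (\<phi>1 i v * u1 j v + u2 i j v * \<phi> v))"
  define B1 where "B1 = (\<lambda>v. \<Sum>j\<in>UNIV. kb \<gamma> j (v - c) * (\<phi>1 j v * u v))"
  define B2 where "B2 = (\<lambda>v. \<Sum>j\<in>UNIV. kb \<gamma> j (v - c) * (\<phi> v * u1 j v))"
  define B3 where "B3 = (\<lambda>v. norm (v - c) powr \<gamma> * (\<phi> v * u v))"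
  have a1: "(LBINT v. A1 v) = - (LBINT v. B1 v)"
    unfolding A1_def B1_def using dec
    by (intro ka_divergence_parts[OF \<gamma>_ge \<gamma>_le p]) (auto intro!: decays_add ddir_mult d2 dd1 dec')
  have a2: "(LBINT v. A2 v) = - (LBINT v. B2 v)"
    unfolding A2_def B2_def using dec
    by (intro ka_divergence_parts[OF \<gamma>_ge \<gamma>_le p]) (auto intro!: decays_add ddir_mult d1 dd2 dec')
  have "(LBINT v. (\<Sum>i\<in>UNIV. kb \<gamma> i (v - c) * (\<phi>1 i v * u v + u1 i v * \<phi> v))) = 2 * (\<gamma> + 3) * (LBINT v. B3 v)"
    unfolding B3_def using dec
    by (intro kb_divergence_parts[OF \<gamma>_ge \<gamma>_le p]) (auto intro!: decays_add ddir_mult d1 dd1 dec')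
  moreover have "(\<lambda>v. \<Sum>i\<in>UNIV. kb \<gamma> i (v - c) * (\<phi>1 i v * u v + u1 i v * \<phi> v)) = (\<lambda>v. B1 v + B2 v)"
    unfolding B1_def B2_def by (simp add: fun_eq_iff sum.distrib[symmetric] algebra_simps)
  ultimately have a3: "(LBINT v. B1 v + B2 v) = 2 * (\<gamma> + 3) * (LBINT v. B3 v)" by simp
  have i: "integrable lborel A1" "integrable lborel A2" "integrable lborel B1" "integrable lborel B2" "integrable lborel B3"
    unfolding A1_def A2_def B1_def B2_def B3_def using dec
    by (auto intro!: Bochner_Integration.integrable_sum ki decays_add dec')
  \<comment> \<open>In terms of the integrals the correction is - B1 + B2 + 2 B1 - (B1 + B2) =
    0.\<close>
  have "(\<lambda>v. u v * ((\<Sum>i\<in>UNIV. \<Sum>j\<in>UNIV. ka \<gamma> i j (v - c) * \<phi>2 i j v) + 2 * (\<Sum>i\<in>UNIV. kb \<gamma> i (v - c) * \<phi>1 i v)))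
     = (\<lambda>v. \<phi> v * core v c + A1 v - A2 v + 2 * B1 v - 2 * (\<gamma> + 3) * B3 v)"
  proof
    fix v
    have sym: "(\<Sum>i\<in>UNIV. \<Sum>j\<in>UNIV. ka \<gamma> i j (v - c) * (u1 i v * \<phi>1 j v)) = (\<Sum>i\<in>UNIV. \<Sum>j\<in>UNIV. ka \<gamma> i j (v - c) * (\<phi>1 i v * u1 j v))"
      by (subst sum.swap) (intro sum.cong refl, simp add: ka_def mult.commute)
    show "u v * ((\<Sum>i\<in>UNIV. \<Sum>j\<in>UNIV. ka \<gamma> i j (v - c) * \<phi>2 i j v) + 2 * (\<Sum>i\<in>UNIV. kb \<gamma> i (v - c) * \<phi>1 i v))
      = \<phi> v * core v c + A1 v - A2 v + 2 * B1 v - 2 * (\<gamma> + 3) * B3 v"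
      unfolding A1_def A2_def B1_def B3_def core_def distrib_left sum.distrib sym
      by (simp add: algebra_simps sum_distrib_left)
  qed
  moreover have "integrable lborel (\<lambda>v. \<phi> v * core v c)"
  proof -
    have eq: "(\<lambda>v. \<phi> v * core v c) = (\<lambda>v. (\<Sum>i\<in>UNIV. \<Sum>j\<in>UNIV. ka \<gamma> i j (v - c) * (\<phi> v * u2 i j v)) + 2 * (\<gamma> + 3) * B3 v)"
      unfolding core_def B3_def by (simp add: algebra_simps sum_distrib_left)
    show ?thesis unfolding eq using i dec by (auto intro!: Bochner_Integration.integrable_sum ki)
  qed
  ultimately show ?thesis using i a1 a2 a3 by simp
qed

text \<open>The gradient of ln (1 + u / \<delta>) is the gradient of u divided by u + \<delta>, so
  moving one derivative off \<open>u2\<close> produces the dissipation. The terms ln (1 + u /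
  \<delta>) u cancel, and what is left is the drift against u times that gradient, that is, against
  the gradient of \<open>entG \<delta> u\<close>; one more integration by parts makes it the
  singular term.\<close>

lemma core_entropy:
  assumes \<delta>: "0 < \<delta>"
  shows "(LBINT v. ln (1 + u v / \<delta>) * core v c)
    = - (LBINT v. (\<Sum>i\<in>UNIV. \<Sum>j\<in>UNIV. ka \<gamma> i j (v - c) * (u1 i v * u1 j v / (u v + \<delta>))))
      + 2 * (\<gamma> + 3) * (LBINT v. norm (v - c) powr \<gamma> * entG \<delta> (u v))"
proof -
  define \<phi> where "\<phi> = (\<lambda>v. ln (1 + u v / \<delta>))"
  define r where "r = (\<lambda>v. inverse (u v + \<delta>))"
  have pos: "u v + \<delta> > 0" for v using u_nonneg[of v] \<delta> by linarith
  have [measurable]: "\<phi> \<in> borel_measurable borel" "r \<in> borel_measurable borel"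
    unfolding \<phi>_def r_def by measurable
  have \<phi>le: "\<bar>\<phi> v\<bar> \<le> 1 / \<delta> * \<bar>u v\<bar>" for v
    using ln_add_one_self_le_self[of "u v / \<delta>"] u_nonneg[of v] \<delta> by (simp add: \<phi>_def)
  have d\<phi>: "decays p \<phi>" by (rule decays_dominated[OF du _ \<phi>le]) (use \<delta> in auto)
  have G: "decays p (\<lambda>v. entG \<delta> (u v))"
    by (rule decays_dominated[OF du, where C=1]) (use entG_nonneg[OF \<delta>] entG_le[OF \<delta>] u_nonneg in \<open>auto simp: entG_def\<close>)
  have rb: "\<bar>r v\<bar> \<le> 1 / \<delta>" for v
    using pos[of v] u_nonneg[of v] \<delta> by (simp add: r_def divide_simps)
  have drat: "decays p (\<lambda>v. r v * g v)" if "decays p g" for g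
    using decays_bounded_mult[OF that _ rb] by simp
  have p0: "0 \<le> p" using p by simp
  have d1: "ddir i \<phi> (\<lambda>v. r v * u1 i v)" for i
  proof -
    have "((\<lambda>x. ln (1 + x / \<delta>)) has_real_derivative r v) (at (u v))" for v
    proof -
      have "1 + u v / \<delta> > 0" using u_nonneg[of v] \<delta> by (simp add: add_pos_nonneg)
      then show ?thesis unfolding r_def using \<delta> pos[of v]
        by (auto intro!: derivative_eq_intros simp: field_simps)
    qed
    then have "((\<lambda>x. ln (1 + x / \<delta>)) has_real_derivative inverse (u v + \<delta>)) (at (u v))" for v
      unfolding r_def by blast
    from ddir_chain[OF dd1, where F="\<lambda>x. ln (1 + x / \<delta>)" and F'="\<lambda>x. inverse (x + \<delta>)", OF this]
    show ?thesis unfolding \<phi>_def r_def by simp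
  qed
  have dG: "ddir i (\<lambda>v. entG \<delta> (u v)) (\<lambda>v. u v * (r v * u1 i v))" for i
    using ddir_chain[OF dd1, where F="entG \<delta>" and F'="\<lambda>x. x / (x + \<delta>)", OF entG_deriv[OF \<delta> u_nonneg]]
    unfolding r_def by (simp add: field_simps)
  note ki = kint[OF kernel_ka[OF \<gamma>_ge \<gamma>_le]] kint[OF kernel_kb[OF \<gamma>_ge \<gamma>_le]]
    kint[OF kernel_norm_powr[OF \<gamma>_ge \<gamma>_le2]]
  note dec = du du1 du2 d\<phi> G drat[OF du1] decays_mult[OF _ _ p0]
  define A0 where "A0 = (\<lambda>v. \<Sum>i\<in>UNIV. \<Sum>j\<in>UNIV. ka \<gamma> i j (v - c) * ((r v * u1 i v) * u1 j v))"
  define A2 where "A2 = (\<lambda>v. \<Sum>i\<in>UNIV. \<Sum>j\<in>UNIV. ka \<gamma> i j (v - c) * (u2 i j v * \<phi> v))"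
  define B1 where "B1 = (\<lambda>v. \<Sum>j\<in>UNIV. kb \<gamma> j (v - c) * (u v * (r v * u1 j v)))"
  define B2 where "B2 = (\<lambda>v. \<Sum>j\<in>UNIV. kb \<gamma> j (v - c) * (\<phi> v * u1 j v))"
  define B3 where "B3 = (\<lambda>v. norm (v - c) powr \<gamma> * (\<phi> v * u v))"
  define B4 where "B4 = (\<lambda>v. norm (v - c) powr \<gamma> * entG \<delta> (u v))"
  have i: "integrable lborel A0" "integrable lborel A2" "integrable lborel B1" "integrable lborel B2" "integrable lborel B3" "integrable lborel B4"
    unfolding A0_def A2_def B1_def B2_def B3_def B4_def
    by (auto intro!: Bochner_Integration.integrable_sum ki dec)
  have "(LBINT v. (\<Sum>i\<in>UNIV. \<Sum>j\<in>UNIV. ka \<gamma> i j (v - c) * ((r v * u1 i v) * u1 j v + u2 i j v * \<phi> v))) = - (LBINT v. B2 v)"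
    unfolding B2_def by (intro ka_divergence_parts[OF \<gamma>_ge \<gamma>_le p] ddir_mult d1 dd2 decays_add dec)
  moreover have "(\<lambda>v. \<Sum>i\<in>UNIV. \<Sum>j\<in>UNIV. ka \<gamma> i j (v - c) * ((r v * u1 i v) * u1 j v + u2 i j v * \<phi> v)) = (\<lambda>v. A0 v + A2 v)"
    unfolding A0_def A2_def by (simp add: distrib_left sum.distrib)
  ultimately have a1: "(LBINT v. A0 v + A2 v) = - (LBINT v. B2 v)" by simp
  have "(LBINT v. (\<Sum>i\<in>UNIV. kb \<gamma> i (v - c) * ((r v * u1 i v) * u v + u1 i v * \<phi> v))) = 2 * (\<gamma> + 3) * (LBINT v. B3 v)"
    unfolding B3_def by (intro kb_divergence_parts[OF \<gamma>_ge \<gamma>_le p] ddir_mult d1 dd1 decays_add dec)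
  moreover have "(\<lambda>v. \<Sum>i\<in>UNIV. kb \<gamma> i (v - c) * ((r v * u1 i v) * u v + u1 i v * \<phi> v)) = (\<lambda>v. B1 v + B2 v)"
    unfolding B1_def B2_def by (simp add: fun_eq_iff sum.distrib[symmetric] algebra_simps)
  ultimately have a2: "(LBINT v. B1 v + B2 v) = 2 * (\<gamma> + 3) * (LBINT v. B3 v)" by simp
  have a3: "(LBINT v. B1 v) = 2 * (\<gamma> + 3) * (LBINT v. B4 v)"
    unfolding B1_def B4_def by (intro kb_divergence_parts[OF \<gamma>_ge \<gamma>_le p] dG dec)
  have eq1: "(\<lambda>v. \<phi> v * core v c) = (\<lambda>v. A2 v + 2 * (\<gamma> + 3) * B3 v)"
    unfolding core_def A2_def B3_def by (simp add: fun_eq_iff algebra_simps sum_distrib_left)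
  have eq2: "(\<lambda>v. \<Sum>i\<in>UNIV. \<Sum>j\<in>UNIV. ka \<gamma> i j (v - c) * (u1 i v * u1 j v / (u v + \<delta>))) = A0"
    unfolding A0_def r_def by (simp add: fun_eq_iff field_simps)
  have "(LBINT v. \<phi> v * core v c) = - (LBINT v. A0 v) + 2 * (\<gamma> + 3) * (LBINT v. B4 v)"
    unfolding eq1 using i a1 a2 a3 by simp
  then show ?thesis unfolding eq2 unfolding \<phi>_def B4_def .
qed

definition grad :: "r3 \<Rightarrow> r3" where "grad v = (\<chi> i. u1 i v)"

lemma decays_grad_sq: "decays p (\<lambda>v. (norm (grad v))\<^sup>2)"
  unfolding norm_sq_3 using p by (auto simp: grad_def power2_eq_square intro!: decays_add decays_mult du1)

lemma grad_sq_integrable: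
  assumes \<delta>: "0 < \<delta>"
  shows "integrable lborel (\<lambda>v. jbracket v powr \<gamma> * (norm (grad v))\<^sup>2 / (u v + \<delta>))"
proof -
  have "\<bar>jbracket v powr \<gamma> * inverse (u v + \<delta>)\<bar> \<le> 1 * (1 / \<delta>)" for v
  proof -
    have "jbracket v powr \<gamma> \<le> 1" using jbracket_powr_mono[of \<gamma> 0 v] \<gamma>_le by auto
    moreover have "inverse (u v + \<delta>) \<le> 1 / \<delta>" using u_nonneg[of v] \<delta> by (simp add: divide_simps)
    ultimately show ?thesis unfolding abs_mult using u_nonneg[of v] \<delta> by (intro mult_mono) auto
  qed
  then have "decays p (\<lambda>v. (jbracket v powr \<gamma> * inverse (u v + \<delta>)) * (norm (grad v))\<^sup>2)"
    by (intro decays_bounded_mult[OF decays_grad_sq]) auto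
  from decays_integrable[OF this] p show ?thesis by (simp add: field_simps)
qed

text \<open>The field -2 z / |z|^2, which is \<open>kb\<close> with exponent -2, has divergence -2 /
  |z|^2. Integrated against the weighted \<open>entG\<close> it yields twice the left-hand side;
  Young's inequality returns 3/2 of the left-hand side plus gradient and mass terms, and the
  remaining half is multiplied by 2.\<close>

lemma hardy:
  assumes \<delta>: "0 < \<delta>"
  shows "(LBINT v. norm (v - c) powr (-2) * (jbracket v powr \<gamma> * entG \<delta> (u v)))
    \<le> 4 * (LBINT v. jbracket v powr \<gamma> * (norm (grad v))\<^sup>2 / (u v + \<delta>)) + 16 * (LBINT v. u v)"
proof -
  define G where "G = (\<lambda>v. entG \<delta> (u v))"
  have G0: "0 \<le> G v" "G v \<le> u v" "(u v)\<^sup>2 / (u v + \<delta>) \<le> 2 * G v" for v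
    using entG_nonneg[OF \<delta> u_nonneg] entG_le[OF \<delta> u_nonneg] entG_lower[OF \<delta> u_nonneg] by (auto simp: G_def)
  have [measurable]: "G \<in> borel_measurable borel" unfolding G_def entG_def by measurable
  have dG: "decays p G" 
    by (rule decays_dominated[OF du, where C=1]) (use G0 u_nonneg in auto)
  have pos: "u v + \<delta> > 0" for v using u_nonneg[of v] \<delta> by linarith
  have J1: "jbracket v powr \<gamma> \<le> 1" for v using jbracket_powr_mono[of \<gamma> 0 v] \<gamma>_le by auto
  have dJG: "decays p (\<lambda>v. jbracket v powr \<gamma> * G v)"
    by (rule decays_bounded_mult[OF dG, where B=1]) (use J1 in auto)
  define e where "e = (\<lambda>i v. (\<gamma> * jbracket v powr (\<gamma> - 2) * v $ i) * G v + (u v / (u v + \<delta>) * u1 i v) * jbracket v powr \<gamma>)"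
  have ddG: "ddir i G (\<lambda>v. u v / (u v + \<delta>) * u1 i v)" for i
    unfolding G_def by (rule ddir_chain[OF dd1 entG_deriv[OF \<delta> u_nonneg]])
  have de: "ddir i (\<lambda>v. jbracket v powr \<gamma> * G v) (e i)" for i
    unfolding e_def by (intro ddir_mult ddir_jbracket_powr ddG)
  have Jv: "jbracket v powr (\<gamma> - 2) * norm v \<le> jbracket v powr \<gamma>" for v
  proof -
    have "jbracket v powr (\<gamma> - 2) * norm v \<le> jbracket v powr (\<gamma> - 2) * jbracket v powr 1"
      using norm_le_jbracket[of v] by (intro mult_left_mono) (auto simp: less_imp_le)
    also have "\<dots> = jbracket v powr (\<gamma> - 1)" by (simp only: powr_add[symmetric]) simp
    also have "\<dots> \<le> jbracket v powr \<gamma>" by (intro jbracket_powr_mono) simp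
    finally show ?thesis .
  qed
  have ub: "\<bar>u v / (u v + \<delta>)\<bar> \<le> 1" for v using pos[of v] u_nonneg[of v] \<delta> by simp
  have dece: "decays p (e i)" for i
  proof -
    have "decays p (\<lambda>v. (\<gamma> * jbracket v powr (\<gamma> - 2) * v $ i) * G v)"
    proof (rule decays_bounded_mult[OF dG])
      fix v
      have "\<bar>\<gamma> * jbracket v powr (\<gamma> - 2) * v $ i\<bar> \<le> \<bar>\<gamma>\<bar> * (jbracket v powr (\<gamma> - 2) * norm v)"
        unfolding abs_mult using abs_nth_le[of v i] by (auto intro!: mult_left_mono simp: mult.assoc)
      also have "\<dots> \<le> \<bar>\<gamma>\<bar> * 1" using Jv[of v] J1[of v] by (intro mult_left_mono) linarith+
      finally show "\<bar>\<gamma> * jbracket v powr (\<gamma> - 2) * v $ i\<bar> \<le> \<bar>\<gamma>\<bar> * 1" .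
    qed measurable
    moreover have "decays p (\<lambda>v. (u v / (u v + \<delta>) * jbracket v powr \<gamma>) * u1 i v)"
    proof (rule decays_bounded_mult[OF du1, where B="1 * 1"])
      fix v show "\<bar>u v / (u v + \<delta>) * jbracket v powr \<gamma>\<bar> \<le> 1 * 1"
        using ub[of v] J1[of v] unfolding abs_mult by (intro mult_mono) auto
    qed measurable
    ultimately show ?thesis unfolding e_def using decays_add by (fastforce simp: ac_simps)
  qed
  let ?I = "\<lambda>v. norm (v - c) powr (-2) * (jbracket v powr \<gamma> * G v)"
  let ?Y = "\<lambda>v. jbracket v powr \<gamma> * (norm (grad v))\<^sup>2 / (u v + \<delta>)"
  have int: "integrable lborel ?I" "integrable lborel (\<lambda>v. \<Sum>i\<in>UNIV. kb (-2) i (v - c) * e i v)" "integrable lborel u"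
    using decays_integrable[OF du] p
    by (auto intro!: Bochner_Integration.integrable_sum kint kernel_kb kernel_norm_powr dece dJG)
  have "2 * (LBINT v. ?I v) = (LBINT v. (\<Sum>i\<in>UNIV. kb (-2) i (v - c) * e i v))"
    using kb_divergence_parts[OF _ _ p dJG dece de, of "-2" c] by simp
  also have "\<dots> \<le> (LBINT v. 2 * ?Y v + (3/2) * ?I v + 8 * u v)"
  proof (intro integral_mono int Bochner_Integration.integrable_add integrable_mult_right grad_sq_integrable[OF \<delta>])
    fix v
    define z where "z = v - c"
    define k where "k = norm z powr (-2)"
    define J where "J = jbracket v powr \<gamma>"
    have J: "0 \<le> J" "J \<le> 1" using J1[of v] by (auto simp: J_def)
    \<comment> \<open>The square root of the weight \<open>k\<close>, so that Young's inequality
      gives back a full power of \<open>k\<close>.\<close>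
    define h where "h = norm z powr (-1)"
    have kh: "k = h * h" unfolding k_def h_def by (simp only: powr_add[symmetric]) simp
    have h0: "0 \<le> h" by (simp add: h_def)
    have kz: "k * norm z \<le> h" unfolding k_def h_def using norm_powr_shift[of z "-2" 1] by simp
    have "(\<Sum>i\<in>UNIV. kb (-2) i (v - c) * e i v)
      = - 2 * k * (J * (u v / (u v + \<delta>)) * (z \<bullet> grad v) + \<gamma> * jbracket v powr (\<gamma> - 2) * G v * (z \<bullet> v))"
      unfolding sum_3 kb_def e_def inner_3 grad_def z_def[symmetric] k_def[symmetric] J_def[symmetric] by (simp add: algebra_simps)
    also have "\<dots> \<le> 2 * k * (J * (u v / (u v + \<delta>)) * (norm z * norm (grad v)) + 2 * (jbracket v powr (\<gamma> - 2) * G v) * (norm z * norm v))"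
    proof -
      have "- (J * (u v / (u v + \<delta>)) * (z \<bullet> grad v)) \<le> J * (u v / (u v + \<delta>)) * (norm z * norm (grad v))"
      proof -
        have "J * (u v / (u v + \<delta>)) * (- (z \<bullet> grad v)) \<le> J * (u v / (u v + \<delta>)) * (norm z * norm (grad v))"
          using Cauchy_Schwarz_ineq2[of z "grad v"] J pos[of v] u_nonneg[of v] by (intro mult_left_mono) auto
        then show ?thesis by simp
      qed
      moreover have "- (\<gamma> * jbracket v powr (\<gamma> - 2) * G v * (z \<bullet> v)) \<le> 2 * (jbracket v powr (\<gamma> - 2) * G v) * (norm z * norm v)"
      proof -
        have "(jbracket v powr (\<gamma> - 2) * G v) * (- \<gamma> * (z \<bullet> v)) \<le> (jbracket v powr (\<gamma> - 2) * G v) * (2 * (norm z * norm v))"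
        proof (intro mult_left_mono mult_nonneg_nonneg)
          have "- \<gamma> * (z \<bullet> v) \<le> \<bar>- \<gamma>\<bar> * \<bar>z \<bullet> v\<bar>" by (metis abs_ge_self abs_mult)
          also have "\<dots> \<le> 2 * (norm z * norm v)"
            using \<gamma>_ge \<gamma>_neg Cauchy_Schwarz_ineq2[of z v] by (intro mult_mono) auto
          finally show "- \<gamma> * (z \<bullet> v) \<le> 2 * (norm z * norm v)" .
        qed (use G0 in auto)
        then show ?thesis by (simp add: algebra_simps)
      qed
      ultimately have "- (J * (u v / (u v + \<delta>)) * (z \<bullet> grad v) + \<gamma> * jbracket v powr (\<gamma> - 2) * G v * (z \<bullet> v))
        \<le> J * (u v / (u v + \<delta>)) * (norm z * norm (grad v)) + 2 * (jbracket v powr (\<gamma> - 2) * G v) * (norm z * norm v)" by linarith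
      then have "2 * k * (- (J * (u v / (u v + \<delta>)) * (z \<bullet> grad v) + \<gamma> * jbracket v powr (\<gamma> - 2) * G v * (z \<bullet> v)))
        \<le> 2 * k * (J * (u v / (u v + \<delta>)) * (norm z * norm (grad v)) + 2 * (jbracket v powr (\<gamma> - 2) * G v) * (norm z * norm v))"
        by (intro mult_left_mono) (auto simp: k_def)
      then show ?thesis by (simp only: mult_minus_left mult_minus_right)
    qed
    also have "\<dots> = (k * norm z) * (2 * (J * (u v / (u v + \<delta>)) * norm (grad v) + 2 * (jbracket v powr (\<gamma> - 2) * norm v) * G v))"
      by (simp add: algebra_simps)
    also have "\<dots> \<le> h * (2 * (J * (u v / (u v + \<delta>)) * norm (grad v) + 2 * J * G v))"
      using Jv[of v] G0[of v] kz h0 J pos[of v] u_nonneg[of v]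
      by (intro mult_mono add_mono mult_left_mono mult_right_mono) (auto simp: J_def)
    also have "\<dots> = 2 * J * (h * ((u v / (u v + \<delta>)) * norm (grad v))) + 4 * J * (h * G v)"
      by (simp add: algebra_simps)
    \<comment> \<open>The gradient term spends one copy of k J G and the term from differentiating
      the weight half a copy: 3/2 in total, less than the 2 on the left.\<close>
    also have "\<dots> \<le> 2 * J * ((norm (grad v))\<^sup>2 / (u v + \<delta>) + k / 2 * G v) + 4 * J * (k / 8 * G v + 2 * G v)"
    proof (intro add_mono mult_left_mono)
      define a where "a = norm (grad v)"
      have "0 \<le> (a - h * u v / 2)\<^sup>2" by simp
      then have "h * u v * a \<le> a\<^sup>2 + (h * h) / 4 * (u v)\<^sup>2"
        by (simp add: power2_eq_square algebra_simps)
      then have "(h * u v * a) / (u v + \<delta>) \<le> (a\<^sup>2 + k / 4 * (u v)\<^sup>2) / (u v + \<delta>)"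
        using pos[of v] unfolding kh by (intro divide_right_mono) auto
      also have "\<dots> = a\<^sup>2 / (u v + \<delta>) + k / 4 * ((u v)\<^sup>2 / (u v + \<delta>))" by (simp add: add_divide_distrib)
      also have "\<dots> \<le> a\<^sup>2 / (u v + \<delta>) + k / 4 * (2 * G v)"
        using G0[of v] by (intro add_mono mult_left_mono) (auto simp: k_def)
      finally show "h * (u v / (u v + \<delta>) * norm (grad v)) \<le> (norm (grad v))\<^sup>2 / (u v + \<delta>) + k / 2 * G v"
        by (simp add: a_def mult.assoc)
      have "0 \<le> (h - 4)\<^sup>2" by simp
      then have "h \<le> k / 8 + 2" by (simp add: kh power2_eq_square algebra_simps)
      then have "h * G v \<le> (k / 8 + 2) * G v" using G0[of v] by (intro mult_right_mono) auto
      then show "h * G v \<le> k / 8 * G v + 2 * G v" by (simp add: algebra_simps)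
    qed (use J in auto)
    also have "\<dots> = 2 * (J * (norm (grad v))\<^sup>2 / (u v + \<delta>)) + (3/2) * (k * (J * G v)) + 8 * (J * G v)"
      by (simp add: algebra_simps)
    also have "\<dots> \<le> 2 * ?Y v + (3/2) * ?I v + 8 * u v"
      using mult_left_le_one_le[of "G v" J] J G0[of v] by (simp add: J_def k_def z_def)
    finally show "(\<Sum>i\<in>UNIV. kb (-2) i (v - c) * e i v) \<le> 2 * ?Y v + (3/2) * ?I v + 8 * u v" .
  qed
  also have "\<dots> = 2 * (LBINT v. ?Y v) + (3/2) * (LBINT v. ?I v) + 8 * (LBINT v. u v)"
    by (intro integral_linear_comb3 int grad_sq_integrable[OF \<delta>])
  finally show ?thesis by (simp add: G_def)
qed

end

subsection \<open>Coercivity of the diffusion matrix\<close>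

lemma ka_quadratic_form:
  "(\<Sum>i\<in>UNIV. \<Sum>j\<in>UNIV. ka \<gamma> i j z * (\<xi> $ i * \<xi> $ j)) = norm z powr \<gamma> * ((norm z)\<^sup>2 * (norm \<xi>)\<^sup>2 - (z \<bullet> \<xi>)\<^sup>2)"
  unfolding sum_3 ka_def norm_sq_3 inner_3 by (simp add: algebra_simps power2_eq_square)

text \<open>The set lies within distance \<theta> of the line through \<open>v\<close> in direction
  \<xi>, and is covered by balls of radius 2 \<theta> centred on the line at spacing \<theta>. At
  most 2 (R + 1) / \<theta> of them are needed, each of volume 8 \<theta>^3 times that of the unit
  ball. The point is the factor \<theta>^2, uniformly in \<open>v\<close> and \<xi>.\<close>

lemma cylinder_volume:
  fixes v \<xi> :: r3
  assumes \<xi>: "norm \<xi> = 1" and \<theta>: "0 < \<theta>" "\<theta> \<le> 1" and R: "0 \<le> R"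
  shows "emeasure lborel {c. norm c \<le> R \<and> (norm (v - c))\<^sup>2 - ((v - c) \<bullet> \<xi>)\<^sup>2 < \<theta>\<^sup>2}
    \<le> ennreal (16 * unit_ball_vol 3 * (R + 1) * \<theta>\<^sup>2)"
proof -
  define S where "S = {c. norm c \<le> R \<and> (norm (v - c))\<^sup>2 - ((v - c) \<bullet> \<xi>)\<^sup>2 < \<theta>\<^sup>2}"
  \<comment> \<open>For points c with |c| \<le> R the coordinate along \<xi>, counted from
    \<open>v\<close>, lies between a and a + 2 R.\<close>
  define a where "a = - (v \<bullet> \<xi>) - R"
  define K where "K = {\<lfloor>a / \<theta>\<rfloor>..\<lfloor>(a + 2 * R) / \<theta>\<rfloor>}"
  have cover: "S \<subseteq> (\<Union>k\<in>K. cball (v + (real_of_int k * \<theta>) *\<^sub>R \<xi>) (2 * \<theta>))"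
  proof
    fix c assume "c \<in> S"
    then have c: "norm c \<le> R" "(norm (v - c))\<^sup>2 - ((v - c) \<bullet> \<xi>)\<^sup>2 < \<theta>\<^sup>2" by (auto simp: S_def)
    define \<tau> where "\<tau> = (c - v) \<bullet> \<xi>"
    have xx: "\<xi> \<bullet> \<xi> = 1" using \<xi> by (simp add: dot_square_norm)
    have "\<bar>c \<bullet> \<xi>\<bar> \<le> R" using Cauchy_Schwarz_ineq2[of c \<xi>] \<xi> c by simp
    then have \<tau>: "a \<le> \<tau>" "\<tau> \<le> a + 2 * R" by (auto simp: \<tau>_def a_def inner_diff_left)
    define k where "k = \<lfloor>\<tau> / \<theta>\<rfloor>"
    have "k \<in> K" unfolding K_def k_def using \<tau> \<theta> by (auto intro!: floor_mono divide_right_mono)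
    have k: "real_of_int k \<le> \<tau> / \<theta>" "\<tau> / \<theta> < real_of_int k + 1" by (auto simp: k_def)
    then have "real_of_int k * \<theta> \<le> \<tau>" "\<tau> < (real_of_int k + 1) * \<theta>"
      using \<theta> by (auto simp: pos_le_divide_eq pos_divide_less_eq)
    then have k: "\<bar>\<tau> - real_of_int k * \<theta>\<bar> \<le> \<theta>" by (auto simp: algebra_simps)
    have "(norm (c - v - \<tau> *\<^sub>R \<xi>))\<^sup>2 = (norm (v - c))\<^sup>2 - ((v - c) \<bullet> \<xi>)\<^sup>2"
    proof -
      define w where "w = c - v"
      have "(norm (w - \<tau> *\<^sub>R \<xi>))\<^sup>2 = (norm w)\<^sup>2 - (w \<bullet> \<xi>)\<^sup>2"
        unfolding power2_norm_eq_inner \<tau>_def w_def[symmetric]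
        by (simp add: inner_diff_left inner_diff_right xx inner_commute[of \<xi> w] power2_eq_square)
      then have "(norm (w - \<tau> *\<^sub>R \<xi>))\<^sup>2 = (norm (- w))\<^sup>2 - ((- w) \<bullet> \<xi>)\<^sup>2" by simp
      moreover have "- w = v - c" by (simp add: w_def)
      ultimately show ?thesis unfolding w_def by (simp only:)
    qed
    then have "norm (c - v - \<tau> *\<^sub>R \<xi>) \<le> \<theta>"
      using c(2) \<theta> by - (rule power2_le_imp_le, simp_all)
    moreover have "norm ((\<tau> - real_of_int k * \<theta>) *\<^sub>R \<xi>) \<le> \<theta>" using k \<xi> by simp
    ultimately have "norm ((c - v - \<tau> *\<^sub>R \<xi>) + (\<tau> - real_of_int k * \<theta>) *\<^sub>R \<xi>) \<le> 2 * \<theta>"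
      using norm_triangle_ineq[of "c - v - \<tau> *\<^sub>R \<xi>" "(\<tau> - real_of_int k * \<theta>) *\<^sub>R \<xi>"] by linarith
    then have "dist (v + (real_of_int k * \<theta>) *\<^sub>R \<xi>) c \<le> 2 * \<theta>"
      unfolding dist_norm by (subst norm_minus_commute) (simp add: algebra_simps)
    then show "c \<in> (\<Union>k\<in>K. cball (v + (real_of_int k * \<theta>) *\<^sub>R \<xi>) (2 * \<theta>))" using \<open>k \<in> K\<close> by auto
  qed
  have card: "real (card K) * \<theta> \<le> 2 * (R + 1)"
  proof -
    have "a / \<theta> \<le> (a + 2 * R) / \<theta>" using R \<theta> by (intro divide_right_mono) auto
    then have "\<lfloor>a / \<theta>\<rfloor> \<le> \<lfloor>(a + 2 * R) / \<theta>\<rfloor>" by (rule floor_mono)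
    then have "real (card K) = real_of_int \<lfloor>(a + 2 * R) / \<theta>\<rfloor> - real_of_int \<lfloor>a / \<theta>\<rfloor> + 1"
      unfolding K_def by (simp add: of_nat_nat)
    also have "\<dots> \<le> (a + 2 * R) / \<theta> - a / \<theta> + 2" by linarith
    also have "\<dots> = 2 * R / \<theta> + 2" by (simp add: add_divide_distrib)
    finally have "real (card K) * \<theta> \<le> (2 * R / \<theta> + 2) * \<theta>" using \<theta> by (intro mult_right_mono) auto
    also have "\<dots> = 2 * R + 2 * \<theta>" using \<theta> by (simp add: field_simps)
    finally show ?thesis using \<theta> by simp
  qed
  have "emeasure lborel S \<le> emeasure lborel (\<Union>k\<in>K. cball (v + (real_of_int k * \<theta>) *\<^sub>R \<xi>) (2 * \<theta>))"
    by (rule emeasure_mono[OF cover]) (auto simp: K_def intro!: sets.finite_UN)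
  also have "\<dots> \<le> (\<Sum>k\<in>K. emeasure lborel (cball (v + (real_of_int k * \<theta>) *\<^sub>R \<xi>) (2 * \<theta>)))"
    by (rule emeasure_subadditive_finite) (auto simp: K_def)
  also have "\<dots> = (\<Sum>k\<in>K. ennreal (unit_ball_vol 3 * (2 * \<theta>) ^ 3))"
    using \<theta> by (intro sum.cong refl) (simp add: emeasure_cball)
  also have "\<dots> = ennreal (real (card K) * (unit_ball_vol 3 * (2 * \<theta>) ^ 3))"
    using \<theta> by (simp add: ennreal_of_nat_eq_real_of_nat ennreal_mult)
  also have "\<dots> \<le> ennreal (16 * unit_ball_vol 3 * (R + 1) * \<theta>\<^sup>2)"
  proof (rule ennreal_leI)
    have "real (card K) * (unit_ball_vol 3 * (2 * \<theta>) ^ 3) = (real (card K) * \<theta>) * (8 * unit_ball_vol 3 * \<theta>\<^sup>2)"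
      by (simp add: power2_eq_square power3_eq_cube)
    also have "\<dots> \<le> (2 * (R + 1)) * (8 * unit_ball_vol 3 * \<theta>\<^sup>2)"
      by (intro mult_right_mono card) auto
    finally show "real (card K) * (unit_ball_vol 3 * (2 * \<theta>) ^ 3) \<le> 16 * unit_ball_vol 3 * (R + 1) * \<theta>\<^sup>2"
      by (simp add: algebra_simps)
  qed
  finally show ?thesis by (simp add: S_def)
qed

text \<open>The quadratic form degenerates only for c near the line through \<open>v\<close> in
  direction \<xi>. Energy confines all but M/4 of the mass to a ball; in this ball a thin cylinder
  around the line carries at most M/8 where the density is bounded and M/8 where it is large, so M/2
  is left where the form is bounded below. The constant does not depend on the density.\<close>

lemma coercivity:
  assumes M: "0 < M" and \<gamma>: "\<gamma> < 0"
  obtains \<kappa> where "0 < \<kappa>"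
    "\<And>(u :: r3 \<Rightarrow> real) v \<xi>. u \<in> borel_measurable borel \<Longrightarrow> (\<And>c. 0 \<le> u c) \<Longrightarrow> integrable lborel u \<Longrightarrow> (LBINT c. u c) = M \<Longrightarrow>
      integrable lborel (\<lambda>c. u c * (norm c)\<^sup>2) \<Longrightarrow> (LBINT c. u c * (norm c)\<^sup>2) \<le> E \<Longrightarrow>
      integrable lborel (\<lambda>c. u c * \<bar>ln (u c)\<bar>) \<Longrightarrow> (LBINT c. u c * \<bar>ln (u c)\<bar>) \<le> H \<Longrightarrow>
      integrable lborel (\<lambda>c. u c * (norm (v - c) powr \<gamma> * ((norm (v - c))\<^sup>2 * (norm \<xi>)\<^sup>2 - ((v - c) \<bullet> \<xi>)\<^sup>2))) \<Longrightarrow>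
      \<kappa> * jbracket v powr \<gamma> * (norm \<xi>)\<^sup>2
        \<le> (LBINT c. u c * (norm (v - c) powr \<gamma> * ((norm (v - c))\<^sup>2 * (norm \<xi>)\<^sup>2 - ((v - c) \<bullet> \<xi>)\<^sup>2)))"
proof -
  define V where "V = unit_ball_vol (3::real)"
  have V: "0 < V" by (simp add: V_def)
  \<comment> \<open>\<open>E\<close> and \<open>H\<close> are arbitrary upper bounds; their positive
    parts keep the square root and the logarithm below meaningful.\<close>
  define E' where "E' = max E 0"
  define H' where "H' = max H 0"
  \<comment> \<open>By Chebyshev's inequality at most M/4 of the mass lies outside this
    radius.\<close>
  define R where "R = sqrt (4 * E' / M) + 1"
  have R: "1 \<le> R" "E' / R\<^sup>2 \<le> M / 4"
  proof -
    show R1: "1 \<le> R" using M by (simp add: R_def E'_def)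
    have "4 * E' / M = (sqrt (4 * E' / M))\<^sup>2" using M by (simp add: E'_def)
    also have "\<dots> \<le> R\<^sup>2" unfolding R_def using M by (intro power_mono) (auto simp: E'_def)
    finally show "E' / R\<^sup>2 \<le> M / 4" using R1 M by (simp add: field_simps)
  qed
  \<comment> \<open>At most M/8 of the mass sits where the density exceeds N, since |ln u| \<ge> ln
    N there.\<close>
  define N where "N = exp (8 * H' / M + 1)"
  have N: "1 < N" "H' / ln N \<le> M / 8"
  proof -
    have p: "0 \<le> 8 * H' / M" using M by (simp add: H'_def)
    then show "1 < N" unfolding N_def using exp_gt_one by (metis add_nonneg_pos zero_less_one)
    show "H' / ln N \<le> M / 8" unfolding N_def using p M by (simp add: divide_simps)
  qed
  define B where "B = 16 * V * (R + 1)"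
  have B: "0 < B" using V R by (simp add: B_def)
  \<comment> \<open>A density of at most N puts at most M/8 on the cylinder of radius \<theta>
    inside the ball.\<close>
  define \<theta> where "\<theta> = min 1 (sqrt (M / (8 * N * B)))"
  have \<theta>: "0 < \<theta>" "\<theta> \<le> 1" "N * (B * \<theta>\<^sup>2) \<le> M / 8"
  proof -
    have p: "0 < M / (8 * N * B)" using M N B by simp
    then show "0 < \<theta>" "\<theta> \<le> 1" by (auto simp: \<theta>_def)
    then have "\<theta>\<^sup>2 \<le> (sqrt (M / (8 * N * B)))\<^sup>2" by (intro power_mono) (auto simp: \<theta>_def)
    also have "\<dots> = M / (8 * N * B)" using p by simp
    finally show "N * (B * \<theta>\<^sup>2) \<le> M / 8" using N B by (simp add: field_simps)
  qed
  \<comment> \<open>Off the cylinder the form is at least \<theta>^2 |\<xi>|^2 |v - c|^\<gamma>, and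
    |v - c| \<le> (1 + R) <v> bounds the power below because \<gamma> < 0.\<close>
  define \<kappa> where "\<kappa> = \<theta>\<^sup>2 * (1 + R) powr \<gamma> * (M / 2)"
  have \<kappa>: "0 < \<kappa>" using \<theta> R M by (simp add: \<kappa>_def)
  show ?thesis
  proof (rule that[OF \<kappa>])
    fix u :: "r3 \<Rightarrow> real" and v \<xi> :: r3
    assume [measurable]: "u \<in> borel_measurable borel" and u0: "\<And>c. 0 \<le> u c" and ui: "integrable lborel u" and uM: "(LBINT c. u c) = M"
      and uE: "integrable lborel (\<lambda>c. u c * (norm c)\<^sup>2)" "(LBINT c. u c * (norm c)\<^sup>2) \<le> E"
      and uH: "integrable lborel (\<lambda>c. u c * \<bar>ln (u c)\<bar>)" "(LBINT c. u c * \<bar>ln (u c)\<bar>) \<le> H"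
      and ua: "integrable lborel (\<lambda>c. u c * (norm (v - c) powr \<gamma> * ((norm (v - c))\<^sup>2 * (norm \<xi>)\<^sup>2 - ((v - c) \<bullet> \<xi>)\<^sup>2)))"
    show "\<kappa> * jbracket v powr \<gamma> * (norm \<xi>)\<^sup>2
        \<le> (LBINT c. u c * (norm (v - c) powr \<gamma> * ((norm (v - c))\<^sup>2 * (norm \<xi>)\<^sup>2 - ((v - c) \<bullet> \<xi>)\<^sup>2)))"
    proof (cases "\<xi> = 0")
      case False
      define \<eta> where "\<eta> = (1 / norm \<xi>) *\<^sub>R \<xi>"
      have \<eta>: "norm \<eta> = 1" "\<xi> = norm \<xi> *\<^sub>R \<eta>" using False by (auto simp: \<eta>_def)
      define Q where "Q = (\<lambda>c. (norm (v - c))\<^sup>2 - ((v - c) \<bullet> \<eta>)\<^sup>2)"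
      have Q: "(norm (v - c))\<^sup>2 * (norm \<xi>)\<^sup>2 - ((v - c) \<bullet> \<xi>)\<^sup>2 = (norm \<xi>)\<^sup>2 * Q c" for c
      proof -
        have "((v - c) \<bullet> \<xi>) = norm \<xi> * ((v - c) \<bullet> \<eta>)" by (subst \<eta>(2)) simp
        then show ?thesis unfolding Q_def by (simp only: power_mult_distrib right_diff_distrib mult.commute)
      qed
      have Q0: "0 \<le> Q c" for c
      proof -
        have "((v - c) \<bullet> \<eta>)\<^sup>2 \<le> (norm (v - c))\<^sup>2"
          using Cauchy_Schwarz_ineq2[of "v - c" \<eta>] \<eta>(1) by (metis abs_norm_cancel abs_le_square_iff mult.right_neutral)
        then show ?thesis by (simp add: Q_def)
      qed
      define S where "S = {c. norm c \<le> R \<and> Q c < \<theta>\<^sup>2}"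
      have [measurable]: "Q \<in> borel_measurable borel" unfolding Q_def by measurable
      have [measurable]: "S \<in> sets borel" unfolding S_def by measurable
      have vol: "emeasure lborel S \<le> ennreal (B * \<theta>\<^sup>2)"
        using cylinder_volume[OF \<eta>(1) \<theta>(1,2), of R v] R by (simp add: S_def Q_def B_def V_def)
      then have volf: "emeasure lborel S < \<infinity>" by (simp add: order_le_less_trans)
      have volm: "measure lborel S \<le> B * \<theta>\<^sup>2"
        unfolding measure_def using vol B \<theta> by (intro enn2real_leI) auto
      have iS: "integrable lborel (indicat_real S)" using volf by simp
      have lower: "M / 2 \<le> (LBINT c. u c * (if norm c \<le> R \<and> \<not> Q c < \<theta>\<^sup>2 then 1 else 0))"
      proof -
        have "(LBINT c. u c - u c * (norm c)\<^sup>2 / R\<^sup>2 - N * indicat_real S c - u c * \<bar>ln (u c)\<bar> / ln N)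
          \<le> (LBINT c. u c * (if norm c \<le> R \<and> \<not> Q c < \<theta>\<^sup>2 then 1 else 0))"
        proof (rule integral_mono)
          show "integrable lborel (\<lambda>c. u c - u c * (norm c)\<^sup>2 / R\<^sup>2 - N * indicat_real S c - u c * \<bar>ln (u c)\<bar> / ln N)"
            using ui uE uH iS by auto
          show "integrable lborel (\<lambda>c. u c * (if norm c \<le> R \<and> \<not> Q c < \<theta>\<^sup>2 then 1 else 0))"
            by (rule Bochner_Integration.integrable_bound[OF ui]) (auto simp: u0)
          fix c
          have lnN: "0 < ln N" using N by simp
          have nn: "0 \<le> u c * (norm c)\<^sup>2 / R\<^sup>2" "0 \<le> u c * \<bar>ln (u c)\<bar> / ln N" "0 \<le> N * indicat_real S c"
            using u0[of c] lnN N by auto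
          consider "norm c > R" | "norm c \<le> R" "\<not> Q c < \<theta>\<^sup>2" | "c \<in> S"
            by (cases "norm c \<le> R"; cases "Q c < \<theta>\<^sup>2") (auto simp: S_def)
          then show "u c - u c * (norm c)\<^sup>2 / R\<^sup>2 - N * indicat_real S c - u c * \<bar>ln (u c)\<bar> / ln N
            \<le> u c * (if norm c \<le> R \<and> \<not> Q c < \<theta>\<^sup>2 then 1 else 0)"
          proof cases
            case 1
            then have "R\<^sup>2 \<le> (norm c)\<^sup>2" using R by (intro power_mono) auto
            then have "u c * R\<^sup>2 \<le> u c * (norm c)\<^sup>2" using u0 by (intro mult_left_mono)
            then have "u c \<le> u c * (norm c)\<^sup>2 / R\<^sup>2" using R by (simp add: field_simps)
            then show ?thesis using nn 1 by simp
          next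
            case 2 then show ?thesis using nn by simp
          next
            case 3
            have "u c \<le> N + u c * \<bar>ln (u c)\<bar> / ln N"
            proof (cases "u c \<le> N")
              case True then show ?thesis using nn by linarith
            next
              case False
              then have "ln N \<le> ln (u c)" using N by simp
              then have "u c * ln N \<le> u c * \<bar>ln (u c)\<bar>" using u0[of c] by (intro mult_left_mono) auto
              then have "u c \<le> u c * \<bar>ln (u c)\<bar> / ln N" using lnN by (simp add: field_simps)
              then show ?thesis using N by linarith
            qed
            then show ?thesis using nn 3 by (simp add: S_def)
          qed
        qed
        moreover have "(LBINT c. u c - u c * (norm c)\<^sup>2 / R\<^sup>2 - N * indicat_real S c - u c * \<bar>ln (u c)\<bar> / ln N)
          = M - (LBINT c. u c * (norm c)\<^sup>2) / R\<^sup>2 - N * measure lborel S - (LBINT c. u c * \<bar>ln (u c)\<bar>) / ln N"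
          using ui uE uH iS uM by simp
        moreover have "(LBINT c. u c * (norm c)\<^sup>2) / R\<^sup>2 \<le> E' / R\<^sup>2" using uE by (intro divide_right_mono) (auto simp: E'_def)
        moreover have "(LBINT c. u c * \<bar>ln (u c)\<bar>) / ln N \<le> H' / ln N" using uH N by (intro divide_right_mono) (auto simp: H'_def)
        moreover have "N * measure lborel S \<le> N * (B * \<theta>\<^sup>2)" using volm N by (intro mult_left_mono) auto
        ultimately show ?thesis using R N \<theta> by linarith
      qed
      have "\<kappa> * jbracket v powr \<gamma> * (norm \<xi>)\<^sup>2 = (norm \<xi>)\<^sup>2 * (\<theta>\<^sup>2 * ((1 + R) * jbracket v) powr \<gamma>) * (M / 2)"
        using R by (simp add: \<kappa>_def powr_mult less_imp_le)
      also have "\<dots> \<le> (norm \<xi>)\<^sup>2 * (\<theta>\<^sup>2 * ((1 + R) * jbracket v) powr \<gamma>) * (LBINT c. u c * (if norm c \<le> R \<and> \<not> Q c < \<theta>\<^sup>2 then 1 else 0))"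
        by (intro mult_left_mono lower) auto
      also have "\<dots> = (LBINT c. (norm \<xi>)\<^sup>2 * (\<theta>\<^sup>2 * ((1 + R) * jbracket v) powr \<gamma>) * (u c * (if norm c \<le> R \<and> \<not> Q c < \<theta>\<^sup>2 then 1 else 0)))"
        by simp
      also have "\<dots> \<le> (LBINT c. u c * (norm (v - c) powr \<gamma> * ((norm (v - c))\<^sup>2 * (norm \<xi>)\<^sup>2 - ((v - c) \<bullet> \<xi>)\<^sup>2)))"
      proof (rule integral_mono[OF _ ua])
        show "integrable lborel (\<lambda>c. (norm \<xi>)\<^sup>2 * (\<theta>\<^sup>2 * ((1 + R) * jbracket v) powr \<gamma>) * (u c * (if norm c \<le> R \<and> \<not> Q c < \<theta>\<^sup>2 then 1 else 0)))"
          by (intro integrable_mult_right Bochner_Integration.integrable_bound[OF ui]) (auto simp: u0)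
        fix c
        show "(norm \<xi>)\<^sup>2 * (\<theta>\<^sup>2 * ((1 + R) * jbracket v) powr \<gamma>) * (u c * (if norm c \<le> R \<and> \<not> Q c < \<theta>\<^sup>2 then 1 else 0))
          \<le> u c * (norm (v - c) powr \<gamma> * ((norm (v - c))\<^sup>2 * (norm \<xi>)\<^sup>2 - ((v - c) \<bullet> \<xi>)\<^sup>2))"
        proof (cases "norm c \<le> R \<and> \<not> Q c < \<theta>\<^sup>2")
          case True
          have ne: "v \<noteq> c" using True \<theta> by (auto simp: Q_def)
          have "norm (v - c) \<le> norm v + R" using norm_triangle_ineq4[of v c] True by linarith
          also have "\<dots> \<le> (1 + R) * jbracket v"
        proof -
          have "R * 1 \<le> R * jbracket v" using R jbracket_ge_1[of v] by (intro mult_left_mono) auto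
          then show ?thesis using norm_le_jbracket[of v] unfolding distrib_right by linarith
        qed
        finally have "((1 + R) * jbracket v) powr \<gamma> \<le> norm (v - c) powr \<gamma>"
            using ne \<gamma> by (intro powr_mono2') auto
          then have "\<theta>\<^sup>2 * ((1 + R) * jbracket v) powr \<gamma> \<le> Q c * norm (v - c) powr \<gamma>"
            using True \<theta> Q0 by (intro mult_mono) auto
          then have "(u c * (norm \<xi>)\<^sup>2) * (\<theta>\<^sup>2 * ((1 + R) * jbracket v) powr \<gamma>) \<le> (u c * (norm \<xi>)\<^sup>2) * (Q c * norm (v - c) powr \<gamma>)"
            using u0 by (intro mult_left_mono) auto
          then show ?thesis unfolding Q using True by (simp add: algebra_simps)
        next
          case False
          then show ?thesis unfolding Q using u0[of c] Q0[of c] by auto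
        qed
      qed
      finally show ?thesis .
    qed simp
  qed
qed

subsection \<open>The Gagliardo--Nirenberg--Sobolev inequality\<close>

text \<open>A square root on the extended half-line, so that repeated use of the Cauchy-Schwarz
  inequality needs no prior finiteness.\<close>

definition esqrt :: "ennreal \<Rightarrow> ennreal" where
  "esqrt x = (if x = \<infinity> then \<infinity> else ennreal (sqrt (enn2real x)))"

lemma esqrt_measurable [measurable]: "esqrt \<in> borel_measurable borel"
  unfolding esqrt_def by measurable

lemma esqrt_sq [simp]: "(esqrt x)\<^sup>2 = x"
  by (cases x) (auto simp: esqrt_def ennreal_power ennreal_top_mult power2_eq_square simp flip: ennreal_mult)

lemma ennreal_power2_le_imp_le:
  fixes x y :: ennreal assumes "x\<^sup>2 \<le> y\<^sup>2" shows "x \<le> y"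
proof (rule ccontr)
  assume "\<not> x \<le> y"
  then have yx: "y < x" by simp
  then obtain b where b: "y = ennreal b" "0 \<le> b" by (cases y) auto
  show False
  proof (cases x)
    case (real a)
    then have "b < a" using yx b by (simp add: ennreal_less_iff)
    then have "b\<^sup>2 < a\<^sup>2" using b by (intro power_strict_mono) auto
    moreover have "a\<^sup>2 \<le> b\<^sup>2" using assms real b by (simp add: ennreal_power)
    ultimately show False by simp
  next
    case top
    then show False using assms b by (simp add: ennreal_power power2_eq_square ennreal_top_mult top_unique flip: ennreal_mult)
  qed
qed

lemma le_esqrt: "x\<^sup>2 \<le> y \<Longrightarrow> x \<le> esqrt y"
  by (rule ennreal_power2_le_imp_le) simp

lemma esqrt_mono: "x \<le> y \<Longrightarrow> esqrt x \<le> esqrt y"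
  by (rule ennreal_power2_le_imp_le) simp

lemma esqrt_mult: "esqrt (x * y) = esqrt x * esqrt y"
  by (rule antisym; rule ennreal_power2_le_imp_le) (simp_all add: power_mult_distrib)

lemma nn_integral_esqrt_mult_le:
  assumes [measurable]: "f \<in> borel_measurable M" "g \<in> borel_measurable M"
  shows "(\<integral>\<^sup>+x. esqrt (f x) * esqrt (g x) \<partial>M) \<le> esqrt (\<integral>\<^sup>+x. f x \<partial>M) * esqrt (\<integral>\<^sup>+x. g x \<partial>M)"
proof -
  have "(\<integral>\<^sup>+x. esqrt (f x) * esqrt (g x) \<partial>M)\<^sup>2 \<le> (\<integral>\<^sup>+x. (esqrt (f x))\<^sup>2 \<partial>M) * (\<integral>\<^sup>+x. (esqrt (g x))\<^sup>2 \<partial>M)"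
    by (rule Cauchy_Schwarz_nn_integral) measurable
  then show ?thesis by - (rule ennreal_power2_le_imp_le, simp add: power_mult_distrib)
qed

text \<open>The Loomis-Whitney inequality in three dimensions. The Cauchy-Schwarz inequality in x
  pairs \<open>b\<close> with \<open>c\<close>, in y it pairs \<open>a\<close> with the x-integral
  of \<open>c\<close>, and in z the remaining integrals of \<open>a\<close> and
  \<open>b\<close>.\<close>

lemma loomis_whitney:
  fixes a b c :: "real \<times> real \<Rightarrow> ennreal"
  assumes [measurable]: "a \<in> borel_measurable borel" "b \<in> borel_measurable borel" "c \<in> borel_measurable borel"
  shows "(\<integral>\<^sup>+z. \<integral>\<^sup>+y. \<integral>\<^sup>+x. esqrt (a (y, z)) * (esqrt (b (x, z)) * esqrt (c (x, y))) \<partial>lborel \<partial>lborel \<partial>lborel)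
    \<le> esqrt (\<integral>\<^sup>+z. \<integral>\<^sup>+y. a (y, z) \<partial>lborel \<partial>lborel) *
      (esqrt (\<integral>\<^sup>+z. \<integral>\<^sup>+x. b (x, z) \<partial>lborel \<partial>lborel) * esqrt (\<integral>\<^sup>+y. \<integral>\<^sup>+x. c (x, y) \<partial>lborel \<partial>lborel))"
proof -
  have [measurable]: "a \<in> borel_measurable (borel \<Otimes>\<^sub>M borel)" "b \<in> borel_measurable (borel \<Otimes>\<^sub>M borel)" "c \<in> borel_measurable (borel \<Otimes>\<^sub>M borel)"
    using assms unfolding borel_prod by auto
  define A where "A = (\<lambda>z. \<integral>\<^sup>+y. a (y, z) \<partial>lborel)"
  define B where "B = (\<lambda>z. \<integral>\<^sup>+x. b (x, z) \<partial>lborel)"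
  define C where "C = (\<lambda>y. \<integral>\<^sup>+x. c (x, y) \<partial>lborel)"
  have [measurable]: "A \<in> borel_measurable borel" "B \<in> borel_measurable borel" "C \<in> borel_measurable borel"
    unfolding A_def B_def C_def by measurable
  have 1: "(\<integral>\<^sup>+x. esqrt (a (y, z)) * (esqrt (b (x, z)) * esqrt (c (x, y))) \<partial>lborel) \<le> esqrt (a (y, z)) * (esqrt (B z) * esqrt (C y))" for y z
    unfolding B_def C_def by (subst nn_integral_cmult) (auto intro!: mult_left_mono nn_integral_esqrt_mult_le)
  have 2: "(\<integral>\<^sup>+y. esqrt (a (y, z)) * (esqrt (B z) * esqrt (C y)) \<partial>lborel) \<le> esqrt (A z) * esqrt (B z) * esqrt (\<integral>\<^sup>+y. C y \<partial>lborel)" for z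
  proof -
    have "(\<integral>\<^sup>+y. esqrt (a (y, z)) * (esqrt (B z) * esqrt (C y)) \<partial>lborel) = esqrt (B z) * (\<integral>\<^sup>+y. esqrt (a (y, z)) * esqrt (C y) \<partial>lborel)"
      by (subst nn_integral_cmult[symmetric]) (auto simp: ac_simps)
    also have "\<dots> \<le> esqrt (B z) * (esqrt (A z) * esqrt (\<integral>\<^sup>+y. C y \<partial>lborel))"
      unfolding A_def by (intro mult_left_mono nn_integral_esqrt_mult_le) auto
    finally show ?thesis by (simp add: ac_simps)
  qed
  have "(\<integral>\<^sup>+z. \<integral>\<^sup>+y. \<integral>\<^sup>+x. esqrt (a (y, z)) * (esqrt (b (x, z)) * esqrt (c (x, y))) \<partial>lborel \<partial>lborel \<partial>lborel)
    \<le> (\<integral>\<^sup>+z. \<integral>\<^sup>+y. esqrt (a (y, z)) * (esqrt (B z) * esqrt (C y)) \<partial>lborel \<partial>lborel)"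
    by (intro nn_integral_mono 1)
  also have "\<dots> \<le> (\<integral>\<^sup>+z. esqrt (A z) * esqrt (B z) * esqrt (\<integral>\<^sup>+y. C y \<partial>lborel) \<partial>lborel)"
    by (intro nn_integral_mono 2)
  also have "\<dots> = (\<integral>\<^sup>+z. esqrt (A z) * esqrt (B z) \<partial>lborel) * esqrt (\<integral>\<^sup>+y. C y \<partial>lborel)"
    by (rule nn_integral_multc) measurable
  also have "\<dots> \<le> (esqrt (\<integral>\<^sup>+z. A z \<partial>lborel) * esqrt (\<integral>\<^sup>+z. B z \<partial>lborel)) * esqrt (\<integral>\<^sup>+y. C y \<partial>lborel)"
    by (intro mult_right_mono nn_integral_esqrt_mult_le) auto
  finally show ?thesis by (simp add: A_def B_def C_def ac_simps)
qed

definition vec3 :: "real \<Rightarrow> real \<Rightarrow> real \<Rightarrow> r3" where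
  "vec3 x y z = (\<chi> i. if i = 1 then x else if i = 2 then y else z)"

lemma vec3_nth [simp]: "vec3 x y z $ 1 = x" "vec3 x y z $ 2 = y" "vec3 x y z $ 3 = z"
  by (simp_all add: vec3_def)

lemma vec3_shift: 
  "vec3 x y z + s *\<^sub>R axis 1 1 = vec3 (x + s) y z"
  "vec3 x y z + s *\<^sub>R axis 2 1 = vec3 x (y + s) z"
  "vec3 x y z + s *\<^sub>R axis 3 1 = vec3 x y (z + s)"
  by (auto simp: vec_eq_iff forall_3 axis_def)

lemma vec3_eq: "vec3 x y z = x *\<^sub>R axis 1 1 + y *\<^sub>R axis 2 1 + z *\<^sub>R axis 3 1"
  by (auto simp: vec_eq_iff forall_3 axis_def)

lemma vec3_measurable [measurable]:
  assumes [measurable]: "f \<in> borel_measurable M" "g \<in> borel_measurable M" "h \<in> borel_measurable M"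
  shows "(\<lambda>x. vec3 (f x) (g x) (h x)) \<in> borel_measurable M"
  unfolding vec3_eq by measurable

lemma vec3_case_measurable [measurable]: "(\<lambda>(z, y, x). vec3 x y z) \<in> borel_measurable borel"
  unfolding borel_prod[symmetric] by measurable

lemma emeasure_lborel_Times:
  fixes A :: "'a::euclidean_space set" and B :: "'b::euclidean_space set"
  assumes "A \<in> sets borel" "B \<in> sets borel"
  shows "emeasure lborel (A \<times> B) = emeasure lborel A * emeasure lborel B"
  using assms by (subst lborel_prod[symmetric], subst lborel.emeasure_pair_measure_Times) auto

text \<open>Lebesgue measure is determined by its values on boxes. The triple is ordered (z, y, x)
  so that x becomes the innermost variable of the iterated integral.\<close>

lemma lborel_vec3: "lborel = distr (lborel :: (real \<times> real \<times> real) measure) borel (\<lambda>(z, y, x). vec3 x y z)"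
proof (rule lborel_eqI)
  fix l w :: r3
  assume le: "\<And>b. b \<in> Basis \<Longrightarrow> l \<bullet> b \<le> w \<bullet> b"
  have le': "l $ i \<le> w $ i" for i using le[of "axis i 1"] by (simp add: inner_axis)
  have pre: "(\<lambda>(z, y, x). vec3 x y z) -` box l w = {l $ 3<..<w $ 3} \<times> {l $ 2<..<w $ 2} \<times> {l $ 1<..<w $ 1}"
    by (auto simp: mem_box_cart forall_3)
  have bp: "(\<Prod>b\<in>Basis. (w - l) \<bullet> b) = (w $ 1 - l $ 1) * (w $ 2 - l $ 2) * (w $ 3 - l $ 3)"
  proof -
    have B: "(Basis :: r3 set) = (\<lambda>i. axis i 1) ` UNIV" by (auto simp: Basis_vec_def)
    have "(\<Prod>b\<in>Basis. (w - l) \<bullet> b) = (\<Prod>i\<in>UNIV. (w - l) $ i)"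
      unfolding B by (subst prod.reindex) (auto simp: inj_on_def axis_eq_axis inner_axis)
    also have "\<dots> = (w $ 1 - l $ 1) * (w $ 2 - l $ 2) * (w $ 3 - l $ 3)"
      unfolding UNIV_3 by (simp add: mult.assoc)
    finally show ?thesis .
  qed
  have "emeasure (distr lborel borel (\<lambda>(z, y, x). vec3 x y z)) (box l w) = emeasure lborel ({l $ 3<..<w $ 3} \<times> {l $ 2<..<w $ 2} \<times> {l $ 1<..<w $ 1})"
    by (subst emeasure_distr) (auto simp: pre)
  also have "\<dots> = emeasure lborel {l $ 3<..<w $ 3} * (emeasure lborel {l $ 2<..<w $ 2} * emeasure lborel {l $ 1<..<w $ 1})"
    by (simp add: emeasure_lborel_Times open_Times)
  also have "\<dots> = ennreal (\<Prod>b\<in>Basis. (w - l) \<bullet> b)"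
    unfolding bp using le' by (simp add: ennreal_mult[symmetric] ac_simps)
  finally show "emeasure (distr lborel borel (\<lambda>(z, y, x). vec3 x y z)) (box l w) = ennreal (\<Prod>b\<in>Basis. (w - l) \<bullet> b)" .
qed simp

lemma nn_integral_lborel_pair:
  fixes g :: "'a::euclidean_space \<times> 'b::euclidean_space \<Rightarrow> ennreal"
  assumes "g \<in> borel_measurable borel"
  shows "(\<integral>\<^sup>+q. g q \<partial>lborel) = (\<integral>\<^sup>+x. \<integral>\<^sup>+y. g (x, y) \<partial>lborel \<partial>lborel)"
proof -
  have "g \<in> borel_measurable (lborel \<Otimes>\<^sub>M lborel)" using assms by (simp add: lborel_prod)
  from lborel.nn_integral_fst[OF this] show ?thesis by (simp add: lborel_prod)
qed

lemma nn_integral_vec3: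
  assumes [measurable]: "g \<in> borel_measurable borel"
  shows "(\<integral>\<^sup>+v. g v \<partial>lborel) = (\<integral>\<^sup>+z. \<integral>\<^sup>+y. \<integral>\<^sup>+x. g (vec3 x y z) \<partial>lborel \<partial>lborel \<partial>lborel)"
proof -
  have "(\<integral>\<^sup>+v. g v \<partial>lborel) = (\<integral>\<^sup>+q. g (case q of (z, y, x) \<Rightarrow> vec3 x y z) \<partial>(lborel :: (real \<times> real \<times> real) measure))"
    by (subst lborel_vec3) (subst nn_integral_distr, auto)
  also have "\<dots> = (\<integral>\<^sup>+z. \<integral>\<^sup>+q. g (case q of (y, x) \<Rightarrow> vec3 x y z) \<partial>lborel \<partial>lborel)"
    by (subst nn_integral_lborel_pair) (auto simp: split_beta' borel_prod[symmetric])
  also have "\<dots> = (\<integral>\<^sup>+z. \<integral>\<^sup>+y. \<integral>\<^sup>+x. g (vec3 x y z) \<partial>lborel \<partial>lborel \<partial>lborel)"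
    by (intro nn_integral_cong, subst nn_integral_lborel_pair) (auto simp: split_beta' borel_prod[symmetric])
  finally show ?thesis .
qed

text \<open>Decay forces \<open>w\<close> to 0 along the backward half-line, so its value at
  \<open>v\<close> is the limit of increments, each bounded by the total variation along the line.
  If the integral is infinite nothing is claimed.\<close>

lemma le_line_integral:
  assumes w: "decays q w" "q > 0" and w0: "\<And>v. 0 \<le> w v" and d: "ddir i w w'" and m [measurable]: "w' \<in> borel_measurable borel"
  shows "ennreal (w v) \<le> (\<integral>\<^sup>+s. ennreal \<bar>w' (v + s *\<^sub>R axis i 1)\<bar> \<partial>lborel)" (is "_ \<le> ?I")
proof (cases "?I = \<infinity>")
  case True
  then show ?thesis by (simp only: infinity_ennreal_def top_greatest)
next
  case False
  define e where "e = (axis i 1 :: r3)"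
  have ne: "norm e = 1" by (simp add: e_def)
  have int: "integrable lborel (\<lambda>s. w' (v + s *\<^sub>R e))"
    by (rule integrableI_bounded) (use False in \<open>auto simp: e_def less_top\<close>)
  then have int': "integrable lborel (\<lambda>s. \<bar>w' (v + s *\<^sub>R e)\<bar>)" by simp
  define L where "L = (LBINT s. \<bar>w' (v + s *\<^sub>R e)\<bar>)"
  have IL: "?I = ennreal L" using nn_integral_eq_integral[OF int'] by (simp add: L_def e_def)
  have der: "((\<lambda>s. w (v + s *\<^sub>R e)) has_real_derivative w' (v + s *\<^sub>R e)) (at s)" for s
  proof -
    have "((\<lambda>t. w ((v + s *\<^sub>R e) + t *\<^sub>R e)) has_real_derivative w' (v + s *\<^sub>R e)) (at (s - s))"
      using d by (simp add: ddir_def e_def)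
    then have "((\<lambda>t. w ((v + s *\<^sub>R e) + (t - s) *\<^sub>R e)) has_real_derivative w' (v + s *\<^sub>R e) * 1) (at s)"
      by (rule DERIV_chain2[where g="\<lambda>t. t - s"]) (auto intro!: derivative_eq_intros)
    then show ?thesis by (simp add: algebra_simps)
  qed
  have bound: "w v - w (v - real n *\<^sub>R e) \<le> L" for n
  proof -
    have "((\<lambda>s. w' (v + s *\<^sub>R e)) has_integral (w (v + 0 *\<^sub>R e) - w (v + (- real n) *\<^sub>R e))) {- real n..0}"
      by (rule fundamental_theorem_of_calculus)
         (auto intro!: has_field_derivative_at_within[OF der] simp: has_real_derivative_iff_has_vector_derivative[symmetric])
    moreover have si: "set_integrable lborel {- real n..0} (\<lambda>s. w' (v + s *\<^sub>R e))"
      unfolding set_integrable_def by (rule integrable_mult_indicator) (use int in auto)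
    ultimately have "w v - w (v - real n *\<^sub>R e) = (LINT s:{- real n..0}|lborel. w' (v + s *\<^sub>R e))"
      using set_borel_integral_eq_integral(2)[OF si] by (simp add: integral_unique)
    also have "\<dots> \<le> L"
      unfolding L_def set_lebesgue_integral_def
      by (rule integral_mono) (use int int' si in \<open>auto simp: set_integrable_def split: split_indicator\<close>)
    finally show ?thesis .
  qed
  obtain K where K: "0 \<le> K" "\<And>v. \<bar>w v\<bar> \<le> K * jbracket v powr (- q)" using decaysE[OF w(1)] by blast
  have "(\<lambda>n. w (v - real n *\<^sub>R e)) \<longlonglongrightarrow> 0"
  proof (rule Lim_null_comparison)
    have lim: "filterlim (\<lambda>n. real n - norm v) at_top sequentially"
      using filterlim_tendsto_add_at_top[OF tendsto_const[of "- norm v"] filterlim_real_sequentially]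
      by (simp add: algebra_simps)
    have "(\<lambda>n. (real n - norm v) powr (- q)) \<longlonglongrightarrow> 0"
      by (rule tendsto_neg_powr[OF _ lim]) (use w(2) in auto)
    then show "(\<lambda>n. K * (real n - norm v) powr (- q)) \<longlonglongrightarrow> 0" by (rule tendsto_mult_right_zero)
    have "eventually (\<lambda>n. real n - norm v > 0) sequentially"
      using lim unfolding filterlim_at_top_dense by blast
    then show "\<forall>\<^sub>F n in sequentially. norm (w (v - real n *\<^sub>R e)) \<le> K * (real n - norm v) powr (- q)"
    proof eventually_elim
      case (elim n)
      have "real n - norm v \<le> norm (v - real n *\<^sub>R e)"
        using norm_triangle_ineq3[of "real n *\<^sub>R e" v] ne by (simp add: norm_minus_commute)
      also have "\<dots> \<le> jbracket (v - real n *\<^sub>R e)" by (rule norm_le_jbracket)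
      finally have "jbracket (v - real n *\<^sub>R e) powr (- q) \<le> (real n - norm v) powr (- q)"
        using elim w(2) by (intro powr_mono2') auto
      then show ?case using K(2)[of "v - real n *\<^sub>R e"] mult_left_mono[OF _ K(1)] by fastforce
    qed
  qed
  then have "(\<lambda>n. w v - w (v - real n *\<^sub>R e)) \<longlonglongrightarrow> w v - 0" by (intro tendsto_intros)
  then have "w v - 0 \<le> L" by (rule LIMSEQ_le_const2) (use bound in auto)
  then show ?thesis unfolding IL by (intro ennreal_leI) simp
qed

text \<open>The Sobolev inequality for the square root of \<open>F\<close>, proved without
  differentiating that root. Bounding F^2 at a point by the line integral of its derivative along
  each axis and writing F^3 as a product of three factors leads to the Loomis-Whitney inequality;
  the integral of 2 F |\<partial>F| is then at most 2 sqrt (x y), with x the integral of F^3. At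
  zeros of \<open>F\<close> the quotient is 0 by convention, which is harmless since F \<partial>F
  vanishes there too.\<close>

lemma sobolev_L3:
  assumes F: "decays p F" "p > 3" and F0: "\<And>v. 0 \<le> F v" and d: "\<And>i. ddir i F (F1 i)"
    and m [measurable]: "\<And>i. F1 i \<in> borel_measurable borel"
    and Z: "\<And>v i. F v = 0 \<Longrightarrow> F1 i v = 0"
    and Y: "(\<integral>\<^sup>+v. ennreal ((\<Sum>i\<in>UNIV. (F1 i v)\<^sup>2) / F v) \<partial>lborel) \<le> ennreal y" and y: "0 \<le> y"
  shows "(LBINT v. F v ^ 3) powr (1 / 3) \<le> 4 * y"
proof -
  have [measurable]: "F \<in> borel_measurable borel" using F by (simp add: decays_def)
  define X where "X = (\<integral>\<^sup>+v. ennreal (F v ^ 3) \<partial>lborel)"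
  define \<alpha> where "\<alpha> = (\<lambda>i. \<integral>\<^sup>+v. ennreal \<bar>F1 i v * F v + F1 i v * F v\<bar> \<partial>lborel)"
  define a where "a = (\<lambda>(y, z). \<integral>\<^sup>+t. ennreal \<bar>F1 1 (vec3 t y z) * F (vec3 t y z) + F1 1 (vec3 t y z) * F (vec3 t y z)\<bar> \<partial>lborel)"
  define b where "b = (\<lambda>(x, z). \<integral>\<^sup>+t. ennreal \<bar>F1 2 (vec3 x t z) * F (vec3 x t z) + F1 2 (vec3 x t z) * F (vec3 x t z)\<bar> \<partial>lborel)"
  define c where "c = (\<lambda>(x, y). \<integral>\<^sup>+t. ennreal \<bar>F1 3 (vec3 x y t) * F (vec3 x y t) + F1 3 (vec3 x y t) * F (vec3 x y t)\<bar> \<partial>lborel)"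
  have mabc: "a \<in> borel_measurable borel" "b \<in> borel_measurable borel" "c \<in> borel_measurable borel"
    unfolding a_def b_def c_def borel_prod[symmetric] by measurable
  have dF2: "decays p (\<lambda>v. F v * F v)" using F by (intro decays_mult) auto
  have line: "(ennreal (F v))\<^sup>2 \<le> (\<integral>\<^sup>+s. ennreal \<bar>F1 i (v + s *\<^sub>R axis i 1) * F (v + s *\<^sub>R axis i 1) + F1 i (v + s *\<^sub>R axis i 1) * F (v + s *\<^sub>R axis i 1)\<bar> \<partial>lborel)" for v i
    using le_line_integral[OF dF2 _ _ ddir_mult[OF d d], of i v] F F0
    by (simp add: power2_eq_square flip: ennreal_mult)
  have shift: "(\<integral>\<^sup>+s. g (x + s) \<partial>lborel) = (\<integral>\<^sup>+t. g t \<partial>lborel)" if [measurable]: "g \<in> borel_measurable borel" for g :: "real \<Rightarrow> ennreal" and x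
    using nn_integral_real_affine[of g 1 x] by simp
  have Fa: "ennreal (F (vec3 x y z)) \<le> esqrt (a (y, z))" for x y z
    unfolding a_def using line[of "vec3 x y z" 1] shift[of "\<lambda>t. ennreal \<bar>F1 1 (vec3 t y z) * F (vec3 t y z) + F1 1 (vec3 t y z) * F (vec3 t y z)\<bar>" x]
    by (intro le_esqrt) (simp add: vec3_shift)
  have Fb: "ennreal (F (vec3 x y z)) \<le> esqrt (b (x, z))" for x y z
    unfolding b_def using line[of "vec3 x y z" 2] shift[of "\<lambda>t. ennreal \<bar>F1 2 (vec3 x t z) * F (vec3 x t z) + F1 2 (vec3 x t z) * F (vec3 x t z)\<bar>" y]
    by (intro le_esqrt) (simp add: vec3_shift)
  have Fc: "ennreal (F (vec3 x y z)) \<le> esqrt (c (x, y))" for x y z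
    unfolding c_def using line[of "vec3 x y z" 3] shift[of "\<lambda>t. ennreal \<bar>F1 3 (vec3 x y t) * F (vec3 x y t) + F1 3 (vec3 x y t) * F (vec3 x y t)\<bar>" z]
    by (intro le_esqrt) (simp add: vec3_shift)
  have ia: "(\<integral>\<^sup>+z. \<integral>\<^sup>+y. a (y, z) \<partial>lborel \<partial>lborel) = \<alpha> 1"
    unfolding \<alpha>_def a_def by (subst nn_integral_vec3) auto
  have ib: "(\<integral>\<^sup>+z. \<integral>\<^sup>+x. b (x, z) \<partial>lborel \<partial>lborel) = \<alpha> 2"
    unfolding \<alpha>_def b_def prod.case
    by (subst nn_integral_vec3, measurable, intro nn_integral_cong lborel_pair.Fubini', measurable)
  have ic: "(\<integral>\<^sup>+y. \<integral>\<^sup>+x. c (x, y) \<partial>lborel \<partial>lborel) = \<alpha> 3"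
  proof -
    have "\<alpha> 3 = (\<integral>\<^sup>+z. \<integral>\<^sup>+y. \<integral>\<^sup>+x. ennreal \<bar>F1 3 (vec3 x y z) * F (vec3 x y z) + F1 3 (vec3 x y z) * F (vec3 x y z)\<bar> \<partial>lborel \<partial>lborel \<partial>lborel)"
      unfolding \<alpha>_def by (subst nn_integral_vec3) auto
    also have "\<dots> = (\<integral>\<^sup>+y. \<integral>\<^sup>+z. \<integral>\<^sup>+x. ennreal \<bar>F1 3 (vec3 x y z) * F (vec3 x y z) + F1 3 (vec3 x y z) * F (vec3 x y z)\<bar> \<partial>lborel \<partial>lborel \<partial>lborel)"
      by (rule lborel_pair.Fubini') measurable
    also have "\<dots> = (\<integral>\<^sup>+y. \<integral>\<^sup>+x. \<integral>\<^sup>+z. ennreal \<bar>F1 3 (vec3 x y z) * F (vec3 x y z) + F1 3 (vec3 x y z) * F (vec3 x y z)\<bar> \<partial>lborel \<partial>lborel \<partial>lborel)"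
      by (intro nn_integral_cong lborel_pair.Fubini') measurable
    finally show ?thesis by (simp add: c_def)
  qed
  have "X = (\<integral>\<^sup>+z. \<integral>\<^sup>+y. \<integral>\<^sup>+x. ennreal (F (vec3 x y z) ^ 3) \<partial>lborel \<partial>lborel \<partial>lborel)"
    unfolding X_def by (subst nn_integral_vec3) auto
  also have "\<dots> \<le> (\<integral>\<^sup>+z. \<integral>\<^sup>+y. \<integral>\<^sup>+x. esqrt (a (y, z)) * (esqrt (b (x, z)) * esqrt (c (x, y))) \<partial>lborel \<partial>lborel \<partial>lborel)"
  proof (intro nn_integral_mono)
    fix x y z
    have "ennreal (F (vec3 x y z) ^ 3) = ennreal (F (vec3 x y z)) * (ennreal (F (vec3 x y z)) * ennreal (F (vec3 x y z)))"
      using F0 by (simp add: ennreal_mult power3_eq_cube mult.assoc)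
    also have "\<dots> \<le> esqrt (a (y, z)) * (esqrt (b (x, z)) * esqrt (c (x, y)))"
      by (intro mult_mono Fa Fb Fc) auto
    finally show "ennreal (F (vec3 x y z) ^ 3) \<le> esqrt (a (y, z)) * (esqrt (b (x, z)) * esqrt (c (x, y)))" .
  qed
  also have "\<dots> \<le> esqrt (\<alpha> 1) * (esqrt (\<alpha> 2) * esqrt (\<alpha> 3))"
    using loomis_whitney[OF mabc] unfolding ia ib ic .
  finally have X1: "X \<le> esqrt (\<alpha> 1) * (esqrt (\<alpha> 2) * esqrt (\<alpha> 3))" .
  \<comment> \<open>Finiteness of this integral, which comes from the decay of \<open>F\<close>, is
    what permits cancelling x^3 at the end.\<close>
  have F3: "integrable lborel (\<lambda>v. F v ^ 3)"
    using decays_integrable[OF decays_mult[OF dF2 F(1)]] F by (simp add: power3_eq_cube mult.assoc)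
  define x where "x = (LBINT v. F v ^ 3)"
  have Xx: "X = ennreal x" and x0: "0 \<le> x"
    unfolding X_def x_def using F3 F0 by (auto intro!: nn_integral_eq_integral integral_nonneg_AE)
  have \<alpha>: "\<alpha> i \<le> ennreal (2 * sqrt (x * y))" for i
  proof -
    have "\<alpha> i \<le> (\<integral>\<^sup>+v. 2 * (esqrt (ennreal (F v ^ 3)) * esqrt (ennreal ((\<Sum>i\<in>UNIV. (F1 i v)\<^sup>2) / F v))) \<partial>lborel)"
      unfolding \<alpha>_def
    proof (intro nn_integral_mono)
      fix v
      have "ennreal \<bar>F1 i v * F v\<bar> \<le> esqrt (ennreal (F v ^ 3) * ennreal ((\<Sum>i\<in>UNIV. (F1 i v)\<^sup>2) / F v))"
      proof (rule le_esqrt)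
        have "(F1 i v * F v)\<^sup>2 \<le> F v ^ 3 * ((\<Sum>i\<in>UNIV. (F1 i v)\<^sup>2) / F v)"
        proof (cases "F v = 0")
          case False
          then have "F v ^ 3 * ((\<Sum>i\<in>UNIV. (F1 i v)\<^sup>2) / F v) = (\<Sum>i\<in>UNIV. (F1 i v)\<^sup>2) * (F v)\<^sup>2"
            by (simp add: power2_eq_square power3_eq_cube)
          moreover have "(F1 i v)\<^sup>2 \<le> (\<Sum>i\<in>UNIV. (F1 i v)\<^sup>2)" by (rule member_le_sum) auto
          ultimately show ?thesis by (simp add: power_mult_distrib mult_right_mono)
        qed simp
        then show "(ennreal \<bar>F1 i v * F v\<bar>)\<^sup>2 \<le> ennreal (F v ^ 3) * ennreal ((\<Sum>i\<in>UNIV. (F1 i v)\<^sup>2) / F v)"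
          using F0[of v] by (simp add: ennreal_power ennreal_leI sum_nonneg flip: ennreal_mult)
      qed
      moreover have "ennreal \<bar>F1 i v * F v + F1 i v * F v\<bar> = 2 * ennreal \<bar>F1 i v * F v\<bar>"
      proof -
        have "\<bar>F1 i v * F v + F1 i v * F v\<bar> = 2 * \<bar>F1 i v * F v\<bar>" by (simp add: abs_mult)
        then show ?thesis by (simp only: ennreal_mult abs_ge_zero zero_le_numeral ennreal_numeral)
      qed
      ultimately show "ennreal \<bar>F1 i v * F v + F1 i v * F v\<bar> \<le> 2 * (esqrt (ennreal (F v ^ 3)) * esqrt (ennreal ((\<Sum>i\<in>UNIV. (F1 i v)\<^sup>2) / F v)))"
        by (simp add: esqrt_mult mult_left_mono)
    qed
    also have "\<dots> = 2 * (\<integral>\<^sup>+v. esqrt (ennreal (F v ^ 3)) * esqrt (ennreal ((\<Sum>i\<in>UNIV. (F1 i v)\<^sup>2) / F v)) \<partial>lborel)"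
      by (rule nn_integral_cmult) measurable
    also have "\<dots> \<le> 2 * (esqrt X * esqrt (\<integral>\<^sup>+v. ennreal ((\<Sum>i\<in>UNIV. (F1 i v)\<^sup>2) / F v) \<partial>lborel))"
      unfolding X_def by (intro mult_left_mono nn_integral_esqrt_mult_le) auto
    also have "\<dots> \<le> 2 * (esqrt X * esqrt (ennreal y))"
      by (intro mult_left_mono esqrt_mono Y) auto
    also have "\<dots> = ennreal (2 * sqrt (x * y))"
      unfolding Xx esqrt_def using x0 y by (simp add: real_sqrt_mult ennreal_mult)
    finally show ?thesis .
  qed
  define s where "s = 2 * sqrt (x * y)"
  have s0: "0 \<le> s" using x0 y by (simp add: s_def)
  have "X\<^sup>2 \<le> (esqrt (\<alpha> 1) * (esqrt (\<alpha> 2) * esqrt (\<alpha> 3)))\<^sup>2" by (intro power_mono X1) auto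
  also have "\<dots> = \<alpha> 1 * (\<alpha> 2 * \<alpha> 3)" by (simp add: power_mult_distrib)
  also have "\<dots> \<le> ennreal s * (ennreal s * ennreal s)"
    unfolding s_def by (intro mult_mono \<alpha>) auto
  finally have "ennreal (x\<^sup>2) \<le> ennreal (s ^ 3)"
    using x0 s0 by (simp add: Xx ennreal_power ennreal_mult power3_eq_cube mult.assoc)
  then have xs: "x\<^sup>2 \<le> s ^ 3" using s0 by simp
  \<comment> \<open>Squaring x^2 \<le> s^3 with s^2 = 4 x y gives x^4 \<le> 64 x^3 y^3.\<close>
  have "x \<le> (4 * y) ^ 3"
  proof (cases "x = 0")
    case False
    have "(x\<^sup>2)\<^sup>2 \<le> (s ^ 3)\<^sup>2" using xs by (intro power_mono) auto
    then have "x ^ 4 \<le> (s ^ 3)\<^sup>2" by (simp flip: power_mult)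
    also have "\<dots> = (s\<^sup>2) ^ 3" by (simp flip: power_mult)
    also have "s\<^sup>2 = 4 * (x * y)" using x0 y by (simp add: s_def power_mult_distrib)
    also have "(4 * (x * y)) ^ 3 = x ^ 3 * (4 * y) ^ 3" by (simp add: power_mult_distrib)
    finally have "x ^ 3 * x \<le> x ^ 3 * (4 * y) ^ 3" by (simp only: power4_eq_xxxx power3_eq_cube)
    then show ?thesis using False x0 by simp
  qed (use y in auto)
  then have "x powr (1 / 3) \<le> ((4 * y) ^ 3) powr (1 / 3)" using x0 by (intro powr_mono2) auto
  also have "\<dots> = 4 * y"
  proof (cases "y = 0")
    case False
    have "((4 * y) ^ 3) powr (1 / 3) = ((4 * y) powr 3) powr (1 / 3)" using y by (subst powr_numeral) auto
    also have "\<dots> = (4 * y) powr (3 * (1 / 3))" by (simp only: powr_powr)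
    finally show ?thesis using y by simp
  qed simp
  finally show ?thesis by (simp add: x_def)
qed

section \<open>Weak form and entropy production of the collision operator\<close>

text \<open>The integral in \<open>v\<close> is at most a multiple of <w>^2, and the decay of
  \<open>h\<close> leaves the power p - 2 > 3. All uses of Fubini's theorem for collisions rest on
  this.\<close>

lemma kernel_pair_integrable:
  assumes k: "kernel k" and g: "decays p g" and h: "decays p h" and p: "p > 5"
  shows "integrable (lborel \<Otimes>\<^sub>M lborel) (\<lambda>(v, w). h w * (k (v - w) * g v))"
proof (rule integrableI_bounded)
  note [measurable] = kernel_measurable[OF k] decays_measurable[OF g] decays_measurable[OF h]
  show "(\<lambda>(v, w). h w * (k (v - w) * g v)) \<in> borel_measurable (lborel \<Otimes>\<^sub>M lborel)" by measurable
  obtain B where B: "0 \<le> B" "\<And>c. (\<integral>\<^sup>+v. ennreal \<bar>k (v - c) * g v\<bar> \<partial>lborel) \<le> ennreal (B * (jbracket c)\<^sup>2)"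
    using kernel_mult_decays_bound[OF k g p] by blast
  obtain K where K: "0 \<le> K" "\<And>v. \<bar>h v\<bar> \<le> K * jbracket v powr (- p)" using decaysE[OF h] by blast
  have "(\<integral>\<^sup>+x. ennreal (norm (case x of (v, w) \<Rightarrow> h w * (k (v - w) * g v))) \<partial>(lborel \<Otimes>\<^sub>M lborel))
    = (\<integral>\<^sup>+w. \<integral>\<^sup>+v. ennreal (norm (h w * (k (v - w) * g v))) \<partial>lborel \<partial>lborel)"
    by (subst lborel_pair.nn_integral_snd[symmetric]) (auto simp: split_beta')
  also have "\<dots> \<le> (\<integral>\<^sup>+w. ennreal (K * B * jbracket w powr (- (p - 2))) \<partial>lborel)"
  proof (rule nn_integral_mono)
    fix w
    have "(\<integral>\<^sup>+v. ennreal (norm (h w * (k (v - w) * g v))) \<partial>lborel) = (\<integral>\<^sup>+v. ennreal \<bar>h w\<bar> * ennreal \<bar>k (v - w) * g v\<bar> \<partial>lborel)"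
      by (intro nn_integral_cong) (simp add: abs_mult ennreal_mult)
    also have "\<dots> = ennreal \<bar>h w\<bar> * (\<integral>\<^sup>+v. ennreal \<bar>k (v - w) * g v\<bar> \<partial>lborel)"
      by (rule nn_integral_cmult) measurable
    also have "\<dots> \<le> ennreal (K * jbracket w powr (- p)) * ennreal (B * (jbracket w)\<^sup>2)"
      by (intro mult_mono ennreal_leI K B) auto
    also have "\<dots> = ennreal (K * B * (jbracket w powr (- p) * (jbracket w)\<^sup>2))"
      using K B by (subst ennreal_mult[symmetric]) (auto simp: ac_simps)
    also have "jbracket w powr (- p) * (jbracket w)\<^sup>2 = jbracket w powr (- (p - 2))"
      using powr_add[of "jbracket w" "- p" 2] by (simp add: less_imp_le algebra_simps)
    finally show "(\<integral>\<^sup>+v. ennreal (norm (h w * (k (v - w) * g v))) \<partial>lborel) \<le> ennreal (K * B * jbracket w powr (- (p - 2)))" .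
  qed
  also have "\<dots> < \<infinity>"
  proof -
    have "integrable lborel (\<lambda>w. K * B * jbracket w powr (- (p - 2)))"
      using p by (intro integrable_mult_right integrable_jbracket_powr) auto
    then show ?thesis using K B by (subst nn_integral_eq_integral) auto
  qed
  finally show "(\<integral>\<^sup>+x. ennreal (norm (case x of (v, w) \<Rightarrow> h w * (k (v - w) * g v))) \<partial>(lborel \<Otimes>\<^sub>M lborel)) < \<infinity>" .
qed

context snapshot
begin

definition coll :: "r3 \<Rightarrow> real" where
  "coll v = (LBINT w. u w * core v w)"

lemmas kernels = kernel_ka[OF \<gamma>_ge \<gamma>_le] kernel_kb[OF \<gamma>_ge \<gamma>_le] kernel_norm_powr[OF \<gamma>_ge \<gamma>_le2]

lemma weighted_pair_integrable:
  assumes \<phi> [measurable]: "\<phi> \<in> borel_measurable borel" and b: "\<And>v. \<bar>\<phi> v\<bar> \<le> B"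
  shows "integrable (lborel \<Otimes>\<^sub>M lborel) (\<lambda>(v, w). u w * (\<phi> v * core v w))"
proof -
  have eq: "(\<lambda>(v, w). u w * (\<phi> v * core v w)) = (\<lambda>q.
     (\<Sum>i\<in>UNIV. \<Sum>j\<in>UNIV. (\<lambda>(v, w). u w * (ka \<gamma> i j (v - w) * (\<phi> v * u2 i j v))) q)
      + 2 * (\<gamma> + 3) * (\<lambda>(v, w). u w * (norm (v - w) powr \<gamma> * (\<phi> v * u v))) q)"
    by (auto simp: core_def fun_eq_iff algebra_simps sum_distrib_left)
  show ?thesis unfolding eq
    by (intro Bochner_Integration.integrable_add Bochner_Integration.integrable_sum integrable_mult_right
      kernel_pair_integrable[OF _ _ du p] kernels decays_bounded_mult[OF du2 \<phi> b] decays_bounded_mult[OF du \<phi> b])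
qed

text \<open>Pulling the factors that depend on \<open>v\<close> alone out of the integral exhibits a
  second order operator in non-divergence form with convolution coefficients. Continuity in time and
  velocity is read off from this form.\<close>

lemma coll_eq:
  "coll v = (\<Sum>i\<in>UNIV. \<Sum>j\<in>UNIV. (LBINT w. ka \<gamma> i j (v - w) * u w) * u2 i j v)
     + 2 * (\<gamma> + 3) * (LBINT w. norm (v - w) powr \<gamma> * u w) * u v"
proof -
  have sym: "ka \<gamma> i j (v - w) = ka \<gamma> i j (w - v)" "norm (v - w) = norm (w - v)" for i j w
    by (simp_all add: ka_def norm_minus_commute algebra_simps)
  have i: "integrable lborel (\<lambda>w. ka \<gamma> i j (v - w) * u w)" "integrable lborel (\<lambda>w. norm (v - w) powr \<gamma> * u w)" for i j
    unfolding sym by (intro kint kernels du)+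
  have "coll v = (LBINT w. (\<Sum>i\<in>UNIV. \<Sum>j\<in>UNIV. (ka \<gamma> i j (v - w) * u w) * u2 i j v) + 2 * (\<gamma> + 3) * (norm (v - w) powr \<gamma> * u w) * u v)"
    unfolding coll_def core_def by (intro Bochner_Integration.integral_cong refl) (simp add: algebra_simps sum_distrib_left)
  also have "\<dots> = (\<Sum>i\<in>UNIV. \<Sum>j\<in>UNIV. (LBINT w. ka \<gamma> i j (v - w) * u w) * u2 i j v)
     + 2 * (\<gamma> + 3) * (LBINT w. norm (v - w) powr \<gamma> * u w) * u v"
    using i by (simp add: Bochner_Integration.integral_sum Bochner_Integration.integrable_sum)
  finally show ?thesis .
qed

lemma coll_swap:
  assumes \<phi> [measurable]: "\<phi> \<in> borel_measurable borel" and b: "\<And>v. \<bar>\<phi> v\<bar> \<le> B"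
  shows "(LBINT v. \<phi> v * coll v) = (LBINT w. u w * (LBINT v. \<phi> v * core v w))"
    and "integrable lborel (\<lambda>v. \<phi> v * coll v)"
proof -
  note I = weighted_pair_integrable[OF \<phi> b]
  have eq: "(LBINT w. u w * (\<phi> v * core v w)) = \<phi> v * coll v" for v
    unfolding coll_def by (simp add: mult.left_commute[of "u _"])
  show "(LBINT v. \<phi> v * coll v) = (LBINT w. u w * (LBINT v. \<phi> v * core v w))"
    using lborel_pair.Fubini_integral[OF I] by (simp add: eq)
  show "integrable lborel (\<lambda>v. \<phi> v * coll v)"
    using lborel_pair.integrable_fst[OF I] by (simp add: eq)
qed

lemma pair_L_integrable:
  assumes b: "\<And>i v. \<bar>\<phi>1 i v\<bar> \<le> B" "\<And>i j v. \<bar>\<phi>2 i j v\<bar> \<le> B"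
    and m [measurable]: "\<And>i. \<phi>1 i \<in> borel_measurable borel" "\<And>i j. \<phi>2 i j \<in> borel_measurable borel"
  shows "integrable (lborel \<Otimes>\<^sub>M lborel)
    (\<lambda>(v, w). u v * u w * ((\<Sum>i\<in>UNIV. \<Sum>j\<in>UNIV. ka \<gamma> i j (v - w) * \<phi>2 i j v) + 2 * (\<Sum>i\<in>UNIV. kb \<gamma> i (v - w) * \<phi>1 i v)))"
proof -
  have eq: "(\<lambda>(v, w). u v * u w * ((\<Sum>i\<in>UNIV. \<Sum>j\<in>UNIV. ka \<gamma> i j (v - w) * \<phi>2 i j v) + 2 * (\<Sum>i\<in>UNIV. kb \<gamma> i (v - w) * \<phi>1 i v))) = (\<lambda>q.
     (\<Sum>i\<in>UNIV. \<Sum>j\<in>UNIV. (\<lambda>(v, w). u w * (ka \<gamma> i j (v - w) * (\<phi>2 i j v * u v))) q)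
      + 2 * (\<Sum>i\<in>UNIV. (\<lambda>(v, w). u w * (kb \<gamma> i (v - w) * (\<phi>1 i v * u v))) q))"
    by (auto simp: fun_eq_iff algebra_simps sum_distrib_left)
  show ?thesis unfolding eq
    by (intro Bochner_Integration.integrable_add Bochner_Integration.integrable_sum integrable_mult_right
      kernel_pair_integrable[OF _ _ du p] kernels decays_bounded_mult[OF du m(2) b(2)] decays_bounded_mult[OF du m(1) b(1)])
qed

text \<open>Integrating in \<open>v\<close> for fixed partner velocity brings the problem to
  \<open>core_weak\<close>; exchanging the order again collects the result into
  \<open>coll\<close>.\<close>

lemma coll_weak:
  assumes b: "\<And>v. \<bar>\<phi> v\<bar> \<le> B" "\<And>i v. \<bar>\<phi>1 i v\<bar> \<le> B" "\<And>i j v. \<bar>\<phi>2 i j v\<bar> \<le> B"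
    and m [measurable]: "\<phi> \<in> borel_measurable borel" "\<And>i. \<phi>1 i \<in> borel_measurable borel" "\<And>i j. \<phi>2 i j \<in> borel_measurable borel"
    and d1: "\<And>i. ddir i \<phi> (\<phi>1 i)" and d2: "\<And>i j. ddir i (\<phi>1 j) (\<phi>2 i j)"
  shows "(LBINT q. (case q of (v, w) \<Rightarrow> u v * u w * ((\<Sum>i\<in>UNIV. \<Sum>j\<in>UNIV. ka \<gamma> i j (v - w) * \<phi>2 i j v) + 2 * (\<Sum>i\<in>UNIV. kb \<gamma> i (v - w) * \<phi>1 i v))))
    = (LBINT v. \<phi> v * coll v)"
proof -
  define g where "g = (\<lambda>v w. u v * u w * ((\<Sum>i\<in>UNIV. \<Sum>j\<in>UNIV. ka \<gamma> i j (v - w) * \<phi>2 i j v) + 2 * (\<Sum>i\<in>UNIV. kb \<gamma> i (v - w) * \<phi>1 i v)))"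
  have gi: "integrable (lborel \<Otimes>\<^sub>M lborel) (\<lambda>(v, w). g v w)"
    unfolding g_def by (rule pair_L_integrable[OF b(2,3) m(2,3)])
  have gw: "g v w = u w * (u v * ((\<Sum>i\<in>UNIV. \<Sum>j\<in>UNIV. ka \<gamma> i j (v - w) * \<phi>2 i j v) + 2 * (\<Sum>i\<in>UNIV. kb \<gamma> i (v - w) * \<phi>1 i v)))" for v w
    by (simp add: g_def)
  have "(LBINT q. (case q of (v, w) \<Rightarrow> g v w)) = (\<integral>q. (case q of (v, w) \<Rightarrow> g v w) \<partial>(lborel \<Otimes>\<^sub>M lborel))"
    by (simp add: lborel_prod)
  also have "\<dots> = (\<integral>w. \<integral>v. g v w \<partial>lborel \<partial>lborel)"
    using lborel_pair.integral_snd[OF gi] by simp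
  also have "\<dots> = (LBINT w. u w * (LBINT v. \<phi> v * core v w))"
    unfolding gw by (simp add: core_weak[OF b m d1 d2])
  also have "\<dots> = (LBINT v. \<phi> v * coll v)" using coll_swap(1)[OF m(1) b(1)] by simp
  finally show ?thesis by (simp add: g_def)
qed

lemma grad_component: "grad v $ i = u1 i v"
  by (simp add: grad_def)

text \<open>The identity of \<open>core_entropy\<close> holds for each fixed partner velocity. In
  the dissipation the order of integration is exchanged, so that the partner is integrated out at
  fixed \<open>v\<close>, where the lower bound for the quadratic form applies with \<xi> the
  gradient of u.\<close>

lemma coll_entropy:
  assumes \<delta>: "0 < \<delta>"
    and co: "\<And>v \<xi>. \<kappa> * jbracket v powr \<gamma> * (norm \<xi>)\<^sup>2
        \<le> (LBINT c. u c * (norm (v - c) powr \<gamma> * ((norm (v - c))\<^sup>2 * (norm \<xi>)\<^sup>2 - ((v - c) \<bullet> \<xi>)\<^sup>2)))"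
  shows "(LBINT v. ln (1 + u v / \<delta>) * coll v)
    \<le> - \<kappa> * (LBINT v. jbracket v powr \<gamma> * (norm (grad v))\<^sup>2 / (u v + \<delta>))
      + 2 * (\<gamma> + 3) * (LBINT w. u w * (LBINT v. norm (v - w) powr \<gamma> * entG \<delta> (u v)))"
proof -
  have pos: "u v + \<delta> > 0" for v using u_nonneg[of v] \<delta> by linarith
  have \<phi>le: "\<bar>ln (1 + u v / \<delta>)\<bar> \<le> 1 / \<delta> * \<bar>u v\<bar>" for v
    using ln_add_one_self_le_self[of "u v / \<delta>"] u_nonneg[of v] \<delta> by simp
  have d\<phi>: "decays p (\<lambda>v. ln (1 + u v / \<delta>))" by (rule decays_dominated[OF du _ \<phi>le]) (use \<delta> in auto)
  obtain B where B: "\<And>v. \<bar>ln (1 + u v / \<delta>)\<bar> \<le> B" using decays_bound[OF d\<phi>] p by auto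
  have G: "decays p (\<lambda>v. entG \<delta> (u v))"
    by (rule decays_dominated[OF du, where C=1]) (use entG_nonneg[OF \<delta>] entG_le[OF \<delta>] u_nonneg in \<open>auto simp: entG_def\<close>)
  have rb: "\<bar>inverse (u v + \<delta>)\<bar> \<le> 1 / \<delta>" for v
    using pos[of v] u_nonneg[of v] \<delta> by (simp add: divide_simps)
  have rmeas: "(\<lambda>v. inverse (u v + \<delta>)) \<in> borel_measurable borel" by measurable
  have drat: "decays p (\<lambda>v. inverse (u v + \<delta>) * (u1 i v * u1 j v))" for i j
    using p by (intro decays_bounded_mult[OF decays_mult[OF du1 du1] rmeas rb]) auto
  define D where "D = (\<lambda>(v, w). u w * (\<Sum>i\<in>UNIV. \<Sum>j\<in>UNIV. ka \<gamma> i j (v - w) * (u1 i v * u1 j v / (u v + \<delta>))))"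
  have Di: "integrable (lborel \<Otimes>\<^sub>M lborel) D"
  proof -
    have eq: "D = (\<lambda>q. \<Sum>i\<in>UNIV. \<Sum>j\<in>UNIV. (\<lambda>(v, w). u w * (ka \<gamma> i j (v - w) * (inverse (u v + \<delta>) * (u1 i v * u1 j v)))) q)"
      by (auto simp: D_def fun_eq_iff field_simps sum_distrib_left)
    show ?thesis unfolding eq
      by (intro Bochner_Integration.integrable_sum kernel_pair_integrable[OF _ _ du p] kernels drat)
  qed
  define S where "S = (\<lambda>(v, w). u w * (norm (v - w) powr \<gamma> * entG \<delta> (u v)))"
  have Si: "integrable (lborel \<Otimes>\<^sub>M lborel) S"
    unfolding S_def by (intro kernel_pair_integrable[OF _ G du p] kernels)
  have "(LBINT v. ln (1 + u v / \<delta>) * coll v) = (LBINT w. u w * (LBINT v. ln (1 + u v / \<delta>) * core v w))"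
    by (rule coll_swap(1)[OF _ B]) measurable
  also have "\<dots> = (LBINT w. - (LBINT v. D (v, w)) + 2 * (\<gamma> + 3) * (LBINT v. S (v, w)))"
    unfolding core_entropy[OF \<delta>] D_def S_def by (simp add: algebra_simps)
  also have "\<dots> = - (\<integral>w. \<integral>v. D (v, w) \<partial>lborel \<partial>lborel) + 2 * (\<gamma> + 3) * (\<integral>w. \<integral>v. S (v, w) \<partial>lborel \<partial>lborel)"
    using lborel_pair.integrable_snd[of "\<lambda>v w. D (v, w)"] lborel_pair.integrable_snd[of "\<lambda>v w. S (v, w)"] Di Si by simp
  also have "(\<integral>w. \<integral>v. D (v, w) \<partial>lborel \<partial>lborel) = (\<integral>v. \<integral>w. D (v, w) \<partial>lborel \<partial>lborel)"
    using lborel_pair.Fubini_integral[of "\<lambda>v w. D (v, w)"] Di by simp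
  finally have 1: "(LBINT v. ln (1 + u v / \<delta>) * coll v) = - (\<integral>v. \<integral>w. D (v, w) \<partial>lborel \<partial>lborel)
      + 2 * (\<gamma> + 3) * (\<integral>w. \<integral>v. S (v, w) \<partial>lborel \<partial>lborel)" .
  have "(LBINT v. \<kappa> * (jbracket v powr \<gamma> * (norm (grad v))\<^sup>2 / (u v + \<delta>))) \<le> (\<integral>v. \<integral>w. D (v, w) \<partial>lborel \<partial>lborel)"
  proof (intro integral_mono integrable_mult_right grad_sq_integrable[OF \<delta>])
    show "integrable lborel (\<lambda>v. \<integral>w. D (v, w) \<partial>lborel)"
      using lborel_pair.integrable_fst[of "\<lambda>v w. D (v, w)"] Di by simp
    fix v
    have "\<kappa> * (jbracket v powr \<gamma> * (norm (grad v))\<^sup>2 / (u v + \<delta>)) = (\<kappa> * jbracket v powr \<gamma> * (norm (grad v))\<^sup>2) / (u v + \<delta>)" by simp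
    also have "\<dots> \<le> (LBINT c. u c * (norm (v - c) powr \<gamma> * ((norm (v - c))\<^sup>2 * (norm (grad v))\<^sup>2 - ((v - c) \<bullet> grad v)\<^sup>2))) / (u v + \<delta>)"
      using pos[of v] by (intro divide_right_mono co) auto
    also have "\<dots> = (LBINT c. u c * (norm (v - c) powr \<gamma> * ((norm (v - c))\<^sup>2 * (norm (grad v))\<^sup>2 - ((v - c) \<bullet> grad v)\<^sup>2)) / (u v + \<delta>))"
      by simp
    also have "\<dots> = (LBINT w. D (v, w))"
    proof (intro Bochner_Integration.integral_cong refl)
      fix c
      have "D (v, c) = u c * (\<Sum>i\<in>UNIV. \<Sum>j\<in>UNIV. ka \<gamma> i j (v - c) * (grad v $ i * grad v $ j)) / (u v + \<delta>)"
        by (simp add: D_def grad_component sum_divide_distrib sum_distrib_left)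
      then show "u c * (norm (v - c) powr \<gamma> * ((norm (v - c))\<^sup>2 * (norm (grad v))\<^sup>2 - ((v - c) \<bullet> grad v)\<^sup>2)) / (u v + \<delta>) = D (v, c)"
        unfolding ka_quadratic_form by simp
    qed
    finally show "\<kappa> * (jbracket v powr \<gamma> * (norm (grad v))\<^sup>2 / (u v + \<delta>)) \<le> (LBINT w. D (v, w))" .
  qed
  then have "\<kappa> * (LBINT v. jbracket v powr \<gamma> * (norm (grad v))\<^sup>2 / (u v + \<delta>)) \<le> (\<integral>v. \<integral>w. D (v, w) \<partial>lborel \<partial>lborel)"
    by (simp only: integral_mult_right_zero)
  then show ?thesis unfolding 1 by (simp add: S_def)
qed

end

subsection \<open>Smooth test functions\<close>

text \<open>One induction proves all three claims, since the product rule needs sums of products in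
  which one factor has lost a derivative.\<close>

lemma Ck_on_add_mult:
  fixes f g :: "'a::euclidean_space \<Rightarrow> real"
  shows "Ck_on (Suc k) UNIV f \<Longrightarrow> Ck_on k UNIV f"
    and "Ck_on k UNIV f \<Longrightarrow> Ck_on k UNIV g \<Longrightarrow> Ck_on k UNIV (\<lambda>x. f x + g x)"
    and "Ck_on k UNIV f \<Longrightarrow> Ck_on k UNIV g \<Longrightarrow> Ck_on k UNIV (\<lambda>x. f x * g x)"
proof (induction k arbitrary: f g)
  case 0
  { case 1 then show ?case by (auto intro!: continuous_at_imp_continuous_on differentiable_imp_continuous_within) }
  { case 2 then show ?case by (auto intro: continuous_intros) }
  { case 3 then show ?case by (auto intro: continuous_intros) }
next
  case (Suc k)
  { case 1 then show ?case using Suc.IH(1) by auto }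
  { case 2
    then have d: "f differentiable (at x)" "g differentiable (at x)" for x by auto
    have "partial b (\<lambda>x. f x + g x) = (\<lambda>x. partial b f x + partial b g x)" for b
      unfolding partial_def
      by (intro ext fun_cong[OF frechet_derivative_at[symmetric], THEN trans])
         (auto intro!: derivative_eq_intros simp: d frechet_derivative_works[symmetric])
    with 2 d Suc.IH(2) show ?case by auto }
  { case 3
    then have d: "f differentiable (at x)" "g differentiable (at x)" for x by auto
    have "partial b (\<lambda>x. f x * g x) = (\<lambda>x. f x * partial b g x + partial b f x * g x)" for b
    proof
      fix x
      have "((\<lambda>x. f x * g x) has_derivative (\<lambda>h. f x * frechet_derivative g (at x) h + frechet_derivative f (at x) h * g x)) (at x)"
        using d by (intro has_derivative_mult) (auto simp: frechet_derivative_works[symmetric])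
      from frechet_derivative_at[OF this, symmetric]
      show "partial b (\<lambda>x. f x * g x) x = f x * partial b g x + partial b f x * g x"
        by (simp add: partial_def)
    qed
    with 3 d Suc.IH show ?case by auto }
qed

lemma partial_chain:
  fixes g :: "r3 \<Rightarrow> real"
  assumes "(H has_real_derivative H') (at (g x))" "(g has_derivative g') (at x)"
  shows "(\<lambda>x. H (g x)) differentiable (at x)" "partial b (\<lambda>x. H (g x)) x = H' * g' b"
proof -
  have "((\<lambda>x. H (g x)) has_derivative (\<lambda>h. H' * g' h)) (at x)"
    using has_derivative_compose[OF assms(2), of H "(*) H'"] assms(1) by (simp add: has_field_derivative_def)
  from this frechet_derivative_at[OF this, symmetric]
  show "(\<lambda>x. H (g x)) differentiable (at x)" "partial b (\<lambda>x. H (g x)) x = H' * g' b"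
    by (auto simp: partial_def differentiable_def)
qed

lemma Ck_on_const: "Ck_on k UNIV (\<lambda>x::r3. c)"
proof (induction k arbitrary: c)
  case (Suc k)
  have "partial b (\<lambda>x::r3. c) = (\<lambda>x. 0)" for b by (simp add: partial_def fun_eq_iff)
  with Suc show ?case by simp
qed simp

lemma Ck_on_affine: "Ck_on k UNIV (\<lambda>x::r3. a * ((x - v0) \<bullet> b))"
proof (cases k)
  case (Suc m)
  have d: "((\<lambda>x::r3. a * ((x - v0) \<bullet> b)) has_derivative (\<lambda>h. a * (h \<bullet> b))) (at x)" for x
    by (auto intro!: derivative_eq_intros)
  then have "partial c (\<lambda>x::r3. a * ((x - v0) \<bullet> b)) = (\<lambda>x. a * (c \<bullet> b))" for c
    unfolding partial_def using frechet_derivative_at[OF d] by (metis (no_types))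
  with Suc d Ck_on_const show ?thesis by (auto simp: differentiable_def)
qed (auto intro!: continuous_intros)

lemma norm_sq_derivative: "((\<lambda>x::r3. (norm (x - v0))\<^sup>2) has_derivative (\<lambda>h. 2 * ((x - v0) \<bullet> h))) (at x)"
  unfolding power2_norm_eq_inner by (auto intro!: derivative_eq_intros simp: inner_commute)

text \<open>A derivative is the power with exponent lowered by 2 times an affine function, so the
  induction runs over all exponents at once.\<close>

lemma Ck_on_jbracket_powr: "Ck_on k UNIV (\<lambda>x. jbracket x powr a)"
proof (induction k arbitrary: a)
  case 0 show ?case by (auto intro!: continuous_intros)
next
  case (Suc k)
  have eq: "jbracket x powr c = (1 + (norm (x - 0))\<^sup>2) powr (c / 2)" for x c
  proof -
    have "jbracket x powr c = (jbracket x powr 2) powr (c / 2)" by (simp only: powr_powr) simp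
    then show ?thesis by (simp add: jbracket_powr_2)
  qed
  have d: "((\<lambda>y. (1 + y) powr (a / 2)) has_real_derivative (a / 2) * (1 + y) powr (a / 2 - 1)) (at y)" if "0 \<le> y" for y
    using that by (auto intro!: derivative_eq_intros simp: add_pos_nonneg)
  have eq2: "(1 + (norm (x - 0))\<^sup>2) powr (a / 2 - 1) = jbracket x powr (a - 2)" for x :: r3
    unfolding eq by (simp add: diff_divide_distrib)
  note D = partial_chain[OF d norm_sq_derivative[of 0], unfolded eq[symmetric] eq2, OF zero_le_power2]
  have "partial b (\<lambda>x. jbracket x powr a) = (\<lambda>x. jbracket x powr (a - 2) * (a * ((x - 0) \<bullet> b)))" for b
    using D(2) by (simp add: fun_eq_iff)
  moreover have "Ck_on k UNIV (\<lambda>x. jbracket x powr (a - 2) * (a * ((x - 0) \<bullet> b)))" for b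
    by (intro Ck_on_add_mult(3) Suc Ck_on_affine)
  ultimately show ?case using D(1) by simp
qed

text \<open>Unlike \<open>exp (- 1 / x)\<close> alone, this family of smooth cut-offs is closed under differentiation.\<close>

definition bq :: "real poly \<Rightarrow> real \<Rightarrow> real" where
  "bq q x = (if x > 0 then poly q (1 / x) * exp (- (1 / x)) else 0)"

lemma poly_exp_tendsto_0: "((\<lambda>y::real. poly q y * exp (- y)) \<longlongrightarrow> 0) at_top"
proof -
  have "((\<lambda>y::real. \<Sum>i\<le>degree q. coeff q i * (y ^ i / exp y)) \<longlongrightarrow> (\<Sum>i\<le>degree q. coeff q i * 0)) at_top"
    by (intro tendsto_intros tendsto_power_div_exp_0)
  then show ?thesis by (simp add: poly_altdef sum_distrib_right exp_minus divide_inverse mult.assoc)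
qed

text \<open>In the variable y = 1 / x the derivative of q (y) exp (-y) is y^2 (q - q') (y) exp (-y);
  the polynomial \<open>[:0, 0, 1:]\<close> is y^2. At 0 both one-sided difference quotients tend to
  0.\<close>

lemma bq_deriv: "(bq q has_real_derivative bq ([:0, 0, 1:] * (q - pderiv q)) x) (at x)"
proof (cases "x = 0")
  case True
  have "((\<lambda>h. bq q h / h) \<longlongrightarrow> 0) (at 0)"
  proof (rule filterlim_split_at)
    show "((\<lambda>h. bq q h / h) \<longlongrightarrow> 0) (at_left 0)"
      by (rule tendsto_eventually) (auto simp: bq_def eventually_at_left_field intro: exI[of _ "-1"])
    \<comment> \<open>Dividing by h multiplies the polynomial by y = 1 / h, which is what
      \<open>pCons 0\<close> does.\<close>
    have "((\<lambda>h. poly (pCons 0 q) (inverse h) * exp (- inverse h)) \<longlongrightarrow> 0) (at_right 0)"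
      by (rule filterlim_compose[OF poly_exp_tendsto_0 filterlim_inverse_at_top_right])
    then show "((\<lambda>h. bq q h / h) \<longlongrightarrow> 0) (at_right 0)"
      by (rule Lim_transform_eventually) (auto simp: bq_def eventually_at_right_field field_simps intro!: exI[of _ 1])
  qed
  then show ?thesis using True by (simp add: has_field_derivative_iff bq_def)
next
  case False
  show ?thesis
  proof (cases "x > 0")
    case True
    have "((\<lambda>x. poly q (1 / x) * exp (- (1 / x))) has_real_derivative bq ([:0, 0, 1:] * (q - pderiv q)) x) (at x)"
      using True by (auto intro!: derivative_eq_intros simp: bq_def field_simps power2_eq_square)
    moreover have "eventually (\<lambda>y. y > 0) (nhds x)"
      using True by (intro eventually_nhds_in_open[of "{0<..}", simplified]) auto
    then have "eventually (\<lambda>y. bq q y = poly q (1 / y) * exp (- (1 / y))) (nhds x)"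
      by eventually_elim (simp add: bq_def)
    ultimately show ?thesis by (simp add: DERIV_cong_ev)
  next
    case F: False
    then have "x < 0" using False by simp
    then have "eventually (\<lambda>y. y < 0) (nhds x)"
      by (intro eventually_nhds_in_open[of "{..<0}", simplified]) auto
    then have "eventually (\<lambda>y. bq q y = 0) (nhds x)"
      by eventually_elim (simp add: bq_def)
    moreover have "((\<lambda>y. 0) has_real_derivative 0) (at x)" by simp
    moreover have "bq ([:0, 0, 1:] * (q - pderiv q)) x = 0" using F by (simp add: bq_def)
    ultimately show ?thesis by (simp add: DERIV_cong_ev)
  qed
qed

lemma bq_continuous: "continuous_on A (bq q)"
  by (intro continuous_at_imp_continuous_on ballI DERIV_isCont[OF bq_deriv])

text \<open>\<open>R\<close> is the square of the radius of the support; using the squared distance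
  keeps the cut-off smooth at its centre.\<close>

lemma Ck_on_bq:
  assumes R: "R > 0"
  shows "Ck_on k UNIV (\<lambda>x::r3. bq q (1 - (norm (x - v0))\<^sup>2 / R))"
proof (induction k arbitrary: q)
  case 0 show ?case using R by (auto intro!: continuous_intros continuous_on_compose2[OF bq_continuous[of UNIV]])
next
  case (Suc k)
  let ?q = "[:0, 0, 1:] * (q - pderiv q)"
  have d: "((\<lambda>x::r3. 1 - (norm (x - v0))\<^sup>2 / R) has_derivative (\<lambda>h. - (2 / R) * ((x - v0) \<bullet> h))) (at x)" for x
    using has_derivative_diff[OF has_derivative_const has_derivative_mult_right[OF norm_sq_derivative, of "1 / R"], of 1]
    by simp
  note D = partial_chain[OF bq_deriv d]
  have "partial b (\<lambda>x::r3. bq q (1 - (norm (x - v0))\<^sup>2 / R)) = (\<lambda>x. bq ?q (1 - (norm (x - v0))\<^sup>2 / R) * (- (2 / R) * ((x - v0) \<bullet> b)))" for b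
    using D(2) by (simp add: fun_eq_iff)
  moreover have "Ck_on k UNIV (\<lambda>x::r3. bq ?q (1 - (norm (x - v0))\<^sup>2 / R) * (- (2 / R) * ((x - v0) \<bullet> b)))" for b
    by (intro Ck_on_add_mult(3) Suc Ck_on_affine)
  ultimately show ?case using D(1) by simp
qed

lemma bq_support:
  assumes "R > 0" "bq q (1 - (norm (x - v0))\<^sup>2 / R) \<noteq> 0" shows "norm (x - v0) < sqrt R"
proof -
  have "1 - (norm (x - v0))\<^sup>2 / R > 0" using assms(2) by (simp add: bq_def split: if_splits)
  then show ?thesis using assms(1) by (intro real_less_rsqrt) (simp add: field_simps)
qed

lemma test_function_bq:
  assumes R: "R > 0" and g: "\<And>k. Ck_on k UNIV g"
  shows "test_function (\<lambda>x. g x * bq q (1 - (norm (x - v0))\<^sup>2 / R))"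
  unfolding test_function_def
proof (intro conjI allI)
  show "Ck_on k UNIV (\<lambda>x. g x * bq q (1 - (norm (x - v0))\<^sup>2 / R))" for k
    by (intro Ck_on_add_mult(3) g Ck_on_bq R)
  have "{x. g x * bq q (1 - (norm (x - v0))\<^sup>2 / R) \<noteq> 0} \<subseteq> cball v0 (sqrt R)"
    using bq_support[OF R] by (fastforce simp: dist_norm norm_minus_commute)
  then have "closure {x. g x * bq q (1 - (norm (x - v0))\<^sup>2 / R) \<noteq> 0} \<subseteq> cball v0 (sqrt R)"
    by (rule closure_minimal) simp
  then show "compact (closure {x. g x * bq q (1 - (norm (x - v0))\<^sup>2 / R) \<noteq> 0})"
    by (meson bounded_cball bounded_subset closed_closure compact_eq_bounded_closed)
qed

lemma differentiable_ddir:
  assumes "\<And>v. g differentiable (at v)"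
  shows "ddir i g (pd i g)"
  unfolding ddir_def
proof
  fix v :: r3
  have "(g has_derivative frechet_derivative g (at v)) (at (v + 0 *\<^sub>R axis i 1))"
    using assms by (simp add: frechet_derivative_works[symmetric])
  moreover have "((\<lambda>s. v + s *\<^sub>R axis i 1) has_derivative (\<lambda>s. s *\<^sub>R axis i 1)) (at 0)"
    by (auto intro!: derivative_eq_intros)
  ultimately have "((\<lambda>s. g (v + s *\<^sub>R axis i 1)) has_derivative (\<lambda>s. frechet_derivative g (at v) (s *\<^sub>R axis i 1))) (at 0)"
    by (rule has_derivative_compose[rotated])
  moreover have "frechet_derivative g (at v) (s *\<^sub>R axis i 1) = partial (axis i 1) g v * s" for s
    using linear_scale[OF linear_frechet_derivative[OF assms]] by (simp add: partial_def mult.commute)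
  ultimately show "((\<lambda>s. g (v + s *\<^sub>R axis i 1)) has_real_derivative pd i g v) (at 0)"
    by (simp add: has_field_derivative_def)
qed

text \<open>Outside the closed support the function vanishes on a neighbourhood, hence so do its
  derivatives.\<close>

lemma partial_support: "closure {v. partial b g v \<noteq> 0} \<subseteq> closure {v. g v \<noteq> 0}"
proof (rule closure_minimal)
  show "{v. partial b g v \<noteq> 0} \<subseteq> closure {v. g v \<noteq> 0}"
  proof (rule subsetI, rule ccontr)
    fix v assume v: "v \<in> {v. partial b g v \<noteq> 0}" "v \<notin> closure {v. g v \<noteq> 0}"
    have "(g has_derivative (\<lambda>h. 0)) (at v)"
    proof (rule has_derivative_transform_within_open)
      show "((\<lambda>x. 0) has_derivative (\<lambda>h. 0)) (at v)" by simp
      show "open (- closure {v. g v \<noteq> 0})" by (rule open_Compl) simp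
      show "v \<in> - closure {v. g v \<noteq> 0}" using v by simp
      show "0 = g x" if "x \<in> - closure {v. g v \<noteq> 0}" for x
        using that closure_subset[of "{v. g v \<noteq> 0}"] by auto
    qed
    from frechet_derivative_at[OF this, symmetric] v(1) show False by (simp add: partial_def)
  qed
qed simp

lemma continuous_compact_support_bounded:
  fixes g :: "r3 \<Rightarrow> real"
  assumes "continuous_on UNIV g" "compact K" "closure {v. g v \<noteq> 0} \<subseteq> K"
  obtains B where "0 \<le> B" "\<And>v. \<bar>g v\<bar> \<le> B"
proof -
  have "bounded (g ` K)"
    by (intro compact_imp_bounded compact_continuous_image continuous_on_subset[OF assms(1)] assms) auto
  then obtain B where B: "0 < B" "\<And>v. v \<in> K \<Longrightarrow> \<bar>g v\<bar> \<le> B" unfolding bounded_pos by auto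
  have "\<bar>g v\<bar> \<le> B" for v
    using B assms(3) closure_subset[of "{v. g v \<noteq> 0}"] by (cases "g v = 0") auto
  then show ?thesis using B(1) by (intro that[of B]) auto
qed

lemma axis_Basis3: "axis i (1::real) \<in> (Basis :: r3 set)"
  by simp

lemma test_functionD:
  assumes "test_function \<phi>"
  shows "continuous_on UNIV \<phi>" "\<And>i. continuous_on UNIV (pd i \<phi>)" "\<And>i j. continuous_on UNIV (pd i (pd j \<phi>))"
    and "\<And>i. ddir i \<phi> (pd i \<phi>)" "\<And>i j. ddir i (pd j \<phi>) (pd i (pd j \<phi>))"
    and "\<exists>B. (\<forall>v. \<bar>\<phi> v\<bar> \<le> B) \<and> (\<forall>i v. \<bar>pd i \<phi> v\<bar> \<le> B) \<and> (\<forall>i j v. \<bar>pd i (pd j \<phi>) v\<bar> \<le> B)"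
proof -
  have C: "Ck_on 0 UNIV \<phi>" "Ck_on (Suc 0) UNIV \<phi>" "Ck_on (Suc (Suc 0)) UNIV \<phi>" and cpt: "compact (closure {v. \<phi> v \<noteq> 0})"
    using assms by (auto simp: test_function_def simp del: Ck_on.simps)
  show c0: "continuous_on UNIV \<phi>" using C(1) by simp
  show c1: "continuous_on UNIV (pd i \<phi>)" for i using C(2) axis_Basis3 by simp
  show c2: "continuous_on UNIV (pd i (pd j \<phi>))" for i j using C(3) axis_Basis3 by simp
  show "ddir i \<phi> (pd i \<phi>)" for i using C(2) by (intro differentiable_ddir) simp
  show "ddir i (pd j \<phi>) (pd i (pd j \<phi>))" for i j using C(3) axis_Basis3 by (intro differentiable_ddir) simp
  obtain B0 where B0: "\<And>v. \<bar>\<phi> v\<bar> \<le> B0" using continuous_compact_support_bounded[OF c0 cpt] by blast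
  have "\<exists>B. \<forall>v. \<bar>pd i \<phi> v\<bar> \<le> B" for i
    using continuous_compact_support_bounded[OF c1 cpt partial_support] by metis
  then obtain B1 where B1: "\<And>i v. \<bar>pd i \<phi> v\<bar> \<le> B1 i" by metis
  have "\<exists>B. \<forall>v. \<bar>pd i (pd j \<phi>) v\<bar> \<le> B" for i j
    using continuous_compact_support_bounded[OF c2 cpt order.trans[OF partial_support partial_support]] by metis
  then obtain B2 where B2: "\<And>i j v. \<bar>pd i (pd j \<phi>) v\<bar> \<le> B2 i j" by metis
  define B where "B = Max (insert B0 (range B1 \<union> range (\<lambda>(i, j). B2 i j)))"
  have fin: "finite (insert B0 (range B1 \<union> range (\<lambda>(i, j). B2 i j)))" by simp
  have "B0 \<le> B" "B1 i \<le> B" "B2 i j \<le> B" for i j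
    unfolding B_def by (rule Max_ge[OF fin]; force)+
  then show "\<exists>B. (\<forall>v. \<bar>\<phi> v\<bar> \<le> B) \<and> (\<forall>i v. \<bar>pd i \<phi> v\<bar> \<le> B) \<and> (\<forall>i j v. \<bar>pd i (pd j \<phi>) v\<bar> \<le> B)"
    using B0 B1 B2 by (intro exI[of _ B]) (meson order_trans)
qed

subsection \<open>From the weak to the strong form\<close>

lemma slice_derivatives:
  fixes G :: "real \<times> r3 \<Rightarrow> real"
  assumes "G differentiable (at (t, v))"
  shows "(\<lambda>v. G (t, v)) differentiable (at v)"
    and "partial b (\<lambda>v. G (t, v)) v = partial (0, b) G (t, v)"
    and "((\<lambda>\<tau>. G (\<tau>, v)) has_real_derivative partial (1, 0) G (t, v)) (at t)"
proof -
  have D: "(G has_derivative frechet_derivative G (at (t, v))) (at (t, v))"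
    using assms by (simp add: frechet_derivative_works[symmetric])
  have "((\<lambda>v. (t, v)) has_derivative (\<lambda>h. (0, h))) (at v)"
    by (auto intro!: derivative_eq_intros)
  from has_derivative_compose[OF this D]
  have d: "((\<lambda>v. G (t, v)) has_derivative (\<lambda>h. frechet_derivative G (at (t, v)) (0, h))) (at v)" .
  then show "(\<lambda>v. G (t, v)) differentiable (at v)" by (auto simp: differentiable_def)
  show "partial b (\<lambda>v. G (t, v)) v = partial (0, b) G (t, v)"
    unfolding partial_def using frechet_derivative_at[OF d, symmetric] by simp
  have "((\<lambda>\<tau>. (\<tau>, v)) has_derivative (\<lambda>h. (h, 0))) (at t)"
    by (auto intro!: derivative_eq_intros)
  from has_derivative_compose[OF this D]
  have d2: "((\<lambda>\<tau>. G (\<tau>, v)) has_derivative (\<lambda>h. frechet_derivative G (at (t, v)) (h, 0))) (at t)" .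
  have "frechet_derivative G (at (t, v)) (h, 0) = partial (1, 0) G (t, v) * h" for h
    using linear_scale[OF linear_frechet_derivative[OF assms], of h "(1, 0)"] by (simp add: partial_def mult.commute)
  with d2 show "((\<lambda>\<tau>. G (\<tau>, v)) has_real_derivative partial (1, 0) G (t, v)) (at t)"
    by (simp add: has_field_derivative_def)
qed

lemma lborel_reflect: "distr lborel borel (\<lambda>x. t - x) = (lborel :: r3 measure)"
  using lborel_affine[of "-1" t] by (simp add: density_1)

lemma integral_reflect:
  fixes g :: "r3 \<Rightarrow> real"
  assumes "g \<in> borel_measurable borel"
  shows "(LBINT z. g (t - z)) = (LBINT z. g z)"
  by (subst (2) lborel_reflect[of t, symmetric], subst integral_distr) (use assms in auto)

text \<open>The fundamental theorem of calculus in time at each fixed velocity, integrated over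
  velocities. Continuity on the closed slab provides joint measurability, and the majorant is
  independent of time.\<close>

lemma fubini_time_derivative:
  fixes g gt :: "real \<Rightarrow> r3 \<Rightarrow> real"
  assumes ab: "a \<le> b" and cont: "continuous_on ({a..b} \<times> UNIV) (\<lambda>(t, v). gt t v)"
    and der: "\<And>t v. t \<in> {a..b} \<Longrightarrow> ((\<lambda>\<tau>. g \<tau> v) has_real_derivative gt t v) (at t)"
    and bd: "\<And>t v. t \<in> {a..b} \<Longrightarrow> \<bar>gt t v\<bar> \<le> K * jbracket v powr (- p)" and p: "p > 3"
  shows "(LBINT v. g b v - g a v) = (LBINT t. indicator {a..b} t * (LBINT v. gt t v))"
    and "integrable lborel (\<lambda>t. indicator {a..b} t * (LBINT v. gt t v))"
    and "integrable lborel (\<lambda>v. g b v - g a v)"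
proof -
  define h where "h = (\<lambda>(t, v). indicator {a..b} t * gt t v)"
  have hm [measurable]: "h \<in> borel_measurable (lborel \<Otimes>\<^sub>M lborel)"
  proof -
    have "(\<lambda>x. indicator ({a..b} \<times> UNIV) x *\<^sub>R (case x of (t, v) \<Rightarrow> gt t v)) \<in> borel_measurable borel"
      by (rule borel_measurable_continuous_on_indicator[OF _ cont]) (auto intro!: borel_closed closed_Times)
    moreover have "h = (\<lambda>x. indicator ({a..b} \<times> UNIV) x *\<^sub>R (case x of (t, v) \<Rightarrow> gt t v))"
      by (auto simp: h_def fun_eq_iff split: split_indicator)
    ultimately show ?thesis by (simp add: lborel_prod)
  qed
  have Ji: "integrable lborel (\<lambda>v. K * jbracket v powr (- p))"
    by (intro integrable_mult_right integrable_jbracket_powr p)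
  have "integrable (lborel \<Otimes>\<^sub>M lborel) (\<lambda>(t, v). indicator {a..b} t * (K * jbracket v powr (- p)))"
  proof (rule lborel_pair.Fubini_integrable)
    have "integrable lborel (indicat_real {a..b})" by (rule integrable_real_indicator) (auto simp: emeasure_lborel_Icc_eq)
    then
    show "integrable lborel (\<lambda>t. \<integral>v. norm (case (t, v) of (t, v) \<Rightarrow> indicator {a..b} t * (K * jbracket v powr (- p))) \<partial>lborel)"
      by (simp add: abs_mult)
    show "AE t in lborel. integrable lborel (\<lambda>v. case (t, v) of (t, v) \<Rightarrow> indicator {a..b} t * (K * jbracket v powr (- p)))"
      using Ji by simp
  qed measurable
  then have hi: "integrable (lborel \<Otimes>\<^sub>M lborel) h"
  proof (rule Bochner_Integration.integrable_bound[OF _ hm])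
    show "AE x in lborel \<Otimes>\<^sub>M lborel. norm (h x) \<le> norm (case x of (t, v) \<Rightarrow> indicator {a..b} t * (K * jbracket v powr (- p)))"
    proof (intro AE_I2)
      fix x :: "real \<times> r3"
      obtain t v where x: "x = (t, v)" by (cases x)
      show "norm (h x) \<le> norm (case x of (t, v) \<Rightarrow> indicator {a..b} t * (K * jbracket v powr (- p)))"
        using bd[of t v] by (cases "t \<in> {a..b}") (auto simp: x h_def)
    qed
  qed
  have inner: "(LBINT t. h (t, v)) = g b v - g a v" for v
  proof -
    have "((\<lambda>t. gt t v) has_integral (g b v - g a v)) {a..b}"
      by (rule fundamental_theorem_of_calculus[OF ab])
        (auto intro!: has_field_derivative_at_within[OF der] simp: has_real_derivative_iff_has_vector_derivative[symmetric])
    moreover have "set_integrable lborel {a..b} (\<lambda>t. gt t v)"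
    proof -
      have "continuous_on {a..b} (\<lambda>t. (\<lambda>(t, v). gt t v) (t, v))"
        by (rule continuous_on_compose2[OF cont]) (auto intro!: continuous_intros)
      then show ?thesis by (simp add: borel_integrable_atLeastAtMost')
    qed
    ultimately show ?thesis
      using set_borel_integral_eq_integral(2)[of "{a..b}" "\<lambda>t. gt t v"]
      by (simp add: h_def set_lebesgue_integral_def integral_unique)
  qed
  have inner2: "(LBINT v. h (t, v)) = indicator {a..b} t * (LBINT v. gt t v)" for t
    by (simp add: h_def)
  have hi': "integrable (lborel \<Otimes>\<^sub>M lborel) (\<lambda>(t, v). h (t, v))" using hi by simp
  show "(LBINT v. g b v - g a v) = (LBINT t. indicator {a..b} t * (LBINT v. gt t v))"
    using lborel_pair.Fubini_integral[OF hi'] by (simp add: inner inner2)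
  show "integrable lborel (\<lambda>t. indicator {a..b} t * (LBINT v. gt t v))"
    using lborel_pair.integrable_fst[OF hi'] by (simp add: inner2)
  show "integrable lborel (\<lambda>v. g b v - g a v)"
    using lborel_pair.integrable_snd[OF hi'] by (simp add: inner)
qed

section \<open>Regularity of a solution and continuity of the collision term\<close>

text \<open>The datum is a parameter next to the solution, so that outside the locale a constant can
  be chosen from the datum before all solutions are quantified over.\<close>

locale landau_solution =
  fixes \<gamma> :: real and fin :: "r3 \<Rightarrow> real" and f :: "real \<Rightarrow> r3 \<Rightarrow> real"
  assumes \<gamma>_ge: "-2 \<le> \<gamma>" and \<gamma>_neg: "\<gamma> < 0" and sol: "formal_landau_solution \<gamma> fin f"
begin

lemma weak: "landau_weak_solution \<gamma> fin f" and cons: "conserves_and_dissipates f"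
  and reg: "regular f" and mom: "keeps_moments f"
  using sol by (auto simp: formal_landau_solution_def)

lemma f_0: "f 0 = fin" and f_nonneg: "0 \<le> t \<Longrightarrow> 0 \<le> f t v" and f_integrable: "0 \<le> t \<Longrightarrow> integrable lborel (f t)"
  using weak by (auto simp: landau_weak_solution_def)

text \<open>Taken from the joint derivative in (t, v), so that joint continuity is inherited from
  the C^2 hypothesis; it agrees with the derivative at fixed velocity.\<close>

definition ft :: "real \<Rightarrow> r3 \<Rightarrow> real" where
  "ft t v = partial (1, 0) (\<lambda>(t, v). f t v) (t, v)"

lemma f_differentiable:
  assumes "0 < t"
  shows "(\<lambda>(t, v). f t v) differentiable (at (t, v))"
    and "b \<in> Basis \<Longrightarrow> partial b (\<lambda>(t, v). f t v) differentiable (at (t, v))"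
    and "b \<in> Basis \<Longrightarrow> b' \<in> Basis \<Longrightarrow> continuous_on ({0<..} \<times> UNIV) (partial b' (partial b (\<lambda>(t, v). f t v)))"
  using reg assms by (auto simp: regular_def numeral_2_eq_2)

lemma axis_pair_Basis: "((0::real), axis i (1::real) :: r3) \<in> Basis" "((1::real), 0 :: r3) \<in> Basis"
  by (auto simp: Basis_prod_def)

lemma pd_eq:
  assumes "0 < t"
  shows "pd i (f t) v = partial (0, axis i 1) (\<lambda>(t, v). f t v) (t, v)"
    and "pd i (pd j (f t)) v = partial (0, axis i 1) (partial (0, axis j 1) (\<lambda>(t, v). f t v)) (t, v)"
proof -
  have eq: "pd i (f t) v = partial (0, axis i 1) (\<lambda>(t, v). f t v) (t, v)" for i v
    using slice_derivatives(2)[OF f_differentiable(1)[OF assms], of "axis i 1"] by simp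
  then show "pd i (f t) v = partial (0, axis i 1) (\<lambda>(t, v). f t v) (t, v)" .
  have "pd j (f t) = (\<lambda>v. partial (0, axis j 1) (\<lambda>(t, v). f t v) (t, v))" using eq by (simp add: fun_eq_iff)
  then show "pd i (pd j (f t)) v = partial (0, axis i 1) (partial (0, axis j 1) (\<lambda>(t, v). f t v)) (t, v)"
    using slice_derivatives(2)[OF f_differentiable(2)[OF assms axis_pair_Basis(1)], of "axis i 1"] by simp
qed

lemma f_ddir:
  assumes "0 < t"
  shows "ddir i (f t) (pd i (f t))" "ddir i (pd j (f t)) (pd i (pd j (f t)))"
proof -
  show "ddir i (f t) (pd i (f t))"
    using slice_derivatives(1)[OF f_differentiable(1)[OF assms]] by (intro differentiable_ddir) simp
  have "pd j (f t) = (\<lambda>v. partial (0, axis j 1) (\<lambda>(t, v). f t v) (t, v))" using pd_eq(1)[OF assms] by (simp add: fun_eq_iff)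
  then show "ddir i (pd j (f t)) (pd i (pd j (f t)))"
    using slice_derivatives(1)[OF f_differentiable(2)[OF assms axis_pair_Basis(1)]] by (intro differentiable_ddir) simp
qed

lemma ft_deriv:
  assumes "0 < t" shows "((\<lambda>\<tau>. f \<tau> v) has_real_derivative ft t v) (at t)"
  using slice_derivatives(3)[OF f_differentiable(1)[OF assms]] by (simp add: ft_def)

abbreviation "X \<equiv> {0::real<..} \<times> (UNIV :: r3 set)"

lemma open_X: "open X" by (intro open_Times) auto

lemma continuous_f: "continuous_on X (\<lambda>(t, v). f t v)"
  by (intro continuous_at_imp_continuous_on ballI differentiable_imp_continuous_within)
     (auto intro!: f_differentiable)

lemma continuous_pd: "continuous_on X (\<lambda>(t, v). pd i (f t) v)"
proof -
  have "continuous_on X (partial (0, axis i 1) (\<lambda>(t, v). f t v))"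
    by (intro continuous_at_imp_continuous_on ballI differentiable_imp_continuous_within)
       (auto intro!: f_differentiable axis_pair_Basis)
  then show ?thesis by (rule continuous_on_eq) (auto simp: pd_eq)
qed

lemma continuous_pd2: "continuous_on X (\<lambda>(t, v). pd i (pd j (f t)) v)"
proof -
  have "continuous_on X (partial (0, axis i 1) (partial (0, axis j 1) (\<lambda>(t, v). f t v)))"
    using f_differentiable(3)[OF zero_less_one axis_pair_Basis(1) axis_pair_Basis(1)] .
  then show ?thesis by (rule continuous_on_eq) (auto simp: pd_eq)
qed

lemma continuous_ft: "continuous_on X (\<lambda>(t, v). ft t v)"
proof -
  have "continuous_on X (partial (1, 0) (\<lambda>(t, v). f t v))"
    by (intro continuous_at_imp_continuous_on ballI differentiable_imp_continuous_within)
       (auto intro!: f_differentiable axis_pair_Basis)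
  then show ?thesis by (rule continuous_on_eq) (auto simp: ft_def)
qed

lemma slice_continuous:
  assumes "continuous_on X (\<lambda>(t, v). g t v)" "0 < t" shows "continuous_on UNIV (g t)"
proof -
  have "continuous_on UNIV (\<lambda>v. (\<lambda>(t, v). g t v) (t, v))"
    by (rule continuous_on_compose2[OF assms(1)]) (use assms(2) in \<open>auto intro!: continuous_intros\<close>)
  then show ?thesis by simp
qed

lemma bounds:
  assumes "0 < a" "a \<le> b"
  obtains p K where "p > 5" "0 \<le> K"
    "\<And>t v. t \<in> {a..b} \<Longrightarrow> \<bar>f t v\<bar> \<le> K * jbracket v powr (- p)"
    "\<And>t v. t \<in> {a..b} \<Longrightarrow> \<bar>ft t v\<bar> \<le> K * jbracket v powr (- p)"
    "\<And>t v i. t \<in> {a..b} \<Longrightarrow> \<bar>pd i (f t) v\<bar> \<le> K * jbracket v powr (- p)"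
    "\<And>t v i j. t \<in> {a..b} \<Longrightarrow> \<bar>pd i (pd j (f t)) v\<bar> \<le> K * jbracket v powr (- p)"
proof -
  obtain p K where p: "p > 5" and K: "\<forall>t\<in>{a..b}. \<forall>v.
           \<bar>f t v\<bar> \<le> K * jbracket v powr (- p) \<and>
           \<bar>deriv (\<lambda>\<tau>. f \<tau> v) t\<bar> \<le> K * jbracket v powr (- p) \<and>
           (\<forall>i. \<bar>pd i (f t) v\<bar> \<le> K * jbracket v powr (- p)) \<and>
           (\<forall>i j. \<bar>pd i (pd j (f t)) v\<bar> \<le> K * jbracket v powr (- p))"
    using reg assms unfolding regular_def by meson
  have "0 \<le> K * jbracket 0 powr (- p)" using K assms by (meson abs_ge_zero atLeastAtMost_iff order_refl order_trans)
  then have "0 \<le> K" by (simp add: jbracket_def)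
  moreover have "deriv (\<lambda>\<tau>. f \<tau> v) t = ft t v" if "t \<in> {a..b}" for t v
    using that assms by (intro DERIV_imp_deriv ft_deriv) auto
  ultimately show ?thesis using K p by (intro that[of p K]) auto
qed

lemma snapshot_f:
  assumes "0 < t"
  obtains p where "snapshot \<gamma> p (f t) (\<lambda>i. pd i (f t)) (\<lambda>i j. pd i (pd j (f t)))" "decays p (ft t)"
proof -
  obtain p K where b: "p > 5" "0 \<le> K" 
    "\<And>s v. s \<in> {t..t} \<Longrightarrow> \<bar>f s v\<bar> \<le> K * jbracket v powr (- p)"
    "\<And>s v. s \<in> {t..t} \<Longrightarrow> \<bar>ft s v\<bar> \<le> K * jbracket v powr (- p)"
    "\<And>s v i. s \<in> {t..t} \<Longrightarrow> \<bar>pd i (f s) v\<bar> \<le> K * jbracket v powr (- p)"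
    "\<And>s v i j. s \<in> {t..t} \<Longrightarrow> \<bar>pd i (pd j (f s)) v\<bar> \<le> K * jbracket v powr (- p)"
    using bounds[OF assms order_refl] by blast
  have "f t \<in> borel_measurable borel" "ft t \<in> borel_measurable borel" "pd i (f t) \<in> borel_measurable borel" "pd i (pd j (f t)) \<in> borel_measurable borel" for i j
    by (intro borel_measurable_continuous_onI slice_continuous[OF _ assms] continuous_f continuous_ft continuous_pd continuous_pd2)+
  then have "decays p (f t)" "decays p (ft t)" "decays p (pd i (f t))" "decays p (pd i (pd j (f t)))" for i j
    using b(3-6)[of t] unfolding decays_def by (auto intro!: exI[of _ K])
  then show ?thesis
    using b(1) \<gamma>_ge \<gamma>_neg f_nonneg assms f_ddir[OF assms] by (intro that[of p]) (unfold_locales, auto)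
qed

definition Q :: "real \<Rightarrow> r3 \<Rightarrow> real" where
  "Q t = snapshot.coll \<gamma> (f t) (\<lambda>i j. pd i (pd j (f t)))"

text \<open>The substitution z = v - w fixes the singularity at z = 0, after which the dominated
  convergence theorem applies with the majorant \<open>kap\<close> times a decaying power. The
  argument is local because the decay bounds hold only on compact intervals of positive
  times.\<close>

lemma continuous_convolution:
  assumes k: "kernel k"
  shows "continuous_on X (\<lambda>(t, v). \<integral>w. k (v - w) * f t w \<partial>lborel)"
proof -
  note [measurable] = kernel_measurable[OF k]
  have fm: "f t \<in> borel_measurable borel" if "0 < t" for t
    by (intro borel_measurable_continuous_onI slice_continuous[OF continuous_f that])
  have eq: "(LBINT w. k (v - w) * f t w) = (LBINT z. k z * f t (v - z))" if "0 < t" for t v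
  proof -
    note [measurable] = fm[OF that]
    have "(\<lambda>w. k (v - w) * f t w) \<in> borel_measurable borel" by measurable
    from integral_reflect[OF this, of v] show ?thesis by simp
  qed
  have loc: "continuous_on ({a<..<b} \<times> ball 0 R) (\<lambda>(t, v). \<integral>z. k z * f t (v - z) \<partial>lborel)" if ab: "0 < a" "a < b" and R: "0 < R" for a b R
  proof -
    obtain p K where p: "p > 5" and K: "0 \<le> K" "\<And>t v. t \<in> {a..b} \<Longrightarrow> \<bar>f t v\<bar> \<le> K * jbracket v powr (- p)"
      using bounds[OF ab(1) less_imp_le[OF ab(2)]] by metis
    obtain C where C: "0 \<le> C" "\<And>z. \<bar>k z\<bar> \<le> C * kap z" using kernelE[OF k] by blast
    \<comment> \<open>The factor by which Peetre's inequality enlarges the decay bound when it is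
      shifted by a velocity of norm less than R, where <v> \<le> 1 + R.\<close>
    define M where "M = (2 * (1 + R)) powr p"
    show ?thesis
    proof (rule continuous_on_sequentiallyI)
      fix s and q :: "real \<times> r3"
      assume s: "\<forall>n. s n \<in> {a<..<b} \<times> ball 0 R" and q: "q \<in> {a<..<b} \<times> ball 0 R" and lim: "s \<longlonglongrightarrow> q"
      have st: "fst (s n) \<in> {a..b}" "0 < fst (s n)" "norm (snd (s n)) < R" for n
        using s[rule_format, of n] ab by (auto simp: mem_Times_iff)
      have q0: "0 < fst q" using q ab by (auto simp: mem_Times_iff)
      have "(\<lambda>n. \<integral>z. k z * f (fst (s n)) (snd (s n) - z) \<partial>lborel) \<longlonglongrightarrow> (LBINT z. k z * f (fst q) (snd q - z))"
      proof (rule integral_dominated_convergence)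
        show "(\<lambda>z. k z * f (fst q) (snd q - z)) \<in> borel_measurable lborel"
          using fm[OF q0] by measurable
        show "(\<lambda>z. k z * f (fst (s n)) (snd (s n) - z)) \<in> borel_measurable lborel" for n
          using fm[OF st(2)[of n]] by measurable
        show "integrable lborel (\<lambda>z. (C * K * M) * (kap (z - 0) * jbracket z powr (- p)))"
          by (intro integrable_mult_right kernel_mult_decays_integrable[OF _ _ p]) (auto simp: kernel_def decays_def intro!: exI[of _ 1])
        show "AE z in lborel. (\<lambda>n. k z * f (fst (s n)) (snd (s n) - z)) \<longlonglongrightarrow> k z * f (fst q) (snd q - z)"
        proof (intro AE_I2 tendsto_intros)
          fix z
          have "isCont (\<lambda>(t, v). f t v) (fst q, snd q - z)"
            using continuous_f q0 unfolding continuous_on_eq_continuous_at[OF open_X] by auto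
          moreover have "(\<lambda>n. (fst (s n), snd (s n) - z)) \<longlonglongrightarrow> (fst q, snd q - z)"
            by (intro tendsto_intros lim)
          ultimately have "(\<lambda>n. (\<lambda>(t, v). f t v) (fst (s n), snd (s n) - z)) \<longlonglongrightarrow> (\<lambda>(t, v). f t v) (fst q, snd q - z)"
            by (rule isCont_tendsto_compose)
          then show "(\<lambda>n. f (fst (s n)) (snd (s n) - z)) \<longlonglongrightarrow> f (fst q) (snd q - z)" by simp
        qed
        show "AE z in lborel. norm (k z * f (fst (s n)) (snd (s n) - z)) \<le> (C * K * M) * (kap (z - 0) * jbracket z powr (- p))" for n
        proof (intro AE_I2)
          fix z
          have "jbracket (snd (s n) - z) powr (- p) = jbracket (z - snd (s n)) powr (- p)"
            by (metis jbracket_minus minus_diff_eq)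
          also have "\<dots> \<le> (2 * jbracket (snd (s n))) powr p * jbracket z powr (- p)"
            using p by (intro jbracket_powr_neg_shift) auto
          also have "\<dots> \<le> M * jbracket z powr (- p)"
          proof (intro mult_right_mono)
            have "(norm (snd (s n)))\<^sup>2 \<le> R\<^sup>2" by (rule power_mono[OF less_imp_le[OF st(3)]]) simp
            then have "1 + (norm (snd (s n)))\<^sup>2 \<le> 1 + R\<^sup>2 + 2 * R" using R by linarith
            then have "(jbracket (snd (s n)))\<^sup>2 \<le> (1 + R)\<^sup>2"
              by (simp add: jbracket_sq power2_sum)
            then have "jbracket (snd (s n)) \<le> 1 + R" using R by (auto dest: power2_le_imp_le)
            then show "(2 * jbracket (snd (s n))) powr p \<le> M" unfolding M_def using p
              by (intro powr_mono2) (auto simp: less_imp_le)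
          qed simp
          finally have "K * jbracket (snd (s n) - z) powr (- p) \<le> K * (M * jbracket z powr (- p))"
            using K(1) by (rule mult_left_mono)
          with K(2)[OF st(1), of n "snd (s n) - z"] have "\<bar>f (fst (s n)) (snd (s n) - z)\<bar> \<le> K * (M * jbracket z powr (- p))" by linarith
          then have "\<bar>k z\<bar> * \<bar>f (fst (s n)) (snd (s n) - z)\<bar> \<le> (C * kap z) * (K * (M * jbracket z powr (- p)))"
            using C by (intro mult_mono) auto
          then show "norm (k z * f (fst (s n)) (snd (s n) - z)) \<le> (C * K * M) * (kap (z - 0) * jbracket z powr (- p))"
            by (simp add: abs_mult ac_simps)
        qed
      qed
      then show "(\<lambda>n. case s n of (t, v) \<Rightarrow> \<integral>z. k z * f t (v - z) \<partial>lborel) \<longlonglongrightarrow> (case q of (t, v) \<Rightarrow> \<integral>z. k z * f t (v - z) \<partial>lborel)"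
        by (simp add: split_beta')
    qed
  qed
  have "continuous_on X (\<lambda>(t, v). \<integral>z. k z * f t (v - z) \<partial>lborel)"
    unfolding continuous_on_eq_continuous_at[OF open_X]
  proof
    fix q assume "q \<in> X"
    then obtain t v where q: "q = (t, v)" "0 < t" by auto
    have "open ({t/2<..<2*t} \<times> ball (0::r3) (norm v + 1))" by (intro open_Times) auto
    moreover have "continuous_on ({t/2<..<2*t} \<times> ball (0::r3) (norm v + 1)) (\<lambda>(t, v). \<integral>z. k z * f t (v - z) \<partial>lborel)"
      using q by (intro loc) (auto simp: add_nonneg_pos)
    moreover have "q \<in> {t/2<..<2*t} \<times> ball (0::r3) (norm v + 1)" using q by simp
    ultimately show "isCont (\<lambda>(t, v). \<integral>z. k z * f t (v - z) \<partial>lborel) q"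
      using continuous_on_eq_continuous_at by blast
  qed
  then show ?thesis by (rule continuous_on_eq) (auto simp: eq)
qed

lemma continuous_Q: "continuous_on X (\<lambda>(t, v). Q t v)"
proof -
  note ker = kernel_ka[OF \<gamma>_ge less_imp_le[OF \<gamma>_neg]] 
  have ker2: "kernel (\<lambda>z. norm z powr \<gamma>)" using \<gamma>_ge \<gamma>_neg by (intro kernel_norm_powr) auto
  have "continuous_on X (\<lambda>q. (\<Sum>i\<in>UNIV. \<Sum>j\<in>UNIV. (\<lambda>(t, v). \<integral>w. ka \<gamma> i j (v - w) * f t w \<partial>lborel) q * (\<lambda>(t, v). pd i (pd j (f t)) v) q)
     + 2 * (\<gamma> + 3) * (\<lambda>(t, v). \<integral>w. norm (v - w) powr \<gamma> * f t w \<partial>lborel) q * (\<lambda>(t, v). f t v) q)"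
    by (intro continuous_intros continuous_convolution ker ker2 continuous_f continuous_pd2)
  then show ?thesis
  proof (rule continuous_on_eq)
    fix q assume "q \<in> X"
    then obtain t v where q: "q = (t, v)" "0 < t" by auto
    obtain p where "snapshot \<gamma> p (f t) (\<lambda>i. pd i (f t)) (\<lambda>i j. pd i (pd j (f t)))" using snapshot_f[OF q(2)] by blast
    then interpret snapshot \<gamma> p "f t" "\<lambda>i. pd i (f t)" "\<lambda>i j. pd i (pd j (f t))" .
    show "(\<Sum>i\<in>UNIV. \<Sum>j\<in>UNIV. (\<lambda>(t, v). \<integral>w. ka \<gamma> i j (v - w) * f t w \<partial>lborel) q * (\<lambda>(t, v). pd i (pd j (f t)) v) q)
     + 2 * (\<gamma> + 3) * (\<lambda>(t, v). \<integral>w. norm (v - w) powr \<gamma> * f t w \<partial>lborel) q * (\<lambda>(t, v). f t v) q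
     = (case q of (t, v) \<Rightarrow> Q t v)"
      by (simp add: q Q_def coll_eq)
  qed
qed

lemma Ioc_Icc_AE: "AE t in lborel. indicator {a<..b} t = (indicator {a..b} t :: real)" for a b :: real
proof -
  have "AE t in lborel. t \<noteq> a" by (rule AE_lborel_singleton)
  then show ?thesis by eventually_elim (auto split: split_indicator)
qed

definition W :: "(r3 \<Rightarrow> real) \<Rightarrow> real \<Rightarrow> real" where
  "W \<phi> t = (LBINT q. (case q of (v, w) \<Rightarrow> f t v * f t w * landau_L \<gamma> \<phi> v w))"

lemma weak_iterated:
  assumes \<phi>: "test_function \<phi>" and T: "0 < T"
  shows "(LBINT v. \<phi> v * f T v) = (LBINT v. \<phi> v * fin v) + (LBINT t. indicator {0..T} t * W \<phi> t)"
    and "integrable lborel (\<lambda>t. indicator {0..T} t * W \<phi> t)"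
proof -
  define g where "g = (\<lambda>(t, v, w). f t v * f t w * landau_L \<gamma> \<phi> v w)"
  have W: "W \<phi> t = (LBINT q. g (t, q))" for t by (simp add: W_def g_def)
  have wk: "set_integrable lborel ({0..T} \<times> UNIV) g"
    "(LBINT v. \<phi> v * f T v) = (LBINT v. \<phi> v * fin v) + set_lebesgue_integral lborel ({0..T} \<times> UNIV) g"
    using weak \<phi> T unfolding landau_weak_solution_def g_def by blast+
  have eq: "(\<lambda>x. indicator ({0..T} \<times> UNIV) x *\<^sub>R g x) = (\<lambda>(t, q). indicator {0..T} t * g (t, q))"
    by (auto simp: fun_eq_iff split: split_indicator)
  have gi: "integrable (lborel \<Otimes>\<^sub>M lborel) (\<lambda>(t, q). indicator {0..T} t * g (t, q))"
    using wk(1) eq by (simp add: set_integrable_def lborel_prod)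
  have "set_lebesgue_integral lborel ({0..T} \<times> UNIV) g = (\<integral>x. (case x of (t, q) \<Rightarrow> indicator {0..T} t * g (t, q)) \<partial>(lborel \<Otimes>\<^sub>M lborel))"
    using eq by (simp add: set_lebesgue_integral_def lborel_prod)
  also have "\<dots> = (\<integral>t. \<integral>q. indicator {0..T} t * g (t, q) \<partial>lborel \<partial>lborel)"
    using lborel_pair.integral_fst[OF gi] by simp
  finally have "set_lebesgue_integral lborel ({0..T} \<times> UNIV) g = (LBINT t. indicator {0..T} t * W \<phi> t)"
    by (simp add: W)
  with wk(2) show "(LBINT v. \<phi> v * f T v) = (LBINT v. \<phi> v * fin v) + (LBINT t. indicator {0..T} t * W \<phi> t)"
    by simp
  show "integrable lborel (\<lambda>t. indicator {0..T} t * W \<phi> t)"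
    using lborel_pair.integrable_fst[OF gi] by (simp add: W)
qed

text \<open>Subtracting the weak formulation at two positive times leaves only slices that are
  regular, and on these the double integral equals the integral of \<phi> against the collision
  term.\<close>

lemma weak_time:
  assumes \<phi>: "test_function \<phi>" and ab: "0 < a" "a < b"
  shows "(LBINT v. \<phi> v * f b v) - (LBINT v. \<phi> v * f a v) = (LBINT t. indicator {a..b} t * (LBINT v. \<phi> v * Q t v))"
    and "integrable lborel (\<lambda>t. indicator {a..b} t * (LBINT v. \<phi> v * Q t v))"
proof -
  note Ii = weak_iterated(2)[OF \<phi>]
  have Wt: "W \<phi> t = (LBINT v. \<phi> v * Q t v)" if t: "0 < t" for t
  proof -
    obtain p where "snapshot \<gamma> p (f t) (\<lambda>i. pd i (f t)) (\<lambda>i j. pd i (pd j (f t)))" using snapshot_f[OF t] by blast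
    then interpret snapshot \<gamma> p "f t" "\<lambda>i. pd i (f t)" "\<lambda>i j. pd i (pd j (f t))" .
    obtain B where B: "\<And>v. \<bar>\<phi> v\<bar> \<le> B" "\<And>i v. \<bar>pd i \<phi> v\<bar> \<le> B" "\<And>i j v. \<bar>pd i (pd j \<phi>) v\<bar> \<le> B"
      using test_functionD(6)[OF \<phi>] by blast
    show ?thesis
      unfolding W_def Q_def landau_L_def landau_a_eq landau_b_eq
      by (rule coll_weak[OF B]) (auto intro!: borel_measurable_continuous_onI test_functionD[OF \<phi>])
  qed
  have eqW: "indicator {a..b} t * W \<phi> t = indicator {a..b} t * (LBINT v. \<phi> v * Q t v)" for t
    using Wt[of t] ab by (auto split: split_indicator)
  have d: "indicator {0..b} t * W \<phi> t - indicator {0..a} t * W \<phi> t = indicator {a<..b} t * W \<phi> t" for t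
    using ab by (auto split: split_indicator)
  have ae: "AE t in lborel. indicator {a<..b} t * W \<phi> t = indicator {a..b} t * W \<phi> t"
    using Ioc_Icc_AE[of a b] by eventually_elim simp
  have i1: "integrable lborel (\<lambda>t. indicator {a<..b} t * W \<phi> t)"
    using Bochner_Integration.integrable_diff[OF Ii[of b] Ii[of a]] ab unfolding d by simp
  have m: "(\<lambda>t. indicator {a..b} t * W \<phi> t) \<in> borel_measurable lborel"
  proof -
    have "(\<lambda>t. indicator {a..b} t * (indicator {0..b} t * W \<phi> t)) \<in> borel_measurable lborel"
      by (rule borel_measurable_times[OF _ borel_measurable_integrable[OF Ii[of b]]]) (use ab in auto)
    moreover have "(\<lambda>t. indicator {a..b} t * (indicator {0..b} t * W \<phi> t)) = (\<lambda>t. indicator {a..b} t * W \<phi> t)"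
      using ab by (auto simp: fun_eq_iff split: split_indicator)
    ultimately show ?thesis by simp
  qed
  have "(LBINT v. \<phi> v * f b v) - (LBINT v. \<phi> v * f a v) = (LBINT t. indicator {0..b} t * W \<phi> t) - (LBINT t. indicator {0..a} t * W \<phi> t)"
    using weak_iterated(1)[OF \<phi>, of b] weak_iterated(1)[OF \<phi>, of a] ab by simp
  also have "\<dots> = (LBINT t. indicator {a<..b} t * W \<phi> t)"
    using Bochner_Integration.integral_diff[OF Ii[of b] Ii[of a]] ab unfolding d by simp
  also have "\<dots> = (LBINT t. indicator {a..b} t * W \<phi> t)"
    using borel_measurable_integrable[OF i1] m ae by (intro integral_cong_AE) auto
  finally show "(LBINT v. \<phi> v * f b v) - (LBINT v. \<phi> v * f a v) = (LBINT t. indicator {a..b} t * (LBINT v. \<phi> v * Q t v))"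
    unfolding eqW .
  show "integrable lborel (\<lambda>t. indicator {a..b} t * (LBINT v. \<phi> v * Q t v))"
    using integrable_cong_AE_imp[OF i1 m] ae unfolding eqW by (simp add: eq_commute)
qed

text \<open>If the two sides differed at a point, their continuous difference would keep its sign
  near it. A non-negative bump localised there, integrated over a short time window, contradicts the
  fact that both sides integrate to the same increment.\<close>

lemma strong_form:
  assumes "0 < t" shows "ft t v = Q t v"
proof (rule ccontr)
  assume ne: "ft t v \<noteq> Q t v"
  define D where "D = (\<lambda>(t, v). ft t v - Q t v)"
  define \<sigma> where "\<sigma> = sgn (D (t, v))"
  define \<eta> where "\<eta> = \<bar>D (t, v)\<bar> / 2"
  have \<eta>: "0 < \<eta>" using ne by (simp add: \<eta>_def D_def)
  have contD: "continuous_on X D"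
    using continuous_on_diff[OF continuous_ft continuous_Q] by (simp add: D_def split_beta')
  have "isCont D (t, v)" using contD assms unfolding continuous_on_eq_continuous_at[OF open_X] by auto
  then obtain d0 where d0: "0 < d0" "\<And>q. dist q (t, v) < d0 \<Longrightarrow> dist (D q) (D (t, v)) < \<eta>"
    using \<eta> unfolding continuous_at_eps_delta by blast
  \<comment> \<open>The bound t / 2 keeps the time window among positive times; d0 / 4 makes 2 d,
    which bounds the distance in the product, smaller than d0.\<close>
  define d where "d = min (d0 / 4) (t / 2)"
  have d: "0 < d" "d \<le> t / 2" "d \<le> d0 / 4" using d0 assms by (auto simp: d_def)
  have near: "\<eta> \<le> \<sigma> * D (s, w)" if "\<bar>s - t\<bar> \<le> d" "norm (w - v) \<le> d" for s w
  proof -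
    have "dist (s, w) (t, v) \<le> \<bar>s - t\<bar> + norm (w - v)"
      unfolding dist_norm diff_Pair norm_Pair using sqrt_sum_squares_le_sum_abs[of "norm (s - t)" "norm (w - v)"] by simp
    also have "\<dots> < d0" using that d d0 by linarith
    finally have "\<bar>D (s, w) - D (t, v)\<bar> < \<eta>" using d0(2) by (simp add: dist_real_def)
    then show ?thesis unfolding \<sigma>_def \<eta>_def using ne by (auto simp: D_def sgn_if abs_if split: if_splits)
  qed
  define \<phi> where "\<phi> = (\<lambda>w::r3. 1 * bq 1 (1 - (norm (w - v))\<^sup>2 / d\<^sup>2))"
  have \<phi>: "test_function \<phi>" unfolding \<phi>_def by (rule test_function_bq[OF _ Ck_on_const]) (use d in auto)
  have \<phi>0: "0 \<le> \<phi> w" for w by (simp add: \<phi>_def bq_def)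
  have \<phi>s: "\<phi> w = 0" if "\<not> norm (w - v) \<le> d" for w
    using bq_support[of "d\<^sup>2" 1 w v] that d by (auto simp: \<phi>_def)
  \<comment> \<open>At half the radius the argument of the cut-off is still at least 3/4, whence exp
    (- 4/3); this only serves to show that the bump has positive integral.\<close>
  have \<phi>1: "exp (- (4/3)) * indicator (ball v (d / 2)) w \<le> \<phi> w" for w
  proof (cases "w \<in> ball v (d / 2)")
    case True
    then have "norm (w - v) \<le> d / 2" by (simp add: dist_norm norm_minus_commute)
    then have "(norm (w - v))\<^sup>2 \<le> (d / 2)\<^sup>2" by (intro power_mono) auto
    then have x: "3/4 \<le> 1 - (norm (w - v))\<^sup>2 / d\<^sup>2" using d by (simp add: field_simps)
    then have "1 / (1 - (norm (w - v))\<^sup>2 / d\<^sup>2) \<le> 1 / (3/4)" by (intro divide_left_mono) auto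
    moreover have "(norm (w - v))\<^sup>2 / d\<^sup>2 < 1" using x by linarith
    ultimately show ?thesis using True by (simp add: \<phi>_def bq_def)
  qed (simp add: \<phi>0)
  obtain B where B: "\<And>v. \<bar>\<phi> v\<bar> \<le> B" using test_functionD(6)[OF \<phi>] by blast
  have \<phi>m [measurable]: "\<phi> \<in> borel_measurable borel" by (intro borel_measurable_continuous_onI test_functionD(1)[OF \<phi>])
  have \<phi>i: "integrable lborel \<phi>"
  proof -
    have "integrable lborel (\<lambda>w. B * indicator (cball v d) w)"
      using emeasure_lborel_cball_finite[of v d] by (intro integrable_mult_right) simp
    then show ?thesis
    proof (rule Bochner_Integration.integrable_bound)
      show "AE w in lborel. norm (\<phi> w) \<le> norm (B * indicat_real (cball v d) w)"
      proof (intro AE_I2)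
        fix w show "norm (\<phi> w) \<le> norm (B * indicat_real (cball v d) w)"
          using \<phi>s[of w] B[of w] by (cases "norm (w - v) \<le> d") (auto simp: dist_norm norm_minus_commute)
      qed
    qed simp
  qed
  define m where "m = (LBINT w. \<phi> w)"
  have m: "0 < m"
  proof -
    have "0 < exp (- (4/3)) * measure lborel (ball v (d / 2))"
      using d content_ball_pos[of "d / 2" v] by simp
    also have "\<dots> = (LBINT w. exp (- (4/3)) * indicator (ball v (d / 2)) w)" by simp
    also have "\<dots> \<le> m" unfolding m_def
      using emeasure_lborel_ball_finite[of v "d / 2"] by (intro integral_mono \<phi>i \<phi>1 integrable_mult_right) simp
    finally show ?thesis .
  qed
  define a b where "a = t - d" and "b = t + d"
  have ab: "0 < a" "a < b" using d assms by (auto simp: a_def b_def)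
  obtain p K where p: "p > 5" "0 \<le> K" 
    and K: "\<And>t v. t \<in> {a..b} \<Longrightarrow> \<bar>f t v\<bar> \<le> K * jbracket v powr (- p)" "\<And>t v. t \<in> {a..b} \<Longrightarrow> \<bar>ft t v\<bar> \<le> K * jbracket v powr (- p)"
    using bounds[OF ab(1) less_imp_le[OF ab(2)]] by metis
  have sub: "{a..b} \<times> UNIV \<subseteq> X" using ab by auto
  have F: "(LBINT v. \<phi> v * f b v - \<phi> v * f a v) = (LBINT t. indicator {a..b} t * (LBINT v. \<phi> v * ft t v))"
    "integrable lborel (\<lambda>t. indicator {a..b} t * (LBINT v. \<phi> v * ft t v))"
  proof -
    have c: "continuous_on ({a..b} \<times> UNIV) (\<lambda>(t, v). \<phi> v * ft t v)"
    proof -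
      have "continuous_on ({a..b} \<times> UNIV) (\<lambda>q. \<phi> (snd q) * (\<lambda>(t, v). ft t v) q)"
        by (intro continuous_intros continuous_on_subset[OF continuous_ft sub] continuous_on_compose2[OF test_functionD(1)[OF \<phi>]]) auto
      then show ?thesis by (simp add: split_beta')
    qed
    have bd: "\<bar>\<phi> v * ft t v\<bar> \<le> (B * K) * jbracket v powr (- p)" if "t \<in> {a..b}" for t v
    proof -
      have "\<bar>\<phi> v\<bar> * \<bar>ft t v\<bar> \<le> B * (K * jbracket v powr (- p))"
        using B[of v] K(2)[OF that, of v] by (intro mult_mono) auto
      then show ?thesis by (simp add: abs_mult mult.assoc)
    qed
    have der: "((\<lambda>\<tau>. \<phi> v * f \<tau> v) has_real_derivative \<phi> v * ft t v) (at t)" if "t \<in> {a..b}" for t v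
      using that ab by (intro DERIV_cmult ft_deriv) auto
    have p3: "p > 3" using p by simp
    note X = fubini_time_derivative[where g="\<lambda>t v. \<phi> v * f t v" and gt="\<lambda>t v. \<phi> v * ft t v", OF less_imp_le[OF ab(2)] c der bd p3]
    show "(LBINT v. \<phi> v * f b v - \<phi> v * f a v) = (LBINT t. indicator {a..b} t * (LBINT v. \<phi> v * ft t v))" by (rule X(1))
    show "integrable lborel (\<lambda>t. indicator {a..b} t * (LBINT v. \<phi> v * ft t v))" by (rule X(2))
  qed
  have \<phi>f: "integrable lborel (\<lambda>v. \<phi> v * f s v)" if s: "0 < s" for s
  proof -
    obtain p where "snapshot \<gamma> p (f s) (\<lambda>i. pd i (f s)) (\<lambda>i j. pd i (pd j (f s)))" using snapshot_f[OF s] by blast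
    then interpret snapshot \<gamma> p "f s" "\<lambda>i. pd i (f s)" "\<lambda>i j. pd i (pd j (f s))" .
    show ?thesis using p by (intro decays_integrable[OF decays_bounded_mult[OF du \<phi>m B]]) auto
  qed
  note W = weak_time[OF \<phi> ab]
  \<comment> \<open>Both time integrals equal the increment of the integral of \<phi> f from a to b,
    one by calculus in time and the other by the weak formulation.\<close>
  have zero: "(LBINT s. indicator {a..b} s * (LBINT v. \<phi> v * ft s v) - indicator {a..b} s * (LBINT v. \<phi> v * Q s v)) = 0"
    using F W \<phi>f[of a] \<phi>f[of b] ab by simp
  have inner: "\<eta> * m \<le> \<sigma> * ((LBINT v. \<phi> v * ft s v) - (LBINT v. \<phi> v * Q s v))" if s: "s \<in> {a..b}" for s
  proof -
    have s0: "0 < s" using s ab by auto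
    obtain p where sn: "snapshot \<gamma> p (f s) (\<lambda>i. pd i (f s)) (\<lambda>i j. pd i (pd j (f s)))" and dft: "decays p (ft s)" using snapshot_f[OF s0] by blast
    interpret snapshot \<gamma> p "f s" "\<lambda>i. pd i (f s)" "\<lambda>i j. pd i (pd j (f s))" by (rule sn)
    have i1: "integrable lborel (\<lambda>v. \<phi> v * ft s v)" using p by (intro decays_integrable[OF decays_bounded_mult[OF dft \<phi>m B]]) auto
    have i2: "integrable lborel (\<lambda>v. \<phi> v * Q s v)" unfolding Q_def by (rule coll_swap(2)[OF \<phi>m B])
    have "\<eta> * m = (LBINT w. \<eta> * \<phi> w)" by (simp add: m_def)
    also have "\<dots> \<le> (LBINT w. \<sigma> * (\<phi> w * ft s w - \<phi> w * Q s w))"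
    proof (intro integral_mono integrable_mult_right \<phi>i Bochner_Integration.integrable_diff i1 i2)
      fix w
      show "\<eta> * \<phi> w \<le> \<sigma> * (\<phi> w * ft s w - \<phi> w * Q s w)"
      proof (cases "norm (w - v) \<le> d")
        case True
        have "\<bar>s - t\<bar> \<le> d" using s by (auto simp: a_def b_def)
        from mult_right_mono[OF near[OF this True] \<phi>0[of w]] show ?thesis by (simp add: D_def algebra_simps)
      qed (simp add: \<phi>s)
    qed
    also have "\<dots> = \<sigma> * ((LBINT v. \<phi> v * ft s v) - (LBINT v. \<phi> v * Q s v))" using i1 i2 by simp
    finally show ?thesis .
  qed
  have "0 < (\<eta> * m) * (b - a)" using \<eta> m ab by simp
  also have "\<dots> = (LBINT s. (\<eta> * m) * indicator {a..b} s)" using ab by simp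
  also have "\<dots> \<le> (LBINT s. \<sigma> * (indicator {a..b} s * (LBINT v. \<phi> v * ft s v) - indicator {a..b} s * (LBINT v. \<phi> v * Q s v)))"
    by (intro integral_mono integrable_mult_right Bochner_Integration.integrable_diff F(2) W(2))
      (use inner in \<open>auto split: split_indicator simp: emeasure_lborel_Icc_eq intro!: integrable_real_indicator\<close>)
  also have "\<dots> = 0" using zero by simp
  finally show False by simp
qed

end

subsection \<open>The singular term\<close>

text \<open>The local part of the most singular kernel. It is integrable, and its support in the
  unit ball makes the weights at the two velocities comparable.\<close>

definition kball :: "r3 \<Rightarrow> real" where
  "kball z = indicator (cball 0 1) z / (norm z)\<^sup>2"

lemma kball_measurable [measurable]: "kball \<in> borel_measurable borel"
  unfolding kball_def by (intro borel_measurable_divide borel_measurable_indicator borel_measurable_power borel_measurable_norm) auto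

lemma kball_nonneg: "0 \<le> kball z"
  by (simp add: kball_def)

lemma kernel_kball: "kernel kball"
  unfolding kernel_def by (auto intro!: exI[of _ 1] simp: kball_def kap_def split: split_indicator)

text \<open>For |z| \<le> \<rho> a factor |z|^(\<gamma>+2) is split off and bounded by
  \<rho>^(\<gamma>+2). This is small for small \<rho> exactly when \<gamma> > -2; for \<gamma> = -2
  the split gains nothing.\<close>

lemma norm_powr_split:
  assumes "-2 \<le> \<gamma>" "\<gamma> < 0" "0 < \<rho>" "\<rho> \<le> 1"
  shows "norm z powr \<gamma> \<le> \<rho> powr \<gamma> + \<rho> powr (\<gamma> + 2) * kball z"
proof (cases "z = 0")
  case False
  show ?thesis
  proof (cases "norm z \<le> \<rho>")
    case True
    have "norm z powr \<gamma> = norm z powr (\<gamma> + 2) * norm z powr (-2)" by (simp only: powr_add[symmetric]) simp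
    also have "\<dots> \<le> \<rho> powr (\<gamma> + 2) * norm z powr (-2)"
      using True assms by (intro mult_right_mono powr_mono2) auto
    also have "norm z powr (-2) = kball z"
      using True assms False by (simp add: kball_def powr_minus inverse_eq_divide)
    finally show ?thesis by (simp add: add_increasing)
  next
    case F: False
    then have "norm z powr \<gamma> \<le> \<rho> powr \<gamma>" using assms by (intro powr_mono2') auto
    then show ?thesis by (simp add: add_increasing2 kball_nonneg)
  qed
qed (simp add: kball_nonneg add_nonneg_nonneg)

text \<open>Hardy's inequality carries the weight <v>^\<gamma>, which has to be inserted by hand.
  Since |v - w| \<le> 1 on the support, <v>^2 \<le> 8 <w>^2, and <v>^(-\<gamma>) \<le> <v>^2 because
  -\<gamma> \<le> 2. The cost <w>^2 is paid by mass and energy of the partner.\<close>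

lemma kball_weight:
  assumes "-2 \<le> \<gamma>" "\<gamma> < 0"
  shows "kball (v - w) \<le> 8 * (jbracket w)\<^sup>2 * (norm (v - w) powr (-2) * jbracket v powr \<gamma>)"
proof (cases "norm (v - w) \<le> 1")
  case True
  have "jbracket v \<le> 2 * jbracket (v - w) * jbracket w" using jbracket_add_le[of "v - w" w] by simp
  then have "(jbracket v)\<^sup>2 \<le> (2 * jbracket (v - w) * jbracket w)\<^sup>2" by (intro power_mono) (auto simp: less_imp_le)
  also have "\<dots> = 4 * (jbracket (v - w))\<^sup>2 * (jbracket w)\<^sup>2" by (simp add: power_mult_distrib)
  also have "\<dots> \<le> 4 * 2 * (jbracket w)\<^sup>2"
  proof -
    have "(norm (v - w))\<^sup>2 \<le> 1" using True by (simp add: power_le_one)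
    then show ?thesis by (intro mult_right_mono) (auto simp: jbracket_sq)
  qed
  finally have J: "(jbracket v)\<^sup>2 \<le> 8 * (jbracket w)\<^sup>2" by simp
  have "1 = jbracket v powr \<gamma> * jbracket v powr (- \<gamma>)" by (simp only: powr_add[symmetric]) simp
  also have "\<dots> \<le> jbracket v powr \<gamma> * jbracket v powr 2"
    using assms by (intro mult_left_mono jbracket_powr_mono) auto
  also have "\<dots> \<le> jbracket v powr \<gamma> * (8 * (jbracket w)\<^sup>2)"
    using J by (intro mult_left_mono) (auto simp: less_imp_le)
  finally have "norm (v - w) powr (-2) * 1 \<le> norm (v - w) powr (-2) * (jbracket v powr \<gamma> * (8 * (jbracket w)\<^sup>2))"
    by (intro mult_left_mono) auto
  moreover have "kball (v - w) = norm (v - w) powr (-2)"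
    using True by (cases "v = w") (simp_all add: kball_def powr_minus inverse_eq_divide)
  ultimately show ?thesis by (simp add: ac_simps)
qed (simp add: kball_def)

definition ckb :: real where "ckb = enn2real (\<integral>\<^sup>+z. ennreal (kball z) \<partial>lborel)"

lemma ckb: "(\<integral>\<^sup>+z. ennreal (kball z) \<partial>lborel) = ennreal ckb" "0 \<le> ckb"
  using inverse_square_integrable_ball unfolding ckb_def kball_def by auto

context snapshot
begin

definition diss :: "real \<Rightarrow> real" where
  "diss \<delta> = (LBINT v. jbracket v powr \<gamma> * (norm (grad v))\<^sup>2 / (u v + \<delta>))"

definition sing :: "real \<Rightarrow> real" where
  "sing \<delta> = (LBINT w. u w * (LBINT v. norm (v - w) powr \<gamma> * entG \<delta> (u v)))"

definition mass :: real where "mass = (LBINT v. u v)"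

lemma u_integrable: "integrable lborel u" using decays_integrable[OF du] p by simp

lemma mass_nonneg: "0 \<le> mass" unfolding mass_def by (intro integral_nonneg_AE AE_I2 u_nonneg)

lemma diss_nonneg: "0 < \<delta> \<Longrightarrow> 0 \<le> diss \<delta>"
  unfolding diss_def by (intro integral_nonneg_AE AE_I2) (auto simp: u_nonneg add_nonneg_pos less_imp_le)

lemma decays_entG:
  assumes \<delta>: "0 < \<delta>" shows "decays p (\<lambda>v. entG \<delta> (u v))"
  by (rule decays_dominated[OF du, where C=1]) (use entG_nonneg[OF \<delta>] entG_le[OF \<delta>] u_nonneg in \<open>auto simp: entG_def\<close>)

lemma entG_mass:
  assumes \<delta>: "0 < \<delta>" shows "integrable lborel (\<lambda>v. entG \<delta> (u v))" "(LBINT v. entG \<delta> (u v)) \<le> mass"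
proof -
  show i: "integrable lborel (\<lambda>v. entG \<delta> (u v))" using decays_integrable[OF decays_entG[OF \<delta>]] p by simp
  show "(LBINT v. entG \<delta> (u v)) \<le> mass"
    unfolding mass_def by (intro integral_mono i u_integrable entG_le \<delta> u_nonneg)
qed

lemma kball_hardy:
  assumes \<delta>: "0 < \<delta>"
  shows "(LBINT v. kball (v - w) * entG \<delta> (u v)) \<le> 8 * (jbracket w)\<^sup>2 * (4 * diss \<delta> + 16 * mass)"
proof -
  note G = decays_entG[OF \<delta>]
  have JG: "decays p (\<lambda>v. jbracket v powr \<gamma> * entG \<delta> (u v))"
  proof (rule decays_bounded_mult[OF G])
    fix v show "\<bar>jbracket v powr \<gamma>\<bar> \<le> 1" using jbracket_powr_mono[of \<gamma> 0 v] \<gamma>_le by auto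
  qed measurable
  have i: "integrable lborel (\<lambda>v. norm (v - w) powr (-2) * (jbracket v powr \<gamma> * entG \<delta> (u v)))"
    by (rule kint[OF kernel_norm_powr JG]) auto
  have "(LBINT v. kball (v - w) * entG \<delta> (u v)) \<le> (LBINT v. 8 * (jbracket w)\<^sup>2 * (norm (v - w) powr (-2) * (jbracket v powr \<gamma> * entG \<delta> (u v))))"
  proof (intro integral_mono integrable_mult_right i kint[OF kernel_kball G])
    fix v
    show "kball (v - w) * entG \<delta> (u v) \<le> 8 * (jbracket w)\<^sup>2 * (norm (v - w) powr (-2) * (jbracket v powr \<gamma> * entG \<delta> (u v)))"
      using mult_right_mono[OF kball_weight[OF \<gamma>_ge \<gamma>_neg, of v w] entG_nonneg[OF \<delta> u_nonneg[of v]]] by (simp add: ac_simps)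
  qed
  also have "\<dots> = 8 * (jbracket w)\<^sup>2 * (LBINT v. norm (v - w) powr (-2) * (jbracket v powr \<gamma> * entG \<delta> (u v)))"
    by simp
  also have "\<dots> \<le> 8 * (jbracket w)\<^sup>2 * (4 * diss \<delta> + 16 * mass)"
    unfolding diss_def mass_def by (intro mult_left_mono hardy[OF \<delta>]) auto
  finally show ?thesis .
qed

lemma inner_sing_bound:
  assumes \<delta>: "0 < \<delta>" and \<rho>: "0 < \<rho>" "\<rho> \<le> 1"
  shows "(LBINT v. norm (v - w) powr \<gamma> * entG \<delta> (u v))
    \<le> \<rho> powr \<gamma> * mass + \<rho> powr (\<gamma> + 2) * (LBINT v. kball (v - w) * entG \<delta> (u v))"
proof -
  note G = decays_entG[OF \<delta>]
  note i = kint[OF kernel_kball G] kint[OF kernel_norm_powr[OF \<gamma>_ge \<gamma>_le2] G] entG_mass(1)[OF \<delta>]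
  have "(LBINT v. norm (v - w) powr \<gamma> * entG \<delta> (u v))
    \<le> (LBINT v. \<rho> powr \<gamma> * entG \<delta> (u v) + \<rho> powr (\<gamma> + 2) * (kball (v - w) * entG \<delta> (u v)))"
  proof (intro integral_mono i Bochner_Integration.integrable_add integrable_mult_right)
    fix v
    show "norm (v - w) powr \<gamma> * entG \<delta> (u v) \<le> \<rho> powr \<gamma> * entG \<delta> (u v) + \<rho> powr (\<gamma> + 2) * (kball (v - w) * entG \<delta> (u v))"
      using mult_right_mono[OF norm_powr_split[OF \<gamma>_ge \<gamma>_neg \<rho>, of "v - w"] entG_nonneg[OF \<delta> u_nonneg[of v]]]
      by (simp add: algebra_simps)
  qed
  also have "\<dots> = \<rho> powr \<gamma> * (LBINT v. entG \<delta> (u v)) + \<rho> powr (\<gamma> + 2) * (LBINT v. kball (v - w) * entG \<delta> (u v))"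
    using i by simp
  also have "\<dots> \<le> \<rho> powr \<gamma> * mass + \<rho> powr (\<gamma> + 2) * (LBINT v. kball (v - w) * entG \<delta> (u v))"
    using entG_mass(2)[OF \<delta>] by (intro add_right_mono mult_left_mono) auto
  finally show ?thesis .
qed

lemma sing_integrable:
  assumes \<delta>: "0 < \<delta>"
  shows "integrable lborel (\<lambda>w. u w * (LBINT v. norm (v - w) powr \<gamma> * entG \<delta> (u v)))"
  using lborel_pair.integrable_snd[OF kernel_pair_integrable[OF kernel_norm_powr[OF \<gamma>_ge \<gamma>_le2] decays_entG[OF \<delta>] du p]] by simp

text \<open>Multiplying the pointwise bound in \<open>w\<close> by \<open>u w\<close> turns <w>^2
  into mass plus energy. The coefficient of the dissipation is \<rho>^(\<gamma>+2) times a conserved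
  quantity.\<close>

lemma sing_bound_power:
  assumes \<delta>: "0 < \<delta>" and \<rho>: "0 < \<rho>" "\<rho> \<le> 1" and e: "integrable lborel (\<lambda>v. u v * (jbracket v)\<^sup>2)"
  shows "sing \<delta> \<le> \<rho> powr \<gamma> * mass\<^sup>2 + 8 * \<rho> powr (\<gamma> + 2) * (LBINT v. u v * (jbracket v)\<^sup>2) * (4 * diss \<delta> + 16 * mass)"
proof -
  define Z where "Z = 4 * diss \<delta> + 16 * mass"
  have "sing \<delta> \<le> (LBINT w. (\<rho> powr \<gamma> * mass) * u w + (8 * \<rho> powr (\<gamma> + 2) * Z) * (u w * (jbracket w)\<^sup>2))"
    unfolding sing_def
  proof (intro integral_mono sing_integrable[OF \<delta>] Bochner_Integration.integrable_add integrable_mult_right u_integrable e)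
    fix w
    have "(LBINT v. norm (v - w) powr \<gamma> * entG \<delta> (u v)) \<le> \<rho> powr \<gamma> * mass + \<rho> powr (\<gamma> + 2) * (8 * (jbracket w)\<^sup>2 * Z)"
      using inner_sing_bound[OF \<delta> \<rho>, of w] mult_left_mono[OF kball_hardy[OF \<delta>, of w], of "\<rho> powr (\<gamma> + 2)"]
      unfolding Z_def by auto
    from mult_left_mono[OF this u_nonneg[of w]]
    show "u w * (LBINT v. norm (v - w) powr \<gamma> * entG \<delta> (u v)) \<le> (\<rho> powr \<gamma> * mass) * u w + (8 * \<rho> powr (\<gamma> + 2) * Z) * (u w * (jbracket w)\<^sup>2)"
      by (simp add: algebra_simps)
  qed
  also have "\<dots> = (\<rho> powr \<gamma> * mass) * mass + (8 * \<rho> powr (\<gamma> + 2) * Z) * (LBINT w. u w * (jbracket w)\<^sup>2)"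
    unfolding mass_def using u_integrable e by simp
  finally show ?thesis unfolding Z_def by (simp add: power2_eq_square algebra_simps)
qed

text \<open>By symmetry of the kernel the integral over the partner velocity is the constant
  \<open>ckb\<close>, whatever \<open>v\<close> is.\<close>

lemma kball_fubini:
  assumes \<delta>: "0 < \<delta>"
  shows "integrable lborel (\<lambda>w. \<integral>v. kball (v - w) * entG \<delta> (u v) \<partial>lborel)"
    "(\<integral>w. \<integral>v. kball (v - w) * entG \<delta> (u v) \<partial>lborel \<partial>lborel) \<le> ckb * mass"
proof -
  note G = decays_entG[OF \<delta>]
  have [measurable]: "(\<lambda>v. entG \<delta> (u v)) \<in> borel_measurable borel" by (rule decays_measurable[OF G])
  have g0: "0 \<le> entG \<delta> (u v)" for v by (rule entG_nonneg[OF \<delta> u_nonneg])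
  have m: "(\<lambda>w. \<integral>v. kball (v - w) * entG \<delta> (u v) \<partial>lborel) \<in> borel_measurable lborel"
    by (rule lborel.borel_measurable_lebesgue_integral) measurable
  have n0: "0 \<le> (LBINT v. kball (v - w) * entG \<delta> (u v))" for w
    by (intro integral_nonneg_AE AE_I2 mult_nonneg_nonneg kball_nonneg g0)
  have "(\<integral>\<^sup>+w. ennreal (LBINT v. kball (v - w) * entG \<delta> (u v)) \<partial>lborel) = (\<integral>\<^sup>+w. \<integral>\<^sup>+v. ennreal (kball (v - w) * entG \<delta> (u v)) \<partial>lborel \<partial>lborel)"
    by (intro nn_integral_cong nn_integral_eq_integral[symmetric] kint[OF kernel_kball G] AE_I2 mult_nonneg_nonneg kball_nonneg g0)
  also have "\<dots> = (\<integral>\<^sup>+v. \<integral>\<^sup>+w. ennreal (kball (v - w) * entG \<delta> (u v)) \<partial>lborel \<partial>lborel)"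
    by (rule lborel_pair.Fubini') measurable
  also have "\<dots> = (\<integral>\<^sup>+v. ennreal ckb * ennreal (entG \<delta> (u v)) \<partial>lborel)"
  proof (rule nn_integral_cong)
    fix v
    have "(\<integral>\<^sup>+w. ennreal (kball (v - w) * entG \<delta> (u v)) \<partial>lborel) = (\<integral>\<^sup>+w. ennreal (kball (w - v)) * ennreal (entG \<delta> (u v)) \<partial>lborel)"
    proof (rule nn_integral_cong)
      fix w
      have "kball (v - w) = kball (w - v)" by (simp add: kball_def norm_minus_commute indicator_def dist_norm)
      then show "ennreal (kball (v - w) * entG \<delta> (u v)) = ennreal (kball (w - v)) * ennreal (entG \<delta> (u v))"
        using kball_nonneg g0 by (simp add: ennreal_mult)
    qed
    also have "\<dots> = (\<integral>\<^sup>+w. ennreal (kball (w - v)) \<partial>lborel) * ennreal (entG \<delta> (u v))"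
      by (rule nn_integral_multc) measurable
    also have "(\<integral>\<^sup>+w. ennreal (kball (w - v)) \<partial>lborel) = ennreal ckb"
      by (subst nn_integral_shift[where g="\<lambda>z. ennreal (kball z)"]) (auto simp: ckb)
    finally show "(\<integral>\<^sup>+w. ennreal (kball (v - w) * entG \<delta> (u v)) \<partial>lborel) = ennreal ckb * ennreal (entG \<delta> (u v))" .
  qed
  also have "\<dots> = ennreal ckb * ennreal (LBINT v. entG \<delta> (u v))"
    using entG_mass(1)[OF \<delta>] g0 by (subst nn_integral_cmult) (auto simp: nn_integral_eq_integral)
  also have "\<dots> = ennreal (ckb * (LBINT v. entG \<delta> (u v)))"
    using ckb(2) g0 by (intro ennreal_mult[symmetric] integral_nonneg_AE) auto
  finally have nn: "(\<integral>\<^sup>+w. ennreal (LBINT v. kball (v - w) * entG \<delta> (u v)) \<partial>lborel) = ennreal (ckb * (LBINT v. entG \<delta> (u v)))" .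
  show i: "integrable lborel (\<lambda>w. \<integral>v. kball (v - w) * entG \<delta> (u v) \<partial>lborel)"
    by (rule integrableI_nonneg[OF m]) (use n0 nn in auto)
  have "ennreal (\<integral>w. \<integral>v. kball (v - w) * entG \<delta> (u v) \<partial>lborel \<partial>lborel) = ennreal (ckb * (LBINT v. entG \<delta> (u v)))"
    using nn_integral_eq_integral[OF i] n0 nn by simp
  moreover have "0 \<le> ckb * (LBINT v. entG \<delta> (u v))"
    using ckb(2) g0 by (intro mult_nonneg_nonneg integral_nonneg_AE) auto
  ultimately have "(\<integral>w. \<integral>v. kball (v - w) * entG \<delta> (u v) \<partial>lborel \<partial>lborel) = ckb * (LBINT v. entG \<delta> (u v))"
    using n0 by (subst (asm) ennreal_inj) (auto intro!: integral_nonneg_AE)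
  then show "(\<integral>w. \<integral>v. kball (v - w) * entG \<delta> (u v) \<partial>lborel \<partial>lborel) \<le> ckb * mass"
    using mult_left_mono[OF entG_mass(2)[OF \<delta>] ckb(2)] by simp
qed

text \<open>In the critical case the singular term is split according to the size of the density:
  where \<open>u \<le> N\<close> the kernel is integrable, and the rest carries little mass.\<close>

lemma sing_bound_split:
  assumes \<delta>: "0 < \<delta>" and N: "0 < N" and e: "integrable lborel (\<lambda>v. u v * (jbracket v)\<^sup>2)"
    and s: "(LBINT v. (if u v \<le> N then 0 else u v * (jbracket v)\<^sup>2)) \<le> \<beta>"
  shows "sing \<delta> \<le> mass\<^sup>2 + N * ckb * mass + 8 * \<beta> * (4 * diss \<delta> + 16 * mass)"
proof -
  define Z where "Z = 4 * diss \<delta> + 16 * mass"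
  have Z: "0 \<le> Z" unfolding Z_def using diss_nonneg[OF \<delta>] mass_nonneg by simp
  have i: "integrable lborel (\<lambda>v. if u v \<le> N then 0 else u v * (jbracket v)\<^sup>2)"
    by (rule Bochner_Integration.integrable_bound[OF e]) (auto simp: u_nonneg)
  define K where "K = (\<lambda>w. \<integral>v. kball (v - w) * entG \<delta> (u v) \<partial>lborel)"
  have K0: "0 \<le> K w" for w
    unfolding K_def by (intro integral_nonneg_AE AE_I2 mult_nonneg_nonneg kball_nonneg entG_nonneg \<delta> u_nonneg)
  have "sing \<delta> \<le> (LBINT w. mass * u w + N * K w + (8 * Z) * (if u w \<le> N then 0 else u w * (jbracket w)\<^sup>2))"
    unfolding sing_def
  proof (intro integral_mono sing_integrable[OF \<delta>] Bochner_Integration.integrable_add integrable_mult_right u_integrable i)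
    show "integrable lborel K" unfolding K_def by (rule kball_fubini(1)[OF \<delta>])
    fix w
    \<comment> \<open>The splitting radius is 1, so that both powers of it equal 1 whatever \<gamma>
      is.\<close>
    have "(LBINT v. norm (v - w) powr \<gamma> * entG \<delta> (u v)) \<le> mass + K w"
      using inner_sing_bound[OF \<delta>, of 1 w] by (simp add: K_def)
    from mult_left_mono[OF this u_nonneg[of w]]
    have "u w * (LBINT v. norm (v - w) powr \<gamma> * entG \<delta> (u v)) \<le> mass * u w + u w * K w" by (simp add: algebra_simps)
    also have "u w * K w \<le> N * K w + (8 * Z) * (if u w \<le> N then 0 else u w * (jbracket w)\<^sup>2)"
    proof (cases "u w \<le> N")
      case True then show ?thesis using K0[of w] by (simp add: mult_right_mono)
    next
      case False
      have "u w * K w \<le> u w * (8 * (jbracket w)\<^sup>2 * Z)"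
        unfolding K_def Z_def by (intro mult_left_mono kball_hardy \<delta> u_nonneg)
      moreover have "0 \<le> N * K w" using N K0[of w] by simp
      ultimately show ?thesis using False by (simp add: algebra_simps)
    qed
    finally show "u w * (LBINT v. norm (v - w) powr \<gamma> * entG \<delta> (u v))
      \<le> mass * u w + N * K w + (8 * Z) * (if u w \<le> N then 0 else u w * (jbracket w)\<^sup>2)" by simp
  qed
  also have "\<dots> = mass * (LBINT w. u w) + N * (LBINT w. K w) + (8 * Z) * (LBINT w. (if u w \<le> N then 0 else u w * (jbracket w)\<^sup>2))"
    by (intro integral_linear_comb3 u_integrable i) (simp add: K_def kball_fubini(1)[OF \<delta>])
  also have "\<dots> \<le> mass * mass + N * (ckb * mass) + (8 * Z) * \<beta>"
    using kball_fubini(2)[OF \<delta>] N Z s mass_nonneg unfolding K_def mass_def[symmetric]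
    by (intro add_mono mult_left_mono) auto
  finally show ?thesis unfolding Z_def by (simp add: power2_eq_square algebra_simps)
qed

end

subsection \<open>Entropy bounds\<close>

text \<open>The inequality ln y \<le> y - 1 at y = 1 / sqrt x.\<close>

lemma neg_x_ln_x_le:
  assumes "0 < x" shows "- (x * ln x) \<le> 2 * sqrt (x::real)"
proof -
  have "ln (1 / sqrt x) \<le> 1 / sqrt x - 1" using assms by (intro ln_le_minus_one) auto
  then have "- ln x \<le> 2 * (1 / sqrt x)" using assms by (simp add: ln_div ln_sqrt)
  then have "x * (- ln x) \<le> x * (2 * (1 / sqrt x))" using assms by (intro mult_left_mono) auto
  also have "\<dots> = 2 * (x / sqrt x)" by simp
  also have "\<dots> = 2 * sqrt x" using assms by (simp only: real_div_sqrt less_imp_le)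
  finally show ?thesis by simp
qed

text \<open>Twice the negative part of x ln x is to be added. If x \<ge> <v>^-8, then -ln x \<le> 8
  ln <v> \<le> 8 <v>^2; otherwise sqrt x \<le> <v>^-4. The threshold exponent 8 is chosen so that
  this last power is integrable in dimension 3.\<close>

lemma abs_x_ln_x_le:
  assumes "0 \<le> x"
  shows "x * \<bar>ln x\<bar> \<le> x * ln x + 16 * (x * (jbracket v)\<^sup>2) + 4 * jbracket v powr (- 4)"
proof (cases "x \<ge> 1 \<or> x = 0")
  case False
  then have x: "0 < x" "x < 1" using assms by auto
  then have ln: "ln x < 0" by simp
  have "- (x * ln x) \<le> 8 * (x * (jbracket v)\<^sup>2) + 2 * jbracket v powr (- 4)"
  proof (cases "jbracket v powr (- 8) \<le> x")
    case True
    then have "ln (jbracket v powr (- 8)) \<le> ln x" using x by (subst ln_le_cancel_iff) auto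
    moreover have "ln (jbracket v powr (- 8)) = - 8 * ln (jbracket v)" by (simp add: ln_powr)
    ultimately have "- ln x \<le> 8 * ln (jbracket v)" by linarith
    also have "\<dots> \<le> 8 * (jbracket v)\<^sup>2"
    proof -
      have "ln (jbracket v) \<le> jbracket v - 1" by (intro ln_le_minus_one) auto
      moreover have "jbracket v \<le> (jbracket v)\<^sup>2" using jbracket_ge_1[of v] by (simp add: power2_eq_square)
      ultimately show ?thesis by linarith
    qed
    finally have "x * (- ln x) \<le> x * (8 * (jbracket v)\<^sup>2)" using x by (intro mult_left_mono) auto
    then have "- (x * ln x) \<le> 8 * (x * (jbracket v)\<^sup>2)" by (simp add: algebra_simps)
    then show ?thesis using jbracket_powr_nonneg[of v "- 4"] by linarith
  next
    case F: False
    have "sqrt x \<le> sqrt (jbracket v powr (- 8))" using F by simp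
    also have "\<dots> = jbracket v powr (- 4)"
      by (rule real_sqrt_unique) (simp_all add: power2_eq_square powr_add[symmetric])
    finally show ?thesis using neg_x_ln_x_le[OF x(1)] x by (smt (verit) mult_nonneg_nonneg zero_le_power2)
  qed
  then show ?thesis using ln by simp
qed (auto simp: assms)

text \<open>The function compared at x and y is the primitive of ln (1 + x / \<delta>) that vanishes
  at 0. Its part that blows up with \<delta> is linear, and is kept apart because it integrates to 0
  by conservation of mass; the remainder is bounded uniformly for \<delta> \<le> 1.\<close>

lemma entropy_difference:
  fixes \<delta> x y :: real
  assumes \<delta>: "0 < \<delta>" "\<delta> \<le> 1" and xy: "0 \<le> x" "0 \<le> y"
  shows "((x + \<delta>) * ln (1 + x / \<delta>) - x) - ((y + \<delta>) * ln (1 + y / \<delta>) - y)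
    \<le> 2 * x + x * \<bar>ln x\<bar> + y * \<bar>ln y\<bar> - (1 + ln \<delta>) * (x - y)"
proof -
  have eq: "(x + \<delta>) * ln (1 + x / \<delta>) - x = x * ln (x + \<delta>) + \<delta> * ln (1 + x / \<delta>) - x * ln \<delta> - x" if "0 \<le> x" for x
  proof -
    have "(x + \<delta>) / \<delta> = x / \<delta> + \<delta> / \<delta>" by (rule add_divide_distrib)
    then have "1 + x / \<delta> = (x + \<delta>) / \<delta>" using \<delta> by simp
    then have l: "ln (1 + x / \<delta>) = ln (x + \<delta>) - ln \<delta>" using that \<delta> by (simp add: ln_div)
    show ?thesis unfolding l by (simp add: algebra_simps)
  qed
  have up: "x * ln (x + \<delta>) + \<delta> * ln (1 + x / \<delta>) \<le> 2 * x + x * \<bar>ln x\<bar>"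
  proof -
    have "ln (1 + x / \<delta>) \<le> x / \<delta>" using \<delta> xy by (intro ln_add_one_self_le_self) auto
    then have 1: "\<delta> * ln (1 + x / \<delta>) \<le> x" using \<delta> by (simp add: field_simps)
    have "x * ln (x + \<delta>) \<le> x * (1 + \<bar>ln x\<bar>)"
    proof (cases "x = 0")
      case False
      then have x: "0 < x" using xy by simp
      have "ln (x + \<delta>) \<le> 1 + \<bar>ln x\<bar>"
      proof (cases "x \<le> 1")
        case True
        have "ln (x + \<delta>) \<le> ln (1 + 1)" using True \<delta> x by (subst ln_le_cancel_iff) auto
        also have "\<dots> \<le> 1" by (rule ln_add_one_self_le_self) simp
        finally show ?thesis by simp
      next
        case F: False
        have "ln (x + \<delta>) \<le> ln ((1 + 1) * x)" using F \<delta> x by (subst ln_le_cancel_iff) auto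
        also have "\<dots> = ln (1 + 1) + ln x" using x by (simp add: ln_mult)
        also have "\<dots> \<le> 1 + ln x" using ln_add_one_self_le_self[of 1] by simp
        finally show ?thesis by simp
      qed
      then show ?thesis using x by (intro mult_left_mono) auto
    qed simp
    with 1 show ?thesis by (simp add: algebra_simps)
  qed
  have low: "- (y * \<bar>ln y\<bar>) \<le> y * ln (y + \<delta>) + \<delta> * ln (1 + y / \<delta>)"
  proof (cases "y = 0")
    case False
    then have y: "0 < y" using xy by simp
    have "ln y \<le> ln (y + \<delta>)" using y \<delta> by simp
    then have "- \<bar>ln y\<bar> \<le> ln (y + \<delta>)" by linarith
    from mult_left_mono[OF this xy(2)] have "- (y * \<bar>ln y\<bar>) \<le> y * ln (y + \<delta>)" by simp
    moreover have "0 \<le> \<delta> * ln (1 + y / \<delta>)" using \<delta> y by (intro mult_nonneg_nonneg ln_ge_zero) auto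
    ultimately show ?thesis by linarith
  qed simp
  show ?thesis unfolding eq[OF xy(1)] eq[OF xy(2)] using up low by (simp add: algebra_simps)
qed

text \<open>This and the next two functionals depend on the datum alone and live outside the locale,
  so that constants can be formed from them before a solution is given.\<close>

definition initial_mass :: "(r3 \<Rightarrow> real) \<Rightarrow> real" where
  "initial_mass g = (LBINT v. g v)"

definition initial_energy :: "(r3 \<Rightarrow> real) \<Rightarrow> real" where
  "initial_energy g = (LBINT v. g v * (norm v)\<^sup>2)"

text \<open>An upper bound for the integral of \<open>g \<bar>ln g\<bar>\<close>: small values of \<open>g\<close> are controlled by the energy.\<close>

definition initial_entropy :: "(r3 \<Rightarrow> real) \<Rightarrow> real" where
  "initial_entropy g = (LBINT v. g v * ln (g v)) + 16 * (initial_mass g + initial_energy g)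
     + 4 * (LBINT v. jbracket v powr (- 4))"

section \<open>Conserved quantities and entropy along a solution\<close>

context landau_solution
begin

lemma f_measurable: "0 \<le> t \<Longrightarrow> f t \<in> borel_measurable borel"
  using f_integrable[of t] by (auto dest: borel_measurable_integrable)

abbreviation "M0 \<equiv> initial_mass fin"
abbreviation "E0 \<equiv> initial_energy fin"
abbreviation "H0 \<equiv> initial_entropy fin"

lemmas M0_def = initial_mass_def[of fin] and E0_def = initial_energy_def[of fin] and H0_def = initial_entropy_def[of fin]

lemma conserved:
  assumes "0 \<le> t"
  shows "(LBINT v. f t v) = M0" "(LBINT v. f t v * (norm v)\<^sup>2) = E0"
    "integrable lborel (\<lambda>v. f t v * (jbracket v)\<^sup>2)" "integrable lborel (\<lambda>v. f t v * (norm v)\<^sup>2)"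
    "(LBINT v. f t v * (jbracket v)\<^sup>2) = M0 + E0"
proof -
  have c: "in_L1w 2 (f t)" "(LBINT v. f t v) = (LBINT v. f 0 v)"
    "(LBINT v. f t v * (norm v)\<^sup>2) = (LBINT v. f 0 v * (norm v)\<^sup>2)"
    using conjunct1[OF cons[unfolded conserves_and_dissipates_def], rule_format, OF assms] by simp_all
  show 1: "(LBINT v. f t v) = M0" and 2: "(LBINT v. f t v * (norm v)\<^sup>2) = E0"
    using c by (simp_all only: M0_def E0_def f_0)
  note c(1)
  then have "integrable lborel (\<lambda>v. \<bar>f t v\<bar> * jbracket v powr 2)" by (simp only: in_L1w_def)
  moreover have "(\<lambda>v. \<bar>f t v\<bar> * jbracket v powr 2) = (\<lambda>v. f t v * (jbracket v)\<^sup>2)"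
    using f_nonneg[OF assms] by (simp add: fun_eq_iff less_imp_le)
  ultimately show 3: "integrable lborel (\<lambda>v. f t v * (jbracket v)\<^sup>2)" by simp
  have "integrable lborel (\<lambda>v. f t v * (jbracket v)\<^sup>2 - f t v)" by (intro Bochner_Integration.integrable_diff 3 f_integrable assms)
  then show 4: "integrable lborel (\<lambda>v. f t v * (norm v)\<^sup>2)" by (simp add: jbracket_sq algebra_simps)
  have "(\<lambda>v. f t v * (jbracket v)\<^sup>2) = (\<lambda>v. f t v + f t v * (norm v)\<^sup>2)" by (simp add: jbracket_sq algebra_simps)
  then show "(LBINT v. f t v * (jbracket v)\<^sup>2) = M0 + E0"
    using f_integrable[OF assms] 1 2 4 by simp
qed

text \<open>The signed entropy does not increase, and the correction that passes to |ln f| is made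
  of conserved quantities; hence the value formed at time 0 serves at all times.\<close>

lemma entropy_bound:
  assumes "0 \<le> t"
  shows "integrable lborel (\<lambda>v. f t v * \<bar>ln (f t v)\<bar>)" "(LBINT v. f t v * \<bar>ln (f t v)\<bar>) \<le> H0"
proof -
  note [measurable] = f_measurable[OF assms]
  have "in_LlogL (f t)"
    using conjunct1[OF cons[unfolded conserves_and_dissipates_def], rule_format, OF assms] by simp
  then show i: "integrable lborel (\<lambda>v. f t v * \<bar>ln (f t v)\<bar>)"
    using f_nonneg[OF assms] unfolding in_LlogL_def by simp
  have i2: "integrable lborel (\<lambda>v. f t v * ln (f t v))"
    by (rule Bochner_Integration.integrable_bound[OF i]) (auto simp: abs_mult f_nonneg[OF assms])
  have i3: "integrable lborel (\<lambda>v. jbracket v powr (- 4))" by (rule integrable_jbracket_powr) simp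
  have "(LBINT v. f t v * \<bar>ln (f t v)\<bar>) \<le> (LBINT v. 1 * (f t v * ln (f t v)) + 16 * (f t v * (jbracket v)\<^sup>2) + 4 * jbracket v powr (- 4))"
    using abs_x_ln_x_le[OF f_nonneg[OF assms]]
    by (intro integral_mono i Bochner_Integration.integrable_add integrable_mult_right i2 i3 conserved assms) simp
  also have "\<dots> = 1 * (LBINT v. f t v * ln (f t v)) + 16 * (M0 + E0) + 4 * (LBINT v. jbracket v powr (- 4))"
    unfolding conserved(5)[OF assms, symmetric] by (intro integral_linear_comb3 i2 i3 conserved assms)
  also have "(LBINT v. f t v * ln (f t v)) \<le> (LBINT v. fin v * ln (fin v))"
    using conjunct2[OF cons[unfolded conserves_and_dissipates_def], rule_format, OF order_refl assms] by (simp only: f_0)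
  finally show "(LBINT v. f t v * \<bar>ln (f t v)\<bar>) \<le> H0" by (simp add: H0_def)
qed

section \<open>The time integral of the dissipation\<close>

definition D :: "real \<Rightarrow> real \<Rightarrow> real" where
  "D \<delta> t = (LBINT v. jbracket v powr \<gamma> * (\<Sum>i\<in>UNIV. (pd i (f t) v)\<^sup>2) / (f t v + \<delta>))"

definition S :: "real \<Rightarrow> real \<Rightarrow> real" where
  "S \<delta> t = (LBINT w. f t w * (LBINT v. norm (v - w) powr \<gamma> * entG \<delta> (f t v)))"

definition coercive :: "real \<Rightarrow> real \<Rightarrow> bool" where
  "coercive \<kappa> t \<longleftrightarrow> (\<forall>v \<xi>. \<kappa> * jbracket v powr \<gamma> * (norm \<xi>)\<^sup>2
        \<le> (LBINT c. f t c * (norm (v - c) powr \<gamma> * ((norm (v - c))\<^sup>2 * (norm \<xi>)\<^sup>2 - ((v - c) \<bullet> \<xi>)\<^sup>2))))"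

lemma snapshot_at:
  assumes "0 < t"
  obtains p where "snapshot \<gamma> p (f t) (\<lambda>i. pd i (f t)) (\<lambda>i j. pd i (pd j (f t)))"
    "\<And>\<delta>. snapshot.diss \<gamma> (f t) (\<lambda>i. pd i (f t)) \<delta> = D \<delta> t"
    "\<And>\<delta>. snapshot.sing \<gamma> (f t) \<delta> = S \<delta> t"
    "snapshot.mass (f t) = M0"
proof -
  obtain p where sn: "snapshot \<gamma> p (f t) (\<lambda>i. pd i (f t)) (\<lambda>i j. pd i (pd j (f t)))" using snapshot_f[OF assms] by blast
  interpret snapshot \<gamma> p "f t" "\<lambda>i. pd i (f t)" "\<lambda>i j. pd i (pd j (f t))" by (rule sn)
  have "(norm (grad v))\<^sup>2 = (\<Sum>i\<in>UNIV. (pd i (f t) v)\<^sup>2)" for v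
    unfolding norm_sq_3 sum_3 by (simp add: grad_component)
  then show ?thesis using sn assms
    by (intro that[of p]) (auto simp: diss_def D_def sing_def S_def mass_def conserved)
qed

lemma coercive_of_constant:
  assumes t: "0 < t"
    and c: "\<And>(u :: r3 \<Rightarrow> real) v \<xi>. u \<in> borel_measurable borel \<Longrightarrow> (\<And>c. 0 \<le> u c) \<Longrightarrow> integrable lborel u \<Longrightarrow> (LBINT c. u c) = M0 \<Longrightarrow>
      integrable lborel (\<lambda>c. u c * (norm c)\<^sup>2) \<Longrightarrow> (LBINT c. u c * (norm c)\<^sup>2) \<le> E0 \<Longrightarrow>
      integrable lborel (\<lambda>c. u c * \<bar>ln (u c)\<bar>) \<Longrightarrow> (LBINT c. u c * \<bar>ln (u c)\<bar>) \<le> H0 \<Longrightarrow>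
      integrable lborel (\<lambda>c. u c * (norm (v - c) powr \<gamma> * ((norm (v - c))\<^sup>2 * (norm \<xi>)\<^sup>2 - ((v - c) \<bullet> \<xi>)\<^sup>2))) \<Longrightarrow>
      \<kappa> * jbracket v powr \<gamma> * (norm \<xi>)\<^sup>2
        \<le> (LBINT c. u c * (norm (v - c) powr \<gamma> * ((norm (v - c))\<^sup>2 * (norm \<xi>)\<^sup>2 - ((v - c) \<bullet> \<xi>)\<^sup>2)))"
  shows "coercive \<kappa> t"
  unfolding coercive_def
proof (intro allI)
  fix v \<xi> :: r3
  have t0: "0 \<le> t" using t by simp
  obtain p where sn: "snapshot \<gamma> p (f t) (\<lambda>i. pd i (f t)) (\<lambda>i j. pd i (pd j (f t)))" using snapshot_f[OF t] by blast
  interpret snapshot \<gamma> p "f t" "\<lambda>i. pd i (f t)" "\<lambda>i j. pd i (pd j (f t))" by (rule sn)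
  have i: "integrable lborel (\<lambda>c. f t c * (norm (v - c) powr \<gamma> * ((norm (v - c))\<^sup>2 * (norm \<xi>)\<^sup>2 - ((v - c) \<bullet> \<xi>)\<^sup>2)))"
  proof -
    have sym: "ka \<gamma> i j (v - c) = ka \<gamma> i j (c - v)" for i j c
      by (simp add: ka_def norm_minus_commute algebra_simps)
    have "integrable lborel (\<lambda>c. \<Sum>i\<in>UNIV. \<Sum>j\<in>UNIV. (\<xi> $ i * \<xi> $ j) * (ka \<gamma> i j (v - c) * f t c))"
      unfolding sym by (intro Bochner_Integration.integrable_sum integrable_mult_right kint kernels du)
    then show ?thesis unfolding ka_quadratic_form[symmetric] by (simp add: sum_distrib_left ac_simps)
  qed
  show "\<kappa> * jbracket v powr \<gamma> * (norm \<xi>)\<^sup>2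
        \<le> (LBINT c. f t c * (norm (v - c) powr \<gamma> * ((norm (v - c))\<^sup>2 * (norm \<xi>)\<^sup>2 - ((v - c) \<bullet> \<xi>)\<^sup>2)))"
    by (rule c) (use conserved[OF t0] entropy_bound[OF t0] f_nonneg[OF t0] f_integrable[OF t0] i in auto)
qed

lemma D_nonneg: "0 < t \<Longrightarrow> 0 < \<delta> \<Longrightarrow> 0 \<le> D \<delta> t"
  unfolding D_def by (intro integral_nonneg_AE AE_I2 divide_nonneg_nonneg mult_nonneg_nonneg sum_nonneg add_nonneg_nonneg f_nonneg) auto

lemma D_nn:
  assumes t: "0 < t" and \<delta>: "0 < \<delta>"
  shows "(\<integral>\<^sup>+v. ennreal (jbracket v powr \<gamma> * (\<Sum>i\<in>UNIV. (pd i (f t) v)\<^sup>2) / (f t v + \<delta>)) \<partial>lborel) = ennreal (D \<delta> t)"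
proof -
  obtain p where sn: "snapshot \<gamma> p (f t) (\<lambda>i. pd i (f t)) (\<lambda>i j. pd i (pd j (f t)))" using snapshot_f[OF t] by blast
  interpret snapshot \<gamma> p "f t" "\<lambda>i. pd i (f t)" "\<lambda>i j. pd i (pd j (f t))" by (rule sn)
  have eq: "(norm (grad v))\<^sup>2 = (\<Sum>i\<in>UNIV. (pd i (f t) v)\<^sup>2)" for v
    unfolding norm_sq_3 sum_3 by (simp add: grad_component)
  show ?thesis unfolding D_def
    by (intro nn_integral_eq_integral AE_I2 divide_nonneg_nonneg mult_nonneg_nonneg sum_nonneg add_nonneg_nonneg f_nonneg)
      (use t \<delta> grad_sq_integrable[OF \<delta>, unfolded eq] in auto)
qed

text \<open>The weighted Fisher information. It takes extended values because it is known to be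
  finite only for almost every time, through its time integral.\<close>

definition Yd :: "real \<Rightarrow> ennreal" where
  "Yd t = (\<integral>\<^sup>+v. ennreal (jbracket v powr \<gamma> * (\<Sum>i\<in>UNIV. (pd i (f t) v)\<^sup>2) / f t v) \<partial>lborel)"

text \<open>A zero of a non-negative function is a minimum.\<close>

lemma f_zero_grad:
  assumes t: "0 < t" and z: "f t v = 0" shows "pd i (f t) v = 0"
proof -
  have "((\<lambda>s. f t (v + s *\<^sub>R axis i 1)) has_real_derivative pd i (f t) v) (at 0)"
    using f_ddir(1)[OF t] by (simp add: ddir_def)
  moreover have "\<forall>y. \<bar>0 - y\<bar> < 1 \<longrightarrow> f t (v + 0 *\<^sub>R axis i 1) \<le> f t (v + y *\<^sub>R axis i 1)"
    using z f_nonneg t by simp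
  ultimately show ?thesis by (intro DERIV_local_min[of _ _ 0 1]) auto
qed

text \<open>Monotone convergence as \<delta> decreases. At zeros of f the quotient in
  \<open>Yd\<close> is 0 by convention, and agrees with the limit only because the gradient vanishes
  there.\<close>

lemma Yd_SUP:
  assumes t: "0 < t"
  shows "Yd t = (SUP n. ennreal (D (1 / real (Suc n)) t))"
proof -
  have t0: "0 \<le> t" using t by simp
  let ?g = "\<lambda>n v. ennreal (jbracket v powr \<gamma> * (\<Sum>i\<in>UNIV. (pd i (f t) v)\<^sup>2) / (f t v + 1 / real (Suc n)))"
  have [measurable]: "pd i (f t) \<in> borel_measurable borel" for i
    by (intro borel_measurable_continuous_onI slice_continuous[OF continuous_pd t])
  note [measurable] = f_measurable[OF t0]
  have inc: "incseq ?g"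
  proof (intro monoI le_funI ennreal_leI divide_left_mono)
    fix m n :: nat and v assume mn: "m \<le> n"
    have "1 / real (Suc n) \<le> 1 / real (Suc m)" using mn by (intro divide_left_mono) auto
    then show "f t v + 1 / real (Suc n) \<le> f t v + 1 / real (Suc m)" by simp
    show "0 \<le> jbracket v powr \<gamma> * (\<Sum>i\<in>UNIV. (pd i (f t) v)\<^sup>2)" by (simp add: sum_nonneg)
    show "0 < (f t v + 1 / real (Suc m)) * (f t v + 1 / real (Suc n))"
      by (intro mult_pos_pos add_nonneg_pos f_nonneg t0) auto
  qed
  have sup: "(SUP n. ?g n v) = ennreal (jbracket v powr \<gamma> * (\<Sum>i\<in>UNIV. (pd i (f t) v)\<^sup>2) / f t v)" for v
  proof (cases "f t v = 0")
    case True
    then have "pd i (f t) v = 0" for i using f_zero_grad[OF t] by blast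
    then show ?thesis by simp
  next
    case False
    have "(\<lambda>n. f t v + 1 / real (Suc n)) \<longlonglongrightarrow> f t v + 0"
      using LIMSEQ_inverse_real_of_nat by (intro tendsto_intros) (simp add: inverse_eq_divide)
    then have "(\<lambda>n. ?g n v) \<longlonglongrightarrow> ennreal (jbracket v powr \<gamma> * (\<Sum>i\<in>UNIV. (pd i (f t) v)\<^sup>2) / f t v)"
      using False by (intro tendsto_ennrealI tendsto_intros) auto
    moreover have "incseq (\<lambda>n. ?g n v)" using inc by (auto simp: incseq_def le_fun_def)
    ultimately show ?thesis using LIMSEQ_SUP LIMSEQ_unique by blast
  qed
  have "Yd t = (\<integral>\<^sup>+v. (SUP n. ?g n v) \<partial>lborel)" by (simp only: Yd_def sup)
  also have "\<dots> = (SUP n. \<integral>\<^sup>+v. ?g n v \<partial>lborel)"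
    by (rule nn_integral_monotone_convergence_SUP[OF inc]) measurable
  also have "\<dots> = (SUP n. ennreal (D (1 / real (Suc n)) t))"
    by (simp only: D_nn[OF t] divide_pos_pos zero_less_one of_nat_0_less_iff zero_less_Suc)
  finally show ?thesis .
qed

lemma D_incseq:
  assumes t: "0 < t" shows "incseq (\<lambda>n. ennreal (D (1 / real (Suc n)) t))"
proof (rule monoI)
  fix m n :: nat assume mn: "m \<le> n"
  have d: "1 / real (Suc n) \<le> 1 / real (Suc m)" using mn by (intro divide_left_mono) auto
  have t0: "0 \<le> t" using t by simp
  have e: "ennreal (D (1 / real (Suc k)) t)
    = (\<integral>\<^sup>+v. ennreal (jbracket v powr \<gamma> * (\<Sum>i\<in>UNIV. (pd i (f t) v)\<^sup>2) / (f t v + 1 / real (Suc k))) \<partial>lborel)" for k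
    by (rule D_nn[OF t, symmetric]) simp
  show "ennreal (D (1 / real (Suc m)) t) \<le> ennreal (D (1 / real (Suc n)) t)"
    unfolding e
    using d f_nonneg[OF t0]
    by (intro nn_integral_mono ennreal_leI divide_left_mono mult_pos_pos add_nonneg_pos mult_nonneg_nonneg sum_nonneg) auto
qed

lemma D_measurable:
  assumes "0 < \<delta>" shows "(\<lambda>t. indicator {0<..} t * ennreal (D \<delta> t)) \<in> borel_measurable borel"
proof -
  have c: "continuous_on X (\<lambda>(t, v). jbracket v powr \<gamma> * (\<Sum>i\<in>UNIV. (pd i (f t) v)\<^sup>2) / (f t v + \<delta>))"
  proof -
    have "continuous_on X (\<lambda>q. jbracket (snd q) powr \<gamma> * (\<Sum>i\<in>UNIV. ((\<lambda>(t, v). pd i (f t) v) q)\<^sup>2) / ((\<lambda>(t, v). f t v) q + \<delta>))"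
    proof (intro continuous_intros continuous_pd continuous_f ballI)
      fix q assume "q \<in> X"
      then have "0 \<le> f (fst q) (snd q)" by (intro f_nonneg) auto
      then show "(case q of (t, v) \<Rightarrow> f t v) + \<delta> \<noteq> 0" using assms by (auto simp: split_beta')
    qed auto
    then show ?thesis by (simp add: split_beta')
  qed
  define h where "h = (\<lambda>(t, v). indicator {0<..} t * (jbracket v powr \<gamma> * (\<Sum>i\<in>UNIV. (pd i (f t) v)\<^sup>2) / (f t v + \<delta>)))"
  have "(\<lambda>x. indicator X x *\<^sub>R (case x of (t, v) \<Rightarrow> jbracket v powr \<gamma> * (\<Sum>i\<in>UNIV. (pd i (f t) v)\<^sup>2) / (f t v + \<delta>))) \<in> borel_measurable borel"
    by (rule borel_measurable_continuous_on_indicator[OF borel_open[OF open_X] c])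
  moreover have "h = (\<lambda>x. indicator X x *\<^sub>R (case x of (t, v) \<Rightarrow> jbracket v powr \<gamma> * (\<Sum>i\<in>UNIV. (pd i (f t) v)\<^sup>2) / (f t v + \<delta>)))"
    by (auto simp: h_def fun_eq_iff split: split_indicator)
  ultimately have [measurable]: "h \<in> borel_measurable (lborel \<Otimes>\<^sub>M lborel)" by (simp add: lborel_prod)
  have "(\<lambda>t. \<integral>\<^sup>+v. ennreal (h (t, v)) \<partial>lborel) \<in> borel_measurable lborel" by measurable
  moreover have "(\<integral>\<^sup>+v. ennreal (h (t, v)) \<partial>lborel) = indicator {0<..} t * ennreal (D \<delta> t)" for t
    using D_nn[of t \<delta>] assms by (cases "0 < t") (auto simp: h_def)
  ultimately show ?thesis by simp
qed

text \<open>The regularised entropy has the time derivative \<integral> ln (1 + f / \<delta>) Q, to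
  which the entropy estimate of a slice applies. The endpoint \<open>a\<close> is positive because f
  is smooth only at positive times; the bound involves neither \<open>a\<close> nor \<delta>, as the
  two limits require.\<close>

lemma dissipation_bound_regularised:
  assumes ab: "0 < a" "a < b" and \<delta>: "0 < \<delta>" "\<delta> \<le> 1" and \<kappa>: "0 < \<kappa>"
    and co: "\<And>t. 0 < t \<Longrightarrow> coercive \<kappa> t" and B: "0 \<le> B"
    and hS: "\<And>t. 0 < t \<Longrightarrow> t \<le> b \<Longrightarrow> 2 * (\<gamma> + 3) * S \<delta> t \<le> \<kappa> / 2 * D \<delta> t + B"
  shows "(\<integral>\<^sup>+t. indicator {a..b} t * ennreal (D \<delta> t) \<partial>lborel) \<le> ennreal (2 / \<kappa> * (B * b + 2 * M0 + 2 * H0))"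
proof -
  define \<Phi> where "\<Phi> = (\<lambda>x. (x + \<delta>) * ln (1 + x / \<delta>) - x)"
  define L where "L = (\<lambda>t v. ln (1 + f t v / \<delta>) * ft t v)"
  have sub: "{a..b} \<times> UNIV \<subseteq> X" using ab by auto
  have p1: "0 < 1 + f t v / \<delta>" if "0 \<le> t" for t v
    using f_nonneg[OF that, of v] \<delta> by (simp add: add_pos_nonneg)
  obtain p K where p: "p > 5" "0 \<le> K" 
    and K: "\<And>t v. t \<in> {a..b} \<Longrightarrow> \<bar>f t v\<bar> \<le> K * jbracket v powr (- p)" "\<And>t v. t \<in> {a..b} \<Longrightarrow> \<bar>ft t v\<bar> \<le> K * jbracket v powr (- p)"
    using bounds[OF ab(1) less_imp_le[OF ab(2)]] by metis
  have c: "continuous_on ({a..b} \<times> UNIV) (\<lambda>(t, v). L t v)"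
  proof -
    have "continuous_on ({a..b} \<times> UNIV) (\<lambda>q. ln (1 + (\<lambda>(t, v). f t v) q / \<delta>) * (\<lambda>(t, v). ft t v) q)"
    proof (intro continuous_intros continuous_on_subset[OF continuous_ft sub] continuous_on_subset[OF continuous_f sub] ballI)
      fix q assume "q \<in> {a..b} \<times> (UNIV :: r3 set)"
      then show "1 + (case q of (t, v) \<Rightarrow> f t v) / \<delta> \<noteq> 0" using p1[of "fst q" "snd q"] ab by (auto simp: split_beta')
    qed (use \<delta> in auto)
    then show ?thesis by (simp add: L_def split_beta')
  qed
  have der: "((\<lambda>\<tau>. \<Phi> (f \<tau> v)) has_real_derivative L t v) (at t)" if t: "t \<in> {a..b}" for t v
  proof -
    have f0: "0 \<le> f t v" using t ab by (intro f_nonneg) auto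
    have pos: "0 < 1 + f t v / \<delta>" using t ab by (intro p1) auto
    have "(\<Phi> has_real_derivative (1 * ln (1 + f t v / \<delta>) + 1 / (1 + f t v / \<delta>) * (1 / \<delta>) * (f t v + \<delta>) - 1)) (at (f t v))"
      unfolding \<Phi>_def using pos \<delta> by (auto intro!: derivative_eq_intros)
    moreover have "1 / (1 + f t v / \<delta>) * (1 / \<delta>) * (f t v + \<delta>) = 1"
    proof -
      have "f t v + \<delta> = (1 + f t v / \<delta>) * \<delta>" using \<delta> by (simp add: distrib_right)
      then show ?thesis using pos \<delta> by simp
    qed
    then have "1 * ln (1 + f t v / \<delta>) + 1 / (1 + f t v / \<delta>) * (1 / \<delta>) * (f t v + \<delta>) - 1 = ln (1 + f t v / \<delta>)" by linarith
    ultimately have "(\<Phi> has_real_derivative ln (1 + f t v / \<delta>)) (at (f t v))" by (simp only:)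
    from DERIV_chain2[OF this ft_deriv] show ?thesis using t ab by (simp add: L_def)
  qed
  have bd: "\<bar>L t v\<bar> \<le> (K / \<delta> * K) * jbracket v powr (- p)" if t: "t \<in> {a..b}" for t v
  proof -
    have f0: "0 \<le> f t v" using t ab by (intro f_nonneg) auto
    have "\<bar>ln (1 + f t v / \<delta>)\<bar> \<le> f t v / \<delta>" using ln_add_one_self_le_self[of "f t v / \<delta>"] f0 \<delta> by simp
    also have "\<dots> \<le> K / \<delta>"
    proof -
      have "jbracket v powr (- p) \<le> 1" using jbracket_powr_mono[of "-p" 0 v] p by auto
      then have "K * jbracket v powr (- p) \<le> K * 1" using p by (intro mult_left_mono) auto
      then show ?thesis using K(1)[OF t, of v] \<delta> by (intro divide_right_mono) auto
    qed
    finally have "\<bar>ln (1 + f t v / \<delta>)\<bar> * \<bar>ft t v\<bar> \<le> K / \<delta> * (K * jbracket v powr (- p))"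
      using K(2)[OF t, of v] p \<delta> by (intro mult_mono) auto
    then show ?thesis by (simp add: L_def abs_mult mult.assoc)
  qed
  have p3: "p > 3" using p by simp
  note F = fubini_time_derivative[where g="\<lambda>t v. \<Phi> (f t v)" and gt=L, OF less_imp_le[OF ab(2)] c der bd p3]
  \<comment> \<open>Half of the dissipation absorbs the singular term, the other half is
    kept.\<close>
  have inner: "\<kappa> / 2 * D \<delta> t \<le> B - (LBINT v. L t v)" if t: "0 < t" "t \<le> b" for t
  proof -
    obtain p where sn: "snapshot \<gamma> p (f t) (\<lambda>i. pd i (f t)) (\<lambda>i j. pd i (pd j (f t)))"
      and e: "\<And>\<delta>. snapshot.diss \<gamma> (f t) (\<lambda>i. pd i (f t)) \<delta> = D \<delta> t" "\<And>\<delta>. snapshot.sing \<gamma> (f t) \<delta> = S \<delta> t"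
      using snapshot_at[OF t(1)] by metis
    interpret snapshot \<gamma> p "f t" "\<lambda>i. pd i (f t)" "\<lambda>i j. pd i (pd j (f t))" by (rule sn)
    have "(LBINT v. L t v) = (LBINT v. ln (1 + f t v / \<delta>) * coll v)"
      by (simp add: L_def strong_form[OF t(1)] Q_def)
    also have "\<dots> \<le> - \<kappa> * D \<delta> t + 2 * (\<gamma> + 3) * S \<delta> t"
      unfolding e[symmetric] diss_def sing_def using co[OF t(1)] unfolding coercive_def by (intro coll_entropy \<delta>) blast
    also have "\<dots> \<le> - \<kappa> * D \<delta> t + (\<kappa> / 2 * D \<delta> t + B)" using hS[OF t] by simp
    finally show ?thesis by simp
  qed
  have f0: "0 \<le> f a v" "0 \<le> f b v" for v using ab by (auto intro!: f_nonneg)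
  have fi: "integrable lborel (f a)" "integrable lborel (f b)" using ab by (auto intro!: f_integrable)
  have fl: "integrable lborel (\<lambda>v. f a v * \<bar>ln (f a v)\<bar>)" "integrable lborel (\<lambda>v. f b v * \<bar>ln (f b v)\<bar>)" 
    "(LBINT v. f a v * \<bar>ln (f a v)\<bar>) \<le> H0" "(LBINT v. f b v * \<bar>ln (f b v)\<bar>) \<le> H0"
    using ab by (auto intro!: entropy_bound)
  have "- (LBINT v. \<Phi> (f b v) - \<Phi> (f a v)) = (LBINT v. - (\<Phi> (f b v) - \<Phi> (f a v)))"
    by (rule Bochner_Integration.integral_minus[symmetric])
  also have "\<dots> \<le> (LBINT v. 2 * f a v + f a v * \<bar>ln (f a v)\<bar> + f b v * \<bar>ln (f b v)\<bar> - (1 + ln \<delta>) * (f a v - f b v))"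
  proof (rule integral_mono)
    show "integrable lborel (\<lambda>v. - (\<Phi> (f b v) - \<Phi> (f a v)))" by (rule Bochner_Integration.integrable_minus[OF F(3)])
    show "integrable lborel (\<lambda>v. 2 * f a v + f a v * \<bar>ln (f a v)\<bar> + f b v * \<bar>ln (f b v)\<bar> - (1 + ln \<delta>) * (f a v - f b v))"
      using fi fl by auto
    fix v
    show "- (\<Phi> (f b v) - \<Phi> (f a v)) \<le> 2 * f a v + f a v * \<bar>ln (f a v)\<bar> + f b v * \<bar>ln (f b v)\<bar> - (1 + ln \<delta>) * (f a v - f b v)"
      using entropy_difference[OF \<delta> f0(1)[of v] f0(2)[of v]] by (simp add: \<Phi>_def)
  qed
  \<comment> \<open>Here the term with 1 + ln \<delta> disappears, since the masses at
    \<open>a\<close> and \<open>b\<close> agree.\<close>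
  also have "\<dots> = 2 * M0 + (LBINT v. f a v * \<bar>ln (f a v)\<bar>) + (LBINT v. f b v * \<bar>ln (f b v)\<bar>)"
    using fi fl ab by (simp add: conserved)
  also have "\<dots> \<le> 2 * M0 + 2 * H0" using fl by simp
  finally have ent: "- (LBINT v. \<Phi> (f b v) - \<Phi> (f a v)) \<le> 2 * M0 + 2 * H0" .
  define R where "R = (\<lambda>t. 2 / \<kappa> * (B * indicator {a..b} t - indicator {a..b} t * (LBINT v. L t v)))"
  have ii: "integrable lborel (indicat_real {a..b})" by (rule integrable_real_indicator) (auto simp: emeasure_lborel_Icc_eq)
  have Ri: "integrable lborel R" unfolding R_def using F(2) ii by auto
  have DR: "indicator {a..b} t * D \<delta> t \<le> R t" for t
  proof (cases "t \<in> {a..b}")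
    case True
    then have "\<kappa> / 2 * D \<delta> t \<le> B - (LBINT v. L t v)" using ab by (intro inner) auto
    then have "2 / \<kappa> * (\<kappa> / 2 * D \<delta> t) \<le> 2 / \<kappa> * (B - (LBINT v. L t v))" using \<kappa> by (intro mult_left_mono) auto
    then show ?thesis using True \<kappa> by (simp add: R_def)
  qed (simp add: R_def)
  have R0: "0 \<le> R t" for t
    using DR[of t] D_nonneg[of t \<delta>] ab \<delta> by (cases "t \<in> {a..b}") auto
  have "(\<integral>\<^sup>+t. indicator {a..b} t * ennreal (D \<delta> t) \<partial>lborel) \<le> (\<integral>\<^sup>+t. ennreal (R t) \<partial>lborel)"
    by (intro nn_integral_mono order_trans[OF _ ennreal_leI[OF DR]]) (auto split: split_indicator)
  also have "\<dots> = ennreal (LBINT t. R t)" by (intro nn_integral_eq_integral Ri AE_I2 R0)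
  also have "(LBINT t. R t) = 2 / \<kappa> * (B * (b - a) - (LBINT v. \<Phi> (f b v) - \<Phi> (f a v)))"
    unfolding R_def using F(1,2) ii ab by simp
  also have "ennreal \<dots> \<le> ennreal (2 / \<kappa> * (B * b + 2 * M0 + 2 * H0))"
  proof (intro ennreal_leI mult_left_mono)
    have "B * (b - a) \<le> B * b" using B ab by (intro mult_left_mono) auto
    then show "B * (b - a) - (LBINT v. \<Phi> (f b v) - \<Phi> (f a v)) \<le> B * b + 2 * M0 + 2 * H0" using ent by linarith
  qed (use \<kappa> in auto)
  finally show ?thesis .
qed

text \<open>The lower endpoint and \<delta> tend to 0 along the same index, so the integrands
  increase and one application of monotone convergence suffices.\<close>

lemma dissipation_bound:
  assumes T: "0 < T" and \<kappa>: "0 < \<kappa>"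
    and co: "\<And>t. 0 < t \<Longrightarrow> coercive \<kappa> t" and B: "0 \<le> B"
    and hS: "\<And>t \<delta>. 0 < t \<Longrightarrow> t \<le> T \<Longrightarrow> 0 < \<delta> \<Longrightarrow> \<delta> \<le> 1 \<Longrightarrow> 2 * (\<gamma> + 3) * S \<delta> t \<le> \<kappa> / 2 * D \<delta> t + B"
  shows "(\<integral>\<^sup>+t. indicator {0<..T} t * Yd t \<partial>lborel) \<le> ennreal (2 / \<kappa> * (B * T + 2 * M0 + 2 * H0))"
    and "(\<lambda>t. indicator {0<..T} t * Yd t) \<in> borel_measurable borel"
proof -
  \<comment> \<open>The shift by 2 keeps the endpoint strictly below T already for n = 0.\<close>
  define a where "a = (\<lambda>n. T / real (n + 2))"
  have a: "0 < a n" "a n < T" for n using T by (auto simp: a_def divide_simps)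
  define g where "g = (\<lambda>n t. indicator {a n..T} t * ennreal (D (1 / real (Suc n)) t))"
  have gm: "g n \<in> borel_measurable borel" for n
  proof -
    have [measurable]: "(\<lambda>t. indicator {0<..} t * ennreal (D (1 / real (Suc n)) t)) \<in> borel_measurable borel" by (rule D_measurable) simp
    have eq: "g n = (\<lambda>t. indicator {a n..T} t * (indicator {0<..} t * ennreal (D (1 / real (Suc n)) t)))"
      using a(1)[of n] by (auto simp: g_def fun_eq_iff split: split_indicator)
    show ?thesis unfolding eq by measurable
  qed
  have adec: "a n \<le> a m" if "m \<le> n" for m n
    unfolding a_def using T that by (intro divide_left_mono) auto
  have inc: "incseq g"
  proof (intro monoI le_funI)
    fix m n :: nat and t assume mn: "m \<le> n"
    show "g m t \<le> g n t"
    proof (cases "t \<in> {a m..T}")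
      case True
      then have t: "0 < t" using a(1)[of m] by simp
      have "t \<in> {a n..T}" using True adec[OF mn] by auto
      then show ?thesis using True monoD[OF D_incseq[OF t] mn] unfolding g_def by (simp only: indicator_simps mult_1)
    qed (simp add: g_def)
  qed
  have sup: "(SUP n. g n t) = indicator {0<..T} t * Yd t" for t
  proof (cases "t \<in> {0<..T}")
    case True
    then have t: "0 < t" "t \<le> T" by auto
    obtain k where k: "a k \<le> t"
    proof -
      obtain n where n: "T / t < real n" using reals_Archimedean2 by blast
      then have "T / t \<le> real (n + 2)" by simp
      then have "a n \<le> t" using t T by (simp add: a_def divide_simps mult.commute)
      then show ?thesis using that by blast
    qed
    have "(SUP n. g n t) = (SUP n. ennreal (D (1 / real (Suc n)) t))"
    proof (rule antisym)
      show "(SUP n. g n t) \<le> (SUP n. ennreal (D (1 / real (Suc n)) t))"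
        by (intro SUP_mono) (auto simp: g_def split: split_indicator)
      show "(SUP n. ennreal (D (1 / real (Suc n)) t)) \<le> (SUP n. g n t)"
      proof (rule SUP_mono)
        fix n
        have "ennreal (D (1 / real (Suc n)) t) \<le> ennreal (D (1 / real (Suc (max n k))) t)"
          using D_incseq[OF t(1)] by (rule monoD) simp
        also have "\<dots> = g (max n k) t"
          using k adec[of k "max n k"] t by (simp add: g_def)
        finally show "\<exists>m\<in>UNIV. ennreal (D (1 / real (Suc n)) t) \<le> g m t" by blast
      qed
    qed
    then show ?thesis using True Yd_SUP[OF t(1)] by simp
  next
    case False
    have "g n t = 0" for n using False a(1)[of n] by (auto simp: g_def)
    then show ?thesis using False by simp
  qed
  show "(\<lambda>t. indicator {0<..T} t * Yd t) \<in> borel_measurable borel"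
    unfolding sup[symmetric] using gm by measurable
  have "(\<integral>\<^sup>+t. indicator {0<..T} t * Yd t \<partial>lborel) = (SUP n. \<integral>\<^sup>+t. g n t \<partial>lborel)"
    unfolding sup[symmetric] by (rule nn_integral_monotone_convergence_SUP[OF inc]) (simp add: gm)
  also have "\<dots> \<le> ennreal (2 / \<kappa> * (B * T + 2 * M0 + 2 * H0))"
  proof (rule SUP_least)
    fix n
    show "(\<integral>\<^sup>+t. g n t \<partial>lborel) \<le> ennreal (2 / \<kappa> * (B * T + 2 * M0 + 2 * H0))"
      unfolding g_def by (rule dissipation_bound_regularised[OF a _ _ \<kappa> co B hS]) auto
  qed
  finally show "(\<integral>\<^sup>+t. indicator {0<..T} t * Yd t \<partial>lborel) \<le> ennreal (2 / \<kappa> * (B * T + 2 * M0 + 2 * H0))" .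
qed

end

subsection \<open>Propagation of moments\<close>

text \<open>The squared length of the cross product of v and w. It is unchanged when v is replaced
  by v - w, which is the cancellation that tames the kernel on the diagonal.\<close>

definition gram :: "r3 \<Rightarrow> r3 \<Rightarrow> real" where
  "gram v w = (norm v)\<^sup>2 * (norm w)\<^sup>2 - (v \<bullet> w)\<^sup>2"

text \<open>The symmetrisation of \<open>landau_L\<close> at a radial test function \<open>h (\<bar>v\<bar>\<^sup>2)\<close>, where \<open>h1\<close> and
  \<open>h2\<close> are the first two derivatives of \<open>h\<close>; only the first term can be positive for convex \<open>h\<close>.\<close>

definition symL :: "real \<Rightarrow> (real \<Rightarrow> real) \<Rightarrow> (real \<Rightarrow> real) \<Rightarrow> r3 \<Rightarrow> r3 \<Rightarrow> real" where
  "symL \<gamma> h1 h2 v w = 4 * norm (v - w) powr \<gamma> *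
     ((h2 ((norm v)\<^sup>2) + h2 ((norm w)\<^sup>2)) * gram v w
      - (h1 ((norm v)\<^sup>2) - h1 ((norm w)\<^sup>2)) * ((norm v)\<^sup>2 - (norm w)\<^sup>2))"

lemma gram_commute: "gram v w = gram w v"
  by (simp add: gram_def inner_commute mult.commute)

lemma symL_commute: "symL \<gamma> h1 h2 v w = symL \<gamma> h1 h2 w v"
  unfolding symL_def gram_commute[of w v] norm_minus_commute[of w v] by (simp add: algebra_simps)

lemma gram_nonneg: "0 \<le> gram v w"
  using Cauchy_Schwarz_ineq[of v w] by (simp add: gram_def power2_norm_eq_inner)

lemma gram_le: "gram v w \<le> (norm v * norm w)\<^sup>2"
  by (simp add: gram_def power_mult_distrib)

lemma gram_le_diff: "gram v w \<le> (norm (v - w) * norm w)\<^sup>2"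
proof -
  have "gram v w = gram (v - w) w"
    unfolding gram_def power2_norm_eq_inner
    by (simp add: inner_diff_left inner_diff_right inner_commute[of w v] power2_eq_square algebra_simps)
  then show ?thesis using gram_le[of "v - w" w] by simp
qed

lemma radial_derivatives:
  fixes h h1 h2 :: "real \<Rightarrow> real"
  assumes h: "\<And>x. 0 \<le> x \<Longrightarrow> (h has_real_derivative h1 x) (at x)"
    and h1: "\<And>x. 0 \<le> x \<Longrightarrow> (h1 has_real_derivative h2 x) (at x)"
  shows "pd i (\<lambda>v. h ((norm v)\<^sup>2)) v = 2 * h1 ((norm v)\<^sup>2) * v $ i"
    and "pd i (pd j (\<lambda>v. h ((norm v)\<^sup>2))) v = 2 * h1 ((norm v)\<^sup>2) * (if i = j then 1 else 0) + 4 * h2 ((norm v)\<^sup>2) * (v $ i * v $ j)"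
proof -
  have ax: "axis i (1::real) $ j = (if i = j then 1 else 0)" by (simp add: axis_def)
  have n: "((\<lambda>v::r3. (norm v)\<^sup>2) has_derivative (\<lambda>h. 2 * (v \<bullet> h))) (at v)" for v
    using norm_sq_derivative[of 0 v] by simp
  have e: "pd i (\<lambda>v. h ((norm v)\<^sup>2)) = (\<lambda>v. 2 * h1 ((norm v)\<^sup>2) * v $ i)" for i
    using partial_chain(2)[OF h n, of _ "axis i 1"] by (simp add: fun_eq_iff inner_axis)
  then show "pd i (\<lambda>v. h ((norm v)\<^sup>2)) v = 2 * h1 ((norm v)\<^sup>2) * v $ i" by simp
  have "((\<lambda>v. h1 ((norm v)\<^sup>2)) has_derivative (\<lambda>k. h2 ((norm v)\<^sup>2) * (2 * (v \<bullet> k)))) (at v)"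
    using has_derivative_compose[OF n, of h1 "(*) (h2 ((norm v)\<^sup>2))"] h1[of "(norm v)\<^sup>2"] by (simp add: has_field_derivative_def)
  moreover have "((\<lambda>v::r3. v $ j) has_derivative (\<lambda>k. k $ j)) (at v)"
    by (rule bounded_linear_imp_has_derivative[OF bounded_linear_vec_nth])
  ultimately have "((\<lambda>v. 2 * (h1 ((norm v)\<^sup>2) * v $ j)) has_derivative
      (\<lambda>k. 2 * (h1 ((norm v)\<^sup>2) * k $ j + (h2 ((norm v)\<^sup>2) * (2 * (v \<bullet> k))) * v $ j))) (at v)"
    by (intro has_derivative_mult_right has_derivative_mult)
  from frechet_derivative_at[OF this, symmetric]
  show "pd i (pd j (\<lambda>v. h ((norm v)\<^sup>2))) v = 2 * h1 ((norm v)\<^sup>2) * (if i = j then 1 else 0) + 4 * h2 ((norm v)\<^sup>2) * (v $ i * v $ j)"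
    unfolding e mult.assoc partial_def by (simp add: inner_axis ax algebra_simps)
qed

text \<open>With z = v - w: the trace of the matrix is 2 |z|^(\<gamma>+2), its quadratic form at v
  is |z|^\<gamma> \<open>gram v w\<close>, and |z|^2 - 2 (z, v) = |w|^2 - |v|^2 combines the trace
  with the drift.\<close>

lemma landau_L_radial:
  assumes h: "\<And>x. 0 \<le> x \<Longrightarrow> (h has_real_derivative h1 x) (at x)"
    and h1: "\<And>x. 0 \<le> x \<Longrightarrow> (h1 has_real_derivative h2 x) (at x)"
  shows "landau_L \<gamma> (\<lambda>v. h ((norm v)\<^sup>2)) v w = 4 * norm (v - w) powr \<gamma> *
     (h1 ((norm v)\<^sup>2) * ((norm w)\<^sup>2 - (norm v)\<^sup>2) + h2 ((norm v)\<^sup>2) * gram v w)"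
proof -
  have e1: "pd i (\<lambda>v. h ((norm v)\<^sup>2)) v = 2 * h1 ((norm v)\<^sup>2) * v $ i" for i
    by (rule radial_derivatives(1)[OF h h1])
  have e2: "pd i (pd j (\<lambda>v. h ((norm v)\<^sup>2))) v
     = 2 * h1 ((norm v)\<^sup>2) * (if i = j then 1 else 0) + 4 * h2 ((norm v)\<^sup>2) * (v $ i * v $ j)" for i j
    by (rule radial_derivatives(2)[OF h h1])
  define N a b where "N = norm (v - w) powr \<gamma>" and "a = h1 ((norm v)\<^sup>2)" and "b = h2 ((norm v)\<^sup>2)"
  show ?thesis
    unfolding landau_L_def landau_a_eq landau_b_eq e1 e2 sum_3
      N_def[symmetric] a_def[symmetric] b_def[symmetric] ka_def kb_def gram_def
    by (simp add: N_def[symmetric] norm_sq_3 inner_3) (simp add: algebra_simps power2_eq_square)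
qed

lemma landau_L_radial_sym:
  assumes h: "\<And>x. 0 \<le> x \<Longrightarrow> (h has_real_derivative h1 x) (at x)"
    and h1: "\<And>x. 0 \<le> x \<Longrightarrow> (h1 has_real_derivative h2 x) (at x)"
  shows "landau_L \<gamma> (\<lambda>v. h ((norm v)\<^sup>2)) v w + landau_L \<gamma> (\<lambda>v. h ((norm v)\<^sup>2)) w v = symL \<gamma> h1 h2 v w"
proof -
  have e: "landau_L \<gamma> (\<lambda>v. h ((norm v)\<^sup>2)) v w = 4 * norm (v - w) powr \<gamma> *
     (h1 ((norm v)\<^sup>2) * ((norm w)\<^sup>2 - (norm v)\<^sup>2) + h2 ((norm v)\<^sup>2) * gram v w)" for v w
    by (rule landau_L_radial[OF h h1])
  show ?thesis unfolding e symL_def gram_commute[of w v] norm_minus_commute[of w v]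
    by (simp add: algebra_simps)
qed

lemma jbracket_powr_eq: "jbracket v powr r = (1 + (norm v)\<^sup>2) powr (r / 2)"
proof -
  have "jbracket v powr r = (jbracket v powr 2) powr (r / 2)" by (simp only: powr_powr) simp
  then show ?thesis by (simp add: jbracket_powr_2)
qed

text \<open>For |v - w| \<ge> 1 the power is at most 1; for smaller distances \<open>gram\<close>
  supplies the factor |v - w|^2, which beats |v - w|^\<gamma>.\<close>

lemma powr_gram_le:
  assumes \<gamma>: "-2 \<le> \<gamma>" "\<gamma> < 0"
  shows "norm (v - w) powr \<gamma> * gram v w \<le> (jbracket v)\<^sup>2 * (jbracket w)\<^sup>2"
proof (cases "v = w")
  case False
  then have z: "0 < norm (v - w)" by simp
  have Jn: "(norm x)\<^sup>2 \<le> (jbracket x)\<^sup>2" for x by (simp add: jbracket_sq)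
  show ?thesis
  proof (cases "1 \<le> norm (v - w)")
    case True
    have "norm (v - w) powr \<gamma> \<le> norm (v - w) powr 0" using True \<gamma> by (intro powr_mono) auto
    then have "norm (v - w) powr \<gamma> * gram v w \<le> 1 * (norm v * norm w)\<^sup>2"
      using gram_le gram_nonneg z by (intro mult_mono) auto
    also have "\<dots> \<le> (jbracket v)\<^sup>2 * (jbracket w)\<^sup>2"
      using Jn[of v] Jn[of w] by (simp add: power_mult_distrib mult_mono)
    finally show ?thesis .
  next
    case le: False
    have "norm (v - w) powr \<gamma> * gram v w \<le> norm (v - w) powr \<gamma> * (norm (v - w) * norm w)\<^sup>2"
      by (intro mult_left_mono gram_le_diff) auto
    also have "\<dots> = norm (v - w) powr (\<gamma> + 2) * (norm w)\<^sup>2"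
      using norm_powr_shift[of "v - w" \<gamma> 2] by (simp add: power_mult_distrib)
    also have "\<dots> \<le> 1 * (jbracket w)\<^sup>2"
      using le \<gamma> Jn by (intro mult_mono powr_le1) auto
    also have "\<dots> \<le> (jbracket v)\<^sup>2 * (jbracket w)\<^sup>2"
      by (intro mult_right_mono) (auto simp: jbracket_sq)
    finally show ?thesis .
  qed
qed (simp add: gram_def dot_square_norm power2_eq_square)

text \<open>With s the square root of \<open>gram v w\<close>, the bound s \<le> |v| |w| is raised
  to the power 2 + \<gamma> and s \<le> |v - w| |w| to the power -\<gamma>. The exponents add up to
  2 and the kernel cancels exactly, so only <v>^(2+\<gamma>) is paid in the larger velocity.\<close>

lemma powr_gram_le_max:
  assumes \<gamma>: "-2 \<le> \<gamma>" "\<gamma> < 0"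
  shows "norm (v - w) powr \<gamma> * gram v w \<le> jbracket v powr (2 + \<gamma>) * (jbracket w)\<^sup>2"
proof (cases "gram v w = 0")
  case False
  define s where "s = sqrt (gram v w)"
  have s: "0 < s" "s\<^sup>2 = gram v w" using False gram_nonneg[of v w] by (auto simp: s_def)
  have s1: "s \<le> norm v * norm w" unfolding s_def using gram_le by (intro real_le_lsqrt) auto
  have s2: "s \<le> norm (v - w) * norm w" unfolding s_def using gram_le_diff by (intro real_le_lsqrt) auto
  have z: "0 < norm (v - w)" using s2 s by (metis less_le_trans linorder_not_less mult_eq_0_iff norm_ge_zero order_le_less)
  have w: "0 < norm w" using s2 s by (metis less_le_trans linorder_not_less mult_eq_0_iff norm_ge_zero order_le_less)
  have "s\<^sup>2 = s powr (2 + \<gamma>) * s powr (- \<gamma>)" using s by (simp only: powr_add[symmetric]) simp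
  also have "\<dots> \<le> (norm v * norm w) powr (2 + \<gamma>) * (norm (v - w) * norm w) powr (- \<gamma>)"
    using s s1 s2 \<gamma> by (intro mult_mono powr_mono2) auto
  also have "\<dots> = norm v powr (2 + \<gamma>) * (norm w powr (2 + \<gamma>) * norm w powr (- \<gamma>)) * norm (v - w) powr (- \<gamma>)"
    by (simp add: powr_mult)
  also have "norm w powr (2 + \<gamma>) * norm w powr (- \<gamma>) = (norm w)\<^sup>2"
    using w by (simp only: powr_add[symmetric]) simp
  finally have "norm (v - w) powr \<gamma> * s\<^sup>2 \<le> norm (v - w) powr \<gamma> * (norm v powr (2 + \<gamma>) * (norm w)\<^sup>2 * norm (v - w) powr (- \<gamma>))"
    by (intro mult_left_mono) auto
  also have "\<dots> = norm v powr (2 + \<gamma>) * (norm w)\<^sup>2 * (norm (v - w) powr \<gamma> * norm (v - w) powr (- \<gamma>))"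
    by (simp add: ac_simps)
  also have "norm (v - w) powr \<gamma> * norm (v - w) powr (- \<gamma>) = 1"
    using z by (simp only: powr_add[symmetric]) simp
  also have "norm v powr (2 + \<gamma>) * (norm w)\<^sup>2 * 1 \<le> jbracket v powr (2 + \<gamma>) * (jbracket w)\<^sup>2 * 1"
    using \<gamma> norm_le_jbracket[of v] norm_le_jbracket[of w] by (intro mult_right_mono mult_mono powr_mono2 power_mono) auto
  finally show ?thesis using s by simp
qed simp

text \<open>At distance at least 1 the kernel is dropped. Close to the diagonal the mean value
  theorem gives a second factor |v|^2 - |w|^2, the inner product of v - w and v + w, and the two
  factors together absorb the singularity.\<close>

lemma symL_dominated_aux:
  fixes v w :: r3
  assumes \<gamma>: "-2 \<le> \<gamma>" "\<gamma> < 0" and a: "1 < a" and C: "0 \<le> C"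
    and h1: "\<And>x. 0 \<le> x \<Longrightarrow> (h1 has_real_derivative h2 x) (at x)"
    and b1: "\<And>x. 0 \<le> x \<Longrightarrow> \<bar>h1 x\<bar> \<le> C * (1 + x) powr (a - 1)"
    and b2: "\<And>x. 0 \<le> x \<Longrightarrow> \<bar>h2 x\<bar> \<le> C * (1 + x) powr (a - 2)"
    and le: "norm w \<le> norm v"
  shows "norm (v - w) powr \<gamma> * \<bar>(h1 ((norm v)\<^sup>2) - h1 ((norm w)\<^sup>2)) * ((norm v)\<^sup>2 - (norm w)\<^sup>2)\<bar> \<le> 4 * C * (1 + (norm v)\<^sup>2) powr a"
proof (cases "v = w")
  case False
  define x y where "x = (norm v)\<^sup>2" and "y = (norm w)\<^sup>2"
  have xy: "0 \<le> y" "y \<le> x" using le by (auto simp: x_def y_def intro: power_mono)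
  have z: "0 < norm (v - w)" using False by simp
  have X: "(1 + x) powr (a - 1) * (1 + x) = (1 + x) powr a" using xy by (simp add: powr_mult_base powr_diff)
  have "norm (v - w) powr \<gamma> * \<bar>(h1 x - h1 y) * (x - y)\<bar> \<le> 4 * C * (1 + x) powr a"
  proof (cases "1 \<le> norm (v - w)")
    case True
    have "norm (v - w) powr \<gamma> \<le> norm (v - w) powr 0" using True \<gamma> by (intro powr_mono) auto
    then have n1: "norm (v - w) powr \<gamma> \<le> 1" using z by simp
    have "(1 + y) powr (a - 1) \<le> (1 + x) powr (a - 1)" using xy a by (intro powr_mono2) auto
    then have "C * (1 + y) powr (a - 1) \<le> C * (1 + x) powr (a - 1)" using C by (intro mult_left_mono)
    then have "\<bar>h1 x - h1 y\<bar> \<le> 2 * (C * (1 + x) powr (a - 1))"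
      using b1[of x] b1[of y] xy by linarith
    then have "\<bar>h1 x - h1 y\<bar> * \<bar>x - y\<bar> \<le> 2 * (C * (1 + x) powr (a - 1)) * (1 + x)"
      using xy C by (intro mult_mono) auto
    also have "\<dots> = 2 * C * (1 + x) powr a" unfolding X[symmetric] by simp
    finally have prod: "\<bar>h1 x - h1 y\<bar> * \<bar>x - y\<bar> \<le> 2 * C * (1 + x) powr a" .
    have "norm (v - w) powr \<gamma> * \<bar>(h1 x - h1 y) * (x - y)\<bar> \<le> 1 * (2 * C * (1 + x) powr a)"
      unfolding abs_mult by (rule mult_mono[OF n1 prod]) auto
    also have "\<dots> \<le> 4 * C * (1 + x) powr a" using C by simp
    finally show ?thesis .
  next
    case lt: False
    have mvt: "\<bar>h1 x - h1 y\<bar> \<le> C * (1 + x) powr (a - 1) * \<bar>x - y\<bar>"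
    proof (cases "y = x")
      case False
      then have yx: "y < x" using xy by simp
      obtain \<xi> where \<xi>: "y < \<xi>" "\<xi> < x" "h1 x - h1 y = (x - y) * h2 \<xi>"
        using MVT2[OF yx, of h1 h2] h1 xy by (meson order_trans)
      have "\<bar>h2 \<xi>\<bar> \<le> C * (1 + \<xi>) powr (a - 2)" using b2 \<xi> xy by simp
      also have "\<dots> \<le> C * (1 + x) powr (a - 1)"
      proof (intro mult_left_mono C)
        have "(1 + \<xi>) powr (a - 2) \<le> (1 + \<xi>) powr (a - 1)" using \<xi> xy by (intro powr_mono) auto
        also have "\<dots> \<le> (1 + x) powr (a - 1)" using \<xi> xy a by (intro powr_mono2) auto
        finally show "(1 + \<xi>) powr (a - 2) \<le> (1 + x) powr (a - 1)" .
      qed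
      finally have "\<bar>x - y\<bar> * \<bar>h2 \<xi>\<bar> \<le> \<bar>x - y\<bar> * (C * (1 + x) powr (a - 1))" by (intro mult_left_mono) auto
      then show ?thesis unfolding \<xi>(3) abs_mult by (simp add: ac_simps)
    qed simp
    have sq: "\<bar>x - y\<bar> * \<bar>x - y\<bar> \<le> (norm (v - w))\<^sup>2 * (4 * (1 + x))"
    proof -
      have "x - y = (v - w) \<bullet> (v + w)"
        unfolding x_def y_def power2_norm_eq_inner by (simp add: inner_diff_left inner_add_right inner_commute[of w v])
      then have "\<bar>x - y\<bar> \<le> norm (v - w) * norm (v + w)" using Cauchy_Schwarz_ineq2 by simp
      also have "\<dots> \<le> norm (v - w) * (2 * norm v)"
        using norm_triangle_ineq[of v w] le by (intro mult_left_mono) auto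
      finally have "\<bar>x - y\<bar>\<^sup>2 \<le> (norm (v - w) * (2 * norm v))\<^sup>2" by (intro power_mono) auto
      also have "\<dots> = (norm (v - w))\<^sup>2 * (4 * x)" by (simp add: x_def power_mult_distrib)
      also have "\<dots> \<le> (norm (v - w))\<^sup>2 * (4 * (1 + x))" by (intro mult_left_mono) auto
      finally show ?thesis by (simp add: power2_eq_square)
    qed
    have "\<bar>(h1 x - h1 y) * (x - y)\<bar> \<le> C * (1 + x) powr (a - 1) * \<bar>x - y\<bar> * \<bar>x - y\<bar>"
      unfolding abs_mult using mvt by (intro mult_right_mono) auto
    also have "\<dots> \<le> C * (1 + x) powr (a - 1) * ((norm (v - w))\<^sup>2 * (4 * (1 + x)))"
      unfolding mult.assoc[of _ "\<bar>x - y\<bar>"] using sq C by (intro mult_left_mono) auto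
    also have "\<dots> = (norm (v - w))\<^sup>2 * (4 * C * (1 + x) powr a)" unfolding X[symmetric] by (simp add: ac_simps)
    finally have "norm (v - w) powr \<gamma> * \<bar>(h1 x - h1 y) * (x - y)\<bar> \<le> norm (v - w) powr \<gamma> * ((norm (v - w))\<^sup>2 * (4 * C * (1 + x) powr a))"
      by (intro mult_left_mono) auto
    also have "\<dots> = norm (v - w) powr (\<gamma> + 2) * (4 * C * (1 + x) powr a)"
      using norm_powr_shift[of "v - w" \<gamma> 2] by (simp add: mult.assoc[symmetric])
    also have "\<dots> \<le> 1 * (4 * C * (1 + x) powr a)"
      using lt \<gamma> C by (intro mult_right_mono powr_le1) auto
    finally show ?thesis by simp
  qed
  then show ?thesis by (simp add: x_def y_def)
qed (use C in simp)

text \<open>The bound sees \<open>h1\<close> and \<open>h2\<close> only through \<open>C\<close>,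
  hence is uniform over truncations. The constant is 20 = 4 (1 + 4): 1 from the second derivative, 4
  from the difference of first derivatives.\<close>

lemma symL_dominated:
  assumes \<gamma>: "-2 \<le> \<gamma>" "\<gamma> < 0" and r: "2 < r" and C: "0 \<le> C"
    and h1: "\<And>x. 0 \<le> x \<Longrightarrow> (h1 has_real_derivative h2 x) (at x)"
    and b1: "\<And>x. 0 \<le> x \<Longrightarrow> \<bar>h1 x\<bar> \<le> C * (1 + x) powr (r / 2 - 1)"
    and b2: "\<And>x. 0 \<le> x \<Longrightarrow> \<bar>h2 x\<bar> \<le> C * (1 + x) powr (r / 2 - 2)"
  shows "\<bar>symL \<gamma> h1 h2 v w\<bar> \<le> 20 * C * (jbracket v powr r * (jbracket w)\<^sup>2 + jbracket w powr r * (jbracket v)\<^sup>2)"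
proof -
  define A B where "A = jbracket v powr r * (jbracket w)\<^sup>2" and "B = jbracket w powr r * (jbracket v)\<^sup>2"
  have AB: "0 \<le> A" "0 \<le> B" by (auto simp: A_def B_def)
  define T where "T = norm (v - w) powr \<gamma> * \<bar>(h1 ((norm v)\<^sup>2) - h1 ((norm w)\<^sup>2)) * ((norm v)\<^sup>2 - (norm w)\<^sup>2)\<bar>"
  have r2: "1 < r / 2" using r by simp
  have J1: "1 \<le> (jbracket v)\<^sup>2" "1 \<le> (jbracket w)\<^sup>2" by (simp_all add: jbracket_sq)
  have T: "T \<le> 4 * C * (A + B)"
  proof (cases "norm w \<le> norm v")
    case True
    have "T \<le> 4 * C * jbracket v powr r"
      unfolding T_def jbracket_powr_eq by (rule symL_dominated_aux[OF \<gamma> r2 C h1 b1 b2 True])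
    also have "\<dots> \<le> 4 * C * A" unfolding A_def using C J1 by (intro mult_left_mono) (auto simp: mult_le_cancel_left1)
    also have "\<dots> \<le> 4 * C * (A + B)" using C AB by (intro mult_left_mono) auto
    finally show ?thesis .
  next
    case False
    have "T = norm (w - v) powr \<gamma> * \<bar>(h1 ((norm w)\<^sup>2) - h1 ((norm v)\<^sup>2)) * ((norm w)\<^sup>2 - (norm v)\<^sup>2)\<bar>"
      by (simp add: T_def norm_minus_commute abs_mult abs_minus_commute)
    also have "\<dots> \<le> 4 * C * jbracket w powr r"
      unfolding jbracket_powr_eq by (rule symL_dominated_aux[OF \<gamma> r2 C h1 b1 b2]) (use False in auto)
    also have "\<dots> \<le> 4 * C * B" unfolding B_def using C J1 by (intro mult_left_mono) (auto simp: mult_le_cancel_left1)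
    also have "\<dots> \<le> 4 * C * (A + B)" using C AB by (intro mult_left_mono) auto
    finally show ?thesis .
  qed
  define U where "U = norm (v - w) powr \<gamma> * gram v w"
  have U: "0 \<le> U" "U \<le> (jbracket v)\<^sup>2 * (jbracket w)\<^sup>2"
    using powr_gram_le[OF \<gamma>] gram_nonneg by (auto simp: U_def)
  have p: "jbracket x powr (r - 4) * (jbracket x)\<^sup>2 \<le> jbracket x powr r" for x
  proof -
    have "jbracket x powr (r - 4) * (jbracket x)\<^sup>2 = jbracket x powr (r - 2)"
      using powr_add[of "jbracket x" "r - 4" 2] by (simp add: less_imp_le)
    then show ?thesis using jbracket_powr_mono[of "r - 2" r x] by simp
  qed
  have h2: "\<bar>h2 ((norm x)\<^sup>2)\<bar> \<le> C * jbracket x powr (r - 4)" for x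
    using b2[of "(norm x)\<^sup>2"] unfolding jbracket_powr_eq by (simp add: diff_divide_distrib)
  have "\<bar>h2 ((norm v)\<^sup>2)\<bar> * U \<le> (C * jbracket v powr (r - 4)) * ((jbracket v)\<^sup>2 * (jbracket w)\<^sup>2)"
    using h2 U C by (intro mult_mono) auto
  also have "\<dots> = C * ((jbracket v powr (r - 4) * (jbracket v)\<^sup>2) * (jbracket w)\<^sup>2)" by (simp add: ac_simps)
  also have "\<dots> \<le> C * A" unfolding A_def using C p by (intro mult_left_mono mult_right_mono) auto
  finally have 1: "\<bar>h2 ((norm v)\<^sup>2)\<bar> * U \<le> C * A" .
  have "\<bar>h2 ((norm w)\<^sup>2)\<bar> * U \<le> (C * jbracket w powr (r - 4)) * ((jbracket v)\<^sup>2 * (jbracket w)\<^sup>2)"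
    using h2 U C by (intro mult_mono) auto
  also have "\<dots> = C * ((jbracket w powr (r - 4) * (jbracket w)\<^sup>2) * (jbracket v)\<^sup>2)" by (simp add: ac_simps)
  also have "\<dots> \<le> C * B" unfolding B_def using C p by (intro mult_left_mono mult_right_mono) auto
  finally have 2: "\<bar>h2 ((norm w)\<^sup>2)\<bar> * U \<le> C * B" .
  define T' where "T' = norm (v - w) powr \<gamma> * ((h1 ((norm v)\<^sup>2) - h1 ((norm w)\<^sup>2)) * ((norm v)\<^sup>2 - (norm w)\<^sup>2))"
  have T': "\<bar>T'\<bar> = T" by (simp add: T'_def T_def abs_mult)
  have "symL \<gamma> h1 h2 v w = 4 * (h2 ((norm v)\<^sup>2) * U + h2 ((norm w)\<^sup>2) * U - T')"
    unfolding symL_def U_def T'_def by (simp add: algebra_simps)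
  also have "\<bar>\<dots>\<bar> \<le> 4 * (\<bar>h2 ((norm v)\<^sup>2) * U\<bar> + \<bar>h2 ((norm w)\<^sup>2) * U\<bar> + T)"
  proof -
    have "\<bar>4 * (p + q - s)\<bar> \<le> 4 * (\<bar>p\<bar> + \<bar>q\<bar> + \<bar>s\<bar>)" for p q s :: real
    proof -
      have "\<bar>p + q - s\<bar> \<le> \<bar>p\<bar> + \<bar>q\<bar> + \<bar>s\<bar>"
        using abs_triangle_ineq[of "p + q" "- s"] abs_triangle_ineq[of p q] by simp
      then show ?thesis by (simp add: abs_mult)
    qed
    then show ?thesis unfolding T'[symmetric] .
  qed
  also have "\<dots> \<le> 4 * (C * A + C * B + 4 * C * (A + B))"
    using 1 2 T U by (simp add: abs_mult)
  also have "\<dots> = 20 * C * (A + B)" by (simp add: algebra_simps)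
  finally show ?thesis by (simp add: A_def B_def)
qed

text \<open>First derivative of (1 + x)^a, followed by the second; for a = r / 2 and x = |v|^2 the
  power is <v>^r.\<close>

abbreviation "pw1 a \<equiv> (\<lambda>x::real. a * (1 + x) powr (a - 1))"
abbreviation "pw2 a \<equiv> (\<lambda>x::real. a * (a - 1) * (1 + x) powr (a - 2))"

lemma pw1_mono:
  assumes "1 < a" "0 \<le> x" "0 \<le> y"
  shows "0 \<le> (pw1 a x - pw1 a y) * (x - y)"
proof -
  have "pw1 a y \<le> pw1 a x" if "y \<le> x" "0 \<le> y" for x y
    using that assms by (intro mult_left_mono powr_mono2) auto
  then show ?thesis using assms by (cases "y \<le> x") (auto intro: mult_nonneg_nonneg mult_nonpos_nonpos)
qed

text \<open>For r \<le> 4 the second derivative is bounded by r^2 / 4, so the gain is controlled by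
  mass and energy alone; the other term has a sign by convexity and is dropped.\<close>

lemma symL_upper_low:
  assumes \<gamma>: "-2 \<le> \<gamma>" "\<gamma> < 0" and r: "2 < r" "r \<le> 4"
  shows "symL \<gamma> (pw1 (r/2)) (pw2 (r/2)) v w \<le> 2 * r\<^sup>2 * ((jbracket v)\<^sup>2 * (jbracket w)\<^sup>2)"
proof -
  define x y where "x = (norm v)\<^sup>2" and "y = (norm w)\<^sup>2"
  have xy: "0 \<le> x" "0 \<le> y" by (auto simp: x_def y_def)
  have b: "pw2 (r/2) x \<le> r\<^sup>2 / 4" "0 \<le> pw2 (r/2) x" if "0 \<le> x" for x
  proof -
    have "(1 + x) powr (r/2 - 2) \<le> (1 + x) powr 0" using that r by (intro powr_mono) auto
    then have "r/2 * (r/2 - 1) * (1 + x) powr (r/2 - 2) \<le> r/2 * (r/2) * 1"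
      using that r by (intro mult_mono) auto
    then show "pw2 (r/2) x \<le> r\<^sup>2 / 4" by (simp add: power2_eq_square)
    show "0 \<le> pw2 (r/2) x" using r that by auto
  qed
  have "symL \<gamma> (pw1 (r/2)) (pw2 (r/2)) v w = 4 * ((pw2 (r/2) x + pw2 (r/2) y) * (norm (v - w) powr \<gamma> * gram v w))
     - 4 * norm (v - w) powr \<gamma> * ((pw1 (r/2) x - pw1 (r/2) y) * (x - y))"
    unfolding symL_def x_def[symmetric] y_def[symmetric] by (simp add: algebra_simps)
  also have "\<dots> \<le> 4 * ((pw2 (r/2) x + pw2 (r/2) y) * (norm (v - w) powr \<gamma> * gram v w))"
    using pw1_mono[of "r/2" x y] r xy by simp
  also have "\<dots> \<le> 4 * ((r\<^sup>2 / 4 + r\<^sup>2 / 4) * ((jbracket v)\<^sup>2 * (jbracket w)\<^sup>2))"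
    using b(2)[OF xy(1)] b(2)[OF xy(2)] gram_nonneg[of v w]
    by (intro mult_left_mono mult_mono[OF add_mono[OF b(1)[OF xy(1)] b(1)[OF xy(2)]] powr_gram_le[OF \<gamma>]]) auto
  also have "\<dots> = 2 * r\<^sup>2 * ((jbracket v)\<^sup>2 * (jbracket w)\<^sup>2)" by simp
  finally show ?thesis .
qed

text \<open>For |w| \<le> |v| the second derivative gives <v>^(r-4) and the refined bound on
  \<open>gram\<close> another <v>^(2+\<gamma>): a gain of order r - 2 + \<gamma>. When moreover |v|
  \<ge> 2 |w| and |v| \<ge> 1, the convexity term is of full order r + \<gamma>. The indicators,
  with thresholds 2 R + 1 and R, guarantee this regime.\<close>

lemma symL_upper_high:
  assumes \<gamma>: "-2 \<le> \<gamma>" "\<gamma> < 0" and r: "4 < r"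
  obtains c where "0 < c" "\<And>v w R. 0 \<le> R \<Longrightarrow> symL \<gamma> (pw1 (r/2)) (pw2 (r/2)) v w
    \<le> 2 * r\<^sup>2 * (jbracket v powr (r - 2 + \<gamma>) * (jbracket w)\<^sup>2 + jbracket w powr (r - 2 + \<gamma>) * (jbracket v)\<^sup>2)
      - c * (indicator {v. 2 * R + 1 \<le> norm v} v * jbracket v powr (r + \<gamma>) * indicator {w. norm w \<le> R} w)"
proof -
  define a where "a = r / 2"
  have a: "2 < a" using r by (simp add: a_def)
  \<comment> \<open>With x = |v|^2 \<ge> 1 and y = |w|^2 \<le> x / 4 one has 1 + y \<le> 5/8 (1 + x)
    and x - y \<ge> 3/8 (1 + x); the factor \<open>2 powr \<gamma>\<close> comes from |v - w| \<le>
    2 <v>.\<close>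
  define c where "c = 4 * 2 powr \<gamma> * (a * (1 - (5/8) powr (a - 1))) * (3/8)"
  have "(5/8) powr (a - 1) < (1::real)" using a powr_less_mono'[of "5/8" 0 "a - 1"] by simp
  then have c: "0 < c" using a by (simp add: c_def)
  have main: "symL \<gamma> (pw1 a) (pw2 a) v w \<le> 2 * r\<^sup>2 * (jbracket v powr (r - 2 + \<gamma>) * (jbracket w)\<^sup>2)
     - 4 * norm (v - w) powr \<gamma> * ((pw1 a ((norm v)\<^sup>2) - pw1 a ((norm w)\<^sup>2)) * ((norm v)\<^sup>2 - (norm w)\<^sup>2))"
    if le: "norm w \<le> norm v" for v w
  proof -
    define x y where "x = (norm v)\<^sup>2" and "y = (norm w)\<^sup>2"
    have xy: "0 \<le> y" "y \<le> x" using le by (auto simp: x_def y_def intro: power_mono)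
    have p2: "pw2 a x + pw2 a y \<le> r\<^sup>2 / 2 * jbracket v powr (r - 4)" "0 \<le> pw2 a x + pw2 a y"
    proof -
      have "(1 + y) powr (a - 2) \<le> (1 + x) powr (a - 2)" using xy a by (intro powr_mono2) auto
      then have i1: "a * (a - 1) * (1 + y) powr (a - 2) \<le> a * (a - 1) * (1 + x) powr (a - 2)" using a by (intro mult_left_mono) auto
      have i2: "a * (a - 1) * (1 + x) powr (a - 2) \<le> r\<^sup>2 / 4 * (1 + x) powr (a - 2)"
      proof (intro mult_right_mono)
        have "a * (a - 1) \<le> a * a" using a by (intro mult_left_mono) auto
        then show "a * (a - 1) \<le> r\<^sup>2 / 4" by (simp add: a_def power2_eq_square)
      qed simp
      have i3: "(1 + x) powr (a - 2) = jbracket v powr (r - 4)"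
        unfolding jbracket_powr_eq x_def a_def by (simp add: diff_divide_distrib)
      show "pw2 a x + pw2 a y \<le> r\<^sup>2 / 2 * jbracket v powr (r - 4)"
        using i1 i2 unfolding i3 by linarith
      show "0 \<le> pw2 a x + pw2 a y" using a by auto
    qed
    have "symL \<gamma> (pw1 a) (pw2 a) v w = 4 * ((pw2 a x + pw2 a y) * (norm (v - w) powr \<gamma> * gram v w))
       - 4 * norm (v - w) powr \<gamma> * ((pw1 a x - pw1 a y) * (x - y))"
      unfolding symL_def x_def[symmetric] y_def[symmetric] by (simp add: algebra_simps)
    moreover have "4 * ((pw2 a x + pw2 a y) * (norm (v - w) powr \<gamma> * gram v w))
      \<le> 4 * ((r\<^sup>2 / 2 * jbracket v powr (r - 4)) * (jbracket v powr (2 + \<gamma>) * (jbracket w)\<^sup>2))"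
      using gram_nonneg[of v w] by (intro mult_left_mono mult_mono[OF p2(1) powr_gram_le_max[OF \<gamma>]]) auto
    moreover have "4 * ((r\<^sup>2 / 2 * jbracket v powr (r - 4)) * (jbracket v powr (2 + \<gamma>) * (jbracket w)\<^sup>2))
       = 2 * r\<^sup>2 * (jbracket v powr (r - 2 + \<gamma>) * (jbracket w)\<^sup>2)"
    proof -
      have "jbracket v powr (r - 2 + \<gamma>) = jbracket v powr ((r - 4) + (2 + \<gamma>))"
        by (rule arg_cong[where f="\<lambda>s. jbracket v powr s"]) simp
      then have "jbracket v powr (r - 2 + \<gamma>) = jbracket v powr (r - 4) * jbracket v powr (2 + \<gamma>)"
        by (simp only: powr_add)
      then show ?thesis by simp
    qed
    ultimately show ?thesis unfolding x_def y_def by linarith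
  qed
  have neg: "c * jbracket v powr (r + \<gamma>) \<le> 4 * norm (v - w) powr \<gamma> * ((pw1 a ((norm v)\<^sup>2) - pw1 a ((norm w)\<^sup>2)) * ((norm v)\<^sup>2 - (norm w)\<^sup>2))"
    if v: "1 \<le> norm v" "2 * norm w \<le> norm v" for v w
  proof -
    define x y where "x = (norm v)\<^sup>2" and "y = (norm w)\<^sup>2"
    have "(2 * norm w)\<^sup>2 \<le> (norm v)\<^sup>2" using v by (intro power_mono) auto
    then have xy: "0 \<le> y" "4 * y \<le> x" by (auto simp: x_def y_def power_mult_distrib)
    have x1: "1 \<le> x" using v by (simp add: x_def)
    have "(1 + y) powr (a - 1) \<le> (5/8 * (1 + x)) powr (a - 1)" using xy x1 a by (intro powr_mono2) auto
    also have "\<dots> = (5/8) powr (a - 1) * (1 + x) powr (a - 1)" by (rule powr_mult)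
    finally have "a * (1 + y) powr (a - 1) \<le> a * ((5/8) powr (a - 1) * (1 + x) powr (a - 1))" using a by (intro mult_left_mono) auto
    then have d: "(a * (1 - (5/8) powr (a - 1))) * (1 + x) powr (a - 1) \<le> pw1 a x - pw1 a y" by (simp add: algebra_simps)
    have xy2: "(3/8) * (1 + x) \<le> x - y" using xy x1 by simp
    have ne: "v \<noteq> w" using v by auto
    have "norm (v - w) \<le> norm v + norm w" by (rule norm_triangle_ineq4)
    also have "\<dots> \<le> 2 * jbracket v" using v norm_le_jbracket[of v] by linarith
    finally have nz: "(2 * jbracket v) powr \<gamma> \<le> norm (v - w) powr \<gamma>" using ne \<gamma> by (intro powr_mono2') auto
    have p: "0 \<le> (a * (1 - (5/8) powr (a - 1))) * (1 + x) powr (a - 1)"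
      using a \<open>(5/8) powr (a - 1) < (1::real)\<close> by auto
    have "(1 + x) powr (a - 1) * (1 + x) = (1 + x) powr a" using x1 by (simp add: powr_diff)
    also have "\<dots> = jbracket v powr r" by (simp add: jbracket_powr_eq x_def a_def)
    finally have e: "(1 + x) powr (a - 1) * (1 + x) = jbracket v powr r" .
    have "c * jbracket v powr (r + \<gamma>) = 4 * (2 * jbracket v) powr \<gamma> * (((a * (1 - (5/8) powr (a - 1))) * (1 + x) powr (a - 1)) * ((3/8) * (1 + x)))"
      unfolding c_def powr_add e[symmetric] powr_mult by (simp only: mult.assoc mult.commute mult.left_commute)
    also have "\<dots> \<le> 4 * norm (v - w) powr \<gamma> * ((pw1 a x - pw1 a y) * (x - y))"
    proof (rule mult_mono)
      show "4 * (2 * jbracket v) powr \<gamma> \<le> 4 * norm (v - w) powr \<gamma>" using nz by simp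
      show "((a * (1 - (5/8) powr (a - 1))) * (1 + x) powr (a - 1)) * ((3/8) * (1 + x)) \<le> (pw1 a x - pw1 a y) * (x - y)"
        by (rule mult_mono[OF d xy2]) (use order.trans[OF p d] x1 in auto)
      show "0 \<le> ((a * (1 - (5/8) powr (a - 1))) * (1 + x) powr (a - 1)) * ((3/8) * (1 + x))"
        by (rule mult_nonneg_nonneg[OF p]) (use x1 in simp)
    qed simp
    finally show ?thesis by (simp add: x_def y_def)
  qed
  show ?thesis
  proof (rule that[OF c])
    fix v w :: r3 and R :: real assume R: "0 \<le> R"
    have pm: "0 \<le> (pw1 a ((norm v)\<^sup>2) - pw1 a ((norm w)\<^sup>2)) * ((norm v)\<^sup>2 - (norm w)\<^sup>2)" for v w :: r3
      using a by (intro pw1_mono) auto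
    have nn: "0 \<le> 2 * r\<^sup>2 * (jbracket v powr (r - 2 + \<gamma>) * (jbracket w)\<^sup>2)" for v w by simp
    define ind where "ind = indicator {v. 2 * R + 1 \<le> norm v} v * jbracket v powr (r + \<gamma>) * indicat_real {w. norm w \<le> R} w"
    have "symL \<gamma> (pw1 a) (pw2 a) v w \<le> 2 * r\<^sup>2 * (jbracket v powr (r - 2 + \<gamma>) * (jbracket w)\<^sup>2 + jbracket w powr (r - 2 + \<gamma>) * (jbracket v)\<^sup>2) - c * ind"
    proof (cases "norm w \<le> norm v")
      case True
      have "c * ind \<le> 4 * norm (v - w) powr \<gamma> * ((pw1 a ((norm v)\<^sup>2) - pw1 a ((norm w)\<^sup>2)) * ((norm v)\<^sup>2 - (norm w)\<^sup>2))"
      proof (cases "2 * R + 1 \<le> norm v \<and> norm w \<le> R")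
        case T: True
        then show ?thesis using neg[of v w] R by (auto simp: ind_def)
      next
        case False
        then have "ind = 0" by (auto simp: ind_def)
        then show ?thesis using pm[of v w] by simp
      qed
      then show ?thesis using main[OF True] nn[of w v] unfolding distrib_left by linarith
    next
      case False
      then have "ind = 0" using R by (auto simp: ind_def split: split_indicator)
      moreover have "symL \<gamma> (pw1 a) (pw2 a) v w \<le> 2 * r\<^sup>2 * (jbracket w powr (r - 2 + \<gamma>) * (jbracket v)\<^sup>2)"
      proof -
        have "0 \<le> 4 * norm (w - v) powr \<gamma> * ((pw1 a ((norm w)\<^sup>2) - pw1 a ((norm v)\<^sup>2)) * ((norm w)\<^sup>2 - (norm v)\<^sup>2))"
          using pm[of w v] by simp
        moreover have "norm v \<le> norm w" using False by simp
        ultimately show ?thesis using main[of v w] symL_commute[of \<gamma> "pw1 a" "pw2 a" v w] by linarith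
      qed
      ultimately show ?thesis using nn[of v w] unfolding distrib_left by (simp only: mult_zero_right)
    qed
    then show "symL \<gamma> (pw1 (r/2)) (pw2 (r/2)) v w
    \<le> 2 * r\<^sup>2 * (jbracket v powr (r - 2 + \<gamma>) * (jbracket w)\<^sup>2 + jbracket w powr (r - 2 + \<gamma>) * (jbracket v)\<^sup>2)
      - c * (indicator {v. 2 * R + 1 \<le> norm v} v * jbracket v powr (r + \<gamma>) * indicator {w. norm w \<le> R} w)"
      by (simp add: a_def ind_def)
  qed
qed

section \<open>Integrating the symmetrised kernel against a density\<close>

lemma pair_product:
  fixes g h :: "r3 \<Rightarrow> real"
  assumes g: "integrable lborel g" and h: "integrable lborel h"
  shows "integrable (lborel \<Otimes>\<^sub>M lborel) (\<lambda>(v, w). g v * h w)"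
    and "(\<integral>q. (case q of (v, w) \<Rightarrow> g v * h w) \<partial>(lborel \<Otimes>\<^sub>M lborel)) = (LBINT v. g v) * (LBINT w. h w)"
proof -
  have [measurable]: "g \<in> borel_measurable borel" "h \<in> borel_measurable borel"
    using g h by (auto dest: borel_measurable_integrable)
  show i: "integrable (lborel \<Otimes>\<^sub>M lborel) (\<lambda>(v, w). g v * h w)"
  proof (rule lborel_pair.Fubini_integrable)
    show "integrable lborel (\<lambda>v. \<integral>w. norm (case (v, w) of (v, w) \<Rightarrow> g v * h w) \<partial>lborel)"
      using g by (simp add: abs_mult)
    show "AE v in lborel. integrable lborel (\<lambda>w. case (v, w) of (v, w) \<Rightarrow> g v * h w)"
      using h by simp
  qed measurable
  show "(\<integral>q. (case q of (v, w) \<Rightarrow> g v * h w) \<partial>(lborel \<Otimes>\<^sub>M lborel)) = (LBINT v. g v) * (LBINT w. h w)"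
    using lborel_pair.integral_fst[OF i] by simp
qed

lemma weighted_integrable:
  assumes [measurable]: "u \<in> borel_measurable borel" and "\<And>v. 0 \<le> u v" "integrable lborel (\<lambda>v. u v * jbracket v powr r)" "s \<le> r"
  shows "integrable lborel (\<lambda>v. u v * jbracket v powr s)"
  by (rule Bochner_Integration.integrable_bound[OF assms(3)])
     (use assms jbracket_powr_mono[OF assms(4)] in \<open>auto simp: abs_mult intro!: mult_left_mono\<close>)

lemma symL_measurable:
  assumes [measurable]: "h1 \<in> borel_measurable borel" "h2 \<in> borel_measurable borel"
  shows "(\<lambda>(v, w). symL \<gamma> h1 h2 v w) \<in> borel_measurable (borel \<Otimes>\<^sub>M borel)"
  unfolding symL_def gram_def by measurable

lemma pw_facts:
  assumes "1 < a" "0 \<le> x"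
  shows "(pw1 a has_real_derivative pw2 a x) (at x)"
    "\<bar>pw1 a x\<bar> \<le> a\<^sup>2 * (1 + x) powr (a - 1)" "\<bar>pw2 a x\<bar> \<le> a\<^sup>2 * (1 + x) powr (a - 2)"
proof -
  show "(pw1 a has_real_derivative pw2 a x) (at x)"
    using assms by (auto intro!: derivative_eq_intros)
  have "a * 1 \<le> a * a" using assms by (intro mult_left_mono) auto
  then show "\<bar>pw1 a x\<bar> \<le> a\<^sup>2 * (1 + x) powr (a - 1)"
    using assms by (simp add: abs_mult power2_eq_square mult_right_mono)
  have "a * (a - 1) \<le> a * a" using assms by (intro mult_left_mono) auto
  then show "\<bar>pw2 a x\<bar> \<le> a\<^sup>2 * (1 + x) powr (a - 2)"
    using assms by (simp add: abs_mult power2_eq_square mult_right_mono)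
qed

text \<open>The last two claims provide a majorant depending on \<open>h1\<close> and
  \<open>h2\<close> only through \<open>C\<close>, which serves for all truncated powers at
  once.\<close>

lemma symL_pair_integrable:
  assumes \<gamma>: "-2 \<le> \<gamma>" "\<gamma> < 0" and r: "2 < r" and C: "0 \<le> C"
    and h1: "\<And>x. 0 \<le> x \<Longrightarrow> (h1 has_real_derivative h2 x) (at x)"
    and b1: "\<And>x. 0 \<le> x \<Longrightarrow> \<bar>h1 x\<bar> \<le> C * (1 + x) powr (r / 2 - 1)"
    and b2: "\<And>x. 0 \<le> x \<Longrightarrow> \<bar>h2 x\<bar> \<le> C * (1 + x) powr (r / 2 - 2)"
    and m: "h1 \<in> borel_measurable borel" "h2 \<in> borel_measurable borel"
    and u [measurable]: "u \<in> borel_measurable borel" and u0: "\<And>v. 0 \<le> u v"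
    and i2: "integrable lborel (\<lambda>v. u v * (jbracket v)\<^sup>2)" and ir: "integrable lborel (\<lambda>v. u v * jbracket v powr r)"
  shows "integrable (lborel \<Otimes>\<^sub>M lborel) (\<lambda>(v, w). u v * u w * symL \<gamma> h1 h2 v w)"
    and "\<bar>\<integral>q. (case q of (v, w) \<Rightarrow> u v * u w * symL \<gamma> h1 h2 v w) \<partial>(lborel \<Otimes>\<^sub>M lborel)\<bar>
      \<le> 40 * C * ((LBINT v. u v * jbracket v powr r) * (LBINT v. u v * (jbracket v)\<^sup>2))"
    and "integrable (lborel \<Otimes>\<^sub>M lborel) (\<lambda>(v, w). 20 * C * ((u v * jbracket v powr r) * (u w * (jbracket w)\<^sup>2) + (u v * (jbracket v)\<^sup>2) * (u w * jbracket w powr r)))"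
    and "\<And>v w. \<bar>u v * u w * symL \<gamma> h1 h2 v w\<bar> \<le> 20 * C * ((u v * jbracket v powr r) * (u w * (jbracket w)\<^sup>2) + (u v * (jbracket v)\<^sup>2) * (u w * jbracket w powr r))"
proof -
  let ?D = "\<lambda>(v, w). 20 * C * ((u v * jbracket v powr r) * (u w * (jbracket w)\<^sup>2) + (u v * (jbracket v)\<^sup>2) * (u w * jbracket w powr r))"
  note pp = pair_product[OF ir i2] pair_product[OF i2 ir]
  have eq: "?D = (\<lambda>q. 20 * C * ((case q of (v, w) \<Rightarrow> (u v * jbracket v powr r) * (u w * (jbracket w)\<^sup>2)) + (case q of (v, w) \<Rightarrow> (u v * (jbracket v)\<^sup>2) * (u w * jbracket w powr r))))"
    by (auto simp: fun_eq_iff)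
  show Di: "integrable (lborel \<Otimes>\<^sub>M lborel) ?D"
    unfolding eq by (intro integrable_mult_right Bochner_Integration.integrable_add pp)
  have Dv: "(\<integral>q. ?D q \<partial>(lborel \<Otimes>\<^sub>M lborel)) = 40 * C * ((LBINT v. u v * jbracket v powr r) * (LBINT v. u v * (jbracket v)\<^sup>2))"
    unfolding eq using pp by (simp add: algebra_simps)
  show bd: "\<bar>u v * u w * symL \<gamma> h1 h2 v w\<bar> \<le> 20 * C * ((u v * jbracket v powr r) * (u w * (jbracket w)\<^sup>2) + (u v * (jbracket v)\<^sup>2) * (u w * jbracket w powr r))" for v w
  proof -
    have "(u v * u w) * \<bar>symL \<gamma> h1 h2 v w\<bar> \<le> (u v * u w) * (20 * C * (jbracket v powr r * (jbracket w)\<^sup>2 + jbracket w powr r * (jbracket v)\<^sup>2))"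
      by (intro mult_left_mono symL_dominated[OF \<gamma> r C h1 b1 b2] mult_nonneg_nonneg u0)
    then show ?thesis using u0 by (simp add: abs_mult algebra_simps)
  qed
  have bd': "norm (case q of (v, w) \<Rightarrow> u v * u w * symL \<gamma> h1 h2 v w) \<le> ?D q" for q
    using bd by (cases q) auto
  have sm: "(\<lambda>(v, w). symL \<gamma> h1 h2 v w) \<in> borel_measurable (lborel \<Otimes>\<^sub>M lborel)"
    using symL_measurable[OF m] by (simp add: lborel_prod borel_prod)
  have mm: "(\<lambda>(v, w). u v * u w * symL \<gamma> h1 h2 v w) \<in> borel_measurable (lborel \<Otimes>\<^sub>M lborel)"
  proof -
    have "(\<lambda>q. (u (fst q) * u (snd q)) * (case q of (v, w) \<Rightarrow> symL \<gamma> h1 h2 v w)) \<in> borel_measurable (lborel \<Otimes>\<^sub>M lborel)"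
      by (intro borel_measurable_times sm) measurable
    then show ?thesis by (simp add: split_beta')
  qed
  show "integrable (lborel \<Otimes>\<^sub>M lborel) (\<lambda>(v, w). u v * u w * symL \<gamma> h1 h2 v w)"
    by (rule Bochner_Integration.integrable_bound[OF Di mm]) (intro AE_I2 order_trans[OF bd'], simp only: real_norm_def abs_ge_self)
  then show "\<bar>\<integral>q. (case q of (v, w) \<Rightarrow> u v * u w * symL \<gamma> h1 h2 v w) \<partial>(lborel \<Otimes>\<^sub>M lborel)\<bar>
      \<le> 40 * C * ((LBINT v. u v * jbracket v powr r) * (LBINT v. u v * (jbracket v)\<^sup>2))"
    unfolding Dv[symmetric] using bd' Di
    by (intro order_trans[OF integral_abs_bound] integral_mono integrable_abs) auto
qed

text \<open>For r > 4 half of the mass lies in a ball of radius R, so the loss is at least c M / 2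
  times the high velocity part of the moment of order r + \<gamma>. The gain has an order lower by 2
  and is beaten pointwise beyond a threshold A; below it the gain is at most K, which integrates to
  K M.\<close>

lemma symL_moment_bound:
  assumes \<gamma>: "-2 \<le> \<gamma>" "\<gamma> < 0" and r: "2 < r" and M: "0 < M" and E: "0 \<le> E"
  obtains C where "0 \<le> C"
    "\<And>u. u \<in> borel_measurable borel \<Longrightarrow> (\<And>v. 0 \<le> u v) \<Longrightarrow> integrable lborel u \<Longrightarrow> (LBINT v. u v) = M \<Longrightarrow>
      integrable lborel (\<lambda>v. u v * (jbracket v)\<^sup>2) \<Longrightarrow> (LBINT v. u v * (jbracket v)\<^sup>2) = E \<Longrightarrow>
      integrable lborel (\<lambda>v. u v * jbracket v powr r) \<Longrightarrow>
      (\<integral>q. (case q of (v, w) \<Rightarrow> u v * u w * symL \<gamma> (pw1 (r/2)) (pw2 (r/2)) v w) \<partial>(lborel \<Otimes>\<^sub>M lborel)) \<le> C"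
proof (cases "r \<le> 4")
  case True
  show ?thesis
  proof (rule that[of "2 * r\<^sup>2 * (E * E)"])
    fix u :: "r3 \<Rightarrow> real"
    assume u: "u \<in> borel_measurable borel" "\<And>v. 0 \<le> u v" "integrable lborel u" "(LBINT v. u v) = M"
      and e: "integrable lborel (\<lambda>v. u v * (jbracket v)\<^sup>2)" "(LBINT v. u v * (jbracket v)\<^sup>2) = E"
      and ir: "integrable lborel (\<lambda>v. u v * jbracket v powr r)"
    have a: "1 < r / 2" using r by simp
    have i: "integrable (lborel \<Otimes>\<^sub>M lborel) (\<lambda>(v, w). u v * u w * symL \<gamma> (pw1 (r/2)) (pw2 (r/2)) v w)"
      by (rule symL_pair_integrable(1)[OF \<gamma> r _ pw_facts[OF a] _ _ u(1,2) e(1) ir]) auto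
    note pp = pair_product[OF e(1) e(1)]
    have "(\<integral>q. (case q of (v, w) \<Rightarrow> u v * u w * symL \<gamma> (pw1 (r/2)) (pw2 (r/2)) v w) \<partial>(lborel \<Otimes>\<^sub>M lborel))
      \<le> (\<integral>q. 2 * r\<^sup>2 * (case q of (v, w) \<Rightarrow> (u v * (jbracket v)\<^sup>2) * (u w * (jbracket w)\<^sup>2)) \<partial>(lborel \<Otimes>\<^sub>M lborel))"
    proof (intro integral_mono i integrable_mult_right pp)
      fix q :: "r3 \<times> r3"
      obtain v w where q: "q = (v, w)" by (cases q)
      have "(u v * u w) * symL \<gamma> (pw1 (r/2)) (pw2 (r/2)) v w \<le> (u v * u w) * (2 * r\<^sup>2 * ((jbracket v)\<^sup>2 * (jbracket w)\<^sup>2))"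
        by (intro mult_left_mono symL_upper_low \<gamma> r True mult_nonneg_nonneg u)
      then show "(case q of (v, w) \<Rightarrow> u v * u w * symL \<gamma> (pw1 (r/2)) (pw2 (r/2)) v w) \<le> 2 * r\<^sup>2 * (case q of (v, w) \<Rightarrow> (u v * (jbracket v)\<^sup>2) * (u w * (jbracket w)\<^sup>2))"
        by (simp add: q ac_simps)
    qed
    also have "\<dots> = 2 * r\<^sup>2 * (E * E)" using pp e by simp
    finally show "(\<integral>q. (case q of (v, w) \<Rightarrow> u v * u w * symL \<gamma> (pw1 (r/2)) (pw2 (r/2)) v w) \<partial>(lborel \<Otimes>\<^sub>M lborel)) \<le> 2 * r\<^sup>2 * (E * E)" .
  qed (use E in simp)
next
  case False
  then have r4: "4 < r" by simp
  obtain c where c: "0 < c" "\<And>v w R. 0 \<le> R \<Longrightarrow> symL \<gamma> (pw1 (r/2)) (pw2 (r/2)) v w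
    \<le> 2 * r\<^sup>2 * (jbracket v powr (r - 2 + \<gamma>) * (jbracket w)\<^sup>2 + jbracket w powr (r - 2 + \<gamma>) * (jbracket v)\<^sup>2)
      - c * (indicator {v. 2 * R + 1 \<le> norm v} v * jbracket v powr (r + \<gamma>) * indicator {w. norm w \<le> R} w)"
    using symL_upper_high[OF \<gamma> r4] by blast
  define R where "R = sqrt (2 * E / M) + 1"
  have R: "1 \<le> R" "E / R\<^sup>2 \<le> M / 2"
  proof -
    show R1: "1 \<le> R" using M E by (simp add: R_def)
    have "2 * E / M = (sqrt (2 * E / M))\<^sup>2" using M E by simp
    also have "\<dots> \<le> R\<^sup>2" unfolding R_def using M E by (intro power_mono) auto
    finally show "E / R\<^sup>2 \<le> M / 2" using R1 M by (simp add: field_simps)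
  qed
  \<comment> \<open>The first entry places v in the region where the loss acts; the second makes 4
    r^2 E at most c (M / 2) <v>^2.\<close>
  define A where "A = max (2 * R + 2) (sqrt (8 * r\<^sup>2 * E / (c * M)))"
  define K where "K = 4 * r\<^sup>2 * E * A powr (r - 2 + \<gamma>)"
  have K0: "0 \<le> K" using E by (simp add: K_def)
  have pt: "4 * r\<^sup>2 * E * jbracket v powr (r - 2 + \<gamma>) - c * (M / 2) * (indicator {v. 2 * R + 1 \<le> norm v} v * jbracket v powr (r + \<gamma>)) \<le> K" for v
  proof (cases "A \<le> jbracket v")
    case True
    then have J: "2 * R + 2 \<le> jbracket v" "sqrt (8 * r\<^sup>2 * E / (c * M)) \<le> jbracket v" by (auto simp: A_def)
    have "(2 * R + 2)\<^sup>2 \<le> (jbracket v)\<^sup>2" using J R by (intro power_mono) auto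
    then have "(2 * R + 2)\<^sup>2 \<le> 1 + (norm v)\<^sup>2" by (simp only: jbracket_sq)
    moreover have "(2 * R + 2)\<^sup>2 = (2 * R + 1)\<^sup>2 + (4 * R + 3)" by (simp add: power2_eq_square algebra_simps)
    ultimately have "(2 * R + 1)\<^sup>2 \<le> (norm v)\<^sup>2" using R by linarith
    then have nv: "2 * R + 1 \<le> norm v" by (rule power2_le_imp_le) simp
    have "(sqrt (8 * r\<^sup>2 * E / (c * M)))\<^sup>2 \<le> (jbracket v)\<^sup>2" using J(2) c M E by (intro power_mono) auto
    then have "8 * r\<^sup>2 * E / (c * M) \<le> (jbracket v)\<^sup>2" using c M E by simp
    then have "4 * r\<^sup>2 * E \<le> c * (M / 2) * (jbracket v)\<^sup>2" using c M by (simp add: field_simps)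
    then have "4 * r\<^sup>2 * E * jbracket v powr (r - 2 + \<gamma>) \<le> c * (M / 2) * (jbracket v)\<^sup>2 * jbracket v powr (r - 2 + \<gamma>)"
      by (intro mult_right_mono) auto
    also have "\<dots> = c * (M / 2) * ((jbracket v)\<^sup>2 * jbracket v powr (r - 2 + \<gamma>))" by (simp only: mult.assoc)
    also have "(jbracket v)\<^sup>2 * jbracket v powr (r - 2 + \<gamma>) = jbracket v powr (r + \<gamma>)"
      using powr_add[of "jbracket v" 2 "r - 2 + \<gamma>"] by (simp add: less_imp_le)
    finally show ?thesis using nv K0 by simp
  next
    case F: False
    have "4 * r\<^sup>2 * E * jbracket v powr (r - 2 + \<gamma>) \<le> K"
      unfolding K_def using F r4 \<gamma> E by (intro mult_left_mono powr_mono2) (auto simp: less_imp_le)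
    moreover have "0 \<le> c * (M / 2) * (indicator {v. 2 * R + 1 \<le> norm v} v * jbracket v powr (r + \<gamma>))" using c M by simp
    ultimately show ?thesis by linarith
  qed
  show ?thesis
  proof (rule that[of "K * M"])
    fix u :: "r3 \<Rightarrow> real"
    assume u [measurable]: "u \<in> borel_measurable borel" and u0: "\<And>v. 0 \<le> u v" and ui: "integrable lborel u" and uM: "(LBINT v. u v) = M"
      and e: "integrable lborel (\<lambda>v. u v * (jbracket v)\<^sup>2)" "(LBINT v. u v * (jbracket v)\<^sup>2) = E"
      and ir: "integrable lborel (\<lambda>v. u v * jbracket v powr r)"
    have a: "1 < r / 2" using r by simp
    have i: "integrable (lborel \<Otimes>\<^sub>M lborel) (\<lambda>(v, w). u v * u w * symL \<gamma> (pw1 (r/2)) (pw2 (r/2)) v w)"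
      by (rule symL_pair_integrable(1)[OF \<gamma> r _ pw_facts[OF a] _ _ u u0 e(1) ir]) auto
    define g where "g = (\<lambda>v. u v * jbracket v powr (r - 2 + \<gamma>))"
    define n where "n = (\<lambda>v. u v * (indicator {v. 2 * R + 1 \<le> norm v} v * jbracket v powr (r + \<gamma>)))"
    define m where "m = (\<lambda>w. u w * indicat_real {w. norm w \<le> R} w)"
    have gi: "integrable lborel g" unfolding g_def by (rule weighted_integrable[OF u u0 ir]) (use \<gamma> in simp)
    have nni: "integrable lborel (\<lambda>v. u v * jbracket v powr (r + \<gamma>))" by (rule weighted_integrable[OF u u0 ir]) (use \<gamma> in simp)
    have ni: "integrable lborel n" unfolding n_def
      by (rule Bochner_Integration.integrable_bound[OF nni]) (auto simp: u0 split: split_indicator)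
    have mi: "integrable lborel m" unfolding m_def
      by (rule Bochner_Integration.integrable_bound[OF ui]) (auto simp: u0 split: split_indicator)
    have n0: "0 \<le> n v" for v using u0 by (simp add: n_def)
    have mM: "M / 2 \<le> (LBINT w. m w)"
    proof -
      have "M - E / R\<^sup>2 = (LBINT w. u w - u w * (jbracket w)\<^sup>2 / R\<^sup>2)" using ui e uM by simp
      also have "\<dots> \<le> (LBINT w. m w)"
      proof (intro integral_mono mi)
        show "integrable lborel (\<lambda>w. u w - u w * (jbracket w)\<^sup>2 / R\<^sup>2)" using ui e by simp
        fix w
        show "u w - u w * (jbracket w)\<^sup>2 / R\<^sup>2 \<le> m w"
        proof (cases "norm w \<le> R")
          case True then show ?thesis using u0[of w] by (simp add: m_def)
        next
          case F: False
          then have "R\<^sup>2 \<le> (norm w)\<^sup>2" using R by (intro power_mono) auto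
          then have "u w * R\<^sup>2 \<le> u w * (jbracket w)\<^sup>2" using u0 by (intro mult_left_mono) (auto simp: jbracket_sq)
          then have "u w \<le> u w * (jbracket w)\<^sup>2 / R\<^sup>2" using R by (simp add: field_simps)
          then show ?thesis using F by (simp add: m_def)
        qed
      qed
      finally show ?thesis using R by simp
    qed
    note pp = pair_product[OF gi e(1)] pair_product[OF e(1) gi] pair_product[OF ni mi]
    have "(\<integral>q. (case q of (v, w) \<Rightarrow> u v * u w * symL \<gamma> (pw1 (r/2)) (pw2 (r/2)) v w) \<partial>(lborel \<Otimes>\<^sub>M lborel))
      \<le> (\<integral>q. 2 * r\<^sup>2 * (case q of (v, w) \<Rightarrow> g v * (u w * (jbracket w)\<^sup>2)) + 2 * r\<^sup>2 * (case q of (v, w) \<Rightarrow> (u v * (jbracket v)\<^sup>2) * g w)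
        + (- c) * (case q of (v, w) \<Rightarrow> n v * m w) \<partial>(lborel \<Otimes>\<^sub>M lborel))"
    proof (intro integral_mono i Bochner_Integration.integrable_add integrable_mult_right pp)
      fix q :: "r3 \<times> r3"
      obtain v w where q: "q = (v, w)" by (cases q)
      have "(u v * u w) * symL \<gamma> (pw1 (r/2)) (pw2 (r/2)) v w \<le> (u v * u w) * (2 * r\<^sup>2 * (jbracket v powr (r - 2 + \<gamma>) * (jbracket w)\<^sup>2 + jbracket w powr (r - 2 + \<gamma>) * (jbracket v)\<^sup>2)
      - c * (indicator {v. 2 * R + 1 \<le> norm v} v * jbracket v powr (r + \<gamma>) * indicator {w. norm w \<le> R} w))"
        using R by (intro mult_left_mono c(2) mult_nonneg_nonneg u0) auto
      then show "(case q of (v, w) \<Rightarrow> u v * u w * symL \<gamma> (pw1 (r/2)) (pw2 (r/2)) v w) \<le>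
          2 * r\<^sup>2 * (case q of (v, w) \<Rightarrow> g v * (u w * (jbracket w)\<^sup>2)) + 2 * r\<^sup>2 * (case q of (v, w) \<Rightarrow> (u v * (jbracket v)\<^sup>2) * g w)
        + (- c) * (case q of (v, w) \<Rightarrow> n v * m w)"
        unfolding q prod.case g_def n_def m_def by (simp only: algebra_simps)
    qed
    also have "\<dots> = 2 * r\<^sup>2 * ((LBINT v. g v) * E) + 2 * r\<^sup>2 * (E * (LBINT v. g v)) + (- c) * ((LBINT v. n v) * (LBINT w. m w))"
      unfolding e(2)[symmetric] pp(2,4,6)[symmetric] by (intro integral_linear_comb3 pp)
    also have "\<dots> \<le> 4 * r\<^sup>2 * E * (LBINT v. g v) - c * (M / 2) * (LBINT v. n v)"
    proof -
      have "(LBINT v. n v) * (M / 2) \<le> (LBINT v. n v) * (LBINT w. m w)"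
        by (intro mult_left_mono mM integral_nonneg_AE AE_I2 n0)
      then have "c * ((LBINT v. n v) * (M / 2)) \<le> c * ((LBINT v. n v) * (LBINT w. m w))"
        by (rule mult_left_mono) (rule less_imp_le[OF c(1)])
      then show ?thesis by (simp add: algebra_simps)
    qed
    also have "\<dots> = (LBINT v. 4 * r\<^sup>2 * E * g v - c * (M / 2) * n v)" using gi ni by simp
    also have "\<dots> \<le> (LBINT v. K * u v)"
    proof (intro integral_mono)
      show "integrable lborel (\<lambda>v. 4 * r\<^sup>2 * E * g v - c * (M / 2) * n v)" using gi ni by simp
      show "integrable lborel (\<lambda>v. K * u v)" using ui by simp
      fix v
      from mult_left_mono[OF pt[of v] u0[of v]]
      show "4 * r\<^sup>2 * E * g v - c * (M / 2) * n v \<le> K * u v" unfolding g_def n_def by (simp only: algebra_simps)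
    qed
    also have "\<dots> = K * M" using uM by simp
    finally show "(\<integral>q. (case q of (v, w) \<Rightarrow> u v * u w * symL \<gamma> (pw1 (r/2)) (pw2 (r/2)) v w) \<partial>(lborel \<Otimes>\<^sub>M lborel)) \<le> K * M" .
  qed (use K0 M in simp)
qed

subsection \<open>Truncated powers\<close>

text \<open>The polynomials that \<open>bq_deriv\<close> produces for the first two derivatives of
  the basic cut-off \<open>bq 1\<close>.\<close>

definition bq1 :: "real poly" where "bq1 = [:0, 0, 1:] * (1 - pderiv 1)"
definition bq2 :: "real poly" where "bq2 = [:0, 0, 1:] * (bq1 - pderiv bq1)"

lemma bq_bounded: obtains B where "0 \<le> B" "\<And>y. y \<le> 1 \<Longrightarrow> \<bar>bq q y\<bar> \<le> B"
proof -
  have "bounded (bq q ` {0..1})"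
    by (intro compact_imp_bounded compact_continuous_image bq_continuous) simp
  then obtain B where B: "0 < B" "\<And>y. y \<in> {0..1} \<Longrightarrow> \<bar>bq q y\<bar> \<le> B" unfolding bounded_pos by auto
  have "\<bar>bq q y\<bar> \<le> B" if "y \<le> 1" for y
    using B that by (cases "0 \<le> y") (auto simp: bq_def)
  with B(1) that[of B] show ?thesis by simp
qed

text \<open>The factor \<open>exp 1\<close> makes \<open>tp a R\<close> converge to \<open>(1 + x) powr a\<close> as \<open>R\<close> tends to infinity.\<close>

definition tp :: "real \<Rightarrow> real \<Rightarrow> real \<Rightarrow> real" where
  "tp a R x = exp 1 * ((1 + x) powr a * bq 1 (1 - x / R))"
definition tp1 :: "real \<Rightarrow> real \<Rightarrow> real \<Rightarrow> real" where
  "tp1 a R x = exp 1 * (a * (1 + x) powr (a - 1) * bq 1 (1 - x / R) - (1 + x) powr a * (bq bq1 (1 - x / R) / R))"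
definition tp2 :: "real \<Rightarrow> real \<Rightarrow> real \<Rightarrow> real" where
  "tp2 a R x = exp 1 * (a * (a - 1) * (1 + x) powr (a - 2) * bq 1 (1 - x / R)
     - 2 * (a * (1 + x) powr (a - 1) * (bq bq1 (1 - x / R) / R)) + (1 + x) powr a * (bq bq2 (1 - x / R) / R\<^sup>2))"

lemma bq_scaled_deriv: "((\<lambda>x. bq q (1 - x / R)) has_real_derivative - (bq ([:0, 0, 1:] * (q - pderiv q)) (1 - x / R) / R)) (at x)"
proof -
  have "((\<lambda>x. 1 - x / R) has_real_derivative - (1 / R)) (at x)"
    by (auto intro!: derivative_eq_intros simp: divide_inverse)
  from DERIV_chain2[OF bq_deriv this] show ?thesis by simp
qed

lemma tp_deriv:
  assumes "0 \<le> x"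
  shows "(tp a R has_real_derivative tp1 a R x) (at x)" "(tp1 a R has_real_derivative tp2 a R x) (at x)"
proof -
  have pw: "((\<lambda>x. (1 + x) powr b) has_real_derivative b * (1 + x) powr (b - 1)) (at x)" for b
    using assms by (auto intro!: derivative_eq_intros)
  note b0 = bq_scaled_deriv[of 1 R x, folded bq1_def] and b1 = bq_scaled_deriv[of bq1 R x, folded bq2_def]
  show "(tp a R has_real_derivative tp1 a R x) (at x)"
    unfolding tp_def[abs_def]
    by (rule DERIV_cong[OF DERIV_cmult[OF DERIV_mult[OF pw b0]]]) (simp add: tp1_def algebra_simps)
  have b1': "((\<lambda>x. bq bq1 (1 - x / R) / R) has_real_derivative - (bq bq2 (1 - x / R) / R) / R) (at x)"
    by (rule DERIV_cdivide[OF b1])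
  show "(tp1 a R has_real_derivative tp2 a R x) (at x)"
    unfolding tp1_def[abs_def]
    by (rule DERIV_cong[OF DERIV_cmult[OF DERIV_diff[OF DERIV_mult[OF DERIV_cmult[OF pw] b0] DERIV_mult[OF pw b1']]]])
      (simp add: tp2_def algebra_simps power2_eq_square)
qed

text \<open>Each derivative falling on the cut-off costs 1 / R, but on its support x < R, and with R
  \<ge> 1 this gives 1 / R \<le> 2 / (1 + x). Thus every derivative lowers the power by one,
  uniformly in R.\<close>

lemma tp_bounds:
  assumes a: "1 < a"
  obtains C where "0 \<le> C" "\<And>x R. 0 \<le> x \<Longrightarrow> 1 \<le> R \<Longrightarrow> \<bar>tp a R x\<bar> \<le> C * (1 + x) powr a"
    "\<And>x R. 0 \<le> x \<Longrightarrow> 1 \<le> R \<Longrightarrow> \<bar>tp1 a R x\<bar> \<le> C * (1 + x) powr (a - 1)"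
    "\<And>x R. 0 \<le> x \<Longrightarrow> 1 \<le> R \<Longrightarrow> \<bar>tp2 a R x\<bar> \<le> C * (1 + x) powr (a - 2)"
proof -
  obtain B0 where B0: "0 \<le> B0" "\<And>y. y \<le> 1 \<Longrightarrow> \<bar>bq 1 y\<bar> \<le> B0" using bq_bounded by blast
  obtain B1 where B1: "0 \<le> B1" "\<And>y. y \<le> 1 \<Longrightarrow> \<bar>bq bq1 y\<bar> \<le> B1" using bq_bounded by blast
  obtain B2 where B2: "0 \<le> B2" "\<And>y. y \<le> 1 \<Longrightarrow> \<bar>bq bq2 y\<bar> \<le> B2" using bq_bounded by blast
  define B where "B = B0 + B1 + B2"
  have B: "0 \<le> B" "\<And>y. y \<le> 1 \<Longrightarrow> \<bar>bq 1 y\<bar> \<le> B" "\<And>y. y \<le> 1 \<Longrightarrow> \<bar>bq bq1 y\<bar> \<le> B" "\<And>y. y \<le> 1 \<Longrightarrow> \<bar>bq bq2 y\<bar> \<le> B"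
    using B0 B1 B2 by (force simp: B_def)+
  define C where "C = exp 1 * (B * (a\<^sup>2 + 4 * a + 4))"
  have sc: "\<bar>bq q (1 - x / R) / R\<bar> \<le> 2 * B / (1 + x)" "\<bar>bq q (1 - x / R) / R\<^sup>2\<bar> \<le> 4 * B / (1 + x)\<^sup>2"
    if q: "\<And>y. y \<le> 1 \<Longrightarrow> \<bar>bq q y\<bar> \<le> B" and x: "0 \<le> x" "1 \<le> R" for q x R
  proof -
    have "\<bar>bq q (1 - x / R) / R\<bar> \<le> 2 * B / (1 + x) \<and> \<bar>bq q (1 - x / R) / R\<^sup>2\<bar> \<le> 4 * B / (1 + x)\<^sup>2"
    proof (cases "x < R")
      case True
      have R: "1 / R \<le> 2 / (1 + x)" using True x by (simp add: divide_simps)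
      then have R2: "(1 / R)\<^sup>2 \<le> (2 / (1 + x))\<^sup>2" using x by (intro power_mono) auto
      have b: "\<bar>bq q (1 - x / R)\<bar> \<le> B" using x by (intro q) auto
      have "\<bar>bq q (1 - x / R)\<bar> * (1 / R) \<le> B * (2 / (1 + x))" using b R x B by (intro mult_mono) auto
      moreover have "\<bar>bq q (1 - x / R)\<bar> * (1 / R)\<^sup>2 \<le> B * (2 / (1 + x))\<^sup>2" using b R2 x B by (intro mult_mono) auto
      ultimately show ?thesis using x by (simp add: power_divide mult.commute)
    next
      case False
      then have "1 - x / R \<le> 0" using x by simp
      then have "bq q (1 - x / R) = 0" by (simp add: bq_def)
      then show ?thesis using x B by simp
    qed
    then show "\<bar>bq q (1 - x / R) / R\<bar> \<le> 2 * B / (1 + x)" "\<bar>bq q (1 - x / R) / R\<^sup>2\<bar> \<le> 4 * B / (1 + x)\<^sup>2" by auto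
  qed
  have a2: "1 \<le> a\<^sup>2 + 4 * a + 4" "a + 2 \<le> a\<^sup>2 + 4 * a + 4" using a by (auto simp: power2_eq_square add_increasing)
  show ?thesis
  proof (rule that[of C])
    show "0 \<le> C" unfolding C_def using a B by (intro mult_nonneg_nonneg) auto
    fix x R :: real assume x: "0 \<le> x" "1 \<le> R"
    define X where "X = 1 + x"
    have X: "0 < X" using x by (simp add: X_def)
    have y: "1 - x / R \<le> 1" using x by simp
    have p1: "X powr (a - 1) = X powr a / X" and p2: "X powr (a - 2) = X powr a / X\<^sup>2"
      using X by (simp_all add: powr_diff)
    define P where "P = X powr a"
    have P: "0 \<le> P" by (simp add: P_def)
    note s1 = sc[OF B(3) x] and s2 = sc[OF B(4) x] and b0 = B(2)[OF y]
    have "\<bar>tp a R x\<bar> = exp 1 * (P * \<bar>bq 1 (1 - x / R)\<bar>)" by (simp add: tp_def P_def X_def abs_mult)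
    also have "\<dots> \<le> exp 1 * (P * B)" using b0 P by (intro mult_left_mono) auto
    also have "\<dots> \<le> C * P"
    proof -
      have "B * 1 \<le> B * (a\<^sup>2 + 4 * a + 4)" using a2 B by (intro mult_left_mono) auto
      then have "exp 1 * (P * B) \<le> exp 1 * (P * (B * (a\<^sup>2 + 4 * a + 4)))" using P by (intro mult_left_mono) auto
      then show ?thesis by (simp add: C_def ac_simps)
    qed
    finally show "\<bar>tp a R x\<bar> \<le> C * (1 + x) powr a" by (simp add: P_def X_def)
    have t1: "\<bar>a * (P / X) * bq 1 (1 - x / R)\<bar> \<le> a * (P / X) * B"
      unfolding abs_mult using b0 P X a by (intro mult_mono) auto
    have t2: "\<bar>P * (bq bq1 (1 - x / R) / R)\<bar> \<le> P * (2 * B / X)"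
      unfolding abs_mult[of P] using s1(1) P by (intro mult_mono) (auto simp: X_def)
    have "\<bar>tp1 a R x\<bar> = exp 1 * \<bar>a * (P / X) * bq 1 (1 - x / R) - P * (bq bq1 (1 - x / R) / R)\<bar>"
      unfolding tp1_def X_def[symmetric] p1 P_def[symmetric] by (simp add: abs_mult)
    also have "\<dots> \<le> exp 1 * (a * (P / X) * B + P * (2 * B / X))"
      using t1 t2 abs_triangle_ineq4[of "a * (P / X) * bq 1 (1 - x / R)" "P * (bq bq1 (1 - x / R) / R)"]
      by (intro mult_left_mono, linarith, simp)
    also have "\<dots> = exp 1 * (B * (a + 2) * (P / X))" by (simp add: algebra_simps)
    also have "\<dots> \<le> exp 1 * (B * (a\<^sup>2 + 4 * a + 4) * (P / X))"
      using a2 B P X by (intro mult_left_mono mult_right_mono) auto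
    also have "\<dots> = C * (1 + x) powr (a - 1)" unfolding X_def[symmetric] p1 P_def[symmetric] C_def by simp
    finally show "\<bar>tp1 a R x\<bar> \<le> C * (1 + x) powr (a - 1)" .
    have u1: "\<bar>a * (a - 1) * (P / X\<^sup>2) * bq 1 (1 - x / R)\<bar> \<le> a * (a - 1) * (P / X\<^sup>2) * B"
      unfolding abs_mult[of "a * (a - 1) * (P / X\<^sup>2)"] using b0 P X a by (intro mult_mono) auto
    have u2: "\<bar>2 * (a * (P / X) * (bq bq1 (1 - x / R) / R))\<bar> \<le> 2 * (a * (P / X) * (2 * B / X))"
    proof -
      have "\<bar>a * (P / X) * (bq bq1 (1 - x / R) / R)\<bar> \<le> a * (P / X) * (2 * B / X)"
        unfolding abs_mult[of "a * (P / X)"] using s1(1) P X a by (intro mult_mono) (auto simp: X_def)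
      then show ?thesis by simp
    qed
    have u3: "\<bar>P * (bq bq2 (1 - x / R) / R\<^sup>2)\<bar> \<le> P * (4 * B / X\<^sup>2)"
      unfolding abs_mult[of P] using s2(2) P by (intro mult_mono) (auto simp: X_def)
    have "\<bar>tp2 a R x\<bar> = exp 1 * \<bar>a * (a - 1) * (P / X\<^sup>2) * bq 1 (1 - x / R)
     - 2 * (a * (P / X) * (bq bq1 (1 - x / R) / R)) + P * (bq bq2 (1 - x / R) / R\<^sup>2)\<bar>"
      unfolding tp2_def X_def[symmetric] p1 p2 P_def[symmetric] by (simp add: abs_mult)
    also have "\<dots> \<le> exp 1 * (a * (a - 1) * (P / X\<^sup>2) * B + 2 * (a * (P / X) * (2 * B / X)) + P * (4 * B / X\<^sup>2))"
    proof (rule mult_left_mono)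
      have tri: "\<bar>p1 - p2 + p3\<bar> \<le> q1 + q2 + q3" if "\<bar>p1\<bar> \<le> q1" "\<bar>p2\<bar> \<le> q2" "\<bar>p3\<bar> \<le> q3" for p1 p2 p3 q1 q2 q3 :: real
        using that by linarith
      show "\<bar>a * (a - 1) * (P / X\<^sup>2) * bq 1 (1 - x / R)
        - 2 * (a * (P / X) * (bq bq1 (1 - x / R) / R)) + P * (bq bq2 (1 - x / R) / R\<^sup>2)\<bar>
        \<le> a * (a - 1) * (P / X\<^sup>2) * B + 2 * (a * (P / X) * (2 * B / X)) + P * (4 * B / X\<^sup>2)"
        by (rule tri[OF u1 u2 u3])
    qed simp
    also have "\<dots> = exp 1 * (B * (a\<^sup>2 + 3 * a + 4) * (P / X\<^sup>2))"
      using X by (simp add: field_simps power2_eq_square)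
    also have "\<dots> \<le> exp 1 * (B * (a\<^sup>2 + 4 * a + 4) * (P / X\<^sup>2))"
      using a B P X by (intro mult_left_mono mult_right_mono) auto
    also have "\<dots> = C * (1 + x) powr (a - 2)" unfolding X_def[symmetric] p2 P_def[symmetric] C_def by simp
    finally show "\<bar>tp2 a R x\<bar> \<le> C * (1 + x) powr (a - 2)" .
  qed
qed

lemma tp_limits:
  shows "(\<lambda>n. tp a (real (Suc n)) x) \<longlonglongrightarrow> (1 + x) powr a"
    "(\<lambda>n. tp1 a (real (Suc n)) x) \<longlonglongrightarrow> pw1 a x" "(\<lambda>n. tp2 a (real (Suc n)) x) \<longlonglongrightarrow> pw2 a x"
proof -
  have inv: "(\<lambda>n. 1 / real (Suc n)) \<longlonglongrightarrow> 0"
    using LIMSEQ_inverse_real_of_nat by (simp add: inverse_eq_divide)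
  have "(\<lambda>n. 1 - x * (1 / real (Suc n))) \<longlonglongrightarrow> 1 - x * 0" by (intro tendsto_intros inv)
  then have y: "(\<lambda>n. 1 - x / real (Suc n)) \<longlonglongrightarrow> 1" by simp
  have b: "(\<lambda>n. bq q (1 - x / real (Suc n))) \<longlonglongrightarrow> bq q 1" for q
    by (rule isCont_tendsto_compose[OF DERIV_isCont[OF bq_deriv] y])
  have b1: "(\<lambda>n. bq q (1 - x / real (Suc n)) / real (Suc n)) \<longlonglongrightarrow> 0" for q
    using tendsto_mult[OF b[of q] inv] by simp
  have b2: "(\<lambda>n. bq q (1 - x / real (Suc n)) / (real (Suc n))\<^sup>2) \<longlonglongrightarrow> 0" for q
    using tendsto_mult[OF b1[of q] inv] by (simp add: power2_eq_square)
  have e: "exp 1 * (c * bq 1 1) = c" for c :: real by (simp add: bq_def exp_minus)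
  have "(\<lambda>n. tp a (real (Suc n)) x) \<longlonglongrightarrow> exp 1 * ((1 + x) powr a * bq 1 1)"
    unfolding tp_def by (intro tendsto_mult tendsto_const b)
  then show "(\<lambda>n. tp a (real (Suc n)) x) \<longlonglongrightarrow> (1 + x) powr a" unfolding e .
  have "(\<lambda>n. tp1 a (real (Suc n)) x) \<longlonglongrightarrow> exp 1 * (a * (1 + x) powr (a - 1) * bq 1 1 - (1 + x) powr a * 0)"
    unfolding tp1_def by (intro tendsto_mult tendsto_diff tendsto_const b b1)
  then show "(\<lambda>n. tp1 a (real (Suc n)) x) \<longlonglongrightarrow> pw1 a x" by (simp only: mult_zero_right diff_0_right e)
  have "(\<lambda>n. tp2 a (real (Suc n)) x) \<longlonglongrightarrow> exp 1 * (a * (a - 1) * (1 + x) powr (a - 2) * bq 1 1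
     - 2 * (a * (1 + x) powr (a - 1) * 0) + (1 + x) powr a * 0)"
    unfolding tp2_def by (intro tendsto_mult tendsto_diff tendsto_add tendsto_const b b1 b2)
  then show "(\<lambda>n. tp2 a (real (Suc n)) x) \<longlonglongrightarrow> pw2 a x" by (simp only: mult_zero_right diff_0_right add_0_right e)
qed

lemma bq_measurable [measurable]: "bq q \<in> borel_measurable borel"
  by (intro borel_measurable_continuous_onI bq_continuous)

lemma tp_measurable: "tp1 a R \<in> borel_measurable borel" "tp2 a R \<in> borel_measurable borel"
  unfolding tp1_def[abs_def] tp2_def[abs_def] by measurable

section \<open>Growth of moments along a solution\<close>

context landau_solution
begin

lemma L1w_norm_f: "0 \<le> t \<Longrightarrow> L1w_norm r (f t) = (LBINT v. f t v * jbracket v powr r)"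
  using f_nonneg[of t] by (simp add: L1w_norm_def)

lemma moments:
  assumes r: "0 \<le> r" and fin: "in_L1w r fin" and T: "0 \<le> T"
  obtains K where "0 \<le> K" "\<And>t. t \<in> {0..T} \<Longrightarrow> integrable lborel (\<lambda>v. f t v * jbracket v powr r)"
    "\<And>t. t \<in> {0..T} \<Longrightarrow> (LBINT v. f t v * jbracket v powr r) \<le> K"
proof -
  obtain K where K: "\<forall>t\<in>{0..T}. in_L1w r (f t) \<and> L1w_norm r (f t) \<le> K"
    using mom r fin T unfolding keeps_moments_def f_0 by blast
  have "integrable lborel (\<lambda>v. f t v * jbracket v powr r)" "(LBINT v. f t v * jbracket v powr r) \<le> K" if t: "t \<in> {0..T}" for t
  proof -
    have t0: "0 \<le> t" using t by simp
    have "integrable lborel (\<lambda>v. \<bar>f t v\<bar> * jbracket v powr r)" using K t by (auto simp: in_L1w_def)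
    then show "integrable lborel (\<lambda>v. f t v * jbracket v powr r)" using f_nonneg[OF t0] by simp
    show "(LBINT v. f t v * jbracket v powr r) \<le> K" using bspec[OF K t] L1w_norm_f[OF t0, of r] by simp
  qed
  then show ?thesis using that[of "max K 0"] by (auto intro: order_trans[OF _ max.cobounded1])
qed

definition symW :: "(real \<Rightarrow> real) \<Rightarrow> (real \<Rightarrow> real) \<Rightarrow> real \<Rightarrow> real" where
  "symW h1 h2 t = (\<integral>q. (case q of (v, w) \<Rightarrow> f t v * f t w * symL \<gamma> h1 h2 v w) \<partial>(lborel \<Otimes>\<^sub>M lborel))"

text \<open>Lebesgue measure on pairs is invariant under exchanging v and w, so the integral of
  \<open>landau_L\<close> is half that of its symmetrisation.\<close>

lemma W_radial:
  assumes t: "0 < t" and \<phi>: "test_function (\<lambda>v. h ((norm v)\<^sup>2))"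
    and h: "\<And>x. 0 \<le> x \<Longrightarrow> (h has_real_derivative h1 x) (at x)"
    and h1: "\<And>x. 0 \<le> x \<Longrightarrow> (h1 has_real_derivative h2 x) (at x)"
  shows "W (\<lambda>v. h ((norm v)\<^sup>2)) t = symW h1 h2 t / 2"
proof -
  define \<phi> where "\<phi> = (\<lambda>v::r3. h ((norm v)\<^sup>2))"
  have tf: "test_function \<phi>" using \<phi> by (simp add: \<phi>_def)
  obtain p where "snapshot \<gamma> p (f t) (\<lambda>i. pd i (f t)) (\<lambda>i j. pd i (pd j (f t)))" using snapshot_f[OF t] by blast
  then interpret snapshot \<gamma> p "f t" "\<lambda>i. pd i (f t)" "\<lambda>i j. pd i (pd j (f t))" .
  obtain B where B: "\<And>i v. \<bar>pd i \<phi> v\<bar> \<le> B" "\<And>i j v. \<bar>pd i (pd j \<phi>) v\<bar> \<le> B"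
    using test_functionD(6)[OF tf] by blast
  define g where "g = (\<lambda>v w. f t v * f t w * landau_L \<gamma> \<phi> v w)"
  have gi: "integrable (lborel \<Otimes>\<^sub>M lborel) (\<lambda>(v, w). g v w)"
    unfolding g_def landau_L_def landau_a_eq landau_b_eq
    by (rule pair_L_integrable[OF B]) (auto intro!: borel_measurable_continuous_onI test_functionD[OF tf])
  have gm: "(\<lambda>(v, w). g v w) \<in> borel_measurable (lborel \<Otimes>\<^sub>M lborel)" using gi by (rule borel_measurable_integrable)
  have swap: "(\<integral>q. (case q of (v, w) \<Rightarrow> g w v) \<partial>(lborel \<Otimes>\<^sub>M lborel)) = (\<integral>q. (case q of (v, w) \<Rightarrow> g v w) \<partial>(lborel \<Otimes>\<^sub>M lborel))"
    using lborel_pair.integral_product_swap[OF gm] by (simp add: split_beta')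
  have gi': "integrable (lborel \<Otimes>\<^sub>M lborel) (\<lambda>(v, w). g w v)"
    using lborel_pair.integrable_product_swap[OF gi] by (simp add: split_beta')
  have e: "f t v * f t w * symL \<gamma> h1 h2 v w = g v w + g w v" for v w
  proof -
    have "landau_L \<gamma> \<phi> v w + landau_L \<gamma> \<phi> w v = symL \<gamma> h1 h2 v w"
      unfolding \<phi>_def by (rule landau_L_radial_sym[OF h h1])
    then show ?thesis by (simp add: g_def algebra_simps flip: distrib_left)
  qed
  have "symW h1 h2 t = (\<integral>q. (case q of (v, w) \<Rightarrow> g v w) + (case q of (v, w) \<Rightarrow> g w v) \<partial>(lborel \<Otimes>\<^sub>M lborel))"
    unfolding symW_def e by (simp add: split_beta')
  also have "\<dots> = 2 * (\<integral>q. (case q of (v, w) \<Rightarrow> g v w) \<partial>(lborel \<Otimes>\<^sub>M lborel))"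
    using gi gi' swap by simp
  also have "(\<integral>q. (case q of (v, w) \<Rightarrow> g v w) \<partial>(lborel \<Otimes>\<^sub>M lborel)) = W \<phi> t"
    by (simp add: W_def g_def lborel_prod)
  finally show ?thesis by (simp add: \<phi>_def)
qed

text \<open>The weak formulation is tested with truncated powers and the limit is taken in space and
  in time by domination. Truncation destroys convexity and with it the sign of the loss term, so the
  bound \<open>C\<close> is used only after the limit. The assumed finite moments enter
  qualitatively, through the majorants.\<close>

lemma moment_growth:
  assumes r: "2 < r" and fin: "in_L1w r fin" and T: "0 < T"
    and C: "\<And>t. 0 < t \<Longrightarrow> integrable lborel (\<lambda>v. f t v * jbracket v powr r) \<Longrightarrow> symW (pw1 (r/2)) (pw2 (r/2)) t \<le> C" and C0: "0 \<le> C"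
  shows "L1w_norm r (f T) \<le> L1w_norm r fin + C * T"
proof -
  define a where "a = r / 2"
  have a: "1 < a" using r by (simp add: a_def)
  have r0: "0 \<le> r" using r by simp
  obtain K where K: "0 \<le> K" "\<And>t. t \<in> {0..T} \<Longrightarrow> integrable lborel (\<lambda>v. f t v * jbracket v powr r)"
    "\<And>t. t \<in> {0..T} \<Longrightarrow> (LBINT v. f t v * jbracket v powr r) \<le> K"
    using moments[OF r0 fin less_imp_le[OF T]] by blast
  obtain B where B: "0 \<le> B" "\<And>x R. 0 \<le> x \<Longrightarrow> 1 \<le> R \<Longrightarrow> \<bar>tp a R x\<bar> \<le> B * (1 + x) powr a"
    "\<And>x R. 0 \<le> x \<Longrightarrow> 1 \<le> R \<Longrightarrow> \<bar>tp1 a R x\<bar> \<le> B * (1 + x) powr (a - 1)"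
    "\<And>x R. 0 \<le> x \<Longrightarrow> 1 \<le> R \<Longrightarrow> \<bar>tp2 a R x\<bar> \<le> B * (1 + x) powr (a - 2)"
    using tp_bounds[OF a] by blast
  define \<phi> where "\<phi> = (\<lambda>n (v::r3). tp a (real (Suc n)) ((norm v)\<^sup>2))"
  have \<phi>: "test_function (\<phi> n)" for n
  proof -
    have "\<phi> n = (\<lambda>v. (exp 1 * jbracket v powr r) * bq 1 (1 - (norm (v - 0))\<^sup>2 / real (Suc n)))"
      unfolding \<phi>_def tp_def a_def jbracket_powr_eq by (simp add: mult.assoc)
    moreover have "test_function (\<lambda>v::r3. (exp 1 * jbracket v powr r) * bq 1 (1 - (norm (v - 0))\<^sup>2 / real (Suc n)))"
      by (rule test_function_bq) (auto intro!: Ck_on_add_mult(3) Ck_on_const Ck_on_jbracket_powr)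
    ultimately show ?thesis by simp
  qed
  have \<phi>m [measurable]: "\<phi> n \<in> borel_measurable borel" for n
    by (intro borel_measurable_continuous_onI test_functionD(1)[OF \<phi>])
  have \<phi>b: "\<bar>\<phi> n v\<bar> \<le> B * jbracket v powr r" for n v
    using B(2)[of "(norm v)\<^sup>2" "real (Suc n)"] by (simp add: \<phi>_def jbracket_powr_eq a_def)
  have \<phi>l: "(\<lambda>n. \<phi> n v) \<longlonglongrightarrow> jbracket v powr r" for v
    unfolding \<phi>_def using tp_limits(1)[of a "(norm v)\<^sup>2"] by (simp add: jbracket_powr_eq a_def)
  have lim: "(\<lambda>n. \<integral>v. \<phi> n v * f t v \<partial>lborel) \<longlonglongrightarrow> L1w_norm r (f t)" if t: "t \<in> {0..T}" for t
  proof -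
    have t0: "0 \<le> t" using t by simp
    note [measurable] = f_measurable[OF t0]
    have "(\<lambda>n. \<integral>v. \<phi> n v * f t v \<partial>lborel) \<longlonglongrightarrow> (LBINT v. jbracket v powr r * f t v)"
    proof (rule integral_dominated_convergence)
      show "integrable lborel (\<lambda>v. B * (f t v * jbracket v powr r))" by (intro integrable_mult_right K(2) t)
      show "AE v in lborel. (\<lambda>n. \<phi> n v * f t v) \<longlonglongrightarrow> jbracket v powr r * f t v"
        by (intro AE_I2 tendsto_mult \<phi>l tendsto_const)
      show "AE v in lborel. norm (\<phi> n v * f t v) \<le> B * (f t v * jbracket v powr r)" for n
      proof (intro AE_I2)
        fix v show "norm (\<phi> n v * f t v) \<le> B * (f t v * jbracket v powr r)"
          using mult_right_mono[OF \<phi>b[of n v] f_nonneg[OF t0, of v]] f_nonneg[OF t0, of v] by (simp add: abs_mult ac_simps)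
      qed
    qed measurable
    then show ?thesis by (simp add: L1w_norm_f[OF t0] mult.commute)
  qed
  define h1 h2 where "h1 = (\<lambda>n. tp1 a (real (Suc n)))" and "h2 = (\<lambda>n. tp2 a (real (Suc n)))"
  have Wn: "W (\<phi> n) t = symW (h1 n) (h2 n) t / 2" if "0 < t" for n t
    unfolding \<phi>_def h1_def h2_def using \<phi>[of n] that by (intro W_radial tp_deriv) (simp_all add: \<phi>_def)
  have hd: "\<And>x. 0 \<le> x \<Longrightarrow> (h1 n has_real_derivative h2 n x) (at x)"
    and hb1: "\<And>x. 0 \<le> x \<Longrightarrow> \<bar>h1 n x\<bar> \<le> B * (1 + x) powr (r / 2 - 1)"
    and hb2: "\<And>x. 0 \<le> x \<Longrightarrow> \<bar>h2 n x\<bar> \<le> B * (1 + x) powr (r / 2 - 2)"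
    and hm: "h1 n \<in> borel_measurable borel" "h2 n \<in> borel_measurable borel" for n
    unfolding h1_def h2_def a_def[symmetric] using tp_deriv(2) B(3,4) tp_measurable by auto
  define Wi where "Wi = symW (pw1 a) (pw2 a)"
  define E where "E = M0 + E0"
  have E: "0 \<le> E" unfolding E_def conserved(5)[OF order_refl, symmetric]
    by (intro integral_nonneg_AE AE_I2 mult_nonneg_nonneg f_nonneg) auto
  have sb: "\<bar>symW (h1 n) (h2 n) t\<bar> \<le> 40 * B * (K * E)" and sl: "(\<lambda>n. symW (h1 n) (h2 n) t) \<longlonglongrightarrow> Wi t" if t: "0 < t" "t \<le> T" for n t
  proof -
    have t0: "0 \<le> t" and tT: "t \<in> {0..T}" using t by auto
    note u = f_measurable[OF t0] f_nonneg[OF t0] conserved(3)[OF t0] K(2)[OF tT]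
    note S = symL_pair_integrable[OF \<gamma>_ge \<gamma>_neg r B(1) hd hb1 hb2 hm u]
    have "\<bar>symW (h1 n) (h2 n) t\<bar> \<le> 40 * B * ((LBINT v. f t v * jbracket v powr r) * (LBINT v. f t v * (jbracket v)\<^sup>2))"
      unfolding symW_def by (rule S(2))
    also have "\<dots> \<le> 40 * B * (K * E)"
      unfolding conserved(5)[OF t0] E_def[symmetric] using B(1) E K(3)[OF tT] by (intro mult_left_mono mult_right_mono) auto
    finally show "\<bar>symW (h1 n) (h2 n) t\<bar> \<le> 40 * B * (K * E)" .
    show "(\<lambda>n. symW (h1 n) (h2 n) t) \<longlonglongrightarrow> Wi t"
      unfolding symW_def Wi_def
    proof (rule integral_dominated_convergence)
      let ?D = "\<lambda>(v, w). 20 * B * ((f t v * jbracket v powr r) * (f t w * (jbracket w)\<^sup>2) + (f t v * (jbracket v)\<^sup>2) * (f t w * jbracket w powr r))"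
      show "integrable (lborel \<Otimes>\<^sub>M lborel) ?D" by (rule S(3))
      show "(\<lambda>q. case q of (v, w) \<Rightarrow> f t v * f t w * symL \<gamma> (h1 n) (h2 n) v w) \<in> borel_measurable (lborel \<Otimes>\<^sub>M lborel)" for n
        by (rule borel_measurable_integrable[OF S(1)])
      show "(\<lambda>q. case q of (v, w) \<Rightarrow> f t v * f t w * symL \<gamma> (pw1 a) (pw2 a) v w) \<in> borel_measurable (lborel \<Otimes>\<^sub>M lborel)"
        unfolding a_def
        by (rule borel_measurable_integrable[OF symL_pair_integrable(1)[OF \<gamma>_ge \<gamma>_neg r _ pw_facts[OF a[unfolded a_def]] _ _ u]]) auto
      show "AE q in lborel \<Otimes>\<^sub>M lborel. (\<lambda>n. case q of (v, w) \<Rightarrow> f t v * f t w * symL \<gamma> (h1 n) (h2 n) v w)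
        \<longlonglongrightarrow> (case q of (v, w) \<Rightarrow> f t v * f t w * symL \<gamma> (pw1 a) (pw2 a) v w)"
      proof (intro AE_I2)
        fix q :: "r3 \<times> r3"
        obtain v w where q: "q = (v, w)" by (cases q)
        have "(\<lambda>n. symL \<gamma> (h1 n) (h2 n) v w) \<longlonglongrightarrow> symL \<gamma> (pw1 a) (pw2 a) v w"
          unfolding symL_def h1_def h2_def
          by (intro tendsto_mult tendsto_const tendsto_diff tendsto_add tp_limits(2)[of a] tp_limits(3)[of a])
        then show "(\<lambda>n. case q of (v, w) \<Rightarrow> f t v * f t w * symL \<gamma> (h1 n) (h2 n) v w)
          \<longlonglongrightarrow> (case q of (v, w) \<Rightarrow> f t v * f t w * symL \<gamma> (pw1 a) (pw2 a) v w)"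
          unfolding q prod.case by (intro tendsto_mult tendsto_const)
      qed
      show "AE q in lborel \<Otimes>\<^sub>M lborel. norm (case q of (v, w) \<Rightarrow> f t v * f t w * symL \<gamma> (h1 n) (h2 n) v w) \<le> ?D q" for n
        using S(4) by (intro AE_I2) (auto simp: split_beta')
    qed
  qed
  \<comment> \<open>The slice at time 0 need not be smooth, so the symmetrised form is available
    only on the half-open interval; the endpoint is a null set.\<close>
  define s where "s = (\<lambda>n t. indicator {0<..T} t * W (\<phi> n) t)"
  have ae: "AE t in lborel. indicator {0<..T} t * W (\<phi> n) t = indicator {0..T} t * W (\<phi> n) t" for n
    using Ioc_Icc_AE[of 0 T] by eventually_elim simp
  have sm: "s n \<in> borel_measurable lborel" for n
  proof -
    have "(\<lambda>t. indicator {0<..T} t * (indicator {0..T} t * W (\<phi> n) t)) \<in> borel_measurable lborel"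
      by (rule borel_measurable_times[OF _ borel_measurable_integrable[OF weak_iterated(2)[OF \<phi> T]]]) auto
    moreover have "(\<lambda>t. indicator {0<..T} t * (indicator {0..T} t * W (\<phi> n) t)) = s n"
      by (auto simp: s_def fun_eq_iff split: split_indicator)
    ultimately show ?thesis by simp
  qed
  have si: "(LBINT t. indicator {0..T} t * W (\<phi> n) t) = (LBINT t. s n t)" for n
    using ae[of n] sm[of n] borel_measurable_integrable[OF weak_iterated(2)[OF \<phi>[of n] T]] unfolding s_def
    by (intro integral_cong_AE) (auto elim: eventually_mono)
  have slim: "(\<lambda>n. s n t) \<longlonglongrightarrow> indicator {0<..T} t * (Wi t / 2)" for t
  proof (cases "t \<in> {0<..T}")
    case True
    then have t: "0 < t" "t \<le> T" by auto
    have "(\<lambda>n. symW (h1 n) (h2 n) t / 2) \<longlonglongrightarrow> Wi t / 2" by (intro tendsto_divide sl t tendsto_const) simp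
    then show ?thesis unfolding s_def Wn[OF t(1)] using True by simp
  qed (simp add: s_def)
  have ii: "integrable lborel (indicat_real {0<..T})" by (rule integrable_real_indicator) (use T in auto)
  have iw: "(\<lambda>t. indicator {0<..T} t * (Wi t / 2)) \<in> borel_measurable lborel"
    by (rule borel_measurable_LIMSEQ_real[OF slim sm])
  have sbound: "norm (s n t) \<le> (20 * B * (K * E)) * indicator {0<..T} t" for n t
    using sb[of t n] Wn[of t n] by (cases "t \<in> {0<..T}") (auto simp: s_def)
  have "(\<lambda>n. \<integral>t. s n t \<partial>lborel) \<longlonglongrightarrow> (LBINT t. indicator {0<..T} t * (Wi t / 2))"
    by (rule integral_dominated_convergence[OF iw sm integrable_mult_right[OF ii, of "20 * B * (K * E)"]])
      (intro AE_I2 slim sbound)+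
  moreover have "(\<lambda>n. \<integral>t. s n t \<partial>lborel) \<longlonglongrightarrow> L1w_norm r (f T) - L1w_norm r fin"
  proof -
    have "(LBINT t. s n t) = (LBINT v. \<phi> n v * f T v) - (LBINT v. \<phi> n v * f 0 v)" for n
      using weak_iterated(1)[OF \<phi>[of n] T] si[of n] by (simp add: f_0)
    then show ?thesis using tendsto_diff[OF lim[of T] lim[of 0]] T by (simp add: f_0)
  qed
  ultimately have "L1w_norm r (f T) - L1w_norm r fin = (LBINT t. indicator {0<..T} t * (Wi t / 2))"
    by (rule LIMSEQ_unique[symmetric])
  also have "\<dots> \<le> (LBINT t. C * indicator {0<..T} t)"
  proof (rule integral_mono)
    show "integrable lborel (\<lambda>t. C * indicat_real {0<..T} t)" using ii by simp
    have nb: "norm (indicator {0<..T} t * (Wi t / 2)) \<le> (20 * B * (K * E)) * indicator {0<..T} t" for t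
      by (rule LIMSEQ_le_const2[OF tendsto_norm[OF slim]]) (use sbound in auto)
    show "integrable lborel (\<lambda>t. indicator {0<..T} t * (Wi t / 2))"
      by (rule Bochner_Integration.integrable_bound[OF integrable_mult_right[OF ii, of "20 * B * (K * E)"] iw])
        (intro AE_I2 order_trans[OF nb], simp only: real_norm_def abs_ge_self)
    fix t
    show "indicator {0<..T} t * (Wi t / 2) \<le> C * indicat_real {0<..T} t"
    proof (cases "t \<in> {0<..T}")
      case True
      then have "Wi t \<le> C" unfolding Wi_def a_def using K(2)[of t] by (intro C) auto
      then show ?thesis using True C0 by simp
    qed simp
  qed
  also have "\<dots> = C * T" using T by simp
  finally show ?thesis by simp
qed

end

text \<open>The growth rate depends on the solution only through its mass and energy.\<close>

lemma moment_linear_growth: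
  assumes \<gamma>: "-2 \<le> \<gamma>" "\<gamma> < 0" and r: "2 < r" and fin: "in_L1w r fin" "in_L1w 2 fin" "\<And>v. 0 \<le> fin v" and M: "0 < (LBINT v. fin v)"
  obtains C where "0 \<le> C" "\<And>f T. landau_solution \<gamma> fin f \<Longrightarrow> 0 < T \<Longrightarrow> L1w_norm r (f T) \<le> L1w_norm r fin + C * T"
proof -
  define E where "E = (LBINT v. fin v) + (LBINT v. fin v * (norm v)\<^sup>2)"
  have E: "0 \<le> E" unfolding E_def using fin(3) by (intro add_nonneg_nonneg integral_nonneg_AE AE_I2) auto
  obtain C where C: "0 \<le> C"
    "\<And>u. u \<in> borel_measurable borel \<Longrightarrow> (\<And>v. 0 \<le> u v) \<Longrightarrow> integrable lborel u \<Longrightarrow> (LBINT v. u v) = (LBINT v. fin v) \<Longrightarrow>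
      integrable lborel (\<lambda>v. u v * (jbracket v)\<^sup>2) \<Longrightarrow> (LBINT v. u v * (jbracket v)\<^sup>2) = E \<Longrightarrow>
      integrable lborel (\<lambda>v. u v * jbracket v powr r) \<Longrightarrow>
      (\<integral>q. (case q of (v, w) \<Rightarrow> u v * u w * symL \<gamma> (pw1 (r/2)) (pw2 (r/2)) v w) \<partial>(lborel \<Otimes>\<^sub>M lborel)) \<le> C"
    using symL_moment_bound[OF \<gamma> r M E] by blast
  show ?thesis
  proof (rule that[OF C(1)])
    fix f T assume "landau_solution \<gamma> fin f" and T: "0 < (T::real)"
    then interpret landau_solution \<gamma> fin f by simp
    have E': "M0 + E0 = E" by (simp add: M0_def E0_def E_def)
    show "L1w_norm r (f T) \<le> L1w_norm r fin + C * T"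
    proof (rule moment_growth[OF r fin(1) T _ C(1)])
      fix t assume t: "0 < t" and i: "integrable lborel (\<lambda>v. f t v * jbracket v powr r)"
      have t0: "0 \<le> t" using t by simp
      show "symW (pw1 (r/2)) (pw2 (r/2)) t \<le> C"
        unfolding symW_def
        by (rule C(2)) (use t0 i E' conserved[OF t0] f_measurable[OF t0] f_nonneg[OF t0] f_integrable[OF t0] in \<open>auto simp: M0_def\<close>)
    qed
  qed
qed

subsection \<open>Interpolation\<close>

text \<open>Hoelder's inequality in multiplicative form: after dividing both functions by their
  integrals, the weighted inequality of arithmetic and geometric means holds pointwise. If one
  integral is 0, the product vanishes almost everywhere.\<close>

lemma Holder_interpolation:
  fixes g h :: "'a \<Rightarrow> real"
  assumes g: "integrable M g" "\<And>x. 0 \<le> g x" and h: "integrable M h" "\<And>x. 0 \<le> h x" and \<theta>: "0 < \<theta>" "\<theta> < 1"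
  shows "integrable M (\<lambda>x. g x powr (1 - \<theta>) * h x powr \<theta>)"
    and "(\<integral>x. g x powr (1 - \<theta>) * h x powr \<theta> \<partial>M) \<le> (\<integral>x. g x \<partial>M) powr (1 - \<theta>) * (\<integral>x. h x \<partial>M) powr \<theta>"
proof -
  have [measurable]: "g \<in> borel_measurable M" "h \<in> borel_measurable M" using g h by auto
  have young: "a powr (1 - \<theta>) * b powr \<theta> \<le> (1 - \<theta>) * a + \<theta> * b" if "0 \<le> a" "0 \<le> b" for a b
  proof (cases "a = 0 \<or> b = 0")
    case True then show ?thesis using that \<theta> by auto
  next
    case False then show ?thesis using that \<theta> by (intro Youngs_inequality_0) auto
  qed
  show i: "integrable M (\<lambda>x. g x powr (1 - \<theta>) * h x powr \<theta>)"
  proof (rule Bochner_Integration.integrable_bound)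
    show "integrable M (\<lambda>x. (1 - \<theta>) * g x + \<theta> * h x)" using g h by simp
    show "AE x in M. norm (g x powr (1 - \<theta>) * h x powr \<theta>) \<le> norm ((1 - \<theta>) * g x + \<theta> * h x)"
    proof (intro AE_I2)
      fix x
      have "0 \<le> (1 - \<theta>) * g x + \<theta> * h x" using g(2)[of x] h(2)[of x] \<theta> by simp
      then show "norm (g x powr (1 - \<theta>) * h x powr \<theta>) \<le> norm ((1 - \<theta>) * g x + \<theta> * h x)"
        using young[OF g(2)[of x] h(2)[of x]] by simp
    qed
  qed measurable
  define G H where "G = (\<integral>x. g x \<partial>M)" and "H = (\<integral>x. h x \<partial>M)"
  have GH: "0 \<le> G" "0 \<le> H" unfolding G_def H_def using g h by (auto intro!: integral_nonneg_AE)
  show "(\<integral>x. g x powr (1 - \<theta>) * h x powr \<theta> \<partial>M) \<le> (\<integral>x. g x \<partial>M) powr (1 - \<theta>) * (\<integral>x. h x \<partial>M) powr \<theta>"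
  proof (cases "G = 0 \<or> H = 0")
    case True
    then have "(AE x in M. g x = 0) \<or> (AE x in M. h x = 0)"
      using integral_nonneg_eq_0_iff_AE[OF g(1)] integral_nonneg_eq_0_iff_AE[OF h(1)] g(2) h(2) by (auto simp: G_def H_def)
    then have "AE x in M. g x powr (1 - \<theta>) * h x powr \<theta> = 0"
      by (auto elim: eventually_mono)
    then have "(\<integral>x. g x powr (1 - \<theta>) * h x powr \<theta> \<partial>M) = 0" by (rule integral_eq_zero_AE)
    then show ?thesis by simp
  next
    case False
    then have p: "0 < G" "0 < H" using GH by auto
    have "(\<integral>x. g x powr (1 - \<theta>) * h x powr \<theta> \<partial>M) \<le> (\<integral>x. (G powr (1 - \<theta>) * H powr \<theta>) * ((1 - \<theta>) / G * g x + \<theta> / H * h x) \<partial>M)"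
    proof (rule integral_mono[OF i])
      show "integrable M (\<lambda>x. (G powr (1 - \<theta>) * H powr \<theta>) * ((1 - \<theta>) / G * g x + \<theta> / H * h x))"
        by (intro integrable_mult_right Bochner_Integration.integrable_add g h)
      fix x
      have "g x powr (1 - \<theta>) * h x powr \<theta> = (G powr (1 - \<theta>) * H powr \<theta>) * ((g x / G) powr (1 - \<theta>) * (h x / H) powr \<theta>)"
        using p g(2)[of x] h(2)[of x] by (simp add: powr_divide)
      also have "\<dots> \<le> (G powr (1 - \<theta>) * H powr \<theta>) * ((1 - \<theta>) * (g x / G) + \<theta> * (h x / H))"
        using p g(2)[of x] h(2)[of x] by (intro mult_left_mono young) auto
      finally show "g x powr (1 - \<theta>) * h x powr \<theta> \<le> (G powr (1 - \<theta>) * H powr \<theta>) * ((1 - \<theta>) / G * g x + \<theta> / H * h x)" by simp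
    qed
    also have "\<dots> = (G powr (1 - \<theta>) * H powr \<theta>) * ((1 - \<theta>) / G * G + \<theta> / H * H)"
      unfolding G_def H_def using g h by simp
    also have "\<dots> = G powr (1 - \<theta>) * H powr \<theta>" using p by simp
    finally show ?thesis by (simp add: G_def H_def)
  qed
qed

section \<open>From the dissipation to the space-time norm\<close>

context landau_solution
begin

text \<open>For F = <v>^\<gamma> f the quotient |\<nabla>F|^2 / F is at most twice the integrand of
  \<open>Yd\<close> plus 8 f, since differentiating the weight costs at most \<gamma>^2 \<le> 4; the
  factor 4 of \<open>sobolev_L3\<close> turns this into 8 and 32.\<close>

lemma weighted_sobolev:
  assumes t: "0 < t"
  shows "integrable lborel (\<lambda>v. (jbracket v powr \<gamma> * f t v) ^ 3)"
    and "ennreal ((LBINT v. (jbracket v powr \<gamma> * f t v) ^ 3) powr (1 / 3)) \<le> 8 * Yd t + ennreal (32 * M0)"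
proof -
  obtain p where "snapshot \<gamma> p (f t) (\<lambda>i. pd i (f t)) (\<lambda>i j. pd i (pd j (f t)))" using snapshot_f[OF t] by blast
  then interpret snapshot \<gamma> p "f t" "\<lambda>i. pd i (f t)" "\<lambda>i j. pd i (pd j (f t))" .
  have t0: "0 \<le> t" using t by simp
  define F where "F = (\<lambda>v. jbracket v powr \<gamma> * f t v)"
  define F1 where "F1 = (\<lambda>i v. (\<gamma> * jbracket v powr (\<gamma> - 2) * v $ i) * f t v + pd i (f t) v * jbracket v powr \<gamma>)"
  have dF: "decays p F" unfolding F_def
  proof (rule decays_bounded_mult[OF du])
    fix v show "\<bar>jbracket v powr \<gamma>\<bar> \<le> 1" using jbracket_powr_mono[of \<gamma> 0 v] \<gamma>_le by auto
  qed measurable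
  have F0: "0 \<le> F v" for v using u_nonneg by (simp add: F_def)
  have dd: "ddir i F (F1 i)" for i unfolding F_def F1_def by (intro ddir_mult ddir_jbracket_powr dd1)
  have m: "F1 i \<in> borel_measurable borel" for i unfolding F1_def by measurable
  have Z: "F1 i v = 0" if "F v = 0" for i v
  proof -
    have "f t v = 0" using that by (simp add: F_def)
    then show ?thesis using f_zero_grad[OF t] by (simp add: F1_def)
  qed
  have p0: "0 \<le> p" "p > 3" using p by auto
  show "integrable lborel (\<lambda>v. (jbracket v powr \<gamma> * f t v) ^ 3)"
    using decays_integrable[OF decays_mult[OF decays_mult[OF dF dF p0(1)] dF p0(1)] p0(2)]
    by (simp add: F_def power3_eq_cube mult.assoc)
  have pt: "(\<Sum>i\<in>UNIV. (F1 i v)\<^sup>2) / F v \<le> 8 * f t v + 2 * (jbracket v powr \<gamma> * (\<Sum>i\<in>UNIV. (pd i (f t) v)\<^sup>2) / f t v)" for v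
  proof (cases "f t v = 0")
    case True then show ?thesis using f_zero_grad[OF t] by (simp add: F_def F1_def)
  next
    case False
    then have fp: "0 < f t v" using u_nonneg[of v] by simp
    define J where "J = jbracket v powr \<gamma>"
    define J2 where "J2 = jbracket v powr (\<gamma> - 2)"
    have J: "0 < J" by (simp add: J_def)
    have J2J: "J2 * (jbracket v)\<^sup>2 = J"
      unfolding J_def J2_def using powr_add[of "jbracket v" "\<gamma> - 2" 2] by (simp add: less_imp_le)
    have J2le: "J2 \<le> 1" unfolding J2_def using jbracket_powr_mono[of "\<gamma> - 2" 0 v] \<gamma>_le by auto
    have J20: "0 \<le> J2" by (simp add: J2_def)
    define S where "S = (\<Sum>i\<in>UNIV. (pd i (f t) v)\<^sup>2)"
    have sq: "(x + y)\<^sup>2 \<le> 2 * x\<^sup>2 + 2 * y\<^sup>2" for x y :: real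
      using sum_squares_bound[of x y] by (simp add: power2_eq_square algebra_simps)
    have "(\<Sum>i\<in>UNIV. (F1 i v)\<^sup>2) \<le> (\<Sum>i\<in>UNIV. 2 * (\<gamma> * J2 * v $ i * f t v)\<^sup>2 + 2 * (pd i (f t) v * J)\<^sup>2)"
      unfolding F1_def J_def[symmetric] J2_def[symmetric] by (intro sum_mono sq)
    also have "\<dots> = 2 * \<gamma>\<^sup>2 * J2\<^sup>2 * (norm v)\<^sup>2 * (f t v)\<^sup>2 + 2 * J\<^sup>2 * S"
      unfolding norm_sq_3 S_def sum_3 by (simp add: power_mult_distrib algebra_simps)
    also have "\<dots> \<le> 8 * J * (f t v)\<^sup>2 + 2 * J\<^sup>2 * S"
    proof -
      have g2: "\<gamma>\<^sup>2 \<le> 4" using \<gamma>_ge \<gamma>_neg abs_le_square_iff[of \<gamma> 2] by simp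
      have n: "J2 * (norm v)\<^sup>2 \<le> J" using J20 unfolding J2J[symmetric] by (intro mult_left_mono) (auto simp: jbracket_sq)
      have j: "J2 * (J2 * (norm v)\<^sup>2) \<le> 1 * J" by (rule mult_mono[OF J2le n]) (use J20 in simp_all)
      have "\<gamma>\<^sup>2 * (J2 * (J2 * (norm v)\<^sup>2)) \<le> 4 * (1 * J)" by (rule mult_mono[OF g2 j]) (use J20 in simp_all)
      then have "(\<gamma>\<^sup>2 * (J2 * (J2 * (norm v)\<^sup>2))) * (2 * (f t v)\<^sup>2) \<le> (4 * (1 * J)) * (2 * (f t v)\<^sup>2)" by (intro mult_right_mono) auto
      then show ?thesis by (simp add: power2_eq_square algebra_simps)
    qed
    finally have "(\<Sum>i\<in>UNIV. (F1 i v)\<^sup>2) / F v \<le> (8 * J * (f t v)\<^sup>2 + 2 * J\<^sup>2 * S) / (J * f t v)"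
      unfolding F_def J_def[symmetric] using J fp by (intro divide_right_mono) auto
    also have "\<dots> = 8 * f t v + 2 * (J * S / f t v)"
      using J fp by (simp add: field_simps power2_eq_square)
    finally show ?thesis by (simp add: J_def S_def)
  qed
  have "(\<integral>\<^sup>+v. ennreal ((\<Sum>i\<in>UNIV. (F1 i v)\<^sup>2) / F v) \<partial>lborel)
    \<le> (\<integral>\<^sup>+v. 8 * ennreal (f t v) + 2 * ennreal (jbracket v powr \<gamma> * (\<Sum>i\<in>UNIV. (pd i (f t) v)\<^sup>2) / f t v) \<partial>lborel)"
  proof (rule nn_integral_mono)
    fix v
    have n0: "0 \<le> jbracket v powr \<gamma> * (\<Sum>i\<in>UNIV. (pd i (f t) v)\<^sup>2) / f t v"
      using u_nonneg[of v] by (intro divide_nonneg_nonneg mult_nonneg_nonneg sum_nonneg) auto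
    have "ennreal ((\<Sum>i\<in>UNIV. (F1 i v)\<^sup>2) / F v) \<le> ennreal (8 * f t v + 2 * (jbracket v powr \<gamma> * (\<Sum>i\<in>UNIV. (pd i (f t) v)\<^sup>2) / f t v))"
      by (rule ennreal_leI[OF pt])
    also have "\<dots> = ennreal (8 * f t v) + ennreal (2 * (jbracket v powr \<gamma> * (\<Sum>i\<in>UNIV. (pd i (f t) v)\<^sup>2) / f t v))"
      using u_nonneg[of v] n0 by (intro ennreal_plus) auto
    also have "\<dots> = 8 * ennreal (f t v) + 2 * ennreal (jbracket v powr \<gamma> * (\<Sum>i\<in>UNIV. (pd i (f t) v)\<^sup>2) / f t v)"
      using u_nonneg[of v] n0 by (simp only: ennreal_mult zero_le_numeral ennreal_numeral)
    finally show "ennreal ((\<Sum>i\<in>UNIV. (F1 i v)\<^sup>2) / F v) \<le> 8 * ennreal (f t v) + 2 * ennreal (jbracket v powr \<gamma> * (\<Sum>i\<in>UNIV. (pd i (f t) v)\<^sup>2) / f t v)" .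
  qed
  also have "\<dots> = 8 * ennreal M0 + 2 * Yd t"
  proof -
    have "(\<integral>\<^sup>+v. ennreal (f t v) \<partial>lborel) = ennreal M0"
      using nn_integral_eq_integral[OF f_integrable[OF t0]] u_nonneg conserved(1)[OF t0] by simp
    then show ?thesis unfolding Yd_def by (subst nn_integral_add) (auto simp: nn_integral_cmult)
  qed
  finally have Y: "(\<integral>\<^sup>+v. ennreal ((\<Sum>i\<in>UNIV. (F1 i v)\<^sup>2) / F v) \<partial>lborel) \<le> 8 * ennreal M0 + 2 * Yd t" .
  have M0: "0 \<le> M0" using conserved(1)[OF t0] u_nonneg by (metis integral_nonneg_AE AE_I2)
  show "ennreal ((LBINT v. (jbracket v powr \<gamma> * f t v) ^ 3) powr (1 / 3)) \<le> 8 * Yd t + ennreal (32 * M0)"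
  proof (cases "Yd t")
    case top
    then show ?thesis by (simp add: ennreal_mult_top)
  next
    case (real y)
    have e: "8 * ennreal M0 + 2 * Yd t = ennreal (8 * M0 + 2 * y)"
      using real M0 by (simp add: ennreal_mult ennreal_plus)
    have "(LBINT v. F v ^ 3) powr (1 / 3) \<le> 4 * (8 * M0 + 2 * y)"
      by (rule sobolev_L3[OF dF p0(2) F0 dd m Z Y[unfolded e]]) (use M0 real in auto)
    then have "ennreal ((LBINT v. F v ^ 3) powr (1 / 3)) \<le> ennreal (8 * y + 32 * M0)" by (intro ennreal_leI) simp
    also have "\<dots> = 8 * Yd t + ennreal (32 * M0)" using real M0 by (simp add: ennreal_mult ennreal_plus)
    finally show ?thesis by (simp add: F_def)
  qed
qed

text \<open>The parameter \<theta> = \<epsilon> / 2 solves 3 (1 - \<theta>) + \<theta> = 3 -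
  \<epsilon>. The weights cancel when 3 \<gamma> (1 - \<theta>) + r \<theta> = 0, which is the value
  of \<open>r\<close>. Finally \<alpha> / (3 - \<epsilon>) times 1 - \<theta> equals 1/3, so the L^3
  norm of the weighted density occurs to the power 1.\<close>

lemma Lp_interpolation:
  assumes t: "0 < t" and \<epsilon>: "0 < \<epsilon>" "\<epsilon> < 1" and r: "r = - 3 * \<gamma> * (2 - \<epsilon>) / \<epsilon>" and \<alpha>: "\<alpha> = 2 * (3 - \<epsilon>) / (3 * (2 - \<epsilon>))"
    and ir: "integrable lborel (\<lambda>v. f t v * jbracket v powr r)" and N: "(LBINT v. f t v * jbracket v powr r) \<le> N"
  shows "in_Lp (3 - \<epsilon>) (f t)"
    and "Lp_norm (3 - \<epsilon>) (f t) powr \<alpha> \<le> N powr (\<epsilon> / (3 * (2 - \<epsilon>))) * (LBINT v. (jbracket v powr \<gamma> * f t v) ^ 3) powr (1 / 3)"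
proof -
  have t0: "0 \<le> t" using t by simp
  define \<theta> where "\<theta> = \<epsilon> / 2"
  have \<theta>: "0 < \<theta>" "\<theta> < 1" using \<epsilon> by (auto simp: \<theta>_def)
  have n0: "0 \<le> f t v" for v by (rule f_nonneg[OF t0])
  have eq: "\<bar>f t v\<bar> powr (3 - \<epsilon>) = ((jbracket v powr \<gamma> * f t v) ^ 3) powr (1 - \<theta>) * (f t v * jbracket v powr r) powr \<theta>" for v
  proof (cases "f t v = 0")
    case False
    then have fp: "0 < f t v" using n0[of v] by simp
    have "(jbracket v powr \<gamma> * f t v) ^ 3 = (jbracket v powr \<gamma> * f t v) powr 3" using fp by simp
    then have "((jbracket v powr \<gamma> * f t v) ^ 3) powr (1 - \<theta>) = (jbracket v powr \<gamma> * f t v) powr (3 * (1 - \<theta>))"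
      by (simp only: powr_powr)
    also have "\<dots> = jbracket v powr (\<gamma> * (3 * (1 - \<theta>))) * f t v powr (3 * (1 - \<theta>))"
      by (simp only: powr_mult powr_powr)
    finally have "((jbracket v powr \<gamma> * f t v) ^ 3) powr (1 - \<theta>) * (f t v * jbracket v powr r) powr \<theta>
      = (jbracket v powr (\<gamma> * (3 * (1 - \<theta>))) * jbracket v powr (r * \<theta>)) * (f t v powr (3 * (1 - \<theta>)) * f t v powr \<theta>)"
      by (simp add: powr_mult powr_powr ac_simps)
    also have "\<dots> = jbracket v powr (\<gamma> * (3 * (1 - \<theta>)) + r * \<theta>) * f t v powr (3 * (1 - \<theta>) + \<theta>)"
      by (simp only: powr_add)
    also have "\<gamma> * (3 * (1 - \<theta>)) + r * \<theta> = 0" using \<epsilon> unfolding r \<theta>_def by (simp add: field_simps)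
    also have "3 * (1 - \<theta>) + \<theta> = 3 - \<epsilon>" by (simp add: \<theta>_def)
    finally show ?thesis using fp by simp
  qed simp
  note H = Holder_interpolation[OF weighted_sobolev(1)[OF t] _ ir _ \<theta>]
  have F0: "0 \<le> (jbracket v powr \<gamma> * f t v) ^ 3" "0 \<le> f t v * jbracket v powr r" for v using n0 by auto
  show "in_Lp (3 - \<epsilon>) (f t)"
    unfolding in_Lp_def eq using H(1)[OF F0] f_measurable[OF t0] by simp
  define X where "X = (LBINT v. (jbracket v powr \<gamma> * f t v) ^ 3)"
  define m where "m = (LBINT v. f t v * jbracket v powr r)"
  have X0: "0 \<le> X" "0 \<le> m" unfolding X_def m_def using F0 by (auto intro!: integral_nonneg_AE)
  define P where "P = (LBINT v. \<bar>f t v\<bar> powr (3 - \<epsilon>))"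
  have P0: "0 \<le> P" unfolding P_def by (auto intro!: integral_nonneg_AE)
  have PX: "P \<le> X powr (1 - \<theta>) * m powr \<theta>" unfolding P_def X_def m_def eq by (rule H(2)[OF F0])
  define b where "b = 2 / (3 * (2 - \<epsilon>))"
  have e: "3 - \<epsilon> \<noteq> 0" "2 - \<epsilon> \<noteq> 0" using \<epsilon> by auto
  have b: "0 \<le> b" "\<theta> * b = \<epsilon> / (3 * (2 - \<epsilon>))" using \<epsilon> by (simp_all add: b_def \<theta>_def)
  have b1: "(1 - \<theta>) * b = 1 / 3"
  proof -
    have "1 - \<theta> = (2 - \<epsilon>) / 2" by (simp add: \<theta>_def diff_divide_distrib)
    then show ?thesis using e by (simp add: b_def)
  qed
  have cancel: "1 / y * (2 * y / w) = 2 / w" if "y \<noteq> 0" for y w :: real using that by simp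
  have b2: "1 / (3 - \<epsilon>) * \<alpha> = b" unfolding \<alpha> b_def by (rule cancel[OF e(1)])
  have "Lp_norm (3 - \<epsilon>) (f t) powr \<alpha> = P powr b"
    unfolding Lp_norm_def P_def[symmetric] powr_powr b2 ..
  also have "\<dots> \<le> (X powr (1 - \<theta>) * m powr \<theta>) powr b" by (intro powr_mono2 b P0 PX)
  also have "\<dots> = X powr (1 / 3) * m powr (\<epsilon> / (3 * (2 - \<epsilon>)))" unfolding powr_mult powr_powr b1 b(2) ..
  also have "\<dots> \<le> X powr (1 / 3) * N powr (\<epsilon> / (3 * (2 - \<epsilon>)))"
    using X0 N \<epsilon> by (intro mult_left_mono powr_mono2) (auto simp: m_def)
  finally show "Lp_norm (3 - \<epsilon>) (f t) powr \<alpha> \<le> N powr (\<epsilon> / (3 * (2 - \<epsilon>))) * (LBINT v. (jbracket v powr \<gamma> * f t v) ^ 3) powr (1 / 3)"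
    by (simp add: X_def mult.commute)
qed

lemma Lp_norm_measurable: "(\<lambda>t. indicator {0<..T} t * Lp_norm p (f t) powr \<alpha>) \<in> borel_measurable borel"
proof -
  define h where "h = (\<lambda>(t, v). indicator {0<..T} t * \<bar>f t v\<bar> powr p)"
  define k :: "real \<times> r3 \<Rightarrow> real" where "k = (\<lambda>x. indicator X x *\<^sub>R (case x of (t, v) \<Rightarrow> f t v))"
  have "k \<in> borel_measurable borel"
    unfolding k_def by (rule borel_measurable_continuous_on_indicator[OF borel_open[OF open_X] continuous_f])
  then have km[measurable]: "k \<in> borel_measurable (lborel \<Otimes>\<^sub>M lborel)" by (simp add: lborel_prod)
  have eq: "h = (\<lambda>x. indicator {0<..T} (fst x) * \<bar>k x\<bar> powr p)"
    by (auto simp: h_def k_def fun_eq_iff split: split_indicator)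
  have hm: "h \<in> borel_measurable (lborel \<Otimes>\<^sub>M lborel)" unfolding eq by measurable
  then have "(\<lambda>t. \<integral>v. h (t, v) \<partial>lborel) \<in> borel_measurable lborel"
    by (intro lborel.borel_measurable_lebesgue_integral) simp
  then have [measurable]: "(\<lambda>t. \<integral>v. h (t, v) \<partial>lborel) \<in> borel_measurable borel" by simp
  have "(\<lambda>t. indicator {0<..T} t * Lp_norm p (f t) powr \<alpha>) = (\<lambda>t. indicator {0<..T} t * ((LBINT v. h (t, v)) powr (1 / p)) powr \<alpha>)"
    by (auto simp: fun_eq_iff Lp_norm_def h_def split: split_indicator)
  then show ?thesis by simp
qed

lemma LtLp_bound:
  assumes T: "0 < T" and \<epsilon>: "0 < \<epsilon>" "\<epsilon> < 1" and r: "r = - 3 * \<gamma> * (2 - \<epsilon>) / \<epsilon>" and \<alpha>: "\<alpha> = 2 * (3 - \<epsilon>) / (3 * (2 - \<epsilon>))"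
    and ir: "\<And>t. 0 < t \<Longrightarrow> t \<le> T \<Longrightarrow> integrable lborel (\<lambda>v. f t v * jbracket v powr r)"
    and N: "\<And>t. 0 < t \<Longrightarrow> t \<le> T \<Longrightarrow> (LBINT v. f t v * jbracket v powr r) \<le> N"
    and Y: "(\<integral>\<^sup>+t. indicator {0<..T} t * Yd t \<partial>lborel) \<le> ennreal Yb" "(\<lambda>t. indicator {0<..T} t * Yd t) \<in> borel_measurable borel" and Yb: "0 \<le> Yb"
  shows "in_LtLp \<alpha> T (3 - \<epsilon>) f"
    and "(LINT t:{0..T}|lborel. Lp_norm (3 - \<epsilon>) (f t) powr \<alpha>) \<le> N powr (\<epsilon> / (3 * (2 - \<epsilon>))) * (8 * Yb + 32 * M0 * T)"
proof -
  define c where "c = N powr (\<epsilon> / (3 * (2 - \<epsilon>)))"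
  have c0: "0 \<le> c" by (simp add: c_def)
  have M0: "0 \<le> M0" unfolding conserved(1)[OF order_refl, symmetric] by (intro integral_nonneg_AE AE_I2 f_nonneg) simp
  define g where "g = (\<lambda>t. indicator {0<..T} t * Lp_norm (3 - \<epsilon>) (f t) powr \<alpha>)"
  have gm: "g \<in> borel_measurable borel" unfolding g_def by (rule Lp_norm_measurable)
  have g0: "0 \<le> g t" for t by (simp add: g_def)
  have "(\<integral>\<^sup>+t. ennreal (g t) \<partial>lborel) \<le> (\<integral>\<^sup>+t. ennreal c * (8 * (indicator {0<..T} t * Yd t) + ennreal (32 * M0) * indicator {0<..T} t) \<partial>lborel)"
  proof (rule nn_integral_mono)
    fix t
    show "ennreal (g t) \<le> ennreal c * (8 * (indicator {0<..T} t * Yd t) + ennreal (32 * M0) * indicator {0<..T} t)"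
    proof (cases "t \<in> {0<..T}")
      case True
      then have t: "0 < t" "t \<le> T" by auto
      have "ennreal (g t) \<le> ennreal (c * (LBINT v. (jbracket v powr \<gamma> * f t v) ^ 3) powr (1 / 3))"
        unfolding g_def c_def using Lp_interpolation(2)[OF t(1) \<epsilon> r \<alpha> ir[OF t] N[OF t]] True by (intro ennreal_leI) simp
      also have "\<dots> = ennreal c * ennreal ((LBINT v. (jbracket v powr \<gamma> * f t v) ^ 3) powr (1 / 3))"
        using c0 by (intro ennreal_mult) auto
      also have "\<dots> \<le> ennreal c * (8 * Yd t + ennreal (32 * M0))"
        by (intro mult_left_mono weighted_sobolev(2)[OF t(1)]) auto
      finally show ?thesis using True by simp
    qed (simp add: g_def)
  qed
  also have "\<dots> = ennreal c * (8 * (\<integral>\<^sup>+t. indicator {0<..T} t * Yd t \<partial>lborel) + ennreal (32 * M0) * emeasure lborel {0<..T})"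
    using Y(2) by (simp add: nn_integral_cmult nn_integral_add)
  also have "\<dots> \<le> ennreal c * (8 * ennreal Yb + ennreal (32 * M0) * ennreal T)"
    using T Y(1) by (intro mult_left_mono add_mono) auto
  also have "\<dots> = ennreal (c * (8 * Yb + 32 * M0 * T))"
    using c0 Yb M0 T by (simp add: ennreal_mult ennreal_plus)
  finally have nn: "(\<integral>\<^sup>+t. ennreal (g t) \<partial>lborel) \<le> ennreal (c * (8 * Yb + 32 * M0 * T))" .
  have gi: "integrable lborel g"
    by (rule integrableI_nonneg) (use gm g0 nn in \<open>auto simp: order_le_less_trans\<close>)
  have "ennreal (LBINT t. g t) \<le> ennreal (c * (8 * Yb + 32 * M0 * T))"
    using nn nn_integral_eq_integral[OF gi] g0 by simp
  then have gI: "(LBINT t. g t) \<le> c * (8 * Yb + 32 * M0 * T)"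
    using c0 Yb M0 T by (subst (asm) ennreal_le_iff) auto
  \<comment> \<open>The claim concerns the closed interval while the bounds hold for t > 0; the two
    integrands differ only at t = 0.\<close>
  define k where "k = (\<lambda>t. indicator {0..T} t *\<^sub>R Lp_norm (3 - \<epsilon>) (f t) powr \<alpha>)"
  have kg: "k t = g t + indicator {0} t * Lp_norm (3 - \<epsilon>) (f 0) powr \<alpha>" for t
    using T by (auto simp: k_def g_def split: split_indicator)
  have km: "k \<in> borel_measurable lborel" unfolding kg[abs_def] using gm by simp
  have ae: "AE t in lborel. g t = k t"
  proof -
    have "AE t in lborel. t \<noteq> (0::real)" by (rule AE_lborel_singleton)
    then show ?thesis by eventually_elim (simp add: kg)
  qed
  have ki: "integrable lborel k" by (rule integrable_cong_AE_imp[OF gi km ae])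
  have kI: "(LBINT t. k t) = (LBINT t. g t)"
    using gm km ae by (intro integral_cong_AE) auto
  show "(LINT t:{0..T}|lborel. Lp_norm (3 - \<epsilon>) (f t) powr \<alpha>) \<le> N powr (\<epsilon> / (3 * (2 - \<epsilon>))) * (8 * Yb + 32 * M0 * T)"
    using gI kI unfolding set_lebesgue_integral_def k_def c_def by simp
  have "AE t in lborel. t \<noteq> (0::real)" by (rule AE_lborel_singleton)
  then have "AE t in lborel. t \<in> {0..T} \<longrightarrow> in_Lp (3 - \<epsilon>) (f t)"
  proof eventually_elim
    case (elim t)
    show ?case
    proof
      assume "t \<in> {0..T}"
      then have t: "0 < t" "t \<le> T" using elim by auto
      show "in_Lp (3 - \<epsilon>) (f t)" by (rule Lp_interpolation(1)[OF t(1) \<epsilon> r \<alpha> ir[OF t] N[OF t]])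
    qed
  qed
  then show "in_LtLp \<alpha> T (3 - \<epsilon>) f"
    unfolding in_LtLp_def set_integrable_def using ki by (simp add: k_def)
qed

text \<open>A non-negative density of mass 0 vanishes almost everywhere. This case is separate
  because the lower bound on diffusion requires positive mass.\<close>

lemma zero_mass:
  assumes z: "M0 = 0" and \<epsilon>: "0 < \<epsilon>" "\<epsilon> < 1" and T: "0 < T"
  shows "in_LtLp \<alpha> T (3 - \<epsilon>) f" "(LINT t:{0..T}|lborel. Lp_norm (3 - \<epsilon>) (f t) powr \<alpha>) = 0"
proof -
  have i: "integrable lborel (\<lambda>v. \<bar>f t v\<bar> powr (3 - \<epsilon>))" and v: "(LBINT v. \<bar>f t v\<bar> powr (3 - \<epsilon>)) = 0" if t0: "0 \<le> t" for t
  proof -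
    note [measurable] = f_measurable[OF t0]
    have "(LBINT v. f t v) = 0" using conserved(1)[OF t0] z by simp
    then have "AE v in lborel. f t v = 0"
      using integral_nonneg_eq_0_iff_AE[OF f_integrable[OF t0]] f_nonneg[OF t0] by simp
    then have ae0: "AE v in lborel. \<bar>f t v\<bar> powr (3 - \<epsilon>) = 0" by eventually_elim simp
    then have ae: "AE v in lborel. 0 = \<bar>f t v\<bar> powr (3 - \<epsilon>)" by eventually_elim (rule sym)
    show "integrable lborel (\<lambda>v. \<bar>f t v\<bar> powr (3 - \<epsilon>))"
      by (rule integrable_cong_AE_imp[OF integrable_zero _ ae]) measurable
    show "(LBINT v. \<bar>f t v\<bar> powr (3 - \<epsilon>)) = 0"
      by (rule integral_eq_zero_AE[OF ae0])
  qed
  have n: "(\<lambda>t. indicator {0..T} t *\<^sub>R Lp_norm (3 - \<epsilon>) (f t) powr \<alpha>) = (\<lambda>t. 0)"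
    using v by (auto simp: fun_eq_iff Lp_norm_def split: split_indicator)
  show "(LINT t:{0..T}|lborel. Lp_norm (3 - \<epsilon>) (f t) powr \<alpha>) = 0"
    unfolding set_lebesgue_integral_def n by simp
  show "in_LtLp \<alpha> T (3 - \<epsilon>) f"
    unfolding in_LtLp_def set_integrable_def n using i f_measurable by (auto simp: in_Lp_def)
qed

lemma E0_nonneg: "0 \<le> E0" and M0_nonneg: "0 \<le> M0" and H0_nonneg: "0 \<le> H0"
proof -
  show "0 \<le> E0" "0 \<le> M0" unfolding conserved(1,2)[OF order_refl, symmetric]
    by (intro integral_nonneg_AE AE_I2 mult_nonneg_nonneg f_nonneg order_refl zero_le_power2)+
  have "0 \<le> (LBINT v. f 0 v * \<bar>ln (f 0 v)\<bar>)"
    by (intro integral_nonneg_AE AE_I2 mult_nonneg_nonneg f_nonneg order_refl abs_ge_zero)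
  then show "0 \<le> H0" using entropy_bound(2)[of 0] by simp
qed

lemma sing_power:
  assumes t: "0 < t" and \<delta>: "0 < \<delta>" and \<rho>: "0 < \<rho>" "\<rho> \<le> 1"
  shows "S \<delta> t \<le> \<rho> powr \<gamma> * M0\<^sup>2 + 8 * \<rho> powr (\<gamma> + 2) * (M0 + E0) * (4 * D \<delta> t + 16 * M0)"
proof -
  have t0: "0 \<le> t" using t by simp
  obtain p where sn: "snapshot \<gamma> p (f t) (\<lambda>i. pd i (f t)) (\<lambda>i j. pd i (pd j (f t)))"
    and e: "\<And>\<delta>. snapshot.diss \<gamma> (f t) (\<lambda>i. pd i (f t)) \<delta> = D \<delta> t" "\<And>\<delta>. snapshot.sing \<gamma> (f t) \<delta> = S \<delta> t" "snapshot.mass (f t) = M0"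
    using snapshot_at[OF t] by metis
  interpret snapshot \<gamma> p "f t" "\<lambda>i. pd i (f t)" "\<lambda>i j. pd i (pd j (f t))" by (rule sn)
  show ?thesis using sing_bound_power[OF \<delta> \<rho> conserved(3)[OF t0]] unfolding e conserved(5)[OF t0] .
qed

text \<open>On the set where f exceeds N, the part with <v> \<le> R is controlled by the entropy, at
  the cost R^2 / ln N, and the part with <v> > R by the fourth moment, at the cost 1 / R^2. The two
  parameters can therefore be tuned one after the other.\<close>

lemma sing_split:
  assumes t: "0 < t" and \<delta>: "0 < \<delta>" and R: "0 < R" and N: "1 < N"
    and i4: "integrable lborel (\<lambda>v. f t v * jbracket v powr 4)" and m4: "(LBINT v. f t v * jbracket v powr 4) \<le> m"
  shows "S \<delta> t \<le> M0\<^sup>2 + N * ckb * M0 + 8 * (R\<^sup>2 * H0 / ln N + m / R\<^sup>2) * (4 * D \<delta> t + 16 * M0)"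
proof -
  have t0: "0 \<le> t" using t by simp
  obtain p where sn: "snapshot \<gamma> p (f t) (\<lambda>i. pd i (f t)) (\<lambda>i j. pd i (pd j (f t)))"
    and e: "\<And>\<delta>. snapshot.diss \<gamma> (f t) (\<lambda>i. pd i (f t)) \<delta> = D \<delta> t" "\<And>\<delta>. snapshot.sing \<gamma> (f t) \<delta> = S \<delta> t" "snapshot.mass (f t) = M0"
    using snapshot_at[OF t] by metis
  interpret snapshot \<gamma> p "f t" "\<lambda>i. pd i (f t)" "\<lambda>i j. pd i (pd j (f t))" by (rule sn)
  have lnN: "0 < ln N" using N by simp
  note eb = entropy_bound[OF t0]
  have "(LBINT v. (if f t v \<le> N then 0 else f t v * (jbracket v)\<^sup>2))
    \<le> (LBINT v. R\<^sup>2 / ln N * (f t v * \<bar>ln (f t v)\<bar>) + 1 / R\<^sup>2 * (f t v * jbracket v powr 4))"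
  proof (rule integral_mono)
    show "integrable lborel (\<lambda>v. if f t v \<le> N then 0 else f t v * (jbracket v)\<^sup>2)"
      by (rule Bochner_Integration.integrable_bound[OF conserved(3)[OF t0]]) (auto simp: u_nonneg)
    show "integrable lborel (\<lambda>v. R\<^sup>2 / ln N * (f t v * \<bar>ln (f t v)\<bar>) + 1 / R\<^sup>2 * (f t v * jbracket v powr 4))"
      by (intro Bochner_Integration.integrable_add integrable_mult_right eb i4)
    fix v
    have n1: "0 \<le> R\<^sup>2 / ln N * (f t v * \<bar>ln (f t v)\<bar>)" and n2: "0 \<le> 1 / R\<^sup>2 * (f t v * jbracket v powr 4)"
      using u_nonneg[of v] lnN by auto
    show "(if f t v \<le> N then 0 else f t v * (jbracket v)\<^sup>2) \<le> R\<^sup>2 / ln N * (f t v * \<bar>ln (f t v)\<bar>) + 1 / R\<^sup>2 * (f t v * jbracket v powr 4)"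
    proof (cases "f t v \<le> N")
      case False
      have "f t v * (jbracket v)\<^sup>2 \<le> R\<^sup>2 / ln N * (f t v * \<bar>ln (f t v)\<bar>) + 1 / R\<^sup>2 * (f t v * jbracket v powr 4)"
      proof (cases "jbracket v \<le> R")
        case True
        have "ln N \<le> \<bar>ln (f t v)\<bar>" using False N by simp
        then have "1 \<le> \<bar>ln (f t v)\<bar> / ln N" using lnN by simp
        moreover have "(jbracket v)\<^sup>2 \<le> R\<^sup>2" using True by (intro power_mono) (auto simp: less_imp_le)
        ultimately have "(jbracket v)\<^sup>2 * 1 \<le> R\<^sup>2 * (\<bar>ln (f t v)\<bar> / ln N)" by (intro mult_mono) auto
        then have "f t v * ((jbracket v)\<^sup>2 * 1) \<le> f t v * (R\<^sup>2 * (\<bar>ln (f t v)\<bar> / ln N))" by (intro mult_left_mono u_nonneg)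
        also have "\<dots> = R\<^sup>2 / ln N * (f t v * \<bar>ln (f t v)\<bar>)" by simp
        finally show ?thesis using n2 by simp
      next
        case F: False
        then have "R\<^sup>2 \<le> (jbracket v)\<^sup>2" using R by (intro power_mono) auto
        then have "(jbracket v)\<^sup>2 * R\<^sup>2 \<le> (jbracket v)\<^sup>2 * (jbracket v)\<^sup>2" by (intro mult_left_mono) auto
        also have "\<dots> = jbracket v powr 4" by (simp add: less_imp_le flip: power_add)
        finally have "(jbracket v)\<^sup>2 \<le> jbracket v powr 4 / R\<^sup>2" using R by (simp add: pos_le_divide_eq)
        from mult_left_mono[OF this u_nonneg[of v]] show ?thesis using n1 by simp
      qed
      then show ?thesis using False by simp
    qed (use n1 n2 in simp)
  qed
  also have "\<dots> = R\<^sup>2 / ln N * (LBINT v. f t v * \<bar>ln (f t v)\<bar>) + 1 / R\<^sup>2 * (LBINT v. f t v * jbracket v powr 4)"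
    by (subst Bochner_Integration.integral_add)
       (intro integrable_mult_right eb(1) i4, intro integrable_mult_right eb(1) i4, simp only: integral_mult_right_zero)
  also have "\<dots> \<le> R\<^sup>2 / ln N * H0 + 1 / R\<^sup>2 * m"
    by (rule add_mono[OF mult_left_mono[OF eb(2)] mult_left_mono[OF m4]]) (use lnN in simp_all)
  also have "\<dots> = R\<^sup>2 * H0 / ln N + m / R\<^sup>2" by simp
  finally have b: "(LBINT v. (if f t v \<le> N then 0 else f t v * (jbracket v)\<^sup>2)) \<le> R\<^sup>2 * H0 / ln N + m / R\<^sup>2" .
  have "0 < N" using N by simp
  from sing_bound_split[OF \<delta> this conserved(3)[OF t0] b]
  show ?thesis unfolding e .
qed

end

subsection \<open>The a priori estimate\<close>

text \<open>The threshold 48 A \<le> \<kappa> is the condition for absorption: 2 (\<gamma> + 3) is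
  at most 6 and the dissipation carries a factor 4, so 24 A has to stay below \<kappa> / 2. The mass
  term 96 A M0 is then at most 2 \<kappa> M0.\<close>

lemma (in landau_solution) LtLp_estimate:
  assumes T: "0 < T" and \<epsilon>: "0 < \<epsilon>" "\<epsilon> < 1" and r: "r = - 3 * \<gamma> * (2 - \<epsilon>) / \<epsilon>" and \<alpha>: "\<alpha> = 2 * (3 - \<epsilon>) / (3 * (2 - \<epsilon>))"
    and ir: "\<And>t. 0 < t \<Longrightarrow> integrable lborel (\<lambda>v. f t v * jbracket v powr r)"
    and N: "\<And>t. 0 < t \<Longrightarrow> t \<le> T \<Longrightarrow> (LBINT v. f t v * jbracket v powr r) \<le> N"
    and \<kappa>: "0 < \<kappa>" and co: "\<And>t. 0 < t \<Longrightarrow> coercive \<kappa> t" and A0: "0 \<le> A0" and A: "0 \<le> A" "48 * A \<le> \<kappa>"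
    and S: "\<And>t \<delta>. 0 < t \<Longrightarrow> t \<le> T \<Longrightarrow> 0 < \<delta> \<Longrightarrow> S \<delta> t \<le> A0 + A * (4 * D \<delta> t + 16 * M0)"
  shows "in_LtLp \<alpha> T (3 - \<epsilon>) f"
    and "(LINT t:{0..T}|lborel. Lp_norm (3 - \<epsilon>) (f t) powr \<alpha>)
      \<le> N powr (\<epsilon> / (3 * (2 - \<epsilon>))) * ((16 / \<kappa> * (6 * A0 + 2 * \<kappa> * M0 + 2 * M0 + 2 * H0) + 32 * M0) * (1 + T))"
proof -
  define B where "B = 6 * A0 + 2 * \<kappa> * M0"
  have B: "0 \<le> B" using A0 \<kappa> M0_nonneg by (simp add: B_def)
  have hS: "2 * (\<gamma> + 3) * S \<delta> t \<le> \<kappa> / 2 * D \<delta> t + B" if t: "0 < t" "t \<le> T" and \<delta>: "0 < \<delta>" for t \<delta>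
  proof -
    have D0: "0 \<le> D \<delta> t" by (rule D_nonneg[OF t(1) \<delta>])
    define Z where "Z = A0 + A * (4 * D \<delta> t + 16 * M0)"
    have Z: "0 \<le> Z" unfolding Z_def using A0 A D0 M0_nonneg by simp
    have "2 * (\<gamma> + 3) * S \<delta> t \<le> 2 * (\<gamma> + 3) * Z" using S[OF t \<delta>] \<gamma>_ge unfolding Z_def by (intro mult_left_mono) auto
    also have "\<dots> \<le> 6 * Z" using \<gamma>_neg Z by (intro mult_right_mono) auto
    also have "\<dots> = 6 * A0 + (48 * A) * (D \<delta> t / 2) + (48 * A) * (2 * M0)" by (simp add: Z_def algebra_simps)
    also have "\<dots> \<le> 6 * A0 + \<kappa> * (D \<delta> t / 2) + \<kappa> * (2 * M0)"
      by (intro add_mono order_refl mult_right_mono A) (use D0 M0_nonneg in auto)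
    finally show ?thesis by (simp add: B_def)
  qed
  note Y = dissipation_bound[OF T \<kappa> co B hS]
  have Yb: "0 \<le> 2 / \<kappa> * (B * T + 2 * M0 + 2 * H0)" using \<kappa> B T M0_nonneg H0_nonneg by simp
  note L = LtLp_bound[OF T \<epsilon> r \<alpha> ir N Y Yb]
  show "in_LtLp \<alpha> T (3 - \<epsilon>) f" by (rule L(1))
  note L(2)
  also have "N powr (\<epsilon> / (3 * (2 - \<epsilon>))) * (8 * (2 / \<kappa> * (B * T + 2 * M0 + 2 * H0)) + 32 * M0 * T)
      \<le> N powr (\<epsilon> / (3 * (2 - \<epsilon>))) * ((16 / \<kappa> * (6 * A0 + 2 * \<kappa> * M0 + 2 * M0 + 2 * H0) + 32 * M0) * (1 + T))"
  proof (rule mult_left_mono)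
    define G where "G = 2 * M0 + 2 * H0"
    have G: "0 \<le> G" using M0_nonneg H0_nonneg by (simp add: G_def)
    have "B * T + G \<le> (B + G) * (1 + T)" using B G T by (simp add: algebra_simps)
    then have "16 / \<kappa> * (B * T + G) \<le> 16 / \<kappa> * ((B + G) * (1 + T))" using \<kappa> by (intro mult_left_mono) auto
    moreover have "32 * M0 * T \<le> 32 * M0 * (1 + T)" using M0_nonneg T by (intro mult_left_mono) auto
    ultimately have "16 / \<kappa> * (B * T + G) + 32 * M0 * T \<le> 16 / \<kappa> * ((B + G) * (1 + T)) + 32 * M0 * (1 + T)" (is ?L) by (rule add_mono)
    then have *: ?L .
    show "8 * (2 / \<kappa> * (B * T + 2 * M0 + 2 * H0)) + 32 * M0 * T
      \<le> (16 / \<kappa> * (6 * A0 + 2 * \<kappa> * M0 + 2 * M0 + 2 * H0) + 32 * M0) * (1 + T)"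
    proof -
      have "8 * (2 / \<kappa> * (B * T + 2 * M0 + 2 * H0)) = 16 / \<kappa> * (B * T + G)" by (simp add: G_def add.assoc)
      moreover have "6 * A0 + 2 * \<kappa> * M0 + 2 * M0 + 2 * H0 = B + G" by (simp add: B_def G_def)
      ultimately show ?thesis using * by (simp only: distrib_right mult.assoc)
    qed
  qed simp
  finally show "(LINT t:{0..T}|lborel. Lp_norm (3 - \<epsilon>) (f t) powr \<alpha>)
      \<le> N powr (\<epsilon> / (3 * (2 - \<epsilon>))) * ((16 / \<kappa> * (6 * A0 + 2 * \<kappa> * M0 + 2 * M0 + 2 * H0) + 32 * M0) * (1 + T))" .
qed

text \<open>Mass, energy and the entropy bound of a slice depend only on the datum, so one constant
  serves for all solutions and all times.\<close>

lemma coercive_uniform: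
  assumes M: "0 < initial_mass fin" and \<gamma>: "\<gamma> < 0"
  obtains \<kappa> where "0 < \<kappa>" "\<And>f t. landau_solution \<gamma> fin f \<Longrightarrow> 0 < t \<Longrightarrow> landau_solution.coercive \<gamma> f \<kappa> t"
proof (rule coercivity[OF M \<gamma>, of "initial_energy fin" "initial_entropy fin"])
  fix \<kappa> :: real
  assume \<kappa>: "0 < \<kappa>" and c: "\<And>(u :: r3 \<Rightarrow> real) v \<xi>. u \<in> borel_measurable borel \<Longrightarrow> (\<And>c. 0 \<le> u c) \<Longrightarrow> integrable lborel u \<Longrightarrow> (LBINT c. u c) = initial_mass fin \<Longrightarrow>
      integrable lborel (\<lambda>c. u c * (norm c)\<^sup>2) \<Longrightarrow> (LBINT c. u c * (norm c)\<^sup>2) \<le> initial_energy fin \<Longrightarrow>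
      integrable lborel (\<lambda>c. u c * \<bar>ln (u c)\<bar>) \<Longrightarrow> (LBINT c. u c * \<bar>ln (u c)\<bar>) \<le> initial_entropy fin \<Longrightarrow>
      integrable lborel (\<lambda>c. u c * (norm (v - c) powr \<gamma> * ((norm (v - c))\<^sup>2 * (norm \<xi>)\<^sup>2 - ((v - c) \<bullet> \<xi>)\<^sup>2))) \<Longrightarrow>
      \<kappa> * jbracket v powr \<gamma> * (norm \<xi>)\<^sup>2
        \<le> (LBINT c. u c * (norm (v - c) powr \<gamma> * ((norm (v - c))\<^sup>2 * (norm \<xi>)\<^sup>2 - ((v - c) \<bullet> \<xi>)\<^sup>2)))"
  show thesis
  proof (rule that[OF \<kappa>])
    fix f t assume "landau_solution \<gamma> fin f" and t: "0 < (t::real)"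
    then interpret landau_solution \<gamma> fin f by simp
    show "coercive \<kappa> t" by (rule coercive_of_constant[OF t c])
  qed
qed

text \<open>Up to order 2 the conserved mass and energy bound the moment; above order 2 it grows
  linearly with a rate common to all solutions.\<close>

lemma moment_bound:
  assumes \<gamma>: "-2 \<le> \<gamma>" "\<gamma> < 0" and r: "0 \<le> r" and fin: "in_L1w r fin" "in_L1w 2 fin" "\<And>v. 0 \<le> fin v" and M: "0 < initial_mass fin"
  obtains C where "0 \<le> C"
    "\<And>f t. landau_solution \<gamma> fin f \<Longrightarrow> 0 < t \<Longrightarrow> integrable lborel (\<lambda>v. f t v * jbracket v powr r)"
    "\<And>f t. landau_solution \<gamma> fin f \<Longrightarrow> 0 < t \<Longrightarrow> (LBINT v. f t v * jbracket v powr r) \<le> C * (1 + t)"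
proof -
  have i: "integrable lborel (\<lambda>v. f t v * jbracket v powr r)" if l: "landau_solution \<gamma> fin f" and t: "0 < t" for f t
  proof -
    interpret landau_solution \<gamma> fin f by (rule l)
    obtain K where "\<And>t'. t' \<in> {0..t} \<Longrightarrow> integrable lborel (\<lambda>v. f t' v * jbracket v powr r)"
      using moments[OF r fin(1) less_imp_le[OF t]] by blast
    from this[of t] show ?thesis using t by simp
  qed
  have "\<exists>C\<ge>0. \<forall>f t. landau_solution \<gamma> fin f \<longrightarrow> 0 < t \<longrightarrow> L1w_norm r (f t) \<le> C * (1 + t)"
  proof (cases "2 < r")
    case True
    obtain C where C: "0 \<le> C" "\<And>f T. landau_solution \<gamma> fin f \<Longrightarrow> 0 < T \<Longrightarrow> L1w_norm r (f T) \<le> L1w_norm r fin + C * T"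
      using moment_linear_growth[OF \<gamma> True fin M[unfolded initial_mass_def]] by blast
    have n: "0 \<le> L1w_norm r fin" unfolding L1w_norm_def by (intro integral_nonneg_AE AE_I2) simp
    show ?thesis
    proof (intro exI[of _ "L1w_norm r fin + C"] conjI allI impI)
      fix f t assume l: "landau_solution \<gamma> fin f" and t: "0 < (t::real)"
      have "L1w_norm r fin + C * t \<le> (L1w_norm r fin + C) * (1 + t)" using n C(1) t by (simp add: algebra_simps)
      then show "L1w_norm r (f t) \<le> (L1w_norm r fin + C) * (1 + t)" using C(2)[OF l t] by linarith
    qed (use n C in simp)
  next
    case False
    define C where "C = max 0 (initial_mass fin + initial_energy fin)"
    show ?thesis
    proof (intro exI[of _ C] conjI allI impI)
      fix f t assume l: "landau_solution \<gamma> fin f" and t: "0 < (t::real)"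
      interpret landau_solution \<gamma> fin f by (rule l)
      have t0: "0 \<le> t" using t by simp
      have "(LBINT v. f t v * jbracket v powr r) \<le> (LBINT v. f t v * (jbracket v)\<^sup>2)"
      proof (rule integral_mono[OF i[OF l t] conserved(3)[OF t0]])
        fix v
        have "jbracket v powr r \<le> jbracket v powr 2" using False by (intro jbracket_powr_mono) simp
        then have "jbracket v powr r \<le> (jbracket v)\<^sup>2" by (simp add: less_imp_le)
        then show "f t v * jbracket v powr r \<le> f t v * (jbracket v)\<^sup>2" by (rule mult_left_mono[OF _ f_nonneg[OF t0]])
      qed
      also have "\<dots> = M0 + E0" by (rule conserved(5)[OF t0])
      also have "\<dots> \<le> C * 1" by (simp add: C_def)
      also have "\<dots> \<le> C * (1 + t)" using t by (intro mult_left_mono) (auto simp: C_def)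
      finally show "L1w_norm r (f t) \<le> C * (1 + t)" by (simp add: L1w_norm_f[OF t0])
    qed (simp add: C_def)
  qed
  then obtain C where C: "0 \<le> C" "\<And>f t. landau_solution \<gamma> fin f \<Longrightarrow> 0 < t \<Longrightarrow> L1w_norm r (f t) \<le> C * (1 + t)" by blast
  show ?thesis
  proof (rule that[OF C(1)])
    fix f t assume l: "landau_solution \<gamma> fin f" and t: "0 < (t::real)"
    show "integrable lborel (\<lambda>v. f t v * jbracket v powr r)" by (rule i[OF l t])
    interpret landau_solution \<gamma> fin f by (rule l)
    show "(LBINT v. f t v * jbracket v powr r) \<le> C * (1 + t)"
      using C(2)[OF l t] L1w_norm_f[of t r] t by simp
  qed
qed

text \<open>One power of 1 + T comes from integrating the dissipation and mass terms in time. The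
  additional \<epsilon> / (3 (2 - \<epsilon>)) is the exponent with which the linearly growing
  moment enters the interpolation.\<close>

lemma estimate_subcritical:
  assumes \<gamma>: "-2 < \<gamma>" "\<gamma> < 0" and \<epsilon>: "0 < \<epsilon>" "\<epsilon> < 1" and r: "r = - 3 * \<gamma> * (2 - \<epsilon>) / \<epsilon>" and \<alpha>: "\<alpha> = 2 * (3 - \<epsilon>) / (3 * (2 - \<epsilon>))"
    and fin: "in_L1w r fin" "in_L1w 2 fin" "\<And>v. 0 \<le> fin v"
    and M: "0 < initial_mass fin"
  obtains C where "0 < C" "\<And>f T. landau_solution \<gamma> fin f \<Longrightarrow> 0 < T \<Longrightarrow> in_LtLp \<alpha> T (3 - \<epsilon>) f"
    "\<And>f T. landau_solution \<gamma> fin f \<Longrightarrow> 0 < T \<Longrightarrow>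
      (LINT t:{0..T}|lborel. Lp_norm (3 - \<epsilon>) (f t) powr \<alpha>) \<le> C * (1 + T) powr (1 + \<epsilon> / (3 * (2 - \<epsilon>)))"
proof -
  define M E H where "M = initial_mass fin" and "E = initial_energy fin" and "H = initial_entropy fin"
  define e where "e = \<epsilon> / (3 * (2 - \<epsilon>))"
  have r0: "0 \<le> r" unfolding r using \<gamma> \<epsilon> by (simp add: divide_nonpos_pos mult_nonpos_nonneg)
  have \<gamma>': "-2 \<le> \<gamma>" using \<gamma> by simp
  have M0: "0 < M" using M by (simp add: M_def)
  have E0: "0 \<le> E" unfolding E_def initial_energy_def using fin(3) by (intro integral_nonneg_AE AE_I2) auto
  obtain \<kappa> where \<kappa>: "0 < \<kappa>" "\<And>f t. landau_solution \<gamma> fin f \<Longrightarrow> 0 < t \<Longrightarrow> landau_solution.coercive \<gamma> f \<kappa> t"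
    using coercive_uniform[OF M \<gamma>(2)] by blast
  obtain C where C: "0 \<le> C"
    "\<And>f t. landau_solution \<gamma> fin f \<Longrightarrow> 0 < t \<Longrightarrow> integrable lborel (\<lambda>v. f t v * jbracket v powr r)"
    "\<And>f t. landau_solution \<gamma> fin f \<Longrightarrow> 0 < t \<Longrightarrow> (LBINT v. f t v * jbracket v powr r) \<le> C * (1 + t)"
    using moment_bound[OF \<gamma>' \<gamma>(2) r0 fin M] by blast
  \<comment> \<open>The cut-off radius at which 8 \<rho>^(\<gamma>+2) (M + E) meets the absorption
    threshold \<kappa> / 48, as 384 = 8 times 48; it exists because \<gamma> + 2 > 0.\<close>
  define \<rho> where "\<rho> = min 1 ((\<kappa> / (384 * (M + E))) powr (1 / (\<gamma> + 2)))"
  have ME: "0 < M + E" using M0 E0 by simp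
  have \<rho>: "0 < \<rho>" "\<rho> \<le> 1" using \<kappa>(1) ME by (auto simp: \<rho>_def)
  have "\<rho> powr (\<gamma> + 2) \<le> ((\<kappa> / (384 * (M + E))) powr (1 / (\<gamma> + 2))) powr (\<gamma> + 2)"
    using \<rho> \<gamma> by (intro powr_mono2) (auto simp: \<rho>_def)
  also have "\<dots> = (\<kappa> / (384 * (M + E))) powr 1" using \<gamma> by (simp add: powr_powr)
  finally have \<rho>b: "\<rho> powr (\<gamma> + 2) \<le> \<kappa> / (384 * (M + E))" using \<kappa>(1) ME by simp
  define A where "A = 8 * \<rho> powr (\<gamma> + 2) * (M + E)"
  have "48 * A = \<rho> powr (\<gamma> + 2) * (384 * (M + E))" by (simp add: A_def)
  also have "\<dots> \<le> \<kappa>" using pos_le_divide_eq[THEN iffD1, OF _ \<rho>b] ME by simp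
  finally have A: "0 \<le> A" "48 * A \<le> \<kappa>" using ME by (simp_all add: A_def)
  define A0 where "A0 = \<rho> powr \<gamma> * M\<^sup>2"
  have A0: "0 \<le> A0" by (simp add: A0_def)
  define K where "K = 16 / \<kappa> * (6 * A0 + 2 * \<kappa> * M + 2 * M + 2 * H) + 32 * M"
  have main: "in_LtLp \<alpha> T (3 - \<epsilon>) f"
    "(LINT t:{0..T}|lborel. Lp_norm (3 - \<epsilon>) (f t) powr \<alpha>) \<le> \<bar>C powr e * K\<bar> * (1 + T) powr (1 + e)"
    if l: "landau_solution \<gamma> fin f" and T: "0 < T" for f T
  proof -
    interpret landau_solution \<gamma> fin f by (rule l)
    have N: "(LBINT v. f t v * jbracket v powr r) \<le> C * (1 + T)" if "0 < t" "t \<le> T" for t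
      using C(3)[OF l that(1)] mult_left_mono[OF that(2) C(1)] by (simp add: distrib_left)
    have S: "S \<delta> t \<le> A0 + A * (4 * D \<delta> t + 16 * M0)" if "0 < t" "t \<le> T" "0 < \<delta>" for t \<delta>
      using sing_power[OF that(1,3) \<rho>] by (simp add: A0_def A_def M_def E_def)
    note est = LtLp_estimate[OF T \<epsilon> r \<alpha> C(2)[OF l] N \<kappa>(1) \<kappa>(2)[OF l] A0 A S]
    show "in_LtLp \<alpha> T (3 - \<epsilon>) f" by (rule est(1))
    have "(LINT t:{0..T}|lborel. Lp_norm (3 - \<epsilon>) (f t) powr \<alpha>) \<le> (C * (1 + T)) powr e * (K * (1 + T))"
      using est(2) unfolding K_def M_def H_def e_def .
    also have "\<dots> = (C powr e * K) * ((1 + T) powr e * (1 + T))" by (simp add: powr_mult)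
    also have "(1 + T) powr e * (1 + T) = (1 + T) powr (1 + e)" using T by (simp add: powr_add)
    also have "(C powr e * K) * (1 + T) powr (1 + e) \<le> \<bar>C powr e * K\<bar> * (1 + T) powr (1 + e)" by (intro mult_right_mono) auto
    finally show "(LINT t:{0..T}|lborel. Lp_norm (3 - \<epsilon>) (f t) powr \<alpha>) \<le> \<bar>C powr e * K\<bar> * (1 + T) powr (1 + e)" .
  qed
  show ?thesis
  proof (rule that[of "\<bar>C powr e * K\<bar> + 1"])
    fix f T assume l: "landau_solution \<gamma> fin f" and T: "0 < (T::real)"
    show "in_LtLp \<alpha> T (3 - \<epsilon>) f" by (rule main(1)[OF l T])
    have "\<bar>C powr e * K\<bar> * (1 + T) powr (1 + e) \<le> (\<bar>C powr e * K\<bar> + 1) * (1 + T) powr (1 + e)" by (intro mult_right_mono) auto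
    then show "(LINT t:{0..T}|lborel. Lp_norm (3 - \<epsilon>) (f t) powr \<alpha>) \<le> (\<bar>C powr e * K\<bar> + 1) * (1 + T) powr (1 + \<epsilon> / (3 * (2 - \<epsilon>)))"
      using main(2)[OF l T] unfolding e_def by linarith
  qed simp
qed

text \<open>The coefficient of the dissipation is a sum of an entropy and a moment contribution, and
  both must be small up to time T. This forces R^2 to grow like the fourth moment and ln N like R^2;
  the height N then enters the constant linearly.\<close>

lemma estimate_critical:
  assumes \<gamma>: "\<gamma> = -2" and \<epsilon>: "0 < \<epsilon>" "\<epsilon> < 1" and r: "r = - 3 * \<gamma> * (2 - \<epsilon>) / \<epsilon>" and \<alpha>: "\<alpha> = 2 * (3 - \<epsilon>) / (3 * (2 - \<epsilon>))"
    and fin: "in_L1w r fin" "in_L1w 2 fin" "in_L1w 4 fin" "\<And>v. 0 \<le> fin v"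
    and M: "0 < initial_mass fin"
  obtains C c where "0 < C" "0 < c" "\<And>f T. landau_solution \<gamma> fin f \<Longrightarrow> 0 < T \<Longrightarrow> in_LtLp \<alpha> T (3 - \<epsilon>) f"
    "\<And>f T. landau_solution \<gamma> fin f \<Longrightarrow> 0 < T \<Longrightarrow>
      (LINT t:{0..T}|lborel. Lp_norm (3 - \<epsilon>) (f t) powr \<alpha>) \<le> C * exp (c * T)"
proof -
  define M H where "M = initial_mass fin" and "H = initial_entropy fin"
  define e where "e = \<epsilon> / (3 * (2 - \<epsilon>))"
  have e: "0 \<le> e" "e \<le> 1" using \<epsilon> by (simp_all add: e_def pos_divide_le_eq)
  have \<gamma>': "-2 \<le> \<gamma>" "\<gamma> < 0" using \<gamma> by auto
  have r0: "0 \<le> r" unfolding r using \<gamma>' \<epsilon> by (simp add: divide_nonpos_pos mult_nonpos_nonneg)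
  have M0: "0 < M" using M by (simp add: M_def)
  obtain \<kappa> where \<kappa>: "0 < \<kappa>" "\<And>f t. landau_solution \<gamma> fin f \<Longrightarrow> 0 < t \<Longrightarrow> landau_solution.coercive \<gamma> f \<kappa> t"
    using coercive_uniform[OF M \<gamma>'(2)] by blast
  obtain C where C: "0 \<le> C"
    "\<And>f t. landau_solution \<gamma> fin f \<Longrightarrow> 0 < t \<Longrightarrow> integrable lborel (\<lambda>v. f t v * jbracket v powr r)"
    "\<And>f t. landau_solution \<gamma> fin f \<Longrightarrow> 0 < t \<Longrightarrow> (LBINT v. f t v * jbracket v powr r) \<le> C * (1 + t)"
    using moment_bound[OF \<gamma>' r0 fin(1,2,4) M] by blast
  obtain m0 where m0: "0 \<le> m0"
    "\<And>f t. landau_solution \<gamma> fin f \<Longrightarrow> 0 < t \<Longrightarrow> integrable lborel (\<lambda>v. f t v * jbracket v powr 4)"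
    "\<And>f t. landau_solution \<gamma> fin f \<Longrightarrow> 0 < t \<Longrightarrow> (LBINT v. f t v * jbracket v powr 4) \<le> m0 * (1 + t)"
    using moment_bound[OF \<gamma>' _ fin(3,2,4) M] by auto
  \<comment> \<open>768 = 48 times 8 times 2: the absorption threshold, the factor of
    \<open>sing_split\<close>, and two contributions of size at most 1 / k each.\<close>
  define k where "k = 768 / \<kappa>"
  have k: "0 < k" using \<kappa> by (simp add: k_def)
  \<comment> \<open>The absolute value is taken because non-negativity of the entropy bound is known
    only once a solution is given.\<close>
  define c where "c = k\<^sup>2 * (\<bar>H\<bar> + 1) * (m0 + 1)"
  have c: "0 < c" using k m0(1) by (simp add: c_def)
  define K where "K = 16 / \<kappa> * (6 * (M\<^sup>2 + ckb * M) + 2 * \<kappa> * M + 2 * M + 2 * \<bar>H\<bar>) + 32 * M"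
  have K: "0 \<le> K" using \<kappa> M0 ckb(2) by (simp add: K_def)
  have main: "in_LtLp \<alpha> T (3 - \<epsilon>) f"
    "(LINT t:{0..T}|lborel. Lp_norm (3 - \<epsilon>) (f t) powr \<alpha>) \<le> ((1 + C) * K * exp c) * exp ((c + 2) * T)"
    if l: "landau_solution \<gamma> fin f" and T: "0 < T" for f T
  proof -
    interpret landau_solution \<gamma> fin f by (rule l)
    have H0: "0 \<le> H" using H0_nonneg by (simp add: H_def)
    define m where "m = (m0 + 1) * (1 + T)"
    have m: "0 < m" using m0(1) T by (simp add: m_def)
    define R where "R = sqrt (k * m)"
    have R: "0 < R" "R\<^sup>2 = k * m" using k m by (simp_all add: R_def)
    \<comment> \<open>With R^2 = k m and ln P = k^2 (H + 1) m the entropy contribution is H / (k (H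
      + 1)) \<le> 1 / k, and the moment contribution is exactly 1 / k.\<close>
    define P where "P = exp (c * (1 + T))"
    have P: "1 < P" "ln P = k\<^sup>2 * (H + 1) * m" using c T H0 by (simp_all add: P_def c_def m_def)
    define A where "A = 8 * (R\<^sup>2 * H / ln P + m / R\<^sup>2)"
    have "R\<^sup>2 * H / ln P = H / (k * (H + 1))" unfolding R P using k m by (simp add: power2_eq_square)
    also have "\<dots> \<le> 1 / k" using k H0 by (simp add: divide_simps)
    finally have A1: "R\<^sup>2 * H / ln P \<le> 1 / k" .
    have A2: "m / R\<^sup>2 = 1 / k" unfolding R using m by simp
    have "48 * A \<le> 768 * (1 / k)" unfolding A_def A2 using A1 by simp
    also have "768 * (1 / k) = \<kappa>" using \<kappa>(1) unfolding k_def by simp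
    finally have A: "0 \<le> A" "48 * A \<le> \<kappa>"
      using H0 P(1) m by (simp_all add: A_def)
    define A0 where "A0 = M\<^sup>2 + P * ckb * M"
    have A0: "0 \<le> A0" using P M0 ckb(2) by (simp add: A0_def)
    have N: "(LBINT v. f t v * jbracket v powr r) \<le> C * (1 + T)" if "0 < t" "t \<le> T" for t
      using C(3)[OF l that(1)] mult_left_mono[OF that(2) C(1)] by (simp add: distrib_left)
    have S: "S \<delta> t \<le> A0 + A * (4 * D \<delta> t + 16 * M0)" if t: "0 < t" "t \<le> T" "0 < \<delta>" for t \<delta>
    proof -
      have "m0 * (1 + t) \<le> (m0 + 1) * (1 + T)" using m0(1) t by (intro mult_mono) auto
      then have "(LBINT v. f t v * jbracket v powr 4) \<le> m" using m0(3)[OF l t(1)] by (simp add: m_def)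
      from sing_split[OF t(1,3) R(1) P(1) m0(2)[OF l t(1)] this]
      show ?thesis unfolding A0_def A_def M_def H_def .
    qed
    note est = LtLp_estimate[OF T \<epsilon> r \<alpha> C(2)[OF l] N \<kappa>(1) \<kappa>(2)[OF l] A0 A S]
    show "in_LtLp \<alpha> T (3 - \<epsilon>) f" by (rule est(1))
    define K' where "K' = 16 / \<kappa> * (6 * A0 + 2 * \<kappa> * M + 2 * M + 2 * H) + 32 * M"
    have K': "K' \<le> P * K"
    proof -
      define G where "G = 2 * \<kappa> * M + 2 * M + 2 * H"
      have G: "0 \<le> G" using \<kappa>(1) M0 H0 by (simp add: G_def)
      have P1: "x \<le> P * x" if "0 \<le> x" for x using mult_right_mono[OF less_imp_le[OF P(1)] that] by simp
      have "6 * A0 + G \<le> P * (6 * (M\<^sup>2 + ckb * M) + G)"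
        using P1[of "6 * M\<^sup>2"] P1[OF G] by (simp add: A0_def algebra_simps)
      then have "16 / \<kappa> * (6 * A0 + G) \<le> 16 / \<kappa> * (P * (6 * (M\<^sup>2 + ckb * M) + G))"
        using \<kappa>(1) by (intro mult_left_mono) auto
      moreover have "32 * M \<le> P * (32 * M)" using P1[of "32 * M"] M0 by simp
      ultimately have "16 / \<kappa> * (6 * A0 + G) + 32 * M \<le> 16 / \<kappa> * (P * (6 * (M\<^sup>2 + ckb * M) + G)) + P * (32 * M)"
        by (rule add_mono)
      also have "\<dots> = P * (16 / \<kappa> * (6 * (M\<^sup>2 + ckb * M) + G) + 32 * M)" by (simp only: distrib_left mult.left_commute)
      finally show ?thesis unfolding K'_def K_def G_def using H0 by (simp add: add.assoc)
    qed
    have N1: "(C * (1 + T)) powr e \<le> (1 + C) * (1 + T)"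
    proof -
      have "0 \<le> C * (1 + T)" using C(1) T by simp
      moreover have "C * (1 + T) \<le> (1 + C) * (1 + T)" using T by (intro mult_right_mono) auto
      ultimately have "(C * (1 + T)) powr e \<le> ((1 + C) * (1 + T)) powr e" using e by (intro powr_mono2) auto
      also have "\<dots> \<le> ((1 + C) * (1 + T)) powr 1"
      proof (rule powr_mono[OF e(2)])
        have "1 * 1 \<le> (1 + C) * (1 + T)" using C(1) T by (intro mult_mono) auto
        then show "1 \<le> (1 + C) * (1 + T)" by simp
      qed
      finally show ?thesis using C(1) T by simp
    qed
    have "(LINT t:{0..T}|lborel. Lp_norm (3 - \<epsilon>) (f t) powr \<alpha>) \<le> (C * (1 + T)) powr e * (K' * (1 + T))"
      using est(2) unfolding K'_def M_def H_def e_def .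
    also have "\<dots> \<le> (C * (1 + T)) powr e * ((P * K) * (1 + T))" using K' T by (intro mult_left_mono mult_right_mono) auto
    also have "\<dots> \<le> ((1 + C) * (1 + T)) * ((P * K) * (1 + T))" using N1 P(1) K T by (intro mult_right_mono) auto
    also have "\<dots> = ((1 + C) * K * P) * ((1 + T) * (1 + T))" by simp
    \<comment> \<open>The polynomial growth from the moment and from the length of the interval is
      absorbed into the exponential, which raises its rate by 2.\<close>
    also have "\<dots> \<le> ((1 + C) * K * P) * (exp T * exp T)"
    proof -
      have "1 + T \<le> exp T" by simp
      then have "(1 + T) * (1 + T) \<le> exp T * exp T" using T by (intro mult_mono) auto
      then show ?thesis using C(1) K P(1) by (intro mult_left_mono) auto
    qed
    also have "\<dots> = ((1 + C) * K * exp c) * exp ((c + 2) * T)"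
      unfolding P_def by (simp add: algebra_simps mult_2 flip: exp_add)
    finally show "(LINT t:{0..T}|lborel. Lp_norm (3 - \<epsilon>) (f t) powr \<alpha>) \<le> ((1 + C) * K * exp c) * exp ((c + 2) * T)" .
  qed
  show ?thesis
  proof (rule that[of "(1 + C) * K * exp c + 1" "c + 2"])
    show "0 < (1 + C) * K * exp c + 1" using C(1) K by (simp add: add_nonneg_pos)
    show "0 < c + 2" using c by simp
    fix f T assume l: "landau_solution \<gamma> fin f" and T: "0 < (T::real)"
    show "in_LtLp \<alpha> T (3 - \<epsilon>) f" by (rule main(1)[OF l T])
    have "((1 + C) * K * exp c) * exp ((c + 2) * T) \<le> ((1 + C) * K * exp c + 1) * exp ((c + 2) * T)" by (intro mult_right_mono) auto
    then show "(LINT t:{0..T}|lborel. Lp_norm (3 - \<epsilon>) (f t) powr \<alpha>) \<le> ((1 + C) * K * exp c + 1) * exp ((c + 2) * T)"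
      using main(2)[OF l T] by linarith
  qed
qed

theorem theorem1:
  fixes \<gamma> \<epsilon> s q \<alpha> z :: real and fin :: "real ^ 3 \<Rightarrow> real"
  assumes "-2 \<le> \<gamma>" and "\<gamma> < 0" and "0 < \<epsilon>" and "\<epsilon> < 1" and "0 < s"
    and q: "q = - 3 * (\<gamma> - s) * (2 - \<epsilon>) / \<epsilon>"
    and \<alpha>: "\<alpha> = 2 * (3 - \<epsilon>) / (3 * (2 - \<epsilon>))"
    and z: "z = (3 - \<epsilon>) * (3 * (2 + s) * (2 - \<epsilon>) - 2 * \<epsilon>) / (3 * (1 - \<epsilon>))"
    and "\<forall>v. 0 \<le> fin v"
    and "in_L1w 2 fin" and "in_L1w q fin" and "in_LlogL fin"
  shows "(\<forall>f. formal_landau_solution \<gamma> fin f \<longrightarrow> (\<forall>T>0. in_LtLp \<alpha> T (3 - \<epsilon>) f)) \<and>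
    (-2 < \<gamma> \<longrightarrow>
      (\<exists>C>0. \<forall>f. formal_landau_solution \<gamma> fin f \<longrightarrow>
        (\<forall>T>0. (LINT t:{0..T}|lborel. Lp_norm (3 - \<epsilon>) (f t) powr \<alpha>)
           \<le> C * (1 + T) powr (1 + 2 * \<epsilon> * (3 + \<epsilon>) / (3 * (2 - \<epsilon>) * (2 + \<gamma>)))))) \<and>
    (\<gamma> = -2 \<longrightarrow>
      (\<exists>C0>0. \<exists>C>0. \<forall>f. formal_landau_solution \<gamma> fin f \<longrightarrow>
        (\<forall>T>0. (LINT t:{0..T}|lborel. Lp_norm (3 - \<epsilon>) (f t) powr \<alpha>)
           \<le> C0 * exp (C * T powr z))))"
proof -
  note \<gamma> = assms(1,2) and \<epsilon> = assms(3,4) and s = assms(5)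
  have fin0: "0 \<le> fin v" for v using assms(9) by simp
  have LS: "formal_landau_solution \<gamma> fin f \<longleftrightarrow> landau_solution \<gamma> fin f" for f
    using \<gamma> by (simp add: landau_solution_def)
  define r where "r = - 3 * \<gamma> * (2 - \<epsilon>) / \<epsilon>"
  have lower: "in_L1w p fin" if "p \<le> q" for p
    using assms(11) weighted_integrable[OF _ fin0 _ that] fin0 by (simp add: in_L1w_def)
  \<comment> \<open>\<open>r\<close> is the order of the moment consumed by the interpolation;
    lowering the order from \<open>q\<close> costs nothing because <v> \<ge> 1.\<close>
  have "r \<le> q" unfolding r_def q using \<epsilon> s by (intro divide_right_mono mult_right_mono) auto
  note rfin = lower[OF this]
  define M where "M = initial_mass fin"
  have "0 \<le> M" unfolding M_def initial_mass_def by (intro integral_nonneg_AE AE_I2 fin0)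
  then consider "M = 0" | "0 < M" "-2 < \<gamma>" | "0 < M" "\<gamma> = -2" using \<gamma> by fastforce
  then show ?thesis
  proof cases
    case 1
    have Z: "in_LtLp \<alpha> T (3 - \<epsilon>) f" "(LINT t:{0..T}|lborel. Lp_norm (3 - \<epsilon>) (f t) powr \<alpha>) = 0"
      if "landau_solution \<gamma> fin f" "0 < T" for f T
    proof -
      interpret landau_solution \<gamma> fin f by (rule that(1))
      show "in_LtLp \<alpha> T (3 - \<epsilon>) f" "(LINT t:{0..T}|lborel. Lp_norm (3 - \<epsilon>) (f t) powr \<alpha>) = 0"
        using zero_mass[OF _ \<epsilon> that(2)] 1 by (simp_all add: M_def)
    qed
    show ?thesis unfolding LS by (intro conjI impI allI exI[of _ 1]) (simp_all add: Z)
  next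
    case 2
    obtain C where C: "0 < C" "\<And>f T. landau_solution \<gamma> fin f \<Longrightarrow> 0 < T \<Longrightarrow> in_LtLp \<alpha> T (3 - \<epsilon>) f"
      "\<And>f T. landau_solution \<gamma> fin f \<Longrightarrow> 0 < T \<Longrightarrow>
        (LINT t:{0..T}|lborel. Lp_norm (3 - \<epsilon>) (f t) powr \<alpha>) \<le> C * (1 + T) powr (1 + \<epsilon> / (3 * (2 - \<epsilon>)))"
      using estimate_subcritical[OF 2(2) \<gamma>(2) \<epsilon> r_def \<alpha> rfin assms(10) fin0 2(1)[unfolded M_def]] by blast
    define e where "e = \<epsilon> / (3 * (2 - \<epsilon>))"
    \<comment> \<open>Since 0 < 2 + \<gamma> < 2 the factor exceeds 1, so the exponent obtained is
      at most the stated one, and 1 + T \<ge> 1.\<close>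
    have "e * 1 \<le> e * (2 * (3 + \<epsilon>) / (2 + \<gamma>))"
      using 2(2) \<gamma> \<epsilon> by (intro mult_left_mono) (auto simp: e_def pos_le_divide_eq)
    also have "\<dots> = 2 * \<epsilon> * (3 + \<epsilon>) / (3 * (2 - \<epsilon>) * (2 + \<gamma>))" by (simp add: e_def)
    finally have "C * (1 + T) powr (1 + \<epsilon> / (3 * (2 - \<epsilon>))) \<le> C * (1 + T) powr (1 + 2 * \<epsilon> * (3 + \<epsilon>) / (3 * (2 - \<epsilon>) * (2 + \<gamma>)))"
      if "0 < T" for T
      using that C(1) by (intro mult_left_mono powr_mono) (auto simp: e_def)
    then have "(LINT t:{0..T}|lborel. Lp_norm (3 - \<epsilon>) (f t) powr \<alpha>) \<le> C * (1 + T) powr (1 + 2 * \<epsilon> * (3 + \<epsilon>) / (3 * (2 - \<epsilon>) * (2 + \<gamma>)))"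
      if "landau_solution \<gamma> fin f" "0 < T" for f T
      using C(3)[OF that] that(2) order_trans by blast
    then show ?thesis unfolding LS using C(1,2) 2(2) by auto
  next
    case 3
    \<comment> \<open>This supplies the fourth moment that controls large velocities when \<gamma> =
      -2: there q \<epsilon> = (6 + 3 s) (2 - \<epsilon>), which is at least 6.\<close>
    have "4 \<le> q"
    proof -
      have "4 * \<epsilon> \<le> (6 + 3 * s) * (2 - \<epsilon>)"
      proof -
        have "6 * 1 \<le> (6 + 3 * s) * (2 - \<epsilon>)" using \<epsilon> s by (intro mult_mono) auto
        then show ?thesis using \<epsilon> by simp
      qed
      then show ?thesis unfolding q 3(2) using \<epsilon> by (simp add: pos_le_divide_eq add.commute)
    qed
    note fin4 = lower[OF this]
    obtain C c where C: "0 < C" "0 < c" "\<And>f T. landau_solution \<gamma> fin f \<Longrightarrow> 0 < T \<Longrightarrow> in_LtLp \<alpha> T (3 - \<epsilon>) f"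
      "\<And>f T. landau_solution \<gamma> fin f \<Longrightarrow> 0 < T \<Longrightarrow>
        (LINT t:{0..T}|lborel. Lp_norm (3 - \<epsilon>) (f t) powr \<alpha>) \<le> C * exp (c * T)"
      using estimate_critical[OF 3(2) \<epsilon> r_def \<alpha> rfin assms(10) fin4 fin0 3(1)[unfolded M_def]] by blast
    \<comment> \<open>The bracket in the numerator is at least 6 - 2 = 4 and 3 - \<epsilon> at least
      2, while the denominator is below 3.\<close>
    have z1: "1 \<le> z"
    proof -
      have "6 * 1 \<le> 3 * (2 + s) * (2 - \<epsilon>)" using \<epsilon> s by (intro mult_mono) auto
      then have "2 * 4 \<le> (3 - \<epsilon>) * (3 * (2 + s) * (2 - \<epsilon>) - 2 * \<epsilon>)" using \<epsilon> by (intro mult_mono) auto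
      then show ?thesis unfolding z using \<epsilon> by (simp add: pos_le_divide_eq)
    qed
    have "C * exp (c * T) \<le> (C * exp c) * exp (c * T powr z)" if "0 < T" for T
    proof -
      \<comment> \<open>The summand 1 covers T \<le> 1, where \<open>T powr z\<close> may be smaller
        than T; it is paid by the factor exp c in the constant.\<close>
      have "T \<le> 1 + T powr z"
      proof (cases "T \<le> 1")
        case False
        then have "T powr 1 \<le> T powr z" using z1 by (intro powr_mono) auto
        then show ?thesis using that by simp
      qed (simp add: add_increasing2)
      then have "c * T \<le> c * (1 + T powr z)" using C(2) by (intro mult_left_mono) auto
      then have "exp (c * T) \<le> exp c * exp (c * T powr z)" by (simp add: distrib_left flip: exp_add)
      then show ?thesis using C(1) by simp
    qed
    then have "(LINT t:{0..T}|lborel. Lp_norm (3 - \<epsilon>) (f t) powr \<alpha>) \<le> (C * exp c) * exp (c * T powr z)"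
      if "landau_solution \<gamma> fin f" "0 < T" for f T
      using C(4)[OF that] that(2) order_trans by blast
    moreover have "0 < C * exp c" using C(1) by simp
    ultimately show ?thesis unfolding LS using C(2,3) 3(2) by (metis less_irrefl)
  qed
qed

end
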